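(* The following symmetric pairs $(\mathfrak g,\mathfrak g_0)$ do not have GNIB: (i) $(\mathfrak{gl}_n,\mathfrak{gl}_3\oplus\mathfrak{gl}_{n-3})$, $n\ge 7$; (ii) $(\mathfrak{so}_n,\mathfrak{so}_3\oplus\mathfrak{so}_{n-3})$, $n\ge 7$; (iii) $(\mathfrak{sp}_{2n},\mathfrak{sp}_6\oplus\mathfrak{sp}_{2n-6})$, $n\ge 7$.
   Context: The ground field $\Bbbk$ is algebraically closed of characteristic zero. For a Lie algebra $\mathfrak q$ and a finite-dimensional $\mathfrak q$-module $V$, the index is $\mathrm{ind}(\mathfrak q,V)=\dim V-\max_{\xi\in V^*}\dim(\mathfrak q\cdot\xi)$. For a rational representation $(G:V)$ of a reductive group $G$ with Lie algebra $\mathfrak g$, a vector $v\in V$ is nilpotent if $0\in\overline{G\cdot v}$; $\mathfrak g_v$ is the stabiliser of $v$ in $\mathfrak g$, and $V/\mathfrak g\cdot v$ is a $\mathfrak g_v$-module. $(G:V)$ has good nilpotent index behaviour (GNIB) if $\mathrm{ind}(\mathfrak g,V^* )=\mathrm{ind}(\mathfrak g_v,(V/\mathfrak g\cdot v)^* )$ for every nilpotent $v\in V$. If $\sigma$ is an involutory automorphism of $\mathfrak g$ with eigenspace decomposition $\mathfrak g=\mathfrak g_0\oplus\mathfrak g_1$ (eigenvalues $+1$, $-1$) and $G_0\subset G$ is the connected subgroup with Lie algebra $\mathfrak g_0$, then $(G,G_0)$, or $(\mathfrak g,\mathfrak g_0)$, is a symmetric pair; it is said to have GNIB if its isotropy representation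 $(G_0:\mathfrak g_1)$ has GNIB. In the listed pairs, $\mathfrak g_0$ is the subalgebra of $\mathfrak g$ preserving a direct sum decomposition of the standard module into two subspaces of the indicated dimensions (an orthogonal decomposition into non-degenerate subspaces in the $\mathfrak{so}$ and $\mathfrak{sp}$ cases); $\mathfrak{sp}_{2k}$ acts on a $2k$-dimensional space. *)

theory Defs
  imports
    "Jordan_Normal_Form.VS_Connect"
    "HOL-Algebra.AbelCoset"
    "HOL-Analysis.Function_Topology"
begin

section \<open>Finite-dimensional vector spaces, duals and quotients\<close>

text \<open>
  A vector space over the field \<open>'k\<close> is a record of type \<open>('k, 'v) module\<close>, with \<open>class_ring\<close> the
  field itself. Subspaces are obtained by restricting the carrier.
\<close>

abbreviation vdim :: "('k::field, 'v, 'm) module_scheme \<Rightarrow> nat" where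
  "vdim V \<equiv> vectorspace.dim class_ring V"

text \<open>Linear functionals are made \<open>extensional\<close>, so that equal functionals are equal functions.\<close>

definition dual_space :: "('k::field, 'v, 'm) module_scheme \<Rightarrow> ('k, 'v \<Rightarrow> 'k) module" where
  "dual_space V = (ring.func_space class_ring (carrier V))
     \<lparr>carrier := {f \<in> extensional (carrier V).
        (\<forall>v\<in>carrier V. \<forall>w\<in>carrier V. f (v \<oplus>\<^bsub>V\<^esub> w) = f v + f w) \<and>
        (\<forall>c. \<forall>v\<in>carrier V. f (c \<odot>\<^bsub>V\<^esub> v) = c * f v)}\<rparr>"

definition quotient_space ::
    "('k::field, 'v, 'm) module_scheme \<Rightarrow> 'v set \<Rightarrow> ('k, 'v set) module" where
  "quotient_space V U =
     \<lparr>carrier = a_rcosets\<^bsub>V\<^esub> U, mult = undefined, one = undefined,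
      zero = U, add = (<+>\<^bsub>V\<^esub>),
      smult = (\<lambda>c C. \<Union>v\<in>C. U +>\<^bsub>V\<^esub> (c \<odot>\<^bsub>V\<^esub> v))\<rparr>"


section \<open>Modules over Lie algebras and their index\<close>

text \<open>
  A \<open>\<qq>\<close>-module is given by the set \<open>q\<close> of elements of the Lie algebra, the vector space \<open>V\<close> and the
  action \<open>act\<close>, a function of the Lie algebra element and the vector.
\<close>

definition dual_action ::
    "('k::field, 'v, 'm) module_scheme \<Rightarrow> ('x \<Rightarrow> 'v \<Rightarrow> 'v) \<Rightarrow> 'x \<Rightarrow> ('v \<Rightarrow> 'k) \<Rightarrow> ('v \<Rightarrow> 'k)" where
  "dual_action V act x f = (\<lambda>v\<in>carrier V. - f (act x v))"

text \<open>
  \<open>x (v + U) = x v + U\<close>; if \<open>x U \<subseteq> U\<close>, all the cosets in the union coincide.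
\<close>

definition quotient_action ::
    "('k::field, 'v, 'm) module_scheme \<Rightarrow> 'v set \<Rightarrow> ('x \<Rightarrow> 'v \<Rightarrow> 'v) \<Rightarrow> 'x \<Rightarrow> 'v set \<Rightarrow> 'v set" where
  "quotient_action V U act x C = (\<Union>v\<in>C. U +>\<^bsub>V\<^esub> act x v)"

definition tangent_space :: "'x set \<Rightarrow> ('x \<Rightarrow> 'v \<Rightarrow> 'v) \<Rightarrow> 'v \<Rightarrow> 'v set" where
  "tangent_space q act v = (\<lambda>x. act x v) ` q"

definition lie_stabiliser ::
    "'x set \<Rightarrow> ('k::field, 'v, 'm) module_scheme \<Rightarrow> ('x \<Rightarrow> 'v \<Rightarrow> 'v) \<Rightarrow> 'v \<Rightarrow> 'x set" where
  "lie_stabiliser q V act v = {x \<in> q. act x v = \<zero>\<^bsub>V\<^esub>}"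

definition lie_index ::
    "'x set \<Rightarrow> ('k::field, 'v, 'm) module_scheme \<Rightarrow> ('x \<Rightarrow> 'v \<Rightarrow> 'v) \<Rightarrow> int" where
  "lie_index q V act =
     int (vdim V) -
     int (Max ((\<lambda>\<xi>. vdim ((dual_space V)\<lparr>carrier := tangent_space q (dual_action V act) \<xi>\<rparr>))
               ` carrier (dual_space V)))"


section \<open>Zariski topology, nilpotent vectors and GNIB\<close>

inductive_set polynomial_functions :: "('k::field, 'v, 'm) module_scheme \<Rightarrow> ('v \<Rightarrow> 'k) set"
  for V :: "('k, 'v, 'm) module_scheme" where
  linear: "f \<in> carrier (dual_space V) \<Longrightarrow> f \<in> polynomial_functions V"
| const: "(\<lambda>_. c) \<in> polynomial_functions V"
| add: "f \<in> polynomial_functions V \<Longrightarrow> h \<in> polynomial_functions V \<Longrightarrow>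
    (\<lambda>v. f v + h v) \<in> polynomial_functions V"
| mult: "f \<in> polynomial_functions V \<Longrightarrow> h \<in> polynomial_functions V \<Longrightarrow>
    (\<lambda>v. f v * h v) \<in> polynomial_functions V"

definition zariski :: "('k::field, 'v, 'm) module_scheme \<Rightarrow> 'v topology" where
  "zariski V = topology_generated_by {{v \<in> carrier V. f v \<noteq> 0} | f. f \<in> polynomial_functions V}"

definition nilpotent_vector ::
    "'g set \<Rightarrow> ('g \<Rightarrow> 'v \<Rightarrow> 'v) \<Rightarrow> ('k::field, 'v, 'm) module_scheme \<Rightarrow> 'v \<Rightarrow> bool" where
  "nilpotent_vector G gact V v \<longleftrightarrow>
     v \<in> carrier V \<and> \<zero>\<^bsub>V\<^esub> \<in> zariski V closure_of ((\<lambda>g. gact g v) ` G)"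

text \<open>
  Here \<open>G\<close> acts on \<open>V\<close> by \<open>gact\<close>, and \<open>act\<close> is the differential of this action, on the Lie algebra
  \<open>q\<close> of \<open>G\<close>.
\<close>

definition GNIB ::
    "'g set \<Rightarrow> ('g \<Rightarrow> 'v \<Rightarrow> 'v) \<Rightarrow> 'x set \<Rightarrow> ('x \<Rightarrow> 'v \<Rightarrow> 'v) \<Rightarrow>
     ('k::field, 'v, 'm) module_scheme \<Rightarrow> bool" where
  "GNIB G gact q act V \<longleftrightarrow>
     (\<forall>v. nilpotent_vector G gact V v \<longrightarrow>
        lie_index q (dual_space V) (dual_action V act) =
        (let U = tangent_space q act v;
             N = quotient_space V U
         in lie_index (lie_stabiliser q V act v) (dual_space N)
              (dual_action N (quotient_action V U act))))"


section \<open>Linear algebraic groups and their Lie algebras\<close>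

definition mat_subspace :: "nat \<Rightarrow> 'k::field mat set \<Rightarrow> ('k, 'k mat) module" where
  "mat_subspace n S = (module_mat TYPE('k) n n)\<lparr>carrier := S\<rparr>"

definition vec_subspace :: "nat \<Rightarrow> 'k::field vec set \<Rightarrow> ('k, 'k vec) module" where
  "vec_subspace n S = (module_vec TYPE('k) n)\<lparr>carrier := S\<rparr>"

definition general_linear_group :: "'k::field itself \<Rightarrow> nat \<Rightarrow> 'k mat monoid" where
  "general_linear_group ty n = units_of (ring_mat ty n ())"

definition linear_algebraic_group :: "nat \<Rightarrow> 'k::field mat set \<Rightarrow> bool" where
  "linear_algebraic_group n G \<longleftrightarrow>
     subgroup G (general_linear_group TYPE('k) n) \<and>
     closedin (subtopology (zariski (module_mat TYPE('k) n n))
                           (carrier (general_linear_group TYPE('k) n))) G"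

text \<open>
  The Lie algebra is the tangent space at the identity: all \<open>X\<close> such that every polynomial function
  vanishing on \<open>G\<close> has derivative \<open>0\<close> at the identity in the direction \<open>X\<close>. Over an infinite field
  the polynomial \<open>p\<close> is determined by \<open>f\<close> and \<open>X\<close>.
\<close>

definition lie_algebra_of :: "nat \<Rightarrow> 'k::field mat set \<Rightarrow> 'k mat set" where
  "lie_algebra_of n G =
     {X \<in> carrier_mat n n.
        \<forall>f \<in> polynomial_functions (module_mat TYPE('k) n n). (\<forall>A\<in>G. f A = 0) \<longrightarrow>
          (\<exists>p. (\<forall>t. f (1\<^sub>m n + t \<cdot>\<^sub>m X) = poly p t) \<and> poly (pderiv p) 0 = 0)}"

definition lie_bracket :: "'k::field mat \<Rightarrow> 'k mat \<Rightarrow> 'k mat" where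
  "lie_bracket X Y = X * Y - Y * X"

definition conjugation :: "nat \<Rightarrow> 'k::field mat \<Rightarrow> 'k mat \<Rightarrow> 'k mat" where
  "conjugation n A X = A * X * inv\<^bsub>general_linear_group TYPE('k) n\<^esub> A"


section \<open>Symmetric pairs\<close>

definition involutory_automorphism :: "nat \<Rightarrow> 'k::field mat set \<Rightarrow> ('k mat \<Rightarrow> 'k mat) \<Rightarrow> bool" where
  "involutory_automorphism n g \<sigma> \<longleftrightarrow>
     \<sigma> \<in> LinearCombinations.module_hom class_ring (mat_subspace n g) (mat_subspace n g) \<and>
     (\<forall>X\<in>g. \<forall>Y\<in>g. \<sigma> (lie_bracket X Y) = lie_bracket (\<sigma> X) (\<sigma> Y)) \<and>
     (\<forall>X\<in>g. \<sigma> (\<sigma> X) = X) \<and> (\<exists>X\<in>g. \<sigma> X \<noteq> X)"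

definition eigenspace_on :: "'k::field mat set \<Rightarrow> ('k mat \<Rightarrow> 'k mat) \<Rightarrow> 'k \<Rightarrow> 'k mat set" where
  "eigenspace_on g \<sigma> c = {X \<in> g. \<sigma> X = c \<cdot>\<^sub>m X}"

definition symmetric_subalgebra ::
    "nat \<Rightarrow> 'k::field mat set \<Rightarrow> 'k mat set \<Rightarrow> ('k mat \<Rightarrow> 'k mat) \<Rightarrow> bool" where
  "symmetric_subalgebra n g g0 \<sigma> \<longleftrightarrow>
     involutory_automorphism n g \<sigma> \<and> g0 = eigenspace_on g \<sigma> 1"

text \<open>
  Reductivity is not listed as a condition: it follows from the Lie algebras when \<open>g\<close> is one of the
  classical algebras below. Connectedness of \<open>G\<close> plays no role and is not required.
\<close>

definition symmetric_pair_groups ::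
    "nat \<Rightarrow> 'k::field mat set \<Rightarrow> 'k mat set \<Rightarrow> 'k mat set \<Rightarrow> 'k mat set \<Rightarrow> bool" where
  "symmetric_pair_groups n g g0 G G0 \<longleftrightarrow>
     linear_algebraic_group n G \<and> lie_algebra_of n G = g \<and>
     linear_algebraic_group n G0 \<and> G0 \<subseteq> G \<and>
     connectedin (zariski (module_mat TYPE('k) n n)) G0 \<and> lie_algebra_of n G0 = g0"

text \<open>
  The isotropy representation is the restriction of the adjoint representation, that is conjugation,
  whose differential is the bracket.
\<close>

definition isotropy_GNIB ::
    "nat \<Rightarrow> 'k::field mat set \<Rightarrow> ('k mat \<Rightarrow> 'k mat) \<Rightarrow> 'k mat set \<Rightarrow> bool" where
  "isotropy_GNIB n g \<sigma> G0 \<longleftrightarrow>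
     GNIB G0 (conjugation n) (eigenspace_on g \<sigma> 1) lie_bracket
       (mat_subspace n (eigenspace_on g \<sigma> (-1)))"


section \<open>The classical Lie algebras and decompositions of the standard module\<close>

abbreviation gl_algebra :: "nat \<Rightarrow> 'k::field mat set" where
  "gl_algebra n \<equiv> carrier_mat n n"

text \<open>Bilinear forms on the space of column vectors are given by their Gram matrix \<open>J\<close>.\<close>

definition bilinear_form :: "'k::field mat \<Rightarrow> 'k vec \<Rightarrow> 'k vec \<Rightarrow> 'k" where
  "bilinear_form J x y = x \<bullet> (J *\<^sub>v y)"

definition nondegenerate_on :: "nat \<Rightarrow> 'k::field mat \<Rightarrow> 'k vec set \<Rightarrow> bool" where
  "nondegenerate_on n J S \<longleftrightarrow>
     (\<forall>x\<in>S. (\<forall>y\<in>S. bilinear_form J x y = 0) \<longrightarrow> x = 0\<^sub>v n)"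

definition orthogonal_form :: "nat \<Rightarrow> 'k::field mat \<Rightarrow> bool" where
  "orthogonal_form n J \<longleftrightarrow>
     J \<in> carrier_mat n n \<and> nondegenerate_on n J (carrier_vec n) \<and>
     (\<forall>x\<in>carrier_vec n. \<forall>y\<in>carrier_vec n. bilinear_form J y x = bilinear_form J x y)"

definition symplectic_form :: "nat \<Rightarrow> 'k::field mat \<Rightarrow> bool" where
  "symplectic_form n J \<longleftrightarrow>
     J \<in> carrier_mat n n \<and> nondegenerate_on n J (carrier_vec n) \<and>
     (\<forall>x\<in>carrier_vec n. bilinear_form J x x = 0)"

text \<open>This is \<open>\<ss>\<oo>\<^sub>n\<close> for an orthogonal and \<open>\<ss>\<pp>\<^sub>n\<close> for a symplectic form \<open>J\<close>.\<close>

definition form_algebra :: "nat \<Rightarrow> 'k::field mat \<Rightarrow> 'k mat set" where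
  "form_algebra n J =
     {X \<in> carrier_mat n n. \<forall>x\<in>carrier_vec n. \<forall>y\<in>carrier_vec n.
        bilinear_form J (X *\<^sub>v x) y + bilinear_form J x (X *\<^sub>v y) = 0}"

definition direct_decomposition :: "nat \<Rightarrow> 'k::field vec set \<Rightarrow> 'k vec set \<Rightarrow> bool" where
  "direct_decomposition n U W \<longleftrightarrow>
     VectorSpace.subspace class_ring U (module_vec TYPE('k) n) \<and>
     VectorSpace.subspace class_ring W (module_vec TYPE('k) n) \<and>
     U \<inter> W = {0\<^sub>v n} \<and> U <+>\<^bsub>module_vec TYPE('k) n\<^esub> W = carrier_vec n"

definition orthogonal_decomposition ::
    "nat \<Rightarrow> 'k::field mat \<Rightarrow> 'k vec set \<Rightarrow> 'k vec set \<Rightarrow> bool" where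
  "orthogonal_decomposition n J U W \<longleftrightarrow>
     direct_decomposition n U W \<and>
     (\<forall>u\<in>U. \<forall>w\<in>W. bilinear_form J u w = 0) \<and>
     nondegenerate_on n J U \<and> nondegenerate_on n J W"

definition preserving :: "'k::field mat set \<Rightarrow> 'k vec set \<Rightarrow> 'k vec set \<Rightarrow> 'k mat set" where
  "preserving g U W = {X \<in> g. (\<forall>u\<in>U. X *\<^sub>v u \<in> U) \<and> (\<forall>w\<in>W. X *\<^sub>v w \<in> W)}"

end

theory Submission
  imports Defs
begin

text \<open>
  All three families have the same shape. Let \<open>A\<close> be the scalar, the diagonal or all \<open>2 \<times> 2\<close> matrices
  in the orthogonal, general linear and symplectic case, with the adjugate \<open>x\<^sup>*\<close> as involution. In a
  basis adapted to the decomposition and to the form, \<open>g\<close> consists of the skew-hermitian \<open>n \<times> n\<close>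
  matrices over \<open>A\<close>, \<open>g\<^sub>0\<close> of the block diagonal ones with blocks \<open>3\<close> and \<open>n - 3\<close>, and \<open>g\<^sub>1\<close> is
  \<open>A\<close>-valued of size \<open>3 \<times> (n - 3)\<close>.

  On one hand, a generic \<open>x\<close> in \<open>g\<^sub>1\<close> has an orbit of codimension at most \<open>3\<close>, so the index of
  \<open>g\<^sub>1\<^sup>*\<close> is at most \<open>3\<close>. On the other hand, let \<open>v\<close> in \<open>g\<^sub>1\<close> have two independent rows spanning an
  isotropic subspace and third row zero, which needs \<open>n - 3 \<ge> 4\<close>. Some \<open>h\<close> in \<open>g\<^sub>0\<close> with
  \<open>h\<^sup>3 = h\<close> satisfies \<open>[h, v] = v\<close>, and \<open>s \<mapsto> s\<^sup>h\<close> contracts \<open>v\<close> to \<open>0\<close>, so \<open>v\<close> is nilpotent. The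
  functionals on \<open>g\<^sub>1\<close> vanishing on \<open>[g\<^sub>0, v]\<close> contain the pairs of a hermitian \<open>2 \<times> 2\<close>
  matrix \<open>Y\<close> and a row \<open>m\<close> of length \<open>2\<close>. The stabiliser of \<open>v\<close> acts on them through a group with the four
  invariants \<open>tr Y\<close>, \<open>tr Y\<^sup>2\<close>, \<open>m m\<^sup>*\<close> and \<open>m Y m\<^sup>*\<close>, whose differentials are annihilated and
  generically independent; a limit argument gives four independent annihilated vectors at every point.
  Hence the index at \<open>v\<close> is at least \<open>4\<close>.
\<close>

section \<open>Orbit dimensions and annihilators\<close>

text \<open>The two halves of the comparison are unlike. An upper bound for the first index needs
  one good point. The lower bound at the nilpotent element needs annihilated vectors at every point
  of a double dual, because nothing tells where the maximal orbit dimension is attained. At special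
  points the differentials of the invariants become dependent, and this is what forces the passage
  to the limit, taken along polynomial curves.

  Two obstacles come from the generality of the data. The involution is given only through its fixed
  algebra, so its second eigenspace, on which the representation lives, has to be recovered from
  \<open>g0\<close>. And \<open>G0\<close> is just a Zariski closed group with a prescribed Lie
  algebra. There is no exponential map over a general field, so that the contracting torus lies in
  \<open>G0\<close> has to be derived from the vanishing of polynomials alone.

  The constants: \<open>3\<close> is the number of rows of the upper right block and hence of
  diagonal parameters of a generic element; \<open>4\<close> counts two invariants of a hermitian
  matrix of size two and two more that involve the row \<open>m\<close>.\<close>

lemma func_space_simps:
  "carrier (class_ring.func_space S :: ('k::field, 'v \<Rightarrow> 'k) module) = extensional S"
  "f \<oplus>\<^bsub>(class_ring.func_space S :: ('k::field, 'v \<Rightarrow> 'k) module)\<^esub> g = (\<lambda>v\<in>S. f v + g v)"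
  "c \<odot>\<^bsub>(class_ring.func_space S :: ('k::field, 'v \<Rightarrow> 'k) module)\<^esub> f = (\<lambda>v\<in>S. c * f v)"
  "\<zero>\<^bsub>(class_ring.func_space S :: ('k::field, 'v \<Rightarrow> 'k) module)\<^esub> = (\<lambda>v\<in>S. 0)"
  by (auto simp: class_ring.func_space_def PiE_def)

lemma dual_space_simps:
  "\<zero>\<^bsub>dual_space V\<^esub> = (\<lambda>v\<in>carrier V. 0)"
  "f \<oplus>\<^bsub>dual_space V\<^esub> g = (\<lambda>v\<in>carrier V. f v + g v)"
  "c \<odot>\<^bsub>dual_space V\<^esub> f = (\<lambda>v\<in>carrier V. c * f v)"
  by (simp_all add: dual_space_def class_ring.func_space_def)

lemma in_dual_space:
  "f \<in> carrier (dual_space V) \<longleftrightarrow> f \<in> extensional (carrier V) \<and>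
        (\<forall>v\<in>carrier V. \<forall>w\<in>carrier V. f (v \<oplus>\<^bsub>V\<^esub> w) = f v + f w) \<and>
        (\<forall>c. \<forall>v\<in>carrier V. f (c \<odot>\<^bsub>V\<^esub> v) = c * f v)"
  by (simp add: dual_space_def)

text \<open>The functionals form a submodule of the space of all functions on the carrier and
  inherit the axioms from there. So closure of the operations of \<open>V\<close> suffices, and
  quotient structures can be inserted directly.\<close>

lemma dual_space_vectorspace:
  fixes V :: "('k::field, 'v, 'm) module_scheme"
  assumes "\<And>v w. v \<in> carrier V \<Longrightarrow> w \<in> carrier V \<Longrightarrow> v \<oplus>\<^bsub>V\<^esub> w \<in> carrier V"
    and "\<And>c v. v \<in> carrier V \<Longrightarrow> c \<odot>\<^bsub>V\<^esub> v \<in> carrier V"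
  shows "vectorspace class_ring (dual_space V)"
proof -
  have "cring (class_ring :: 'k ring)"
    using class_field by (rule field.axioms(1)[THEN domain.axioms(1)])
  interpret F: Module.module class_ring "class_ring.func_space (carrier V) :: ('k, 'v \<Rightarrow> 'k) module"
    by (rule cring.func_space_is_module) fact
  have "submodule class_ring (carrier (dual_space V)) (class_ring.func_space (carrier V) :: ('k, 'v \<Rightarrow> 'k) module)"
    by (rule submodule.intro)
      (use assms in \<open>auto simp: in_dual_space func_space_simps F.module_axioms algebra_simps\<close>)
  from F.submodule_is_module[OF this]
  have "Module.module class_ring (dual_space V)"
    by (simp add: dual_space_def)
  then show ?thesis
    unfolding vectorspace_def using class_field by blast
qed

lemma injective_image_lin_indpt:
  assumes "linear_map class_ring V W T" and inj: "inj_on T (carrier V)"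
    and A: "finite A" "A \<subseteq> carrier V" and li: "\<not> module.lin_dep class_ring V A"
  shows "\<not> module.lin_dep class_ring W (T ` A)"
proof -
  interpret T: linear_map class_ring V W T by fact
  show ?thesis
  proof (rule T.W.module.finite_lin_indpt2)
    show "finite (T ` A)" "T ` A \<subseteq> carrier W" using A by auto
    fix a assume a: "a \<in> T ` A \<rightarrow> carrier class_ring" and 0: "T.W.module.lincomb a (T ` A) = \<zero>\<^bsub>W\<^esub>"
    have aT: "a \<circ> T \<in> A \<rightarrow> carrier class_ring" by auto
    have "T (T.V.module.lincomb (a \<circ> T) A) = \<zero>\<^bsub>W\<^esub>"
      using T.lincomb_linear_image[OF inj A(2) a A(1)] 0 by simp
    moreover have "T.V.module.lincomb (a \<circ> T) A \<in> carrier V"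
      using A aT by (intro T.V.module.lincomb_closed)
    ultimately have "T.V.module.lincomb (a \<circ> T) A = \<zero>\<^bsub>V\<^esub>"
      by (metis T.f0_is_0 T.V.module.M.zero_closed inj inj_onD)
    from T.V.not_lindepD[OF li A(1) _ aT this] show "\<forall>v\<in>T ` A. a v = \<zero>\<^bsub>class_ring\<^esub>" by auto
  qed
qed

text \<open>Together the functionals embed \<open>W\<close> into the coordinate space of dimension
  \<open>card I\<close>. Finite dimension is part of the conclusion, because \<open>vdim\<close> is
  informative only then.\<close>

lemma vdim_le_functionals:
  fixes W :: "('k::field, 'v, 'm) module_scheme"
  assumes vs: "vectorspace class_ring W" and I: "finite I"
    and add: "\<And>j v w. j \<in> I \<Longrightarrow> v \<in> carrier W \<Longrightarrow> w \<in> carrier W \<Longrightarrow> \<phi> j (v \<oplus>\<^bsub>W\<^esub> w) = \<phi> j v + \<phi> j w"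
    and smult: "\<And>j c v. j \<in> I \<Longrightarrow> v \<in> carrier W \<Longrightarrow> \<phi> j (c \<odot>\<^bsub>W\<^esub> v) = c * \<phi> j v"
    and inj: "\<And>v. v \<in> carrier W \<Longrightarrow> (\<And>j. j \<in> I \<Longrightarrow> \<phi> j v = 0) \<Longrightarrow> v = \<zero>\<^bsub>W\<^esub>"
  shows "vectorspace.fin_dim class_ring W" and "vdim W \<le> card I"
proof -
  interpret W: vectorspace class_ring W by fact
  define m where "m = card I"
  obtain e where e: "bij_betw e {..<m} I"
    using ex_bij_betw_nat_finite[OF I] by (auto simp: m_def atLeast0LessThan)
  then have eI: "j < m \<Longrightarrow> e j \<in> I" for j by (auto simp: bij_betw_def)
  interpret M: vec_space "TYPE('k)" m .
  let ?V = "module_vec TYPE('k) m"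
  define T where "T v = vec m (\<lambda>j. \<phi> (e j) v)" for v
  have lin: "linear_map class_ring W ?V T"
    unfolding linear_map_def mod_hom_def mod_hom_axioms_def LinearCombinations.module_hom_def
    using W.module_axioms W.vectorspace_axioms vec_vs vec_module add smult eI
    by (auto simp: T_def module_vec_simps)
  interpret T: linear_map class_ring W ?V T by fact
  have injT: "inj_on T (carrier W)"
  proof (rule T.Ke0_imp_inj, safe)
    fix v assume "v \<in> carrier (W\<lparr>carrier := T.kerT\<rparr>)"
    then have v: "v \<in> carrier W" "T v = 0\<^sub>v m" by (auto simp: T.ker_def module_vec_simps)
    have "\<phi> j v = 0" if j: "j \<in> I" for j
    proof -
      obtain i where "i < m" "e i = j" using e j unfolding bij_betw_def by blast
      then show ?thesis using v(2) by (auto simp: T_def dest!: arg_cong[where f="\<lambda>x. x $ i"])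
    qed
    then show "v = \<zero>\<^bsub>W\<^esub>" using inj v by auto
  next
    show "\<zero>\<^bsub>W\<^esub> \<in> carrier (W\<lparr>carrier := T.kerT\<rparr>)" by (auto simp: T.ker_def module_vec_simps)
  qed
  have fin_bound: "card A \<le> m" if A: "finite A" "A \<subseteq> carrier W" "\<not> W.lin_dep A" for A
  proof -
    have "\<not> module.lin_dep class_ring ?V (T ` A)"
      using injective_image_lin_indpt[OF lin injT] that by auto
    moreover have "T ` A \<subseteq> carrier_vec m" by (auto simp: T_def)
    ultimately have "card (T ` A) \<le> M.dim" using M.li_le_dim(2)[of "T ` A"] by auto
    moreover have "card (T ` A) = card A" using injT A(2) by (intro card_image) (auto intro: inj_on_subset)
    ultimately show ?thesis by (simp add: M.dim_is_n)
  qed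
  \<comment> \<open>An infinite set, or one with more than \<open>m\<close> elements, would contain
    an independent subset of exactly \<open>Suc m\<close> elements.\<close>
  have bound: "finite A \<and> card A \<le> m" if "A \<subseteq> carrier W \<and> \<not> W.lin_dep A" for A
  proof (rule ccontr)
    assume "\<not> (finite A \<and> card A \<le> m)"
    then have "\<exists>B. B \<subseteq> A \<and> finite B \<and> card B = Suc m"
    proof (cases "finite A")
      case True
      with \<open>\<not> (finite A \<and> card A \<le> m)\<close> have "Suc m \<le> card A" by simp
      from obtain_subset_with_card_n[OF this] show ?thesis by metis
    next
      case False
      from infinite_arbitrarily_large[OF this, of "Suc m"] show ?thesis by blast
    qed
    then obtain B where "B \<subseteq> A" "finite B" "card B = Suc m" by blast
    then show False using fin_bound[of B] that W.subset_li_is_li[of A B] by auto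
  qed
  have "{} \<subseteq> carrier W \<and> \<not> W.lin_dep {}"
    by (auto simp: W.lin_dep_def)
  from maximal_exists[of "\<lambda>A. A \<subseteq> carrier W \<and> \<not> W.lin_dep A", OF bound this]
  obtain A where A: "finite A" "maximal A (\<lambda>A. A \<subseteq> carrier W \<and> \<not> W.lin_dep A)" by auto
  then have basis: "W.basis A" by (intro W.max_li_is_basis)
  show "W.fin_dim" using basis A unfolding W.fin_dim_def W.basis_def by auto
  have "card A \<le> m" using basis bound unfolding W.basis_def by auto
  then show "vdim W \<le> card I" using W.dim_basis[OF A(1) basis] by (simp add: m_def)
qed

lemma functional_zero:
  fixes E :: "('k::field, 'v, 'm) module_scheme"
  assumes "vectorspace class_ring E" and \<tau>: "\<tau> \<in> carrier (dual_space E)"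
    and B: "B \<subseteq> carrier E" "\<And>b. b \<in> B \<Longrightarrow> \<tau> b = 0"
    and f: "f \<in> LinearCombinations.module.span class_ring E B"
  shows "\<tau> f = 0"
proof -
  interpret E: vectorspace class_ring E by fact
  have \<tau>0: "\<tau> \<zero>\<^bsub>E\<^esub> = 0"
  proof -
    have "\<tau> (0 \<odot>\<^bsub>E\<^esub> \<zero>\<^bsub>E\<^esub>) = 0 * \<tau> \<zero>\<^bsub>E\<^esub>"
      using \<tau> E.zero_closed unfolding in_dual_space by blast
    then show ?thesis using E.lmult_0[of "\<zero>\<^bsub>E\<^esub>"] by simp
  qed
  have "submodule class_ring {f \<in> carrier E. \<tau> f = 0} E"
    by (rule submodule.intro) (use \<tau> \<tau>0 E.module_axioms in \<open>auto simp: in_dual_space\<close>)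
  from E.span_is_subset[OF _ this, of B] show ?thesis using f B by auto
qed

text \<open>Extend \<open>F\<close> to a basis: an element of \<open>T\<close> is determined by its
  values on the basis vectors outside \<open>F\<close>.\<close>

lemma annihilated_subspace_dim:
  fixes E :: "('k::field, 'v, 'm) module_scheme"
  assumes vs: "vectorspace class_ring E" and fin: "vectorspace.fin_dim class_ring E"
    and T: "VectorSpace.subspace class_ring T (dual_space E)"
    and F: "F \<subseteq> carrier E" "\<not> module.lin_dep class_ring E F"
    and ann: "\<And>\<tau> f. \<tau> \<in> T \<Longrightarrow> f \<in> F \<Longrightarrow> \<tau> f = 0"
  shows "vectorspace.fin_dim class_ring ((dual_space E)\<lparr>carrier := T\<rparr>)"
    and "vdim ((dual_space E)\<lparr>carrier := T\<rparr>) + card F \<le> vdim E"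
proof -
  interpret E: vectorspace class_ring E by fact
  interpret D: vectorspace class_ring "dual_space E"
    using dual_space_vectorspace[of E] by auto
  have TD: "T \<subseteq> carrier (dual_space E)" using T by (auto simp: VectorSpace.subspace_def submodule_def)
  \<comment> \<open>A maximal independent set among those containing \<open>F\<close> is maximal
    among all independent sets, so this is the basis extension.\<close>
  define P where "P A \<longleftrightarrow> F \<subseteq> A \<and> A \<subseteq> carrier E \<and> \<not> E.lin_dep A" for A
  have "\<exists>A. finite A \<and> maximal A P"
  proof (rule maximal_exists[of P E.dim F])
    show "finite A \<and> card A \<le> E.dim" if "P A" for A
      using E.li_le_dim[OF fin, of A] that unfolding P_def by blast
    show "P F" using F unfolding P_def by blast
  qed
  then obtain B where B: "finite B" "maximal B P" by auto
  have "maximal B (\<lambda>S. S \<subseteq> carrier E \<and> \<not> E.lin_dep S)"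
    using B(2) unfolding maximal_def P_def by blast
  then have basis: "E.basis B" by (rule E.max_li_is_basis)
  have FB: "F \<subseteq> B" using B(2) unfolding maximal_def P_def by blast
  have vsT: "vectorspace class_ring ((dual_space E)\<lparr>carrier := T\<rparr>)"
    using D.subspace_is_vs[OF T] .
  have BE: "B \<subseteq> carrier E" "E.span B = carrier E" using basis unfolding E.basis_def by blast+
  have *: "v = \<zero>\<^bsub>(dual_space E)\<lparr>carrier := T\<rparr>\<^esub>"
    if v: "v \<in> carrier ((dual_space E)\<lparr>carrier := T\<rparr>)" and 0: "\<And>j. j \<in> B - F \<Longrightarrow> v j = 0" for v
  proof -
    have vD: "v \<in> carrier (dual_space E)" and "v \<in> T" using v TD by auto
    then have "v b = 0" if "b \<in> B" for b using 0 ann that by blast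
    then have "v f = 0" if "f \<in> carrier E" for f
      using functional_zero[OF vs vD BE(1)] BE(2) that by auto
    then show ?thesis using vD by (auto simp: dual_space_simps in_dual_space extensional_def fun_eq_iff)
  qed
  note ev = vdim_le_functionals[OF vsT, of "B - F" "\<lambda>b v. v b"]
  have add: "(v \<oplus>\<^bsub>(dual_space E)\<lparr>carrier := T\<rparr>\<^esub> w) j = v j + w j" if "j \<in> B - F" for v w j
    using that BE by (auto simp: dual_space_simps)
  have sm: "(c \<odot>\<^bsub>(dual_space E)\<lparr>carrier := T\<rparr>\<^esub> v) j = c * v j" if "j \<in> B - F" for v c j
    using that BE by (auto simp: dual_space_simps)
  show "vectorspace.fin_dim class_ring ((dual_space E)\<lparr>carrier := T\<rparr>)"
    using B(1) add sm * by (intro ev(1)) auto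
  have "vdim ((dual_space E)\<lparr>carrier := T\<rparr>) \<le> card (B - F)"
    using B(1) add sm * by (intro ev(2)) auto
  also have "card (B - F) = card B - card F" using FB B(1) by (meson card_Diff_subset finite_subset)
  finally show "vdim ((dual_space E)\<lparr>carrier := T\<rparr>) + card F \<le> vdim E"
    using E.dim_basis[OF B(1) basis] card_mono[OF B(1) FB] by simp
qed

text \<open>The bound in the other direction: a basis of \<open>T\<close> together with the extra
  functionals separates the points of \<open>E\<close>.\<close>

lemma annihilator_functionals_dim:
  fixes E :: "('k::field, 'v, 'm) module_scheme"
  assumes vs: "vectorspace class_ring E" and fin: "vectorspace.fin_dim class_ring E"
    and T: "VectorSpace.subspace class_ring T (dual_space E)" and I: "finite I"
    and \<phi>: "\<And>j. j \<in> I \<Longrightarrow> \<phi> j \<in> carrier (dual_space E)"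
    and inj: "\<And>f. f \<in> carrier E \<Longrightarrow> (\<And>\<tau>. \<tau> \<in> T \<Longrightarrow> \<tau> f = 0) \<Longrightarrow> (\<And>j. j \<in> I \<Longrightarrow> \<phi> j f = 0) \<Longrightarrow> f = \<zero>\<^bsub>E\<^esub>"
  shows "vdim E \<le> vdim ((dual_space E)\<lparr>carrier := T\<rparr>) + card I"
proof -
  interpret E: vectorspace class_ring E by fact
  interpret D: vectorspace class_ring "dual_space E"
    using dual_space_vectorspace[of E] by auto
  have TD: "T \<subseteq> carrier (dual_space E)" using T by (auto simp: VectorSpace.subspace_def submodule_def)
  let ?T = "(dual_space E)\<lparr>carrier := T\<rparr>"
  interpret T: vectorspace class_ring ?T using D.subspace_is_vs[OF T] .
  have "\<not> E.lin_dep {}" by (auto simp: E.lin_dep_def)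
  then have "T.fin_dim" by (intro annihilated_subspace_dim(1)[OF vs fin T, of "{}"]) auto
  then obtain B where B: "finite B" "T.basis B" using T.finite_basis_exists by auto
  have BT: "B \<subseteq> T" "T.span B = T" using B(2) by (auto simp: T.basis_def)
  \<comment> \<open>The joint family is indexed by a sum type, since a basis element of
    \<open>T\<close> may coincide with some \<open>\<phi> i\<close>.\<close>
  define \<psi> where "\<psi> j f = (case j of Inl b \<Rightarrow> b f | Inr i \<Rightarrow> \<phi> i f)" for j f
  have \<psi>D: "\<psi> j \<in> carrier (dual_space E)" if "j \<in> B <+> I" for j
  proof (cases j)
    case (Inl b)
    then have "\<psi> j = b" by (auto simp: \<psi>_def)
    then show ?thesis using that BT TD Inl by auto
  next
    case (Inr i)
    then have "\<psi> j = \<phi> i" by (auto simp: \<psi>_def)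
    then show ?thesis using that \<phi> Inr by auto
  qed
  have \<psi>0: "f = \<zero>\<^bsub>E\<^esub>" if f: "f \<in> carrier E" and 0: "\<And>j. j \<in> B <+> I \<Longrightarrow> \<psi> j f = 0" for f
  proof (rule inj[OF f])
    have b: "b f = 0" if "b \<in> B" for b using 0[of "Inl b"] that by (auto simp: \<psi>_def)
    have "submodule class_ring {\<tau> \<in> T. \<tau> f = 0} ?T"
    proof (rule submodule.intro)
      show "Module.module class_ring ?T" by (rule T.module_axioms)
    qed (use f T.zero_closed T.a_closed T.smult_closed in \<open>auto simp: dual_space_simps\<close>)
    from T.span_is_subset[OF _ this, of B] show "\<tau> f = 0" if "\<tau> \<in> T" for \<tau>
      using b BT that by auto
    show "\<phi> j f = 0" if "j \<in> I" for j using 0[of "Inr j"] that by (auto simp: \<psi>_def)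
  qed
  have "vdim E \<le> card (B <+> I)"
    using B(1) I \<psi>D \<psi>0 by (intro vdim_le_functionals(2)[OF vs, of _ \<psi>]) (auto simp: in_dual_space)
  also have "\<dots> = card B + card I" using B(1) I by (simp add: card_Plus)
  finally show ?thesis using T.dim_basis[OF B] by simp
qed

lemma dual_action_mem:
  fixes E :: "('k::field, 'v, 'm) module_scheme"
  assumes "\<And>f. f \<in> carrier E \<Longrightarrow> act a f \<in> carrier E"
    and "\<And>f g. f \<in> carrier E \<Longrightarrow> g \<in> carrier E \<Longrightarrow> act a (f \<oplus>\<^bsub>E\<^esub> g) = act a f \<oplus>\<^bsub>E\<^esub> act a g"
    and "\<And>c f. f \<in> carrier E \<Longrightarrow> act a (c \<odot>\<^bsub>E\<^esub> f) = c \<odot>\<^bsub>E\<^esub> act a f"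
    and closed: "\<And>f g. f \<in> carrier E \<Longrightarrow> g \<in> carrier E \<Longrightarrow> f \<oplus>\<^bsub>E\<^esub> g \<in> carrier E"
      "\<And>c f. f \<in> carrier E \<Longrightarrow> c \<odot>\<^bsub>E\<^esub> f \<in> carrier E"
    and "\<xi> \<in> carrier (dual_space E)"
  shows "dual_action E act a \<xi> \<in> carrier (dual_space E)"
  using assms by (auto simp: in_dual_space dual_action_def)

text \<open>The index depends only on the space of endomorphisms by which \<open>q\<close> acts.
  Hence \<open>q\<close> is a bare set, and sums and multiples of its elements are described through
  their action; this form passes to duals, quotients and stabilisers.\<close>

locale lie_action =
  fixes q :: "'x set" and E :: "('k::field, 'v, 'm) module_scheme" and act :: "'x \<Rightarrow> 'v \<Rightarrow> 'v"
  assumes vs: "vectorspace class_ring E" and fin: "vectorspace.fin_dim class_ring E"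
    and act_closed: "a \<in> q \<Longrightarrow> f \<in> carrier E \<Longrightarrow> act a f \<in> carrier E"
    and act_add: "a \<in> q \<Longrightarrow> f \<in> carrier E \<Longrightarrow> g \<in> carrier E \<Longrightarrow> act a (f \<oplus>\<^bsub>E\<^esub> g) = act a f \<oplus>\<^bsub>E\<^esub> act a g"
    and act_smult: "a \<in> q \<Longrightarrow> f \<in> carrier E \<Longrightarrow> act a (c \<odot>\<^bsub>E\<^esub> f) = c \<odot>\<^bsub>E\<^esub> act a f"
    and q_add: "a \<in> q \<Longrightarrow> b \<in> q \<Longrightarrow> \<exists>d\<in>q. \<forall>f\<in>carrier E. act d f = act a f \<oplus>\<^bsub>E\<^esub> act b f"
    and q_smult: "a \<in> q \<Longrightarrow> \<exists>d\<in>q. \<forall>f\<in>carrier E. act d f = c \<odot>\<^bsub>E\<^esub> act a f"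
    and q_nonempty: "q \<noteq> {}"
begin

interpretation E: vectorspace class_ring E by (rule vs)

lemma dual_vs: "vectorspace class_ring (dual_space E)"
  by (rule dual_space_vectorspace) auto

lemma tangent_space_subspace:
  assumes \<xi>: "\<xi> \<in> carrier (dual_space E)"
  shows "VectorSpace.subspace class_ring (tangent_space q (dual_action E act) \<xi>) (dual_space E)"
proof (rule VectorSpace.subspace.intro[OF dual_vs], rule submodule.intro)
  interpret D: vectorspace class_ring "dual_space E" by (rule dual_vs)
  let ?T = "tangent_space q (dual_action E act) \<xi>"
  have mem: "dual_action E act a \<xi> \<in> carrier (dual_space E)" if "a \<in> q" for a
    using that act_closed act_add act_smult \<xi> by (intro dual_action_mem) auto
  show "Module.module class_ring (dual_space E)" by (rule D.module_axioms)
  show "?T \<subseteq> carrier (dual_space E)" using mem by (auto simp: tangent_space_def)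
  have \<xi>_add: "\<xi> (f \<oplus>\<^bsub>E\<^esub> g) = \<xi> f + \<xi> g" if "f \<in> carrier E" "g \<in> carrier E" for f g
    using \<xi> that by (auto simp: in_dual_space)
  have \<xi>_smult: "\<xi> (c \<odot>\<^bsub>E\<^esub> f) = c * \<xi> f" if "f \<in> carrier E" for f c
    using \<xi> that by (auto simp: in_dual_space)
  have smult_mem: "c \<odot>\<^bsub>dual_space E\<^esub> t \<in> ?T" if t: "t \<in> ?T" for c t
  proof -
    obtain a where a: "a \<in> q" "t = dual_action E act a \<xi>" using t by (auto simp: tangent_space_def)
    obtain d where d: "d \<in> q" "\<forall>f\<in>carrier E. act d f = c \<odot>\<^bsub>E\<^esub> act a f" using q_smult a(1) by blast
    have "c \<odot>\<^bsub>dual_space E\<^esub> t = dual_action E act d \<xi>"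
      using a d act_closed \<xi>_smult by (auto simp: dual_space_simps dual_action_def)
    then show ?thesis using d by (auto simp: tangent_space_def)
  qed
  then show "c \<odot>\<^bsub>dual_space E\<^esub> t \<in> ?T" if "c \<in> carrier class_ring" "t \<in> ?T" for c t using that by blast
  show "t \<oplus>\<^bsub>dual_space E\<^esub> s \<in> ?T" if ts: "t \<in> ?T" "s \<in> ?T" for t s
  proof -
    obtain a b where a: "a \<in> q" "t = dual_action E act a \<xi>" and b: "b \<in> q" "s = dual_action E act b \<xi>"
      using ts by (auto simp: tangent_space_def)
    obtain d where d: "d \<in> q" "\<forall>f\<in>carrier E. act d f = act a f \<oplus>\<^bsub>E\<^esub> act b f" using q_add a(1) b(1) by blast
    have "t \<oplus>\<^bsub>dual_space E\<^esub> s = dual_action E act d \<xi>"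
      using a b d act_closed \<xi>_add by (auto simp: dual_space_simps dual_action_def)
    then show ?thesis using d by (auto simp: tangent_space_def)
  qed
  obtain a where "a \<in> q" using q_nonempty by blast
  then have "0 \<odot>\<^bsub>dual_space E\<^esub> dual_action E act a \<xi> \<in> ?T" using smult_mem by (auto simp: tangent_space_def)
  then show "\<zero>\<^bsub>dual_space E\<^esub> \<in> ?T" using D.lmult_0[OF mem[OF \<open>a \<in> q\<close>]] by simp
qed

abbreviation orbit_dim where
  "orbit_dim \<xi> \<equiv> vdim ((dual_space E)\<lparr>carrier := tangent_space q (dual_action E act) \<xi>\<rparr>)"

lemma orbit_dim_upper:
  assumes \<xi>: "\<xi> \<in> carrier (dual_space E)"
    and F: "F \<subseteq> carrier E" "\<not> module.lin_dep class_ring E F"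
    and ann: "\<And>a f. a \<in> q \<Longrightarrow> f \<in> F \<Longrightarrow> \<xi> (act a f) = 0"
  shows "orbit_dim \<xi> + card F \<le> vdim E"
  using F ann by (intro annihilated_subspace_dim(2)[OF vs fin tangent_space_subspace[OF \<xi>]])
    (auto simp: tangent_space_def dual_action_def)

text \<open>\<open>Max\<close> in the definition of the index is informative only for a finite set;
  all orbit dimensions are bounded by \<open>vdim E\<close>.\<close>

lemma finite_orbit_dims: "finite (orbit_dim ` carrier (dual_space E))"
proof (rule finite_subset)
  have "\<not> module.lin_dep class_ring E {}" by (auto simp: E.lin_dep_def)
  then show "orbit_dim ` carrier (dual_space E) \<subseteq> {..vdim E}"
    using orbit_dim_upper[of _ "{}"] by fastforce
qed simp

text \<open>One point \<open>\<xi>\<close> gives an upper bound, since its orbit is at most as large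
  as the largest one.\<close>

lemma lie_index_le:
  assumes \<xi>: "\<xi> \<in> carrier (dual_space E)" and I: "finite I"
    and \<phi>: "\<And>j. j \<in> I \<Longrightarrow> \<phi> j \<in> carrier (dual_space E)"
    and inj: "\<And>f. f \<in> carrier E \<Longrightarrow> (\<And>a. a \<in> q \<Longrightarrow> \<xi> (act a f) = 0) \<Longrightarrow> (\<And>j. j \<in> I \<Longrightarrow> \<phi> j f = 0) \<Longrightarrow> f = \<zero>\<^bsub>E\<^esub>"
  shows "lie_index q E act \<le> int (card I)"
proof -
  have "vdim E \<le> orbit_dim \<xi> + card I"
  proof (rule annihilator_functionals_dim[OF vs fin tangent_space_subspace[OF \<xi>] I \<phi>])
    fix f assume f: "f \<in> carrier E" and 0: "\<And>\<tau>. \<tau> \<in> tangent_space q (dual_action E act) \<xi> \<Longrightarrow> \<tau> f = 0"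
      and 1: "\<And>j. j \<in> I \<Longrightarrow> \<phi> j f = 0"
    have "\<xi> (act a f) = 0" if "a \<in> q" for a
      using 0[of "dual_action E act a \<xi>"] that f by (auto simp: tangent_space_def dual_action_def)
    then show "f = \<zero>\<^bsub>E\<^esub>" using inj f 1 by blast
  qed
  moreover have "orbit_dim \<xi> \<le> Max (orbit_dim ` carrier (dual_space E))"
    using finite_orbit_dims \<xi> by (intro Max_ge) auto
  ultimately show ?thesis by (simp add: lie_index_def)
qed

text \<open>The hypothesis ranges over all points because the one of maximal orbit dimension is
  unknown; there, \<open>m\<close> independent annihilated vectors force the orbit to have
  codimension at least \<open>m\<close>.\<close>

lemma lie_index_ge:
  assumes "\<And>\<xi>. \<xi> \<in> carrier (dual_space E) \<Longrightarrow> \<exists>F. F \<subseteq> carrier E \<and> \<not> module.lin_dep class_ring E F \<and> card F = m \<and>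
     (\<forall>a\<in>q. \<forall>f\<in>F. \<xi> (act a f) = 0)"
  shows "lie_index q E act \<ge> int m"
proof -
  interpret D: vectorspace class_ring "dual_space E" by (rule dual_vs)
  have "Max (orbit_dim ` carrier (dual_space E)) \<in> orbit_dim ` carrier (dual_space E)"
    using finite_orbit_dims D.zero_closed by (intro Max_in) blast+
  then obtain \<xi> where \<xi>: "\<xi> \<in> carrier (dual_space E)" "Max (orbit_dim ` carrier (dual_space E)) = orbit_dim \<xi>"
    by (metis (no_types, lifting) imageE)
  obtain F where F: "F \<subseteq> carrier E" "\<not> module.lin_dep class_ring E F" "card F = m"
     "\<forall>a\<in>q. \<forall>f\<in>F. \<xi> (act a f) = 0" using assms[OF \<xi>(1)] by blast
  have "orbit_dim \<xi> + m \<le> vdim E"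
    using orbit_dim_upper[OF \<xi>(1) F(1,2)] F(3,4) by blast
  then show ?thesis using \<xi>(2) by (simp add: lie_index_def)
qed

end

section \<open>Dual modules and points of the double dual\<close>

lemma dual_lin_indpt:
  fixes V :: "('k::field, 'v, 'm) module_scheme"
  assumes vs: "vectorspace class_ring (dual_space V)"
    and f: "\<And>i. i < m \<Longrightarrow> f i \<in> carrier (dual_space V)"
    and indep: "\<And>c i. (\<And>v. v \<in> carrier V \<Longrightarrow> (\<Sum>i<m. c i * f i v) = 0) \<Longrightarrow> i < m \<Longrightarrow> c i = 0"
  shows "\<not> module.lin_dep class_ring (dual_space V) (f ` {..<m})" and "card (f ` {..<m}) = (m::nat)"
proof -
  interpret D: vectorspace class_ring "dual_space V" by (rule vs)
  have inj: "inj_on f {..<m}"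
  proof (rule inj_onI, rule ccontr)
    fix i j assume ij: "i \<in> {..<m}" "j \<in> {..<m}" "f i = f j" "i \<noteq> j"
    \<comment> \<open>Two equal members would give a vanishing combination with coefficients
      \<open>1\<close> and \<open>-1\<close>, so the indexed form of independence also yields
      distinctness.\<close>
    define c :: "nat \<Rightarrow> 'k" where "c l = (if l = i then 1 else if l = j then -1 else 0)" for l
    have "(\<Sum>l<m. c l * f l v) = 0" for v
    proof -
      have "(\<Sum>l<m. c l * f l v) = (\<Sum>l\<in>{i,j}. c l * f l v)"
        using ij by (intro sum.mono_neutral_right) (auto simp: c_def)
      also have "\<dots> = 0" using ij by (simp add: c_def)
      finally show ?thesis .
    qed
    then have "c i = 0" using indep ij by auto
    then show False by (simp add: c_def)
  qed
  then show card: "card (f ` {..<m}) = m" by (simp add: card_image)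
  have lincomb_eval: "D.lincomb a B v = (\<Sum>g\<in>B. a g * g v)"
    if "finite B" "B \<subseteq> carrier (dual_space V)" "v \<in> carrier V" for a B v
    using that
  proof (induction B rule: finite_induct)
    case (insert x B)
    have "D.lincomb a (insert x B) = a x \<odot>\<^bsub>dual_space V\<^esub> x \<oplus>\<^bsub>dual_space V\<^esub> D.lincomb a B"
      using insert.hyps insert.prems by (intro D.lincomb_insert2) auto
    then show ?case using insert by (simp add: dual_space_simps)
  qed (simp add: D.lincomb_def dual_space_simps)
  show "\<not> D.lin_dep (f ` {..<m})"
  proof (rule D.finite_lin_indpt2)
    show "finite (f ` {..<m})" "f ` {..<m} \<subseteq> carrier (dual_space V)" using f by auto
    fix a assume 0: "D.lincomb a (f ` {..<m}) = \<zero>\<^bsub>dual_space V\<^esub>"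
    have "(\<Sum>i<m. a (f i) * f i v) = 0" if v: "v \<in> carrier V" for v
    proof -
      have "(\<Sum>i<m. a (f i) * f i v) = (\<Sum>g\<in>f ` {..<m}. a g * g v)"
        by (simp add: sum.reindex[OF inj])
      also have "\<dots> = D.lincomb a (f ` {..<m}) v"
        using f v by (intro lincomb_eval[symmetric]) auto
      finally show ?thesis using 0 v by (simp add: dual_space_simps)
    qed
    then have "a (f i) = 0" if "i < m" for i
      using indep[of "\<lambda>i. a (f i)" i] that by blast
    then show "\<forall>v\<in>f ` {..<m}. a v = \<zero>\<^bsub>class_ring\<^esub>" by simp
  qed
qed

text \<open>Stated for a structure with closed operations so that quotients are covered; the dual is
  finite-dimensional because functionals are determined by their values on the finite set
  \<open>P\<close>.\<close>

lemma dual_lie_action: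
  fixes V :: "('k::field, 'v, 'm) module_scheme"
  assumes closed: "\<And>v w. v \<in> carrier V \<Longrightarrow> w \<in> carrier V \<Longrightarrow> v \<oplus>\<^bsub>V\<^esub> w \<in> carrier V"
      "\<And>c v. v \<in> carrier V \<Longrightarrow> c \<odot>\<^bsub>V\<^esub> v \<in> carrier V"
    and act_closed: "\<And>a v. a \<in> q \<Longrightarrow> v \<in> carrier V \<Longrightarrow> act a v \<in> carrier V"
    and act_add: "\<And>a v w. a \<in> q \<Longrightarrow> v \<in> carrier V \<Longrightarrow> w \<in> carrier V \<Longrightarrow> act a (v \<oplus>\<^bsub>V\<^esub> w) = act a v \<oplus>\<^bsub>V\<^esub> act a w"
    and act_smult: "\<And>a c v. a \<in> q \<Longrightarrow> v \<in> carrier V \<Longrightarrow> act a (c \<odot>\<^bsub>V\<^esub> v) = c \<odot>\<^bsub>V\<^esub> act a v"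
    and q_add: "\<And>a b. a \<in> q \<Longrightarrow> b \<in> q \<Longrightarrow> \<exists>d\<in>q. \<forall>v\<in>carrier V. act d v = act a v \<oplus>\<^bsub>V\<^esub> act b v"
    and q_smult: "\<And>a c. a \<in> q \<Longrightarrow> \<exists>d\<in>q. \<forall>v\<in>carrier V. act d v = c \<odot>\<^bsub>V\<^esub> act a v"
    and "q \<noteq> {}" and P: "finite P" "P \<subseteq> carrier V"
    and sep: "\<And>f. f \<in> carrier (dual_space V) \<Longrightarrow> (\<And>p. p \<in> P \<Longrightarrow> f p = 0) \<Longrightarrow> f = \<zero>\<^bsub>dual_space V\<^esub>"
  shows "lie_action q (dual_space V) (dual_action V act)"
proof (rule lie_action.intro)
  show vs: "vectorspace class_ring (dual_space V)"
    using closed by (rule dual_space_vectorspace)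
  show "vectorspace.fin_dim class_ring (dual_space V)"
    by (rule vdim_le_functionals(1)[OF vs P(1), of "\<lambda>p f. f p"]) (use P sep in \<open>auto simp: dual_space_simps\<close>)
  show "dual_action V act a f \<in> carrier (dual_space V)" if "a \<in> q" "f \<in> carrier (dual_space V)" for a f
    using that assms by (intro dual_action_mem) auto
  show "dual_action V act a (f \<oplus>\<^bsub>dual_space V\<^esub> g) = dual_action V act a f \<oplus>\<^bsub>dual_space V\<^esub> dual_action V act a g"
    if "a \<in> q" for a f g
    using that act_closed by (auto simp: dual_action_def dual_space_simps fun_eq_iff)
  show "dual_action V act a (c \<odot>\<^bsub>dual_space V\<^esub> f) = c \<odot>\<^bsub>dual_space V\<^esub> dual_action V act a f"
    if "a \<in> q" for a f c
    using that act_closed by (auto simp: dual_action_def dual_space_simps fun_eq_iff)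
  show "\<exists>d\<in>q. \<forall>f\<in>carrier (dual_space V). dual_action V act d f = dual_action V act a f \<oplus>\<^bsub>dual_space V\<^esub> dual_action V act b f"
    if ab: "a \<in> q" "b \<in> q" for a b
  proof -
    obtain d where "d \<in> q" "\<forall>v\<in>carrier V. act d v = act a v \<oplus>\<^bsub>V\<^esub> act b v" using q_add[OF ab] by blast
    then show ?thesis
      by (intro bexI[of _ d]) (use ab act_closed in \<open>auto simp: dual_action_def dual_space_simps fun_eq_iff in_dual_space\<close>)
  qed
  show "\<exists>d\<in>q. \<forall>f\<in>carrier (dual_space V). dual_action V act d f = c \<odot>\<^bsub>dual_space V\<^esub> dual_action V act a f"
    if a: "a \<in> q" for a c
  proof -
    obtain d where "d \<in> q" "\<forall>v\<in>carrier V. act d v = c \<odot>\<^bsub>V\<^esub> act a v" using q_smult[OF a] by blast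
    then show ?thesis
      by (intro bexI[of _ d]) (use a act_closed in \<open>auto simp: dual_action_def dual_space_simps fun_eq_iff in_dual_space\<close>)
  qed
qed fact

lemma evaluation_functional:
  fixes V :: "('k::field, 'v, 'm) module_scheme"
  assumes vs: "vectorspace class_ring (dual_space V)" and x: "x \<in> carrier V"
  shows "(\<lambda>f\<in>carrier (dual_space V). f x) \<in> carrier (dual_space (dual_space V))"
proof -
  interpret D: vectorspace class_ring "dual_space V" by (rule vs)
  have "f \<oplus>\<^bsub>dual_space V\<^esub> g \<in> carrier (dual_space V)" "c \<odot>\<^bsub>dual_space V\<^esub> f \<in> carrier (dual_space V)"
    if "f \<in> carrier (dual_space V)" "g \<in> carrier (dual_space V)" for f g c
    using that D.a_closed D.smult_closed by auto
  then show ?thesis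
    unfolding in_dual_space[of _ "dual_space V"] using x by (simp add: dual_space_simps)
qed

context lie_action
begin

lemma vanishes_if_spanned:
  assumes f: "f \<in> carrier (dual_space E)" and P: "P \<subseteq> carrier E" "LinearCombinations.module.span class_ring E P = carrier E"
    and 0: "\<And>p. p \<in> P \<Longrightarrow> f p = 0"
  shows "f = \<zero>\<^bsub>dual_space E\<^esub>"
proof -
  have "f v = 0" if "v \<in> carrier E" for v
    using functional_zero[OF vs f P(1) 0] P(2) that by blast
  then show ?thesis using f by (auto simp: dual_space_simps in_dual_space extensional_def fun_eq_iff)
qed

lemma separating_points:
  "\<exists>P. finite P \<and> P \<subseteq> carrier E \<and> LinearCombinations.module.span class_ring E P = carrier E"
proof -
  interpret E: vectorspace class_ring E by (rule vs)
  show ?thesis using fin unfolding E.fin_dim_def by blast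
qed

lemma dual: "lie_action q (dual_space E) (dual_action E act)"
proof -
  interpret E: vectorspace class_ring E by (rule vs)
  obtain P where P: "finite P" "P \<subseteq> carrier E" "LinearCombinations.module.span class_ring E P = carrier E"
    using separating_points by blast
  show ?thesis
  proof (rule dual_lie_action[OF _ _ act_closed act_add act_smult q_add q_smult q_nonempty P(1,2)])
    show "f = \<zero>\<^bsub>dual_space E\<^esub>" if "f \<in> carrier (dual_space E)" "\<And>p. p \<in> P \<Longrightarrow> f p = 0" for f
      using vanishes_if_spanned[OF that(1) P(2,3) that(2)] .
  qed auto
qed

text \<open>For an upper bound it is enough to consider evaluation at a vector \<open>x\<close>. The
  annihilated functionals are then those vanishing on the tangent space at \<open>x\<close>, and the
  \<open>e j\<close> have to span \<open>E\<close> together with that tangent space.\<close>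

lemma lie_index_dual_le:
  assumes x: "x \<in> carrier E" and I: "finite I" and e: "\<And>j. j \<in> I \<Longrightarrow> e j \<in> carrier E"
    and inj: "\<And>f. f \<in> carrier (dual_space E) \<Longrightarrow> (\<And>a. a \<in> q \<Longrightarrow> f (act a x) = 0) \<Longrightarrow>
      (\<And>j. j \<in> I \<Longrightarrow> f (e j) = 0) \<Longrightarrow> f = \<zero>\<^bsub>dual_space E\<^esub>"
  shows "lie_index q (dual_space E) (dual_action E act) \<le> int (card I)"
proof -
  interpret D: lie_action q "dual_space E" "dual_action E act" by (rule dual)
  have ev: "(\<lambda>f\<in>carrier (dual_space E). f v) \<in> carrier (dual_space (dual_space E))" if "v \<in> carrier E" for v
    by (rule evaluation_functional[OF D.vs that])
  show ?thesis
  proof (rule D.lie_index_le[OF ev[OF x] I, of "\<lambda>j. \<lambda>f\<in>carrier (dual_space E). f (e j)"])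
    show "(\<lambda>f\<in>carrier (dual_space E). f (e j)) \<in> carrier (dual_space (dual_space E))" if "j \<in> I" for j
      by (rule ev[OF e[OF that]])
    fix f assume f: "f \<in> carrier (dual_space E)"
      and 0: "\<And>a. a \<in> q \<Longrightarrow> (\<lambda>f\<in>carrier (dual_space E). f x) (dual_action E act a f) = 0"
      and 1: "\<And>j. j \<in> I \<Longrightarrow> (\<lambda>f\<in>carrier (dual_space E). f (e j)) f = 0"
    have "f (act a x) = 0" if "a \<in> q" for a
      using 0[OF that] D.act_closed[OF that f] x by (simp add: dual_action_def)
    moreover have "f (e j) = 0" if "j \<in> I" for j using 1[OF that] f by simp
    ultimately show "f = \<zero>\<^bsub>dual_space E\<^esub>" using inj f by blast
  qed
qed

end

section \<open>Functionals on a quotient module\<close>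

definition descend :: "('k::field, 'v, 'm) module_scheme \<Rightarrow> 'v set \<Rightarrow> ('v \<Rightarrow> 'k) \<Rightarrow> 'v set \<Rightarrow> 'k" where
  "descend V U f = (\<lambda>C\<in>carrier (quotient_space V U). f (SOME v. v \<in> C))"

locale quotient_by_subspace =
  fixes V :: "('k::field, 'v, 'm) module_scheme" and U :: "'v set"
  assumes V_vs: "vectorspace class_ring V" and U: "submodule class_ring U V"
begin

interpretation V: vectorspace class_ring V by (rule V_vs)

abbreviation N where "N \<equiv> quotient_space V U"

lemma U_subset: "U \<subseteq> carrier V" using U by (simp add: submodule_def)

lemma U_add: "u \<in> U \<Longrightarrow> w \<in> U \<Longrightarrow> u \<oplus>\<^bsub>V\<^esub> w \<in> U"
  and U_smult: "u \<in> U \<Longrightarrow> c \<odot>\<^bsub>V\<^esub> u \<in> U" and U_zero: "\<zero>\<^bsub>V\<^esub> \<in> U"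
  using U by (auto simp: submodule_def)

lemma U_minus: "u \<in> U \<Longrightarrow> \<ominus>\<^bsub>V\<^esub> u \<in> U"
  using U_smult[of u "-1"] V.smult_minus_1[of u] U_subset by (auto simp: class_ring_simps)

lemma coset_mem: "w \<in> U +>\<^bsub>V\<^esub> v \<longleftrightarrow> (\<exists>u\<in>U. w = u \<oplus>\<^bsub>V\<^esub> v)"
  by (auto simp: a_r_coset_def')

lemma coset_self: "v \<in> carrier V \<Longrightarrow> v \<in> U +>\<^bsub>V\<^esub> v"
  unfolding coset_mem by (rule bexI[OF _ U_zero]) simp

lemma coset_eq:
  assumes v: "v \<in> carrier V" and u: "u \<in> U"
  shows "U +>\<^bsub>V\<^esub> (u \<oplus>\<^bsub>V\<^esub> v) = U +>\<^bsub>V\<^esub> v"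
proof -
  have uV: "u \<in> carrier V" by (rule subsetD[OF U_subset u])
  have "\<exists>u'\<in>U. w \<oplus>\<^bsub>V\<^esub> (u \<oplus>\<^bsub>V\<^esub> v) = u' \<oplus>\<^bsub>V\<^esub> v" if w: "w \<in> U" for w
  proof -
    have "w \<in> carrier V" by (rule subsetD[OF U_subset w])
    from V.a_assoc[OF this uV v] show ?thesis
      by (intro bexI[of _ "w \<oplus>\<^bsub>V\<^esub> u"] U_add w u) simp
  qed
  moreover have "\<exists>u'\<in>U. w \<oplus>\<^bsub>V\<^esub> v = u' \<oplus>\<^bsub>V\<^esub> (u \<oplus>\<^bsub>V\<^esub> v)" if w: "w \<in> U" for w
  proof (rule bexI)
    have wV: "w \<in> carrier V" by (rule subsetD[OF U_subset w])
    have "w \<oplus>\<^bsub>V\<^esub> \<ominus>\<^bsub>V\<^esub> u \<oplus>\<^bsub>V\<^esub> (u \<oplus>\<^bsub>V\<^esub> v) = w \<oplus>\<^bsub>V\<^esub> (\<ominus>\<^bsub>V\<^esub> u \<oplus>\<^bsub>V\<^esub> (u \<oplus>\<^bsub>V\<^esub> v))"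
      using uV wV v by (intro V.a_assoc) auto
    also have "\<dots> = w \<oplus>\<^bsub>V\<^esub> v" using uV v V.r_neg2 V.r_neg1 by simp
    finally show "w \<oplus>\<^bsub>V\<^esub> v = w \<oplus>\<^bsub>V\<^esub> \<ominus>\<^bsub>V\<^esub> u \<oplus>\<^bsub>V\<^esub> (u \<oplus>\<^bsub>V\<^esub> v)" by simp
    show "w \<oplus>\<^bsub>V\<^esub> \<ominus>\<^bsub>V\<^esub> u \<in> U" by (intro U_add U_minus w u)
  qed
  ultimately show ?thesis
    by (intro equalityI subsetI) (force simp: coset_mem)+
qed

lemma carrier_N: "carrier N = (\<lambda>v. U +>\<^bsub>V\<^esub> v) ` carrier V"
  by (auto simp: quotient_space_def A_RCOSETS_def')

lemma coset_in_N: "v \<in> carrier V \<Longrightarrow> U +>\<^bsub>V\<^esub> v \<in> carrier N"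
  by (simp add: carrier_N)

lemma N_add:
  assumes v: "v \<in> carrier V" and w: "w \<in> carrier V"
  shows "(U +>\<^bsub>V\<^esub> v) \<oplus>\<^bsub>N\<^esub> (U +>\<^bsub>V\<^esub> w) = U +>\<^bsub>V\<^esub> (v \<oplus>\<^bsub>V\<^esub> w)"
proof -
  have "(U +>\<^bsub>V\<^esub> v) <+>\<^bsub>V\<^esub> (U +>\<^bsub>V\<^esub> w) = U +>\<^bsub>V\<^esub> (v \<oplus>\<^bsub>V\<^esub> w)" (is "?L = ?R")
  proof (intro equalityI subsetI)
    fix x assume "x \<in> ?L"
    then obtain a b where ab: "a \<in> U" "b \<in> U" "x = (a \<oplus>\<^bsub>V\<^esub> v) \<oplus>\<^bsub>V\<^esub> (b \<oplus>\<^bsub>V\<^esub> w)"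
      by (auto simp: set_add_def' coset_mem)
    have abV: "a \<in> carrier V" "b \<in> carrier V" using ab U_subset by auto
    have "x = (a \<oplus>\<^bsub>V\<^esub> b) \<oplus>\<^bsub>V\<^esub> (v \<oplus>\<^bsub>V\<^esub> w)" using ab(3) abV v w by (simp add: V.a_ac)
    then show "x \<in> ?R" unfolding coset_mem by (rule bexI) (intro U_add ab)
  next
    fix x assume "x \<in> ?R"
    then obtain a where a: "a \<in> U" "x = a \<oplus>\<^bsub>V\<^esub> (v \<oplus>\<^bsub>V\<^esub> w)" by (auto simp: coset_mem)
    have "a \<in> carrier V" by (rule subsetD[OF U_subset a(1)])
    then have x: "x = (a \<oplus>\<^bsub>V\<^esub> v) \<oplus>\<^bsub>V\<^esub> w" using a(2) v w by (simp add: V.a_assoc)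
    have av: "a \<oplus>\<^bsub>V\<^esub> v \<in> U +>\<^bsub>V\<^esub> v" unfolding coset_mem by (rule bexI[OF refl a(1)])
    show "x \<in> ?L"
      unfolding set_add_def' x by (rule UN_I[OF av], rule UN_I[where a = w], rule coset_self[OF w], simp)
  qed
  then show ?thesis by (simp add: quotient_space_def)
qed

text \<open>Scalar multiplication and the action on the quotient are both unions over all
  representatives of a coset; this is the common reason why such a union collapses to one
  coset.\<close>

lemma union_over_coset:
  assumes v: "v \<in> carrier V"
    and "\<And>u. u \<in> U \<Longrightarrow> \<exists>u'\<in>U. F (u \<oplus>\<^bsub>V\<^esub> v) = u' \<oplus>\<^bsub>V\<^esub> F v" and "F v \<in> carrier V"
  shows "(\<Union>w\<in>U +>\<^bsub>V\<^esub> v. U +>\<^bsub>V\<^esub> F w) = U +>\<^bsub>V\<^esub> F v"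
proof -
  have "U +>\<^bsub>V\<^esub> F w = U +>\<^bsub>V\<^esub> F v" if w: "w \<in> U +>\<^bsub>V\<^esub> v" for w
  proof -
    obtain u where u: "u \<in> U" "w = u \<oplus>\<^bsub>V\<^esub> v" using w unfolding coset_mem by blast
    then obtain u' where "u' \<in> U" "F w = u' \<oplus>\<^bsub>V\<^esub> F v" using assms(2) by blast
    then show ?thesis using coset_eq[OF assms(3)] by simp
  qed
  then show ?thesis using coset_self[OF v] by blast
qed

lemma N_smult:
  assumes v: "v \<in> carrier V"
  shows "c \<odot>\<^bsub>N\<^esub> (U +>\<^bsub>V\<^esub> v) = U +>\<^bsub>V\<^esub> (c \<odot>\<^bsub>V\<^esub> v)"
proof -
  have "c \<odot>\<^bsub>V\<^esub> (u \<oplus>\<^bsub>V\<^esub> v) = c \<odot>\<^bsub>V\<^esub> u \<oplus>\<^bsub>V\<^esub> c \<odot>\<^bsub>V\<^esub> v" if "u \<in> U" for u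
    using that U_subset v by (intro V.smult_r_distr) (auto simp: class_ring_simps)
  then have "(\<Union>w\<in>U +>\<^bsub>V\<^esub> v. U +>\<^bsub>V\<^esub> (c \<odot>\<^bsub>V\<^esub> w)) = U +>\<^bsub>V\<^esub> (c \<odot>\<^bsub>V\<^esub> v)"
    using v U_smult V.smult_closed[of c v] by (intro union_over_coset) (auto simp: class_ring_simps)
  then show ?thesis by (simp add: quotient_space_def)
qed

lemma quotient_action_coset:
  assumes v: "v \<in> carrier V" and act: "\<And>w. w \<in> carrier V \<Longrightarrow> act a w \<in> carrier V"
    "\<And>u w. u \<in> carrier V \<Longrightarrow> w \<in> carrier V \<Longrightarrow> act a (u \<oplus>\<^bsub>V\<^esub> w) = act a u \<oplus>\<^bsub>V\<^esub> act a w" "\<And>u. u \<in> U \<Longrightarrow> act a u \<in> U"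
  shows "quotient_action V U act a (U +>\<^bsub>V\<^esub> v) = U +>\<^bsub>V\<^esub> act a v"
  unfolding quotient_action_def using v act U_subset by (intro union_over_coset) blast+

text \<open>The representative chosen by \<open>SOME\<close> differs from \<open>v\<close> by an
  element of \<open>U\<close>, where \<open>f\<close> vanishes.\<close>

lemma descend_coset:
  assumes f: "\<And>u. u \<in> U \<Longrightarrow> f u = 0" "\<And>u w. u \<in> carrier V \<Longrightarrow> w \<in> carrier V \<Longrightarrow> f (u \<oplus>\<^bsub>V\<^esub> w) = f u + f w"
    and v: "v \<in> carrier V"
  shows "descend V U f (U +>\<^bsub>V\<^esub> v) = f v"
proof -
  have "(SOME w. w \<in> U +>\<^bsub>V\<^esub> v) \<in> U +>\<^bsub>V\<^esub> v" using coset_self[OF v] by (rule someI)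
  then obtain u where "u \<in> U" "(SOME w. w \<in> U +>\<^bsub>V\<^esub> v) = u \<oplus>\<^bsub>V\<^esub> v" unfolding coset_mem by blast
  then have "f (SOME w. w \<in> U +>\<^bsub>V\<^esub> v) = f v" using f v U_subset by auto
  then show ?thesis using coset_in_N[OF v] by (simp add: descend_def)
qed

lemma descend_in_dual:
  assumes f: "\<And>u. u \<in> U \<Longrightarrow> f u = 0" "\<And>u w. u \<in> carrier V \<Longrightarrow> w \<in> carrier V \<Longrightarrow> f (u \<oplus>\<^bsub>V\<^esub> w) = f u + f w"
    and smult: "\<And>c w. w \<in> carrier V \<Longrightarrow> f (c \<odot>\<^bsub>V\<^esub> w) = c * f w"
  shows "descend V U f \<in> carrier (dual_space N)"
  unfolding in_dual_space
proof (intro conjI ballI allI)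
  show "descend V U f \<in> extensional (carrier N)" by (simp add: descend_def)
  note [simp] = descend_coset[of f, OF f]
  fix C assume "C \<in> carrier N"
  then obtain v where v: "v \<in> carrier V" "C = U +>\<^bsub>V\<^esub> v" by (auto simp: carrier_N)
  show "descend V U f (c \<odot>\<^bsub>N\<^esub> C) = c * descend V U f C" for c
    using v V.smult_closed[of c v] by (simp add: N_smult smult class_ring_simps)
  fix D assume "D \<in> carrier N"
  then obtain w where w: "w \<in> carrier V" "D = U +>\<^bsub>V\<^esub> w" by (auto simp: carrier_N)
  show "descend V U f (C \<oplus>\<^bsub>N\<^esub> D) = descend V U f C + descend V U f D"
    using v w V.a_closed[of v w] by (simp add: N_add f(2))
qed

lemma quotient_dual_lie_action:
  assumes "lie_action q V act" and stable: "\<And>a u. a \<in> q \<Longrightarrow> u \<in> U \<Longrightarrow> act a u \<in> U"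
  shows "lie_action q (dual_space N) (dual_action N (quotient_action V U act))"
proof -
  interpret A: lie_action q V act by fact
  note qa = quotient_action_coset[OF _ A.act_closed A.act_add stable]
  obtain P where P: "finite P" "P \<subseteq> carrier V" "V.span P = carrier V"
    using A.separating_points by blast
  show ?thesis
  proof (rule dual_lie_action[where P = "(\<lambda>v. U +>\<^bsub>V\<^esub> v) ` P"])
    show "C \<oplus>\<^bsub>N\<^esub> D \<in> carrier N" if CD: "C \<in> carrier N" "D \<in> carrier N" for C D
      using CD unfolding carrier_N by (auto simp: N_add)
    show "c \<odot>\<^bsub>N\<^esub> C \<in> carrier N" if C: "C \<in> carrier N" for c C
      using C V.smult_closed unfolding carrier_N by (auto simp: N_smult class_ring_simps)
    show "quotient_action V U act a C \<in> carrier N" if "a \<in> q" "C \<in> carrier N" for a C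
      using that A.act_closed unfolding carrier_N by (auto simp: qa)
    show "quotient_action V U act a (C \<oplus>\<^bsub>N\<^esub> D) = quotient_action V U act a C \<oplus>\<^bsub>N\<^esub> quotient_action V U act a D"
      if "a \<in> q" "C \<in> carrier N" "D \<in> carrier N" for a C D
      using that A.act_closed A.act_add unfolding carrier_N by (auto simp: qa N_add)
    show "quotient_action V U act a (c \<odot>\<^bsub>N\<^esub> C) = c \<odot>\<^bsub>N\<^esub> quotient_action V U act a C"
      if "a \<in> q" "C \<in> carrier N" for a c C
      using that A.act_closed A.act_smult V.smult_closed[of c] unfolding carrier_N by (auto simp: qa N_smult class_ring_simps)
    show "\<exists>d\<in>q. \<forall>C\<in>carrier N. quotient_action V U act d C = quotient_action V U act a C \<oplus>\<^bsub>N\<^esub> quotient_action V U act b C"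
      if ab: "a \<in> q" "b \<in> q" for a b
    proof -
      obtain d where "d \<in> q" "\<forall>v\<in>carrier V. act d v = act a v \<oplus>\<^bsub>V\<^esub> act b v" using A.q_add[OF ab] by blast
      then show ?thesis
        using ab A.act_closed unfolding carrier_N by (intro bexI[of _ d]) (auto simp: qa N_add)
    qed
    show "\<exists>d\<in>q. \<forall>C\<in>carrier N. quotient_action V U act d C = c \<odot>\<^bsub>N\<^esub> quotient_action V U act a C"
      if a: "a \<in> q" for a c
    proof -
      obtain d where "d \<in> q" "\<forall>v\<in>carrier V. act d v = c \<odot>\<^bsub>V\<^esub> act a v" using A.q_smult[OF a] by blast
      then show ?thesis
        using a A.act_closed unfolding carrier_N by (intro bexI[of _ d]) (auto simp: qa N_smult)
    qed
    show "q \<noteq> {}" by (rule A.q_nonempty)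
    show "finite ((\<lambda>v. U +>\<^bsub>V\<^esub> v) ` P)" "(\<lambda>v. U +>\<^bsub>V\<^esub> v) ` P \<subseteq> carrier N"
      using P unfolding carrier_N by auto
    fix f assume f: "f \<in> carrier (dual_space N)" and 0: "\<And>p. p \<in> (\<lambda>v. U +>\<^bsub>V\<^esub> v) ` P \<Longrightarrow> f p = 0"
    \<comment> \<open>Pulled back to \<open>V\<close>, a functional on the quotient is determined on
      a spanning set; hence the cosets of a spanning set of \<open>V\<close> separate the
      functionals on \<open>N\<close>.\<close>
    define f' where "f' = (\<lambda>v\<in>carrier V. f (U +>\<^bsub>V\<^esub> v))"
    have "f' \<in> carrier (dual_space V)"
      unfolding in_dual_space
    proof (intro conjI ballI allI)
      show "f' \<in> extensional (carrier V)" by (simp add: f'_def)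
      fix v assume v: "v \<in> carrier V"
      have "f (c \<odot>\<^bsub>N\<^esub> (U +>\<^bsub>V\<^esub> v)) = c * f (U +>\<^bsub>V\<^esub> v)" for c
        using f coset_in_N[OF v] unfolding in_dual_space by blast
      then show "f' (c \<odot>\<^bsub>V\<^esub> v) = c * f' v" for c
        using v V.smult_closed[of c v] by (simp add: f'_def N_smult class_ring_simps)
      fix w assume w: "w \<in> carrier V"
      have "f ((U +>\<^bsub>V\<^esub> v) \<oplus>\<^bsub>N\<^esub> (U +>\<^bsub>V\<^esub> w)) = f (U +>\<^bsub>V\<^esub> v) + f (U +>\<^bsub>V\<^esub> w)"
        using f coset_in_N[OF v] coset_in_N[OF w] unfolding in_dual_space by blast
      then show "f' (v \<oplus>\<^bsub>V\<^esub> w) = f' v + f' w"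
        using v w V.a_closed[of v w] by (simp add: f'_def N_add)
    qed
    then have "f' = \<zero>\<^bsub>dual_space V\<^esub>"
      by (rule A.vanishes_if_spanned[OF _ P(2,3)]) (use 0 P(2) in \<open>auto simp: f'_def\<close>)
    then have f'0: "f' v = 0" if "v \<in> carrier V" for v using that by (simp add: dual_space_simps)
    have "f C = 0" if C: "C \<in> carrier N" for C
    proof -
      obtain v where "v \<in> carrier V" "C = U +>\<^bsub>V\<^esub> v" using C by (auto simp: carrier_N)
      then show ?thesis using f'0[of v] by (simp add: f'_def)
    qed
    then show "f = \<zero>\<^bsub>dual_space N\<^esub>"
      using f by (auto simp: dual_space_simps in_dual_space extensional_def fun_eq_iff)
  qed
qed

text \<open>Functionals on the quotient are the functionals on \<open>V\<close> that vanish on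
  \<open>U\<close>, so the annihilated family is sought on \<open>V\<close> itself. The dual action
  becomes \<open>f \<mapsto> (\<lambda>v. - f (act a v))\<close> before descending.\<close>

lemma lie_index_quotient_dual_ge:
  assumes action: "lie_action q V act" and stable: "\<And>a u. a \<in> q \<Longrightarrow> u \<in> U \<Longrightarrow> act a u \<in> U"
    and D: "\<And>\<xi>. \<xi> \<in> carrier (dual_space (dual_space N)) \<Longrightarrow> \<exists>f. (\<forall>i<m. f i \<in> carrier (dual_space V) \<and> (\<forall>u\<in>U. f i u = 0)
        \<and> (\<forall>a\<in>q. \<xi> (descend V U (\<lambda>v. - f i (act a v))) = 0)) \<and>
       (\<forall>c. (\<forall>v\<in>carrier V. (\<Sum>i<m. c i * f i v) = 0) \<longrightarrow> (\<forall>i<m. c i = 0))"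
  shows "lie_index q (dual_space N) (dual_action N (quotient_action V U act)) \<ge> int m"
proof -
  interpret A: lie_action q V act by fact
  interpret DN: lie_action q "dual_space N" "dual_action N (quotient_action V U act)"
    using quotient_dual_lie_action[OF action stable] by blast
  show ?thesis
  proof (rule DN.lie_index_ge)
    fix \<xi> assume "\<xi> \<in> carrier (dual_space (dual_space N))"
    from D[OF this] obtain f where f0: "\<forall>i<m. f i \<in> carrier (dual_space V) \<and> (\<forall>u\<in>U. f i u = 0)
        \<and> (\<forall>a\<in>q. \<xi> (descend V U (\<lambda>v. - f i (act a v))) = 0)"
      and indep: "\<forall>c. (\<forall>v\<in>carrier V. (\<Sum>i<m. c i * f i v) = 0) \<longrightarrow> (\<forall>i<m. c i = 0)"
      by (elim exE conjE)
    from f0 have f: "\<And>i. i < m \<Longrightarrow> f i \<in> carrier (dual_space V)" "\<And>i u. i < m \<Longrightarrow> u \<in> U \<Longrightarrow> f i u = 0"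
      "\<And>i a. i < m \<Longrightarrow> a \<in> q \<Longrightarrow> \<xi> (descend V U (\<lambda>v. - f i (act a v))) = 0" by simp_all
    have f_add: "f i (v \<oplus>\<^bsub>V\<^esub> w) = f i v + f i w" if "i < m" "v \<in> carrier V" "w \<in> carrier V" for i v w
      using f(1)[OF that(1)] that by (auto simp: in_dual_space)
    have f_smult: "f i (c \<odot>\<^bsub>V\<^esub> v) = c * f i v" if "i < m" "v \<in> carrier V" for i v c
      using f(1)[OF that(1)] that by (auto simp: in_dual_space)
    define g where "g i = descend V U (f i)" for i
    have g: "g i \<in> carrier (dual_space N)" if "i < m" for i
      unfolding g_def using that f(2) f_add f_smult by (intro descend_in_dual) auto
    have g_coset: "g i (U +>\<^bsub>V\<^esub> v) = f i v" if "i < m" "v \<in> carrier V" for i v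
      unfolding g_def using that f(2) f_add by (intro descend_coset) auto
    have g_indep: "c i = 0" if c: "\<And>C. C \<in> carrier N \<Longrightarrow> (\<Sum>i<m. c i * g i C) = 0" and i: "i < m" for c i
    proof -
      have "(\<Sum>i<m. c i * f i v) = 0" if "v \<in> carrier V" for v
      proof -
        have "(\<Sum>i<m. c i * f i v) = (\<Sum>i<m. c i * g i (U +>\<^bsub>V\<^esub> v))"
          by (rule sum.cong) (simp_all add: g_coset that)
        then show ?thesis using c[OF coset_in_N[OF that]] by simp
      qed
      then show ?thesis using indep i by blast
    qed
    have li: "\<not> module.lin_dep class_ring (dual_space N) (g ` {..<m})" "card (g ` {..<m}) = m"
    proof -
      have gi: "c i = 0" if "\<And>C. C \<in> carrier N \<Longrightarrow> (\<Sum>i<m. c i * g i C) = 0" "i < m" for c i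
        using g_indep[of c i] that by blast
      note * = dual_lin_indpt[OF DN.vs, of m g]
      show "\<not> module.lin_dep class_ring (dual_space N) (g ` {..<m})" by (rule *(1)) (fact g gi)+
      show "card (g ` {..<m}) = m" by (rule *(2)) (fact g gi)+
    qed
    have act: "dual_action N (quotient_action V U act) a (g i) = descend V U (\<lambda>v. - f i (act a v))"
      if a: "a \<in> q" and i: "i < m" for a i
    proof
      fix C
      show "dual_action N (quotient_action V U act) a (g i) C = descend V U (\<lambda>v. - f i (act a v)) C"
      proof (cases "C \<in> carrier N")
        case True
        then obtain v where v: "v \<in> carrier V" "C = U +>\<^bsub>V\<^esub> v" by (auto simp: carrier_N)
        have "quotient_action V U act a C = U +>\<^bsub>V\<^esub> act a v"
          unfolding v(2) using a v(1) stable A.act_closed A.act_add by (intro quotient_action_coset) auto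
        then have "dual_action N (quotient_action V U act) a (g i) C = - f i (act a v)"
          using True a i v(1) A.act_closed by (simp add: dual_action_def g_coset)
        moreover have "descend V U (\<lambda>v. - f i (act a v)) C = - f i (act a v)"
          unfolding v(2) using a i v(1) stable A.act_closed A.act_add f(2) f_add by (intro descend_coset) auto
        ultimately show ?thesis by simp
      qed (simp add: dual_action_def descend_def)
    qed
    show "\<exists>F. F \<subseteq> carrier (dual_space N) \<and> \<not> module.lin_dep class_ring (dual_space N) F \<and> card F = m \<and>
         (\<forall>a\<in>q. \<forall>h\<in>F. \<xi> (dual_action N (quotient_action V U act) a h) = 0)"
      using li g act f(3) by (intro exI[of _ "g ` {..<m}"]) auto
  qed
qed

end

section \<open>Stabilisers and the comparison of the two indices\<close>

lemma (in lie_action) stabiliser_action: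
  assumes v: "v \<in> carrier E"
  shows "lie_action (lie_stabiliser q E act v) E act"
proof (rule lie_action.intro)
  interpret E: vectorspace class_ring E by (rule vs)
  let ?s = "lie_stabiliser q E act v"
  have sub: "?s \<subseteq> q" by (auto simp: lie_stabiliser_def)
  show "vectorspace class_ring E" "vectorspace.fin_dim class_ring E" by (rule vs fin)+
  show "act a f \<in> carrier E" if "a \<in> ?s" "f \<in> carrier E" for a f
    using that sub act_closed by blast
  show "act a (f \<oplus>\<^bsub>E\<^esub> g) = act a f \<oplus>\<^bsub>E\<^esub> act a g" if "a \<in> ?s" "f \<in> carrier E" "g \<in> carrier E" for a f g
    using that sub act_add by blast
  show "act a (c \<odot>\<^bsub>E\<^esub> f) = c \<odot>\<^bsub>E\<^esub> act a f" if "a \<in> ?s" "f \<in> carrier E" for a c f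
    using that sub act_smult by blast
  show "\<exists>d\<in>?s. \<forall>f\<in>carrier E. act d f = act a f \<oplus>\<^bsub>E\<^esub> act b f" if ab: "a \<in> ?s" "b \<in> ?s" for a b
  proof -
    obtain d where "d \<in> q" "\<forall>f\<in>carrier E. act d f = act a f \<oplus>\<^bsub>E\<^esub> act b f" using q_add ab sub by blast
    then show ?thesis using ab v by (intro bexI[of _ d]) (auto simp: lie_stabiliser_def)
  qed
  show "\<exists>d\<in>?s. \<forall>f\<in>carrier E. act d f = c \<odot>\<^bsub>E\<^esub> act a f" if a: "a \<in> ?s" for a c
  proof -
    obtain d where "d \<in> q" "\<forall>f\<in>carrier E. act d f = c \<odot>\<^bsub>E\<^esub> act a f" using q_smult a sub by blast
    then show ?thesis using a v E.smult_r_null[of c] by (intro bexI[of _ d]) (auto simp: lie_stabiliser_def)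
  qed
  \<comment> \<open>The bare set \<open>q\<close> has no distinguished zero; an element acting as
    zero is obtained as a multiple by \<open>0\<close>.\<close>
  obtain a where "a \<in> q" using q_nonempty by blast
  then obtain d where "d \<in> q" "\<forall>f\<in>carrier E. act d f = 0 \<odot>\<^bsub>E\<^esub> act a f" using q_smult by blast
  then have "d \<in> ?s" using v act_closed[OF \<open>a \<in> q\<close> v] E.lmult_0 by (auto simp: lie_stabiliser_def)
  then show "?s \<noteq> {}" by blast
qed

lemma (in lie_action) tangent_submodule:
  assumes v: "v \<in> carrier E"
  shows "submodule class_ring (tangent_space q act v) E"
proof (rule submodule.intro)
  interpret E: vectorspace class_ring E by (rule vs)
  show "Module.module class_ring E" by (rule E.module_axioms)
  show "tangent_space q act v \<subseteq> carrier E" using act_closed v by (auto simp: tangent_space_def)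
  have *: "c \<odot>\<^bsub>E\<^esub> u \<in> tangent_space q act v" if "u \<in> tangent_space q act v" for c u
  proof -
    obtain a where a: "a \<in> q" "u = act a v" using \<open>u \<in> tangent_space q act v\<close> by (auto simp: tangent_space_def)
    obtain d where "d \<in> q" "\<forall>f\<in>carrier E. act d f = c \<odot>\<^bsub>E\<^esub> act a f" using q_smult[OF a(1)] by blast
    then show ?thesis using a v by (auto simp: tangent_space_def intro!: image_eqI[of _ _ d])
  qed
  then show "c \<odot>\<^bsub>E\<^esub> u \<in> tangent_space q act v" if "u \<in> tangent_space q act v" for c u using that by blast
  show "u \<oplus>\<^bsub>E\<^esub> w \<in> tangent_space q act v" if "u \<in> tangent_space q act v" "w \<in> tangent_space q act v" for u w
  proof -
    obtain a b where a: "a \<in> q" "u = act a v" and b: "b \<in> q" "w = act b v"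
      using \<open>u \<in> tangent_space q act v\<close> \<open>w \<in> tangent_space q act v\<close> by (auto simp: tangent_space_def)
    obtain d where "d \<in> q" "\<forall>f\<in>carrier E. act d f = act a f \<oplus>\<^bsub>E\<^esub> act b f" using q_add[OF a(1) b(1)] by blast
    then show ?thesis using a b v by (auto simp: tangent_space_def intro!: image_eqI[of _ _ d])
  qed
  obtain a where "a \<in> q" using q_nonempty by blast
  then have "0 \<odot>\<^bsub>E\<^esub> act a v \<in> tangent_space q act v" using * unfolding tangent_space_def by blast
  then show "\<zero>\<^bsub>E\<^esub> \<in> tangent_space q act v" using E.lmult_0 act_closed[OF \<open>a \<in> q\<close> v] by simp
qed

text \<open>Equality of the indices is refuted by squeezing: \<open>card I\<close> bounds the index
  of the whole algebra from above, \<open>m\<close> bounds that of the stabiliser from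
  below.\<close>

lemma (in lie_action) not_GNIB_criterion:
  assumes nil: "nilpotent_vector G gact E v"
    and x: "x \<in> carrier E" and I: "finite I" "card I < m" and e: "\<And>j. j \<in> I \<Longrightarrow> e j \<in> carrier E"
    and inj: "\<And>f. f \<in> carrier (dual_space E) \<Longrightarrow> (\<And>a. a \<in> q \<Longrightarrow> f (act a x) = 0) \<Longrightarrow>
      (\<And>j. j \<in> I \<Longrightarrow> f (e j) = 0) \<Longrightarrow> f = \<zero>\<^bsub>dual_space E\<^esub>"
    and stable: "\<And>a b. a \<in> lie_stabiliser q E act v \<Longrightarrow> b \<in> q \<Longrightarrow> act a (act b v) \<in> tangent_space q act v"
    and D: "\<And>\<xi>. \<xi> \<in> carrier (dual_space (dual_space (quotient_space E (tangent_space q act v)))) \<Longrightarrow>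
       \<exists>f. (\<forall>i<m. f i \<in> carrier (dual_space E) \<and> (\<forall>u\<in>tangent_space q act v. f i u = 0)
        \<and> (\<forall>a\<in>lie_stabiliser q E act v. \<xi> (descend E (tangent_space q act v) (\<lambda>v. - f i (act a v))) = 0)) \<and>
       (\<forall>c. (\<forall>v\<in>carrier E. (\<Sum>i<m. c i * f i v) = 0) \<longrightarrow> (\<forall>i<m. c i = 0))"
  shows "\<not> GNIB G gact q act E"
proof
  assume GNIB: "GNIB G gact q act E"
  have v: "v \<in> carrier E" using nil by (simp add: nilpotent_vector_def)
  let ?U = "tangent_space q act v"
  let ?N = "quotient_space E ?U"
  interpret Q: quotient_by_subspace E ?U
    by (rule quotient_by_subspace.intro[OF vs tangent_submodule[OF v]])
  have "lie_index q (dual_space E) (dual_action E act) =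
     lie_index (lie_stabiliser q E act v) (dual_space ?N) (dual_action ?N (quotient_action E ?U act))"
    using GNIB nil unfolding GNIB_def Let_def by blast
  moreover have "lie_index q (dual_space E) (dual_action E act) \<le> int (card I)"
    by (rule lie_index_dual_le[OF x I(1) e inj])
  moreover have "lie_index (lie_stabiliser q E act v) (dual_space ?N) (dual_action ?N (quotient_action E ?U act)) \<ge> int m"
  proof (rule Q.lie_index_quotient_dual_ge[OF stabiliser_action[OF v] _ D])
    show "act a u \<in> ?U" if "a \<in> lie_stabiliser q E act v" "u \<in> ?U" for a u
      using stable that by (auto simp: tangent_space_def)
  qed
  ultimately show False using I(2) by simp
qed

section \<open>One-parameter subgroups and nilpotent vectors\<close>

text \<open>\<open>g\<close> is the derivative of \<open>f\<close> along the left invariant vector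
  field of \<open>X\<close>; a polynomial in \<open>t\<close> takes the place of a limit.\<close>

definition invariant_derivative ::
  "nat \<Rightarrow> 'k::field mat \<Rightarrow> ('k mat \<Rightarrow> 'k) \<Rightarrow> ('k mat \<Rightarrow> 'k) \<Rightarrow> bool" where
  "invariant_derivative N X f g \<longleftrightarrow> (\<forall>A\<in>carrier_mat N N.
     \<exists>p. (\<forall>t. f (A * (1\<^sub>m N + t \<cdot>\<^sub>m X)) = poly p t) \<and> poly (pderiv p) 0 = g A)"

text \<open>For \<open>h\<^sup>3 = h\<close> this is the cocharacter acting by \<open>s\<^sup>c\<close> on the \<open>c\<close>-eigenspace of \<open>h\<close>.\<close>

definition cube_curve :: "nat \<Rightarrow> 'k::field mat \<Rightarrow> 'k \<Rightarrow> 'k mat" where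
  "cube_curve N h s = 1\<^sub>m N + ((s + inverse s) / 2 - 1) \<cdot>\<^sub>m (h * h) + ((s - inverse s) / 2) \<cdot>\<^sub>m h"

text \<open>Along the curve a polynomial function is a Laurent polynomial in \<open>s\<close>; the
  factor \<open>s ^ m\<close> clears its negative powers.\<close>

definition laurent_on_curve ::
  "nat \<Rightarrow> 'k::field mat \<Rightarrow> ('k mat \<Rightarrow> 'k) \<Rightarrow> 'k poly \<Rightarrow> nat \<Rightarrow> bool" where
  "laurent_on_curve N h f P m \<longleftrightarrow> (\<forall>s. s \<noteq> 0 \<longrightarrow> f (cube_curve N h s) * s ^ m = poly P s)"

lemma laurent_on_curveD:
  "laurent_on_curve N h f P m \<Longrightarrow> s \<noteq> 0 \<Longrightarrow> f (cube_curve N h s) * s ^ m = poly P s"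
  by (simp add: laurent_on_curve_def)

lemma cube_curve_closed[simp]: "h \<in> carrier_mat N N \<Longrightarrow> cube_curve N h s \<in> carrier_mat N N"
  by (simp add: cube_curve_def)

lemma cube_curve_1[simp]:
  fixes h :: "'k::field_char_0 mat"
  shows "h \<in> carrier_mat N N \<Longrightarrow> cube_curve N h 1 = 1\<^sub>m N"
  by (intro eq_matI) (auto simp: cube_curve_def)

text \<open>If \<open>h * (h * h) = h\<close>, the three coefficients are the projections onto the
  eigenspaces of \<open>h\<close> for \<open>0\<close>, \<open>1\<close> and
  \<open>-1\<close>.\<close>

lemma cube_curve_linear_comb:
  fixes h :: "'k::field_char_0 mat"
  assumes "h \<in> carrier_mat N N"
  shows "cube_curve N h s = (1\<^sub>m N + (-1) \<cdot>\<^sub>m (h * h)) + s \<cdot>\<^sub>m ((1/2) \<cdot>\<^sub>m (h * h + h)) + inverse s \<cdot>\<^sub>m ((1/2) \<cdot>\<^sub>m (h * h + (-1) \<cdot>\<^sub>m h))"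
  using assms by (intro eq_matI) (auto simp: cube_curve_def algebra_simps add_divide_distrib diff_divide_distrib)

text \<open>The right hand side is the derivative of the curve under the derivation
  \<open>s d/ds\<close>, which makes it an integral curve of the left invariant field of
  \<open>h\<close>.\<close>

lemma cube_curve_times:
  fixes h :: "'k::field_char_0 mat"
  assumes h: "h \<in> carrier_mat N N" and h3: "h * (h * h) = h"
  shows "cube_curve N h s * h = s \<cdot>\<^sub>m ((1/2) \<cdot>\<^sub>m (h * h + h)) + (- inverse s) \<cdot>\<^sub>m ((1/2) \<cdot>\<^sub>m (h * h + (-1) \<cdot>\<^sub>m h))"
proof -
  have h3': "h * h * h = h" using h h3 by (simp add: assoc_mult_mat[OF h h h])
  have "cube_curve N h s * h = h + ((s + inverse s) / 2 - 1) \<cdot>\<^sub>m h + ((s - inverse s) / 2) \<cdot>\<^sub>m (h * h)"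
    unfolding cube_curve_def
    using h by (subst add_mult_distrib_mat[of _ N N _ _ N], simp, simp, simp,
        subst add_mult_distrib_mat[of _ N N _ _ N]) (auto simp: h3' mult_smult_assoc_mat[of _ N N _ N])
  then show ?thesis using h by (auto intro!: eq_matI simp: algebra_simps add_divide_distrib diff_divide_distrib)
qed

lemma cube_curve_inverse:
  fixes h :: "'k::field_char_0 mat"
  assumes h: "h \<in> carrier_mat N N" and h3: "h * (h * h) = h" and s: "s \<noteq> 0"
  shows "cube_curve N h s * cube_curve N h (inverse s) = 1\<^sub>m N"
proof -
  let ?g = "cube_curve N h s"
  have h3': "h * h * h = h" using h h3 by (simp add: assoc_mult_mat[OF h h h])
  have gh: "?g * h = s \<cdot>\<^sub>m ((1/2) \<cdot>\<^sub>m (h * h + h)) + (- inverse s) \<cdot>\<^sub>m ((1/2) \<cdot>\<^sub>m (h * h + (-1) \<cdot>\<^sub>m h))" (is "_ = ?A")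
    by (rule cube_curve_times[OF h h3])
  have ghh: "?g * (h * h) = s \<cdot>\<^sub>m ((1/2) \<cdot>\<^sub>m (h + h * h)) + (- inverse s) \<cdot>\<^sub>m ((1/2) \<cdot>\<^sub>m (h + (-1) \<cdot>\<^sub>m (h * h)))"
  proof -
    have "?g * (h * h) = ?A * h" using h by (simp add: gh[symmetric] assoc_mult_mat[of _ N N _ N _ N])
    also have "?A * h = s \<cdot>\<^sub>m ((1/2) \<cdot>\<^sub>m (h * h * h + h * h)) + (- inverse s) \<cdot>\<^sub>m ((1/2) \<cdot>\<^sub>m (h * h * h + (-1) \<cdot>\<^sub>m (h * h)))"
      using h by (simp add: add_mult_distrib_mat[of _ N N _ _ N] mult_smult_assoc_mat[of _ N N _ N])
    finally show ?thesis by (simp add: h3')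
  qed
  have "?g * cube_curve N h (inverse s) = ?g + ((inverse s + s) / 2 - 1) \<cdot>\<^sub>m (?g * (h * h)) + ((inverse s - s) / 2) \<cdot>\<^sub>m (?g * h)"
    unfolding cube_curve_def[of N h "inverse s"]
    using h by (simp add: mult_add_distrib_mat[of _ N N _ N] mult_smult_distrib[of _ N N _ N] right_mult_one_mat[OF cube_curve_closed[OF h]])
  also have "\<dots> = 1\<^sub>m N"
    unfolding gh ghh using h s by (auto intro!: eq_matI simp: cube_curve_def field_simps)
  finally show ?thesis .
qed

lemma poly_eqI_nonzero:
  fixes p q :: "'k::field_char_0 poly"
  assumes "\<And>s. s \<noteq> 0 \<Longrightarrow> poly p s = poly q s"
  shows "p = q"
proof (rule ccontr)
  assume "p \<noteq> q"
  then have "finite {s. poly (p - q) s = 0}" by (intro poly_roots_finite) auto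
  moreover have "UNIV - {0} \<subseteq> {s. poly (p - q) s = 0}" using assms by auto
  ultimately have "finite (UNIV - {0::'k})" by (rule finite_subset[rotated])
  then show False by (simp add: infinite_UNIV_char_0)
qed

text \<open>Chain rule along the curve: if \<open>f\<close> becomes \<open>P / s ^ m\<close>, the
  derivation \<open>s d/ds\<close> gives \<open>(s P' - m P) / s ^ m\<close>, and this is the value
  of the invariant derivative. It is checked for linear functions and passes to sums and products by
  the Leibniz rule.\<close>

lemma polynomial_function_derivative:
  fixes h :: "'k::field_char_0 mat"
  assumes h: "h \<in> carrier_mat N N" and h3: "h * (h * h) = h"
    and f: "f \<in> polynomial_functions (module_mat TYPE('k) N N)"
  shows "\<exists>g\<in>polynomial_functions (module_mat TYPE('k) N N). invariant_derivative N h f g \<and>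
    (\<exists>P m. laurent_on_curve N h f P m \<and> laurent_on_curve N h g ([:0, 1:] * pderiv P - Polynomial.smult (of_nat m) P) m)"
  using f
proof (induction rule: polynomial_functions.induct)
  case (linear f)
  let ?V = "module_mat TYPE('k) N N"
  have ext: "f \<in> extensional (carrier_mat N N)"
    and fadd: "\<And>A B. A \<in> carrier_mat N N \<Longrightarrow> B \<in> carrier_mat N N \<Longrightarrow> f (A + B) = f A + f B"
    and fsmult: "\<And>c A. A \<in> carrier_mat N N \<Longrightarrow> f (c \<cdot>\<^sub>m A) = c * f A"
    using linear by (auto simp: dual_space_def module_mat_simps)
  define g where "g = (\<lambda>A\<in>carrier_mat N N. f (A * h))"
  have "g \<in> carrier (dual_space ?V)"
    using h by (auto simp: g_def dual_space_def module_mat_simps add_mult_distrib_mat[of _ N N _ _ N] fadd fsmult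
        mult_smult_assoc_mat[of _ N N _ N])
  then have g: "g \<in> polynomial_functions ?V" by (rule polynomial_functions.linear)
  have der: "invariant_derivative N h f g"
    unfolding invariant_derivative_def
  proof
    fix A :: "'k mat" assume A: "A \<in> carrier_mat N N"
    have "A * (1\<^sub>m N + t \<cdot>\<^sub>m h) = A + t \<cdot>\<^sub>m (A * h)" for t
      using A h by (simp add: mult_add_distrib_mat[of _ N N _ N] mult_smult_distrib[of _ N N _ N])
    then have "f (A * (1\<^sub>m N + t \<cdot>\<^sub>m h)) = poly [:f A, f (A * h):] t" for t
      using A h by (simp add: fadd fsmult)
    then show "\<exists>p. (\<forall>t. f (A * (1\<^sub>m N + t \<cdot>\<^sub>m h)) = poly p t) \<and> poly (pderiv p) 0 = g A"
      using A by (intro exI[of _ "[:f A, f (A * h):]"]) (simp add: g_def pderiv_pCons)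
  qed
  define M0 where "M0 = 1\<^sub>m N + (-1) \<cdot>\<^sub>m (h * h)"
  define Mp where "Mp = (1/2) \<cdot>\<^sub>m (h * h + h)"
  define Mm where "Mm = (1/2) \<cdot>\<^sub>m (h * h + (-1) \<cdot>\<^sub>m h)"
  have M: "M0 \<in> carrier_mat N N" "Mp \<in> carrier_mat N N" "Mm \<in> carrier_mat N N"
    using h by (auto simp: M0_def Mp_def Mm_def)
  have c1: "cube_curve N h s = M0 + s \<cdot>\<^sub>m Mp + inverse s \<cdot>\<^sub>m Mm" for s
    unfolding M0_def Mp_def Mm_def by (rule cube_curve_linear_comb[OF h])
  have c2: "cube_curve N h s * h = s \<cdot>\<^sub>m Mp + (- inverse s) \<cdot>\<^sub>m Mm" for s
    unfolding Mp_def Mm_def by (rule cube_curve_times[OF h h3])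
  have f1: "f (cube_curve N h s) = f M0 + s * f Mp + inverse s * f Mm" for s
    unfolding c1 using M by (simp add: fadd fsmult)
  have g1: "g (cube_curve N h s) = s * f Mp - inverse s * f Mm" for s
    using h M by (simp add: g_def c2 fadd fsmult)
  have "laurent_on_curve N h f [:f Mm, f M0, f Mp:] 1"
    unfolding laurent_on_curve_def f1 by (auto simp: field_simps)
  moreover have "laurent_on_curve N h g ([:0, 1:] * pderiv [:f Mm, f M0, f Mp:] - Polynomial.smult (of_nat 1) [:f Mm, f M0, f Mp:]) 1"
    unfolding laurent_on_curve_def g1 by (auto simp: field_simps pderiv_pCons)
  ultimately show ?case using g der by blast
next
  case (const c)
  show ?case
  proof (intro bexI[of _ "\<lambda>_. 0"] conjI exI)
    show "invariant_derivative N h (\<lambda>_. c) (\<lambda>_. 0)"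
      unfolding invariant_derivative_def by (auto intro!: exI[of _ "[:c:]"] simp: pderiv_pCons)
    show "laurent_on_curve N h (\<lambda>_. c) [:c:] 0" "laurent_on_curve N h (\<lambda>_. 0) ([:0, 1:] * pderiv [:c:] - Polynomial.smult (of_nat 0) [:c:]) 0"
      by (auto simp: laurent_on_curve_def pderiv_pCons)
  qed (rule polynomial_functions.const)
next
  case (add f1 f2)
  then obtain g1 P1 m1 g2 P2 m2 where
    1: "g1 \<in> polynomial_functions (module_mat TYPE('k) N N)" "invariant_derivative N h f1 g1"
       "laurent_on_curve N h f1 P1 m1" "laurent_on_curve N h g1 ([:0, 1:] * pderiv P1 - Polynomial.smult (of_nat m1) P1) m1" and
    2: "g2 \<in> polynomial_functions (module_mat TYPE('k) N N)" "invariant_derivative N h f2 g2"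
       "laurent_on_curve N h f2 P2 m2" "laurent_on_curve N h g2 ([:0, 1:] * pderiv P2 - Polynomial.smult (of_nat m2) P2) m2"
    by blast
  have der: "invariant_derivative N h (\<lambda>A. f1 A + f2 A) (\<lambda>A. g1 A + g2 A)"
    unfolding invariant_derivative_def
  proof
    fix A :: "'k mat" assume A: "A \<in> carrier_mat N N"
    obtain p1 where "\<forall>t. f1 (A * (1\<^sub>m N + t \<cdot>\<^sub>m h)) = poly p1 t" "poly (pderiv p1) 0 = g1 A"
      using 1(2) A unfolding invariant_derivative_def by blast
    moreover obtain p2 where "\<forall>t. f2 (A * (1\<^sub>m N + t \<cdot>\<^sub>m h)) = poly p2 t" "poly (pderiv p2) 0 = g2 A"
      using 2(2) A unfolding invariant_derivative_def by blast
    ultimately show "\<exists>p. (\<forall>t. f1 (A * (1\<^sub>m N + t \<cdot>\<^sub>m h)) + f2 (A * (1\<^sub>m N + t \<cdot>\<^sub>m h)) = poly p t) \<and> poly (pderiv p) 0 = g1 A + g2 A"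
      by (intro exI[of _ "p1 + p2"]) (simp add: pderiv_add)
  qed
  \<comment> \<open>Both summands are brought to the common exponent \<open>m1 + m2\<close>.\<close>
  define P where "P = P1 * monom 1 m2 + P2 * monom 1 m1"
  have xd: "x * poly (pderiv (monom 1 m)) x = of_nat m * x ^ m" for x :: 'k and m
    by (cases m) (simp_all add: pderiv_monom poly_monom)
  have L1: "laurent_on_curve N h (\<lambda>A. f1 A + f2 A) P (m1 + m2)"
    using 1(3) 2(3) unfolding laurent_on_curve_def P_def
    by (auto simp: poly_monom power_add algebra_simps)
  have L2: "laurent_on_curve N h (\<lambda>A. g1 A + g2 A) ([:0, 1:] * pderiv P - Polynomial.smult (of_nat (m1 + m2)) P) (m1 + m2)"
    unfolding laurent_on_curve_def
  proof (intro allI impI)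
    fix s :: 'k assume s: "s \<noteq> 0"
    have a1: "g1 (cube_curve N h s) * s ^ m1 = s * poly (pderiv P1) s - of_nat m1 * poly P1 s"
      using 1(4) s by (simp add: laurent_on_curve_def)
    have a2: "g2 (cube_curve N h s) * s ^ m2 = s * poly (pderiv P2) s - of_nat m2 * poly P2 s"
      using 2(4) s by (simp add: laurent_on_curve_def)
    have "(g1 (cube_curve N h s) + g2 (cube_curve N h s)) * s ^ (m1 + m2) =
      (g1 (cube_curve N h s) * s ^ m1) * s ^ m2 + (g2 (cube_curve N h s) * s ^ m2) * s ^ m1"
      by (simp add: power_add algebra_simps)
    also have "\<dots> = (s * poly (pderiv P1) s) * s ^ m2 + poly P1 s * (s * poly (pderiv (monom 1 m2)) s)
       + (s * poly (pderiv P2) s) * s ^ m1 + poly P2 s * (s * poly (pderiv (monom 1 m1)) s)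
       - of_nat (m1 + m2) * (poly P1 s * s ^ m2 + poly P2 s * s ^ m1)"
      unfolding a1 a2 xd by (simp add: algebra_simps)
    also have "\<dots> = poly ([:0, 1:] * pderiv P - Polynomial.smult (of_nat (m1 + m2)) P) s"
      unfolding P_def by (simp add: pderiv_add pderiv_mult poly_monom algebra_simps)
    finally show "(g1 (cube_curve N h s) + g2 (cube_curve N h s)) * s ^ (m1 + m2) = \<dots>" .
  qed
  show ?case using polynomial_functions.add[OF 1(1) 2(1)] der L1 L2 by blast
next
  case (mult f1 f2)
  then obtain g1 P1 m1 g2 P2 m2 where
    1: "g1 \<in> polynomial_functions (module_mat TYPE('k) N N)" "invariant_derivative N h f1 g1"
       "laurent_on_curve N h f1 P1 m1" "laurent_on_curve N h g1 ([:0, 1:] * pderiv P1 - Polynomial.smult (of_nat m1) P1) m1" and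
    2: "g2 \<in> polynomial_functions (module_mat TYPE('k) N N)" "invariant_derivative N h f2 g2"
       "laurent_on_curve N h f2 P2 m2" "laurent_on_curve N h g2 ([:0, 1:] * pderiv P2 - Polynomial.smult (of_nat m2) P2) m2"
    by blast
  have der: "invariant_derivative N h (\<lambda>A. f1 A * f2 A) (\<lambda>A. f1 A * g2 A + g1 A * f2 A)"
    unfolding invariant_derivative_def
  proof
    fix A :: "'k mat" assume A: "A \<in> carrier_mat N N"
    have "1\<^sub>m N + 0 \<cdot>\<^sub>m h = 1\<^sub>m N" using h by (intro eq_matI) auto
    then have A0: "A * (1\<^sub>m N + 0 \<cdot>\<^sub>m h) = A" using A by simp
    obtain p1 where p1: "\<forall>t. f1 (A * (1\<^sub>m N + t \<cdot>\<^sub>m h)) = poly p1 t" "poly (pderiv p1) 0 = g1 A"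
      using 1(2) A unfolding invariant_derivative_def by blast
    obtain p2 where p2: "\<forall>t. f2 (A * (1\<^sub>m N + t \<cdot>\<^sub>m h)) = poly p2 t" "poly (pderiv p2) 0 = g2 A"
      using 2(2) A unfolding invariant_derivative_def by blast
    have "poly p1 0 = f1 A" "poly p2 0 = f2 A" using p1(1) p2(1) A0 by metis+
    with p1 p2 show "\<exists>p. (\<forall>t. f1 (A * (1\<^sub>m N + t \<cdot>\<^sub>m h)) * f2 (A * (1\<^sub>m N + t \<cdot>\<^sub>m h)) = poly p t) \<and>
        poly (pderiv p) 0 = f1 A * g2 A + g1 A * f2 A"
      by (intro exI[of _ "p1 * p2"]) (simp add: pderiv_mult)
  qed
  have L1: "laurent_on_curve N h (\<lambda>A. f1 A * f2 A) (P1 * P2) (m1 + m2)"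
    unfolding laurent_on_curve_def
  proof (intro allI impI)
    fix s :: 'k assume s: "s \<noteq> 0"
    have "f1 (cube_curve N h s) * f2 (cube_curve N h s) * s ^ (m1 + m2) =
      (f1 (cube_curve N h s) * s ^ m1) * (f2 (cube_curve N h s) * s ^ m2)"
      by (simp add: power_add algebra_simps)
    then show "f1 (cube_curve N h s) * f2 (cube_curve N h s) * s ^ (m1 + m2) = poly (P1 * P2) s"
      by (simp only: poly_mult laurent_on_curveD[OF 1(3) s] laurent_on_curveD[OF 2(3) s])
  qed
  have L2: "laurent_on_curve N h (\<lambda>A. f1 A * g2 A + g1 A * f2 A) ([:0, 1:] * pderiv (P1 * P2) - Polynomial.smult (of_nat (m1 + m2)) (P1 * P2)) (m1 + m2)"
    unfolding laurent_on_curve_def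
  proof (intro allI impI)
    fix s :: 'k assume s: "s \<noteq> 0"
    let ?c = "cube_curve N h s"
    have "(f1 ?c * g2 ?c + g1 ?c * f2 ?c) * s ^ (m1 + m2) =
      (f1 ?c * s ^ m1) * (g2 ?c * s ^ m2) + (g1 ?c * s ^ m1) * (f2 ?c * s ^ m2)"
      by (simp add: power_add algebra_simps)
    also have "\<dots> = poly P1 s * (s * poly (pderiv P2) s - of_nat m2 * poly P2 s) + (s * poly (pderiv P1) s - of_nat m1 * poly P1 s) * poly P2 s"
      using 1(3,4) 2(3,4) s by (simp add: laurent_on_curve_def)
    also have "\<dots> = poly ([:0, 1:] * pderiv (P1 * P2) - Polynomial.smult (of_nat (m1 + m2)) (P1 * P2)) s"
      by (simp add: pderiv_mult algebra_simps)
    finally show "(f1 ?c * g2 ?c + g1 ?c * f2 ?c) * s ^ (m1 + m2) = \<dots>" .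
  qed
  show ?case
    using polynomial_functions.add[OF polynomial_functions.mult[OF mult.hyps(1) 2(1)] polynomial_functions.mult[OF 1(1) mult.hyps(2)]] der L1 L2
    by blast
qed

section \<open>Zariski closed groups and polynomials vanishing on them\<close>

lemma polynomial_function_left_translate:
  fixes A :: "'k::field mat"
  assumes A: "A \<in> carrier_mat N N" and f: "f \<in> polynomial_functions (module_mat TYPE('k) N N)"
  shows "\<exists>f'\<in>polynomial_functions (module_mat TYPE('k) N N). \<forall>B\<in>carrier_mat N N. f' B = f (A * B)"
  using f
proof (induction rule: polynomial_functions.induct)
  case (linear f)
  have "(\<lambda>B\<in>carrier_mat N N. f (A * B)) \<in> carrier (dual_space (module_mat TYPE('k) N N))"
    using linear A by (auto simp: dual_space_def module_mat_simps mult_add_distrib_mat[of _ N N _ N] mult_smult_distrib[of _ N N _ N])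
  then have "(\<lambda>B\<in>carrier_mat N N. f (A * B)) \<in> polynomial_functions (module_mat TYPE('k) N N)"
    by (rule polynomial_functions.linear)
  then show ?case by (rule bexI[rotated]) simp
next
  case (const c)
  show ?case by (rule bexI[of _ "\<lambda>_. c"]) (auto intro: polynomial_functions.const)
next
  case (add f g)
  then obtain f' g' where "f' \<in> polynomial_functions (module_mat TYPE('k) N N)" "g' \<in> polynomial_functions (module_mat TYPE('k) N N)"
    "\<forall>B\<in>carrier_mat N N. f' B = f (A * B)" "\<forall>B\<in>carrier_mat N N. g' B = g (A * B)" by blast
  then show ?case by (intro bexI[of _ "\<lambda>B. f' B + g' B"]) (auto intro: polynomial_functions.add)
next
  case (mult f g)
  then obtain f' g' where "f' \<in> polynomial_functions (module_mat TYPE('k) N N)" "g' \<in> polynomial_functions (module_mat TYPE('k) N N)"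
    "\<forall>B\<in>carrier_mat N N. f' B = f (A * B)" "\<forall>B\<in>carrier_mat N N. g' B = g (A * B)" by blast
  then show ?case by (intro bexI[of _ "\<lambda>B. f' B * g' B"]) (auto intro: polynomial_functions.mult)
qed

lemma linear_algebraic_group_carrier:
  assumes "linear_algebraic_group N G"
  shows "G \<subseteq> carrier_mat N N" "1\<^sub>m N \<in> G" "\<And>A B. A \<in> G \<Longrightarrow> B \<in> G \<Longrightarrow> A * B \<in> G"
proof -
  have G: "subgroup G (general_linear_group TYPE('a) N)" using assms by (simp add: linear_algebraic_group_def)
  show "G \<subseteq> carrier_mat N N"
    using subgroup.subset[OF G] by (auto simp: general_linear_group_def units_of_def Units_def ring_mat_simps)
  show "1\<^sub>m N \<in> G" using subgroup.one_closed[OF G] by (simp add: general_linear_group_def units_of_def ring_mat_simps)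
  show "\<And>A B. A \<in> G \<Longrightarrow> B \<in> G \<Longrightarrow> A * B \<in> G"
    using subgroup.m_closed[OF G] by (simp add: general_linear_group_def units_of_def ring_mat_simps)
qed

text \<open>The Lie algebra is defined by derivatives at the identity only; translating
  \<open>f\<close> on the left by \<open>A\<close> carries the information to the point
  \<open>A\<close>.\<close>

lemma derivative_vanishes_on_group:
  fixes G :: "'k::field_char_0 mat set"
  assumes G: "linear_algebraic_group N G" and X: "X \<in> lie_algebra_of N G"
    and f: "f \<in> polynomial_functions (module_mat TYPE('k) N N)" and van: "\<And>A. A \<in> G \<Longrightarrow> f A = 0"
    and der: "invariant_derivative N X f g" and A: "A \<in> G"
  shows "g A = 0"
proof -
  note G' = linear_algebraic_group_carrier[OF G]
  have AN: "A \<in> carrier_mat N N" using G' A by blast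
  have XN: "X \<in> carrier_mat N N" using X by (simp add: lie_algebra_of_def)
  obtain f' where f': "f' \<in> polynomial_functions (module_mat TYPE('k) N N)" "\<forall>B\<in>carrier_mat N N. f' B = f (A * B)"
    using polynomial_function_left_translate[OF AN f] by blast
  have "\<forall>B\<in>G. f' B = 0" using f' van G' A by auto
  then obtain p where p: "\<forall>t. f' (1\<^sub>m N + t \<cdot>\<^sub>m X) = poly p t" "poly (pderiv p) 0 = 0"
    using X f'(1) unfolding lie_algebra_of_def by blast
  obtain p2 where p2: "\<forall>t. f (A * (1\<^sub>m N + t \<cdot>\<^sub>m X)) = poly p2 t" "poly (pderiv p2) 0 = g A"
    using der AN unfolding invariant_derivative_def by blast
  \<comment> \<open>Over an infinite field a polynomial is determined by its values, so both
    derivatives at \<open>0\<close> agree.\<close>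
  have "poly p t = poly p2 t" for t
    using p(1) p2(1) f'(2) XN by (metis add_carrier_mat one_carrier_mat smult_carrier_mat)
  then have "p = p2" by (intro poly_eqI_nonzero)
  then show ?thesis using p p2 by simp
qed

lemma topspace_zariski:
  fixes V :: "('k::field, 'v, 'm) module_scheme"
  shows "topspace (zariski V) = carrier V"
proof -
  have "{v \<in> carrier V. (\<lambda>_. 1 :: 'k) v \<noteq> 0} \<in> {{v \<in> carrier V. f v \<noteq> 0} | f. f \<in> polynomial_functions V}"
    by (intro CollectI exI[of _ "\<lambda>_. 1"] conjI refl polynomial_functions.const)
  then have "carrier V \<in> {{v \<in> carrier V. f v \<noteq> 0} | f. f \<in> polynomial_functions V}" by simp
  from Union_upper[OF this] show ?thesis unfolding zariski_def topology_generated_by_topspace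
    by (intro equalityI Union_least) blast+
qed

text \<open>The generating sets are already a base of the topology, since the intersection of two of
  them is the non-vanishing set of a product.\<close>

lemma zariski_nhd:
  assumes "openin (zariski V) T" "x \<in> T"
  shows "\<exists>f\<in>polynomial_functions V. f x \<noteq> 0 \<and> {v \<in> carrier V. f v \<noteq> 0} \<subseteq> T"
proof -
  have "generate_topology_on {{v \<in> carrier V. f v \<noteq> 0} | f. f \<in> polynomial_functions V} T"
    using assms(1) unfolding zariski_def by (rule openin_topology_generated_by)
  then show ?thesis using assms(2)
  proof (induction T)
    case (Int S T)
    then obtain f g where "f \<in> polynomial_functions V" "f x \<noteq> 0" "{v \<in> carrier V. f v \<noteq> 0} \<subseteq> S"
      "g \<in> polynomial_functions V" "g x \<noteq> 0" "{v \<in> carrier V. g v \<noteq> 0} \<subseteq> T" by blast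
    then show ?case
      by (intro bexI[of _ "\<lambda>v. f v * g v"]) (auto intro: polynomial_functions.mult)
  next
    case (UN K)
    then show ?case by blast
  qed auto
qed

text \<open>Closedness in the general linear group means that \<open>G\<close> is cut out there by
  the polynomial functions vanishing on it.\<close>

lemma linear_algebraic_group_closed:
  fixes G :: "'k::field mat set"
  assumes G: "linear_algebraic_group N G" and A: "A \<in> carrier (general_linear_group TYPE('k) N)"
    and van: "\<And>f. f \<in> polynomial_functions (module_mat TYPE('k) N N) \<Longrightarrow> (\<And>B. B \<in> G \<Longrightarrow> f B = 0) \<Longrightarrow> f A = 0"
  shows "A \<in> G"
proof (rule ccontr)
  assume "A \<notin> G"
  let ?V = "module_mat TYPE('k) N N" and ?GL = "carrier (general_linear_group TYPE('k) N)"
  have "closedin (subtopology (zariski ?V) ?GL) G" using G by (simp add: linear_algebraic_group_def)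
  then obtain C where C: "closedin (zariski ?V) C" "G = C \<inter> ?GL" by (auto simp: closedin_subtopology)
  have AV: "A \<in> carrier_mat N N" using A by (auto simp: general_linear_group_def units_of_def Units_def ring_mat_simps)
  have "openin (zariski ?V) (carrier ?V - C)" using C(1) by (simp add: closedin_def topspace_zariski)
  moreover have "A \<in> carrier ?V - C" using \<open>A \<notin> G\<close> C(2) A AV by (auto simp: module_mat_simps)
  ultimately have "\<exists>f\<in>polynomial_functions ?V. f A \<noteq> 0 \<and> {v \<in> carrier ?V. f v \<noteq> 0} \<subseteq> carrier ?V - C"
    by (rule zariski_nhd)
  then obtain f where f: "f \<in> polynomial_functions ?V" "f A \<noteq> 0" "{v \<in> carrier ?V. f v \<noteq> 0} \<subseteq> carrier ?V - C"
    by blast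
  have "f B = 0" if "B \<in> G" for B
    using f(3) that C(2) linear_algebraic_group_carrier(1)[OF G] by (auto simp: module_mat_simps)
  then show False using van f by blast
qed

text \<open>A substitute for the exponential map. A function vanishing on \<open>G\<close> has an
  invariant derivative that vanishes on \<open>G\<close> too, and along the curve this derivative
  has a zero at \<open>s = 1\<close> of order one less. So the zero there has no finite order, and
  the function vanishes on the whole curve.\<close>

lemma cube_curve_in_group:
  fixes G :: "'k::field_char_0 mat set"
  assumes G: "linear_algebraic_group N G" and h: "h \<in> lie_algebra_of N G" and h3: "h * (h * h) = h"
    and s: "s \<noteq> 0"
  shows "cube_curve N h s \<in> G"
proof (rule linear_algebraic_group_closed[OF G])
  have hN: "h \<in> carrier_mat N N" using h by (simp add: lie_algebra_of_def)
  show "cube_curve N h s \<in> carrier (general_linear_group TYPE('k) N)"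
    using cube_curve_inverse[OF hN h3 s] cube_curve_inverse[OF hN h3, of "inverse s"] s hN
    by (auto simp: general_linear_group_def units_of_def Units_def ring_mat_simps intro!: bexI[of _ "cube_curve N h (inverse s)"])
  let ?PF = "polynomial_functions (module_mat TYPE('k) N N)"
  \<comment> \<open>Induction on the supposed order \<open>k\<close>; order \<open>0\<close> is
    excluded because the curve passes through the identity at \<open>s = 1\<close>.\<close>
  have key: "order 1 P \<noteq> k"
    if "f \<in> ?PF" "\<And>A. A \<in> G \<Longrightarrow> f A = 0" "laurent_on_curve N h f P m" "P \<noteq> 0" for f P m k
    using that
  proof (induction k arbitrary: f P m)
    case 0
    have "f (cube_curve N h 1) * 1 ^ m = poly P 1"
      by (rule laurent_on_curveD[OF 0(3)]) simp
    then have "poly P 1 = 0" using 0(2) linear_algebraic_group_carrier(2)[OF G] hN by simp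
    then show ?case using 0(4) order_root by blast
  next
    case (Suc k)
    show ?case
    proof
      assume ord: "order 1 P = Suc k"
      obtain g P1 m1 where g: "g \<in> ?PF" "invariant_derivative N h f g" "laurent_on_curve N h f P1 m1"
         "laurent_on_curve N h g ([:0, 1:] * pderiv P1 - Polynomial.smult (of_nat m1) P1) m1"
        using polynomial_function_derivative[OF hN h3 Suc.prems(1)] by blast
      have ord_monom: "order 1 (monom 1 l :: 'k poly) = 0" for l
        by (rule order_0I) (simp add: poly_monom)
      \<comment> \<open>\<open>P\<close> and \<open>P1\<close> represent the same function with
        possibly different exponents; they differ by powers of \<open>s\<close>, which do not affect
        the order at \<open>1\<close>.\<close>
      have PP1: "P * monom 1 m1 = P1 * monom 1 m"
      proof (rule poly_eqI_nonzero)
        fix s :: 'k assume "s \<noteq> 0"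
        note laurent_on_curveD[OF Suc.prems(3) this, symmetric] laurent_on_curveD[OF g(3) this, symmetric]
        then show "poly (P * monom 1 m1) s = poly (P1 * monom 1 m) s"
          by (simp add: poly_monom algebra_simps)
      qed
      have "P * monom 1 m1 \<noteq> 0" using Suc.prems(4) by (simp add: monom_eq_0_iff)
      then have P1: "P1 \<noteq> 0" "P1 * monom 1 m \<noteq> 0" using PP1 by auto
      have "order 1 (P * monom 1 m1) = order 1 P" "order 1 (P1 * monom 1 m) = order 1 P1"
        using \<open>P * monom 1 m1 \<noteq> 0\<close> P1 by (simp_all add: order_mult ord_monom)
      then have ord1: "order 1 P1 = Suc k" using ord PP1 by simp
      let ?R = "[:0, 1:] * pderiv P1 - Polynomial.smult (of_nat m1) P1"
      obtain Q where Q: "P1 = [:-1, 1:] ^ Suc k * Q" "\<not> [:-1, 1:] dvd Q"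
        using order_decomp[OF P1(1), of 1] ord1 by auto
      have Q1: "poly Q 1 \<noteq> 0" using Q(2) by (simp add: poly_eq_0_iff_dvd)
      \<comment> \<open>\<open>S\<close> is what remains of \<open>s P1' - m1 P1\<close> once
        \<open>(s - 1) ^ k\<close> is taken out. Its value at \<open>1\<close> is
        \<open>Suc k\<close> times that of \<open>Q\<close>, nonzero in characteristic zero.\<close>
      define S where "S = Polynomial.smult (of_nat (Suc k)) ([:0, 1:] * Q) + [:-1, 1:] * ([:0,1:] * pderiv Q - Polynomial.smult (of_nat m1) Q)"
      have R: "?R = [:-1, 1:] ^ k * S"
      proof (rule poly_eqI_nonzero)
        fix s :: 'k
        define E :: "'k poly" where "E = [:-1, 1:] ^ Suc k"
        have E: "poly E s = (s - 1) * (s - 1) ^ k" by (simp add: E_def poly_power algebra_simps)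
        have E': "poly (pderiv E) s = of_nat (Suc k) * (s - 1) ^ k"
          unfolding E_def by (subst pderiv_power_Suc) (simp add: pderiv_pCons poly_power del: power_Suc)
        have PE: "P1 = E * Q" by (simp only: Q(1) E_def)
        show "poly ?R s = poly ([:-1, 1:] ^ k * S) s"
          by (simp add: PE S_def pderiv_mult E E' poly_power algebra_simps)
      qed
      have S1: "poly S 1 \<noteq> 0" using Q1 unfolding S_def by (simp del: of_nat_Suc)
      then have R0: "?R \<noteq> 0" unfolding R by auto
      have "order 1 ?R = order 1 ([:-1, 1:] ^ k :: 'k poly) + order 1 S"
        unfolding R by (rule order_mult) (use S1 in auto)
      also have "\<dots> = k" using S1 order_power_n_n[of 1 k] by (simp add: order_0I)
      finally have "order 1 ?R = k" .
      moreover have "g A = 0" if "A \<in> G" for A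
        using derivative_vanishes_on_group[OF G h Suc.prems(1,2) g(2) that] by blast
      ultimately show False using Suc.IH[OF g(1) _ g(4) R0] by blast
    qed
  qed
  fix f assume f: "f \<in> ?PF" "\<And>B. B \<in> G \<Longrightarrow> f B = 0"
  obtain P m where L: "laurent_on_curve N h f P m"
    using polynomial_function_derivative[OF hN h3 f(1)] by blast
  then have "P = 0" using key[OF f L] by blast
  then have "f (cube_curve N h s) * s ^ m = 0" using laurent_on_curveD[OF L s] by simp
  then show "f (cube_curve N h s) = 0" using s by simp
qed

lemma polynomial_function_scaling:
  fixes S :: "'k::field mat set"
  assumes f: "f \<in> polynomial_functions (mat_subspace N S)" and v: "\<And>c. c \<cdot>\<^sub>m v \<in> S" "v \<in> S"
  shows "\<exists>p. \<forall>s. f (s \<cdot>\<^sub>m v) = poly p s"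
  using f
proof (induction rule: polynomial_functions.induct)
  case (linear f)
  then have "f (s \<cdot>\<^sub>m v) = poly [:0, f v:] s" for s
    using v by (auto simp: dual_space_def mat_subspace_def module_mat_simps)
  then show ?case by blast
next
  case (const c)
  show ?case by (rule exI[of _ "[:c:]"]) simp
next
  case (add f h)
  then obtain p q where "\<forall>s. f (s \<cdot>\<^sub>m v) = poly p s" "\<forall>s. h (s \<cdot>\<^sub>m v) = poly q s" by blast
  then show ?case by (intro exI[of _ "p + q"]) simp
next
  case (mult f h)
  then obtain p q where "\<forall>s. f (s \<cdot>\<^sub>m v) = poly p s" "\<forall>s. h (s \<cdot>\<^sub>m v) = poly q s" by blast
  then show ?case by (intro exI[of _ "p * q"]) simp
qed

text \<open>The cocharacter of \<open>h\<close> multiplies \<open>v\<close> by \<open>s\<close>, so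
  the orbit contains all nonzero multiples of \<open>v\<close>; and a polynomial on the line of
  \<open>v\<close> that is nonzero at \<open>0\<close> is nonzero at some other point.\<close>

lemma nilpotent_vector_of_grading:
  fixes G :: "'k::field_char_0 mat set"
  assumes G: "linear_algebraic_group N G" and h: "h \<in> lie_algebra_of N G" and h3: "h * (h * h) = h"
    and v: "v \<in> S" "\<And>c. c \<cdot>\<^sub>m v \<in> S" "S \<subseteq> carrier_mat N N" and hv: "lie_bracket h v = v"
  shows "nilpotent_vector G (conjugation N) (mat_subspace N S) v"
proof -
  have hN: "h \<in> carrier_mat N N" using h by (simp add: lie_algebra_of_def)
  have vN: "v \<in> carrier_mat N N" using v by blast
  note carr = hN vN
  have hv': "h * v = v * h + v"
  proof -
    have "v * h + (h * v - v * h) = h * v" using carr by (intro eq_matI) auto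
    then show ?thesis using hv carr by (simp add: lie_bracket_def)
  qed
  have hhv: "h * (h * v) = v * (h * h) + 2 \<cdot>\<^sub>m (v * h) + v"
  proof -
    have "h * (h * v) = (h * v) * h + h * v"
      using carr by (simp add: hv' mult_add_distrib_mat[of _ N N _ N] assoc_mult_mat[of _ N N _ N _ N, symmetric])
    also have "\<dots> = v * h * h + v * h + (v * h + v)"
      using carr by (simp add: hv' add_mult_distrib_mat[of _ N N _ _ N])
    also have "\<dots> = v * (h * h) + 2 \<cdot>\<^sub>m (v * h) + v"
      using carr by (intro eq_matI) (auto simp: assoc_mult_mat[of _ N N _ N _ N])
    finally show ?thesis .
  qed
  have h3v: "h * (h * (h * v)) = v * (h * (h * h)) + 3 \<cdot>\<^sub>m (v * (h * h)) + 3 \<cdot>\<^sub>m (v * h) + v"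
  proof -
    have "h * (h * (h * v)) = h * v * (h * h) + 2 \<cdot>\<^sub>m (h * v * h) + h * v"
      using carr by (simp add: hhv mult_add_distrib_mat[of _ N N _ N] mult_smult_distrib[of _ N N _ N] assoc_mult_mat[of _ N N _ N _ N])
    also have "\<dots> = v * h * (h * h) + v * (h * h) + 2 \<cdot>\<^sub>m (v * h * h + v * h) + (v * h + v)"
      using carr by (simp add: hv' add_mult_distrib_mat[of _ N N _ _ N])
    also have "\<dots> = v * (h * (h * h)) + 3 \<cdot>\<^sub>m (v * (h * h)) + 3 \<cdot>\<^sub>m (v * h) + v"
      using carr by (intro eq_matI) (auto simp: assoc_mult_mat[of _ N N _ N _ N])
    finally show ?thesis .
  qed
  \<comment> \<open>\<open>v\<close> raises eigenvalues of \<open>h\<close> by one and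
    \<open>2\<close> is not an eigenvalue, so \<open>v\<close> kills the eigenspace for
    \<open>1\<close>. In formulas, the two expressions for \<open>h (h (h v))\<close> leave
    \<open>3 (v h h + v h) = 0\<close>.\<close>
  have vh: "v * (h * h) = (-1) \<cdot>\<^sub>m (v * h)"
  proof -
    have "h * (h * (h * v)) = (h * (h * h)) * v" using carr by (simp add: assoc_mult_mat[of _ N N _ N _ N])
    then have "v * h + v = v * h + 3 \<cdot>\<^sub>m (v * (h * h)) + 3 \<cdot>\<^sub>m (v * h) + v"
      using h3v by (simp add: h3 hv')
    then have "(v * h + v) $$ (i, j) = (v * h + 3 \<cdot>\<^sub>m (v * (h * h)) + 3 \<cdot>\<^sub>m (v * h) + v) $$ (i, j)" for i j by simp
    moreover have "(v * (h * h)) $$ (i, j) = - (v * h) $$ (i, j)"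
      if "i < N" "j < N" "(v * h + v) $$ (i, j) = (v * h + 3 \<cdot>\<^sub>m (v * (h * h)) + 3 \<cdot>\<^sub>m (v * h) + v) $$ (i, j)" for i j
    proof -
      have "3 * ((v * (h * h)) $$ (i, j) + (v * h) $$ (i, j)) = 0"
        using that carr by (simp add: algebra_simps)
      then have "(v * (h * h)) $$ (i, j) + (v * h) $$ (i, j) = 0" by (metis mult_eq_0_iff zero_neq_numeral)
      then show ?thesis by (simp add: eq_neg_iff_add_eq_0)
    qed
    ultimately show ?thesis using carr by (intro eq_matI) auto
  qed
  \<comment> \<open>Likewise \<open>h\<close> and its square agree on the image of \<open>v\<close>:
    the eigenvalue \<open>-1\<close> does not occur there.\<close>
  have hhv2: "h * (h * v) = v * h + v"
    unfolding hhv vh using carr by (intro eq_matI) auto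
  have act: "conjugation N (cube_curve N h s) v = s \<cdot>\<^sub>m v" if s: "s \<noteq> 0" for s
  proof -
    let ?c = "cube_curve N h s"
    have cN: "?c \<in> carrier_mat N N" using hN by simp
    have "?c * v = v + ((s + inverse s) / 2 - 1) \<cdot>\<^sub>m (h * (h * v)) + ((s - inverse s) / 2) \<cdot>\<^sub>m (h * v)"
      unfolding cube_curve_def using carr
      by (simp add: add_mult_distrib_mat[of _ N N _ _ N] mult_smult_assoc_mat[of _ N N _ N] assoc_mult_mat[of _ N N _ N _ N])
    moreover have "s \<cdot>\<^sub>m (v * ?c) = s \<cdot>\<^sub>m (v + ((s + inverse s) / 2 - 1) \<cdot>\<^sub>m (v * (h * h)) + ((s - inverse s) / 2) \<cdot>\<^sub>m (v * h))"
      unfolding cube_curve_def using carr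
      by (simp add: mult_add_distrib_mat[of _ N N _ N] mult_smult_distrib[of _ N N _ N])
    \<comment> \<open>By the relations above, the curve commutes with \<open>v\<close> up to the
      factor \<open>s\<close>.\<close>
    ultimately have cv: "?c * v = (s \<cdot>\<^sub>m v) * ?c"
      unfolding hhv2 vh unfolding hv' using carr cN s
      by (simp add: mult_smult_assoc_mat[of _ N N _ N]) (intro eq_matI; simp add: field_simps)
    let ?i = "inv\<^bsub>general_linear_group TYPE('k) N\<^esub> ?c"
    have "monoid (ring_mat TYPE('k) N ())" by (rule ring.axioms(2)[OF ring_mat])
    then have grp: "group (general_linear_group TYPE('k) N)"
      unfolding general_linear_group_def by (rule monoid.units_group)
    have cG: "?c \<in> carrier (general_linear_group TYPE('k) N)"
      using cube_curve_in_group[OF G h h3 s] G subgroup.subset unfolding linear_algebraic_group_def by blast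
    have inv: "?c * ?i = 1\<^sub>m N" "?i \<in> carrier_mat N N"
      using group.r_inv[OF grp cG] group.inv_closed[OF grp cG]
      by (auto simp: general_linear_group_def units_of_def Units_def ring_mat_simps)
    have "conjugation N ?c v = (s \<cdot>\<^sub>m v) * ?c * ?i" by (simp add: conjugation_def cv)
    also have "\<dots> = s \<cdot>\<^sub>m v" using carr cN inv by (simp add: assoc_mult_mat[of _ N N _ N _ N])
    finally show ?thesis .
  qed
  have zero: "0\<^sub>m N N = 0 \<cdot>\<^sub>m v" using vN by (intro eq_matI) auto
  show ?thesis
    unfolding nilpotent_vector_def
  proof (intro conjI)
    show "v \<in> carrier (mat_subspace N S)" using v by (simp add: mat_subspace_def)
    show "\<zero>\<^bsub>mat_subspace N S\<^esub> \<in> zariski (mat_subspace N S) closure_of (\<lambda>g. conjugation N g v) ` G"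
      unfolding in_closure_of
    proof (intro conjI allI impI)
      have "0\<^sub>m N N \<in> S" using v(2)[of 0] zero by simp
      then show "\<zero>\<^bsub>mat_subspace N S\<^esub> \<in> topspace (zariski (mat_subspace N S))"
        by (simp add: topspace_zariski mat_subspace_def module_mat_simps)
      fix T assume T: "\<zero>\<^bsub>mat_subspace N S\<^esub> \<in> T \<and> openin (zariski (mat_subspace N S)) T"
      then obtain f where f: "f \<in> polynomial_functions (mat_subspace N S)" "f (0\<^sub>m N N) \<noteq> 0"
        "{v \<in> carrier (mat_subspace N S). f v \<noteq> 0} \<subseteq> T"
        using zariski_nhd[of "mat_subspace N S" T "0\<^sub>m N N"] by (auto simp: mat_subspace_def module_mat_simps)
      obtain p where p: "\<forall>s. f (s \<cdot>\<^sub>m v) = poly p s" using polynomial_function_scaling[OF f(1) v(2,1)] by blast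
      have "poly p 0 \<noteq> 0" using f(2) p zero by metis
      have "\<exists>s. s \<noteq> 0 \<and> poly p s \<noteq> 0"
      proof (rule ccontr)
        assume "\<nexists>s. s \<noteq> 0 \<and> poly p s \<noteq> 0"
        then have "p = 0" by (intro poly_eqI_nonzero) auto
        with \<open>poly p 0 \<noteq> 0\<close> show False by simp
      qed
      then obtain s where s: "s \<noteq> 0" "poly p s \<noteq> 0" by blast
      then have "s \<cdot>\<^sub>m v \<in> T" using f(3) p v(2) by (auto simp: mat_subspace_def)
      moreover have "s \<cdot>\<^sub>m v \<in> (\<lambda>g. conjugation N g v) ` G"
        using act[OF s(1)] cube_curve_in_group[OF G h h3 s(1)] by (metis image_eqI)
      ultimately show "\<exists>y. y \<in> (\<lambda>g. conjugation N g v) ` G \<and> y \<in> T" by blast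
    qed
  qed
qed

section \<open>Two by two matrices and their adjugates\<close>

text \<open>A type of its own turns the entries of the large matrices into ring elements, so their
  sums and products involve no carrier conditions; the large matrices are functions of two
  indices.\<close>

datatype 'a m2 = M2 (m11: 'a) (m12: 'a) (m21: 'a) (m22: 'a)

instantiation m2 :: (comm_ring_1) ring_1
begin

definition "0 = M2 0 0 0 0"
definition "1 = M2 1 0 0 1"
definition "x + y = M2 (m11 x + m11 y) (m12 x + m12 y) (m21 x + m21 y) (m22 x + m22 y)"
definition "x - y = M2 (m11 x - m11 y) (m12 x - m12 y) (m21 x - m21 y) (m22 x - m22 y)"
definition "- x = M2 (- m11 x) (- m12 x) (- m21 x) (- m22 x)"
definition "x * y = M2 (m11 x * m11 y + m12 x * m21 y) (m11 x * m12 y + m12 x * m22 y)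
  (m21 x * m11 y + m22 x * m21 y) (m21 x * m12 y + m22 x * m22 y)"

instance
  by intro_classes
    (auto simp: zero_m2_def one_m2_def plus_m2_def minus_m2_def uminus_m2_def times_m2_def algebra_simps intro: m2.expand)

end

lemma m2_sel[simp]:
  "m11 0 = 0" "m12 0 = 0" "m21 0 = 0" "m22 0 = 0"
  "m11 1 = 1" "m12 1 = 0" "m21 1 = 0" "m22 1 = 1"
  "m11 (x + y) = m11 x + m11 y" "m12 (x + y) = m12 x + m12 y"
  "m21 (x + y) = m21 x + m21 y" "m22 (x + y) = m22 x + m22 y"
  "m11 (x - y) = m11 x - m11 y" "m12 (x - y) = m12 x - m12 y"
  "m21 (x - y) = m21 x - m21 y" "m22 (x - y) = m22 x - m22 y"
  "m11 (- x) = - m11 x" "m12 (- x) = - m12 x"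
  "m21 (- x) = - m21 x" "m22 (- x) = - m22 x"
  "m11 (x * y) = m11 x * m11 y + m12 x * m21 y" "m12 (x * y) = m11 x * m12 y + m12 x * m22 y"
  "m21 (x * y) = m21 x * m11 y + m22 x * m21 y" "m22 (x * y) = m21 x * m12 y + m22 x * m22 y"
  by (simp_all add: zero_m2_def one_m2_def plus_m2_def minus_m2_def uminus_m2_def times_m2_def)

lemma m2_sum_sel[simp]:
  "m11 (sum f A) = (\<Sum>i\<in>A. m11 (f i))" "m12 (sum f A) = (\<Sum>i\<in>A. m12 (f i))"
  "m21 (sum f A) = (\<Sum>i\<in>A. m21 (f i))" "m22 (sum f A) = (\<Sum>i\<in>A. m22 (f i))"
  by (induction A rule: infinite_finite_induct, simp_all)

lemma m2_eq_iff: "x = y \<longleftrightarrow> m11 x = m11 y \<and> m12 x = m12 y \<and> m21 x = m21 y \<and> m22 x = m22 y"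
  by (auto intro: m2.expand)

definition adj :: "'a::comm_ring_1 m2 \<Rightarrow> 'a m2" where
  "adj x = M2 (m22 x) (- m12 x) (- m21 x) (m11 x)"

definition scal :: "'a::comm_ring_1 \<Rightarrow> 'a m2" where
  "scal c = M2 c 0 0 c"

definition tr :: "'a::comm_ring_1 m2 \<Rightarrow> 'a" where
  "tr x = m11 x + m22 x"

lemma adj_sel[simp]: "m11 (adj x) = m22 x" "m12 (adj x) = - m12 x" "m21 (adj x) = - m21 x" "m22 (adj x) = m11 x"
  by (simp_all add: adj_def)

lemma scal_sel[simp]: "m11 (scal c) = c" "m12 (scal c) = 0" "m21 (scal c) = 0" "m22 (scal c) = c"
  by (simp_all add: scal_def)

lemma adj_simps[simp]:
  "adj 0 = 0" "adj 1 = 1" "adj (x + y) = adj x + adj y" "adj (x - y) = adj x - adj y" "adj (- x) = - adj x"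
  "adj (adj x) = x" "adj (scal c) = scal c"
  by (simp_all add: m2_eq_iff)

lemma adj_mult: "adj (x * y) = adj y * adj x"
  by (simp add: m2_eq_iff algebra_simps)

lemma adj_sum: "adj (sum f A) = (\<Sum>i\<in>A. adj (f i))"
  by (induction A rule: infinite_finite_induct) simp_all

lemma scal_simps:
  "scal 0 = 0" "scal 1 = 1" "scal (a + b) = scal a + scal b" "scal (a - b) = scal a - scal b"
  "scal (- a) = - scal a" "scal a * scal b = scal (a * b)"
  by (simp_all add: m2_eq_iff)

lemma scal_commute: "x * scal c = scal c * x"
  by (simp add: m2_eq_iff algebra_simps)

lemma tr_simps:
  "tr 0 = 0" "tr (x + y) = tr x + tr y" "tr (x - y) = tr x - tr y" "tr (- x) = - tr x" "tr (scal c * x) = c * tr x"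
  by (simp_all add: tr_def algebra_simps)

lemma tr_sum: "tr (sum f A) = (\<Sum>i\<in>A. tr (f i))"
  by (induction A rule: infinite_finite_induct) (simp_all add: tr_simps)

lemma tr_commute: "tr (x * y) = tr (y * x)"
  by (simp add: tr_def algebra_simps)

lemma tr_adj[simp]: "tr (adj x) = tr x"
  by (simp add: tr_def)

lemma add_adj: "x + adj x = scal (tr x)"
  by (simp add: m2_eq_iff tr_def)

text \<open>
  The subalgebra of scalar, diagonal, or all matrices for \<open>d = 1\<close>, \<open>2\<close>, \<open>4\<close>.
\<close>

definition in_alg :: "nat \<Rightarrow> 'a::comm_ring_1 m2 \<Rightarrow> bool" where
  "in_alg d x \<longleftrightarrow> (d \<le> 2 \<longrightarrow> m12 x = 0 \<and> m21 x = 0) \<and> (d \<le> 1 \<longrightarrow> m11 x = m22 x)"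

lemma in_alg_simps[simp]:
  "in_alg d 0" "in_alg d 1" "in_alg d (scal c)"
  "in_alg d x \<Longrightarrow> in_alg d y \<Longrightarrow> in_alg d (x + y)"
  "in_alg d x \<Longrightarrow> in_alg d y \<Longrightarrow> in_alg d (x - y)"
  "in_alg d x \<Longrightarrow> in_alg d y \<Longrightarrow> in_alg d (x * y)"
  "in_alg d x \<Longrightarrow> in_alg d (- x)" "in_alg d x \<Longrightarrow> in_alg d (adj x)"
  by (simp_all add: in_alg_def)

lemma in_alg_sum: "(\<And>i. i \<in> A \<Longrightarrow> in_alg d (f i)) \<Longrightarrow> in_alg d (sum f A)"
  by (induction A rule: infinite_finite_induct) simp_all

text \<open>Test with the identity and with those matrix units that the subalgebra contains. In the
  scalar case one finds that twice an entry is zero, and characteristic zero finishes.\<close>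

lemma tr_nondegenerate:
  fixes x :: "'k::field_char_0 m2"
  assumes x: "in_alg d x" and 0: "\<And>y. in_alg d y \<Longrightarrow> tr (adj x * y) = 0"
  shows "x = 0"
proof -
  have "tr (adj x * scal 1) = 0" by (rule 0) simp
  then have a: "m22 x + m11 x = 0" by (simp add: tr_def)
  have "m22 x = 0 \<and> m11 x = 0"
  proof (cases "d \<le> 1")
    case True
    then have "m11 x = m22 x" using x by (simp add: in_alg_def)
    then have "2 * m22 x = 0" using a by simp
    then show ?thesis using \<open>m11 x = m22 x\<close> by simp
  next
    case False
    then have "tr (adj x * M2 1 0 0 0) = 0" by (intro 0) (simp add: in_alg_def)
    then show ?thesis using a by (simp add: tr_def)
  qed
  moreover have "m12 x = 0 \<and> m21 x = 0"
  proof (cases "d \<le> 2")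
    case True
    then show ?thesis using x by (simp add: in_alg_def)
  next
    case False
    then have "tr (adj x * M2 0 1 0 0) = 0" "tr (adj x * M2 0 0 1 0) = 0" by (auto intro!: 0 simp: in_alg_def)
    then show ?thesis by (simp add: tr_def)
  qed
  ultimately show ?thesis by (simp add: m2_eq_iff)
qed

text \<open>The dual bases are written down in all three cases; \<open>adj\<close> exchanges the
  diagonal entries and negates the others, which explains the order and the signs of the entries of
  \<open>z\<close>.\<close>

lemma tr_riesz:
  fixes l :: "'k::field_char_0 m2 \<Rightarrow> 'k"
  assumes add: "\<And>x y. in_alg d x \<Longrightarrow> in_alg d y \<Longrightarrow> l (x + y) = l x + l y"
    and smult: "\<And>c x. in_alg d x \<Longrightarrow> l (scal c * x) = c * l x"
  shows "\<exists>z. in_alg d z \<and> (\<forall>x. in_alg d x \<longrightarrow> l x = tr (adj z * x))"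
proof -
  consider "d \<le> 1" | "d = 2" | "d > 2" by linarith
  then show ?thesis
  proof cases
    case 1
    \<comment> \<open>The denominator \<open>2\<close> is the trace of the identity.\<close>
    have "l x = tr (adj (scal (l 1 / 2)) * x)" if "in_alg d x" for x
    proof -
      have x: "x = scal (m11 x) * 1" using that 1 by (simp add: in_alg_def m2_eq_iff)
      have "l x = m11 x * l 1" by (subst x, rule smult) simp
      moreover have "m22 x = m11 x" using that 1 by (simp add: in_alg_def)
      ultimately show ?thesis by (simp add: tr_def algebra_simps)
    qed
    then show ?thesis using in_alg_simps(3) by blast
  next
    case 2
    let ?a = "M2 1 0 0 0" and ?b = "M2 0 0 0 1"
    have ab: "in_alg d ?a" "in_alg d ?b" using 2 by (simp_all add: in_alg_def)
    have "l x = tr (adj (M2 (l ?b) 0 0 (l ?a)) * x)" if "in_alg d x" for x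
    proof -
      have x: "x = scal (m11 x) * ?a + scal (m22 x) * ?b" using that 2 by (simp add: in_alg_def m2_eq_iff)
      have "l x = m11 x * l ?a + m22 x * l ?b" by (subst x) (simp add: add smult ab)
      then show ?thesis by (simp add: tr_def algebra_simps)
    qed
    moreover have "in_alg d (M2 (l ?b) 0 0 (l ?a))" using 2 by (simp add: in_alg_def)
    ultimately show ?thesis by blast
  next
    case 3
    let ?a = "M2 1 0 0 0" and ?b = "M2 0 0 0 1" and ?e = "M2 0 1 0 0" and ?f = "M2 0 0 1 0"
    have all: "in_alg d x" for x :: "'k m2" using 3 by (simp add: in_alg_def)
    have "l x = tr (adj (M2 (l ?b) (- l ?f) (- l ?e) (l ?a)) * x)" for x
    proof -
      have x: "x = scal (m11 x) * ?a + scal (m22 x) * ?b + scal (m12 x) * ?e + scal (m21 x) * ?f" by (simp add: m2_eq_iff)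
      have "l x = m11 x * l ?a + m22 x * l ?b + m12 x * l ?e + m21 x * l ?f" by (subst x) (simp add: add smult all)
      then show ?thesis by (simp add: tr_def algebra_simps)
    qed
    then show ?thesis using all by blast
  qed
qed

text \<open>
  If the constant terms of the curves \<open>F i\<close> are dependent, the combination of the \<open>F i\<close> that vanishes
  at \<open>0\<close> is divided by the variable and replaces a curve of maximal degree among those involved.
\<close>

lemma saturate_curves:
  fixes K :: "('c \<Rightarrow> 'k::field poly) set" and m :: nat
  assumes C: "finite C"
    and lin: "\<And>F c. (\<And>i. i < m \<Longrightarrow> F i \<in> K) \<Longrightarrow> (\<lambda>x. \<Sum>i<m. Polynomial.smult (c i) (F i x)) \<in> K"
    and div: "\<And>F. (\<lambda>x. [:0, 1:] * F x) \<in> K \<Longrightarrow> F \<in> K"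
    and cong: "\<And>F G. F \<in> K \<Longrightarrow> (\<And>x. x \<in> C \<Longrightarrow> F x = G x) \<Longrightarrow> G \<in> K"
    and t: "t \<noteq> 0"
    and F: "\<And>i. i < m \<Longrightarrow> F i \<in> K"
    and indep: "\<And>c i. (\<And>x. x \<in> C \<Longrightarrow> (\<Sum>i<m. c i * poly (F i x) t) = 0) \<Longrightarrow> i < m \<Longrightarrow> c i = 0"
  shows "\<exists>F. (\<forall>i<m. F i \<in> K) \<and>
    (\<forall>c. (\<forall>x\<in>C. (\<Sum>i<m. c i * poly (F i x) 0) = 0) \<longrightarrow> (\<forall>i<m. c i = 0))"
proof -
  \<comment> \<open>Initially a bound for the degrees of \<open>F i\<close>; in the induction
    \<open>D\<close> is any such bound, and its sum decreases.\<close>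
  define D where "D i = (\<Sum>x\<in>C. degree (F i x))" for i
  have deg: "degree (F i x) \<le> D i" if "x \<in> C" for i x
    unfolding D_def using C that by (intro member_le_sum) auto
  from F indep deg show ?thesis
  proof (induction "\<Sum>i<m. D i" arbitrary: D F rule: less_induct)
    case less
    note F = less.prems(1) and indep = less.prems(2) and deg = less.prems(3)
    show ?case
    proof (cases "\<forall>c. (\<forall>x\<in>C. (\<Sum>i<m. c i * poly (F i x) 0) = 0) \<longrightarrow> (\<forall>i<m. c i = 0)")
      case True
      then show ?thesis using F by blast
    next
      case False
      then obtain c j where c: "\<And>x. x \<in> C \<Longrightarrow> (\<Sum>i<m. c i * poly (F i x) 0) = 0" and j: "j < m" "c j \<noteq> 0" by blast
      let ?S = "{i. i < m \<and> c i \<noteq> 0}"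
      have "finite ?S" by simp
      then have fS: "finite (D ` ?S)" "D ` ?S \<noteq> {}" using j by blast+
      \<comment> \<open>With a largest bound among the curves that enter the relation, the
        combination \<open>G\<close> respects the bound of the curve it is going to replace.\<close>
      obtain l where l: "l < m" "c l \<noteq> 0" "D l = Max (D ` ?S)"
        using Max_in[OF fS] by auto
      have max: "D i \<le> D l" if "i < m" "c i \<noteq> 0" for i
        unfolding l(3) using fS that by (intro Max_ge) auto
      define G where "G x = (\<Sum>i<m. Polynomial.smult (c i) (F i x))" for x
      have GK: "G \<in> K" unfolding G_def[abs_def] by (rule lin) (rule F)
      have degG: "degree (G x) \<le> D l" if "x \<in> C" for x
        unfolding G_def
      proof (rule degree_sum_le)
        fix i assume "i \<in> {..<m}"
        then show "degree (Polynomial.smult (c i) (F i x)) \<le> D l"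
          using max[of i] deg[OF that, of i] by (cases "c i = 0") auto
      qed simp
      have "[:0, 1:] dvd G x" if "x \<in> C" for x
      proof -
        have "poly (G x) 0 = 0" unfolding G_def using c[OF that] by (simp add: poly_sum)
        then show ?thesis by (simp add: poly_eq_0_iff_dvd)
      qed
      then have "\<forall>x\<in>C. \<exists>h. G x = [:0, 1:] * h" unfolding dvd_def by blast
      then obtain H where H: "\<And>x. x \<in> C \<Longrightarrow> G x = [:0, 1:] * H x" by metis
      have HK: "H \<in> K" by (rule div, rule cong[OF GK H])
      have Gt: "(\<Sum>i<m. c i * poly (F i x) t) = t * poly (H x) t" if "x \<in> C" for x
      proof -
        have "(\<Sum>i<m. c i * poly (F i x) t) = poly (G x) t" by (simp add: G_def poly_sum)
        then show ?thesis using H[OF that] by simp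
      qed
      \<comment> \<open>With bound \<open>0\<close> the curve \<open>G\<close> would be constant and
        divisible by the variable, hence zero, and the family would be dependent at
        \<open>t\<close>.\<close>
      have "D l \<noteq> 0"
      proof
        assume D0: "D l = 0"
        have "H x = 0" if "x \<in> C" for x
        proof (rule ccontr)
          assume "H x \<noteq> 0"
          then have "degree (G x) = Suc (degree (H x))" using H[OF that] by (simp add: degree_pCons_eq)
          then show False using degG[OF that] D0 by simp
        qed
        then have "c l = 0" using indep[of c l] Gt l(1) by simp
        then show False using l(2) by simp
      qed
      have degH: "degree (H x) \<le> D l - 1" if "x \<in> C" for x
      proof (cases "H x = 0")
        case False
        then have "degree (G x) = Suc (degree (H x))" using H[OF that] by (simp add: degree_pCons_eq)
        then show ?thesis using degG[OF that] by simp
      qed simp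
      define F' where "F' = F(l := H)"
      define D' where "D' = D(l := D l - 1)"
      show ?thesis
      proof (rule less.hyps[of D' F'])
        show "(\<Sum>i<m. D' i) < (\<Sum>i<m. D i)"
          by (rule sum_strict_mono_ex1) (use l \<open>D l \<noteq> 0\<close> in \<open>auto simp: D'_def\<close>)
        show "F' i \<in> K" if "i < m" for i using F that HK by (simp add: F'_def)
        show "degree (F' i x) \<le> D' i" if "x \<in> C" for i x
          using that degH deg by (simp add: F'_def D'_def)
        fix b i assume b: "\<And>x. x \<in> C \<Longrightarrow> (\<Sum>i<m. b i * poly (F' i x) t) = 0" and i: "i < m"
        \<comment> \<open>A relation of the new family at \<open>t\<close>, rewritten for the old
          family: at \<open>t\<close> the new curve \<open>H\<close> is \<open>G\<close> divided by
          \<open>t\<close>, which is a nonzero number.\<close>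
        define a where "a i = (if i = l then b l * c l / t else b i + b l * c i / t)" for i
        have "(\<Sum>i<m. a i * poly (F i x) t) = 0" if x: "x \<in> C" for x
        proof -
          have "(\<Sum>i<m. a i * poly (F i x) t) =
             (\<Sum>i<m. (if i = l then 0 else b i * poly (F i x) t) + b l / t * (c i * poly (F i x) t))"
            by (rule sum.cong) (auto simp: a_def field_simps t)
          also have "\<dots> = (\<Sum>i<m. if i = l then 0 else b i * poly (F i x) t) + b l / t * (t * poly (H x) t)"
            by (simp only: sum.distrib sum_distrib_left[symmetric] Gt[OF x])
          also have "\<dots> = (\<Sum>i<m. (if i = l then 0 else b i * poly (F i x) t) + (if i = l then b l * poly (H x) t else 0))"
            using l(1) t by (simp add: sum.distrib)
          also have "\<dots> = (\<Sum>i<m. b i * poly (F' i x) t)"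
            by (rule sum.cong) (auto simp: F'_def)
          finally show ?thesis using b[OF x] by simp
        qed
        then have a0: "a i = 0" if "i < m" for i using indep[of a i] that by simp
        have bl: "b l = 0" using a0[OF l(1)] l(2) t by (simp add: a_def)
        show "b i = 0" using a0[OF i] bl by (cases "i = l") (simp_all add: a_def)
      qed
    qed
  qed
qed

section \<open>Four invariants of the slice\<close>

text \<open>The arguments are arrays \<open>[Y; m]\<close>: rows \<open>0\<close> and
  \<open>1\<close> hold the matrix \<open>Y\<close>, row \<open>2\<close> the row
  \<open>m\<close>.\<close>

definition pairing :: "(nat \<Rightarrow> nat \<Rightarrow> 'a::comm_ring_1 m2) \<Rightarrow> (nat \<Rightarrow> nat \<Rightarrow> 'a m2) \<Rightarrow> 'a" where
  "pairing Q P = (\<Sum>i<3. \<Sum>j<2. tr (adj (Q i j) * P i j))"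

text \<open>For block diagonal \<open>A\<close> with blocks \<open>B\<close> and \<open>a\<close> of
  sizes two and one, \<open>[Y; m]\<close> goes to \<open>[B Y - Y B; a m - m B]\<close>:
  \<open>Y\<close> is conjugated infinitesimally and \<open>m\<close> is moved along.\<close>

definition slice_action :: "(nat \<Rightarrow> nat \<Rightarrow> 'a::comm_ring_1 m2) \<Rightarrow> (nat \<Rightarrow> nat \<Rightarrow> 'a m2) \<Rightarrow> nat \<Rightarrow> nat \<Rightarrow> 'a m2" where
  "slice_action A P = (\<lambda>i j. (\<Sum>k<3. A i k * P k j) - (\<Sum>l<2. P i l * A l j))"

definition top_hermitian :: "(nat \<Rightarrow> nat \<Rightarrow> 'a::comm_ring_1 m2) \<Rightarrow> bool" where
  "top_hermitian P \<longleftrightarrow> (\<forall>i<2. \<forall>j<2. P j i = adj (P i j))"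

text \<open>By skewness \<open>A 0 2\<close> and \<open>A 1 2\<close> vanish as well, so
  \<open>A\<close> is block diagonal with blocks of sizes two and one.\<close>

definition skew_2_1 :: "(nat \<Rightarrow> nat \<Rightarrow> 'a::comm_ring_1 m2) \<Rightarrow> bool" where
  "skew_2_1 A \<longleftrightarrow> (\<forall>i<3. \<forall>j<3. A j i = - adj (A i j)) \<and> A 2 0 = 0 \<and> A 2 1 = 0"

text \<open>
  Differentials at \<open>Q = [Y; m]\<close> of the invariants \<open>tr Y\<close>, \<open>tr Y\<^sup>2 / 2\<close>, \<open>m m\<^sup>* / 2\<close> and
  \<open>m Y m\<^sup>*\<close>, up to the identification given by \<^term>\<open>pairing\<close>.
\<close>

definition invariant_differential :: "nat \<Rightarrow> (nat \<Rightarrow> nat \<Rightarrow> 'a::comm_ring_1 m2) \<Rightarrow> nat \<Rightarrow> nat \<Rightarrow> 'a m2" where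
  "invariant_differential k Q = (\<lambda>i j.
     if k = 0 then (if i = j then 1 else 0)
     else if k = 1 then (if i < 2 then Q i j else 0)
     else if k = 2 then (if i < 2 then 0 else Q 2 j)
     else (if i < 2 then adj (Q 2 i) * Q 2 j else scal 2 * (\<Sum>k<2. Q 2 k * Q k j)))"

lemma adj_top_hermitian: "top_hermitian P \<Longrightarrow> i < 2 \<Longrightarrow> j < 2 \<Longrightarrow> adj (P i j) = P j i"
  unfolding top_hermitian_def by metis

lemma top_hermitianI: "(\<And>i j. i < 2 \<Longrightarrow> j < 2 \<Longrightarrow> adj (P i j) = P j i) \<Longrightarrow> top_hermitian P"
  unfolding top_hermitian_def by metis

lemma lessThan_2: "{..<2::nat} = {0, 1}" and lessThan_3: "{..<3::nat} = {0, 1, 2}"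
  by auto

lemma all_less_2: "(\<forall>i<2::nat. R i) \<longleftrightarrow> R 0 \<and> R 1" and all_less_3: "(\<forall>i<3::nat. R i) \<longleftrightarrow> R 0 \<and> R 1 \<and> R 2"
  and all_less_4: "(\<forall>i<4::nat. R i) \<longleftrightarrow> R 0 \<and> R 1 \<and> R 2 \<and> R 3"
  by (auto simp: eval_nat_numeral less_Suc_eq)

lemma self_adjoint_scal:
  fixes x :: "'a::{idom, ring_char_0} m2"
  assumes "x = adj x"
  shows "\<exists>c. x = scal c"
proof -
  have *: "a = 0" if "a = - a" for a :: 'a
  proof -
    have "2 * a = 0" using that by (metis add.right_inverse mult_2)
    then show ?thesis by simp
  qed
  have "m11 x = m11 (adj x)" "m12 x = m12 (adj x)" "m21 x = m21 (adj x)" using assms by simp_all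
  then have "m11 x = m22 x" "m12 x = 0" "m21 x = 0" using * by auto
  then have "x = scal (m11 x)" by (simp add: m2_eq_iff)
  then show ?thesis by blast
qed

text \<open>The pairing is invariant, so up to sign and a constant factor this is the derivative of
  an invariant in the direction of an orbit. The direct expansion closes once the diagonal entries
  of \<open>Y\<close> are replaced by scalars and those of \<open>A\<close> are made
  traceless.\<close>

lemma pairing_invariant_differential:
  fixes Q :: "nat \<Rightarrow> nat \<Rightarrow> 'a::{idom, ring_char_0} m2"
  assumes Q: "top_hermitian Q" and A: "skew_2_1 A"
  shows "pairing Q (slice_action A (invariant_differential k Q)) = 0"
proof -
  have "Q 0 0 = adj (Q 0 0)" "Q 1 1 = adj (Q 1 1)" and Q10: "Q 1 0 = adj (Q 0 1)"
    using Q unfolding top_hermitian_def all_less_2 by blast+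
  then obtain s r where Qd: "Q 0 0 = scal s" "Q 1 1 = scal r" using self_adjoint_scal by metis
  have A': "A 0 0 = - adj (A 0 0)" "A 1 1 = - adj (A 1 1)" "A 2 2 = - adj (A 2 2)" "A 1 0 = - adj (A 0 1)"
    "A 2 0 = 0" "A 2 1 = 0" "A 0 2 = - adj (A 2 0)" "A 1 2 = - adj (A 2 1)"
    using A unfolding skew_2_1_def all_less_3 by blast+
  have Ad: "m22 (A i i) = - m11 (A i i)" if "A i i = - adj (A i i)" for i
    using arg_cong[OF that, of m22] by simp
  note Add = Ad[OF A'(1)] Ad[OF A'(2)] Ad[OF A'(3)]
  have A02: "A 0 2 = 0" "A 1 2 = 0" using A'(5-8) by simp_all
  consider "k = 0" | "k = 1" | "k = 2" | "k > 2" by linarith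
  then show ?thesis
  proof cases
    case 1
    then show ?thesis
      by (simp add: pairing_def slice_action_def invariant_differential_def lessThan_2 lessThan_3 tr_def
          Qd Q10 A'(4-6) A02 Add algebra_simps del: One_nat_def)
  next
    case 2
    then show ?thesis
      by (simp add: pairing_def slice_action_def invariant_differential_def lessThan_2 lessThan_3 tr_def
          Qd Q10 A'(4-6) A02 Add algebra_simps del: One_nat_def)
  next
    case 3
    then show ?thesis
      by (simp add: pairing_def slice_action_def invariant_differential_def lessThan_2 lessThan_3 tr_def
          Qd Q10 A'(4-6) A02 Add algebra_simps del: One_nat_def)
  next
    case 4
    then show ?thesis
      by (simp add: pairing_def slice_action_def invariant_differential_def lessThan_2 lessThan_3 tr_def
          Qd Q10 A'(4-6) A02 Add algebra_simps del: One_nat_def)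
  qed
qed

lemma invariant_differential_top_hermitian:
  assumes "top_hermitian Q"
  shows "top_hermitian (invariant_differential k Q)"
proof (rule top_hermitianI)
  fix i j :: nat assume ij: "i < 2" "j < 2"
  show "adj (invariant_differential k Q i j) = invariant_differential k Q j i"
    using ij by (simp add: invariant_differential_def adj_mult adj_top_hermitian[OF assms])
qed

lemma invariant_differential_in_alg:
  assumes "\<forall>i<3. \<forall>j<2. in_alg d (Q i j)" "i < 3" "j < 2"
  shows "in_alg d (invariant_differential k Q i j)"
  using assms unfolding invariant_differential_def
  by (auto intro!: in_alg_simps in_alg_sum)

lemma slice_action_top_hermitian:
  assumes P: "top_hermitian P" and A: "skew_2_1 A"
  shows "top_hermitian (slice_action A P)"
proof -
  have A': "A 0 0 = - adj (A 0 0)" "A 1 1 = - adj (A 1 1)" "A 1 0 = - adj (A 0 1)"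
    "A 2 0 = 0" "A 2 1 = 0" "A 0 2 = - adj (A 2 0)" "A 1 2 = - adj (A 2 1)"
    using A unfolding skew_2_1_def all_less_3 by blast+
  have adjA: "adj (A 0 0) = - A 0 0" "adj (A 1 1) = - A 1 1" using A'(1,2) by (metis add.inverse_inverse)+
  have A02: "A 0 2 = 0" "A 1 2 = 0" using A'(4-7) by simp_all
  have adjP: "adj (P 0 0) = P 0 0" "adj (P 1 1) = P 1 1" "adj (P 0 1) = P 1 0" "adj (P 1 0) = P 0 1"
    by (rule adj_top_hermitian[OF P]; simp)+
  have adjA': "adj (A 0 1) = - A 1 0" "adj (A 1 0) = - A 0 1" using A'(3) by simp_all
  have "adj (slice_action A P i j) = slice_action A P j i" if "i < 2" "j < 2" for i j
  proof -
    have "i = 0 \<or> i = 1" "j = 0 \<or> j = 1" using that by auto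
    then show ?thesis
      by (auto simp: slice_action_def lessThan_2 lessThan_3 adj_mult adjA adjP adjA' A02 simp del: One_nat_def)
  qed
  then show ?thesis by (rule top_hermitianI)
qed

lemma slice_action_in_alg:
  assumes "\<forall>i<3. \<forall>j<3. in_alg d (A i j)" "\<forall>i<3. \<forall>j<2. in_alg d (P i j)" "i < 3" "j < 2"
  shows "in_alg d (slice_action A P i j)"
  using assms unfolding slice_action_def by (auto intro!: in_alg_simps in_alg_sum)

lemma slice_action_linear:
  "slice_action A (\<lambda>i j. P i j + R i j) = (\<lambda>i j. slice_action A P i j + slice_action A R i j)"
  "slice_action A (\<lambda>i j. scal c * P i j) = (\<lambda>i j. scal c * slice_action A P i j)"
  by (auto simp: slice_action_def fun_eq_iff algebra_simps sum.distrib sum_distrib_left scal_commute mult.assoc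
      simp flip: mult.assoc[of _ "scal c"])

lemma pairing_linear:
  "pairing Q (\<lambda>i j. P i j + R i j) = pairing Q P + pairing Q R"
  "pairing Q (\<lambda>i j. scal c * P i j) = c * pairing Q P"
proof -
  have "adj (Q i j) * (scal c * P i j) = scal c * (adj (Q i j) * P i j)" for i j
    by (simp add: scal_commute flip: mult.assoc)
  then show "pairing Q (\<lambda>i j. scal c * P i j) = c * pairing Q P"
    by (simp add: pairing_def tr_simps sum_distrib_left)
qed (simp add: pairing_def algebra_simps sum.distrib tr_simps)

section \<open>Polynomial curves of slice vectors and their limits\<close>

definition eval_m2 :: "'a::comm_ring_1 \<Rightarrow> 'a poly m2 \<Rightarrow> 'a m2" where
  "eval_m2 t x = M2 (poly (m11 x) t) (poly (m12 x) t) (poly (m21 x) t) (poly (m22 x) t)"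

definition const_m2 :: "'a::comm_ring_1 m2 \<Rightarrow> 'a poly m2" where
  "const_m2 x = M2 [:m11 x:] [:m12 x:] [:m21 x:] [:m22 x:]"

lemma const_m2_sel[simp]: "m11 (const_m2 x) = [:m11 x:]" "m12 (const_m2 x) = [:m12 x:]"
   "m21 (const_m2 x) = [:m21 x:]" "m22 (const_m2 x) = [:m22 x:]"
  by (simp_all add: const_m2_def)

lemma eval_m2_sel[simp]: "m11 (eval_m2 t x) = poly (m11 x) t" "m12 (eval_m2 t x) = poly (m12 x) t"
   "m21 (eval_m2 t x) = poly (m21 x) t" "m22 (eval_m2 t x) = poly (m22 x) t"
  by (simp_all add: eval_m2_def)

lemma eval_m2_hom:
  "eval_m2 t 0 = 0" "eval_m2 t 1 = 1" "eval_m2 t (x + y) = eval_m2 t x + eval_m2 t y" "eval_m2 t (x - y) = eval_m2 t x - eval_m2 t y"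
  "eval_m2 t (x * y) = eval_m2 t x * eval_m2 t y" "eval_m2 t (adj x) = adj (eval_m2 t x)"
  "eval_m2 t (scal p) = scal (poly p t)" "eval_m2 t (const_m2 z) = z" "poly (tr x) t = tr (eval_m2 t x)"
  by (simp_all add: m2_eq_iff tr_def)

lemma eval_m2_sum: "eval_m2 t (sum f A) = (\<Sum>i\<in>A. eval_m2 t (f i))"
  by (simp add: m2_eq_iff poly_sum)

lemma eval_pairing: "poly (pairing Q P) t = pairing (\<lambda>i j. eval_m2 t (Q i j)) (\<lambda>i j. eval_m2 t (P i j))"
  by (simp add: pairing_def poly_sum eval_m2_hom)

lemma eval_slice_action:
  "eval_m2 t (slice_action A P i j) = slice_action (\<lambda>i j. eval_m2 t (A i j)) (\<lambda>i j. eval_m2 t (P i j)) i j"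
  by (simp add: slice_action_def eval_m2_sum eval_m2_hom)

lemma eval_invariant_differential:
  "eval_m2 t (invariant_differential k Q i j) = invariant_differential k (\<lambda>i j. eval_m2 t (Q i j)) i j"
  by (simp add: invariant_differential_def eval_m2_sum eval_m2_hom)

lemma const_m2_neg_adj: "const_m2 (- adj x) = - adj (const_m2 x)" and const_m2_0: "const_m2 0 = 0"
  by (simp_all add: m2_eq_iff)

text \<open>Scalar coordinates, indexed by row, column and position inside the
  \<open>2 \<times> 2\<close> entry, are the form in which \<open>saturate_curves\<close> takes its
  curves.\<close>

definition m2_of_coords :: "(nat \<times> nat \<times> nat \<Rightarrow> 'a) \<Rightarrow> nat \<Rightarrow> nat \<Rightarrow> 'a m2" where
  "m2_of_coords F = (\<lambda>i j. M2 (F (i, j, 0)) (F (i, j, 1)) (F (i, j, 2)) (F (i, j, 3)))"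

definition coords_of_m2 :: "(nat \<Rightarrow> nat \<Rightarrow> 'a m2) \<Rightarrow> nat \<times> nat \<times> nat \<Rightarrow> 'a" where
  "coords_of_m2 P = (\<lambda>(i, j, c). if c = 0 then m11 (P i j) else if c = 1 then m12 (P i j) else if c = 2 then m21 (P i j) else m22 (P i j))"

lemma m2_of_coords_of_m2[simp]: "m2_of_coords (coords_of_m2 P) = P"
  by (simp add: m2_of_coords_def coords_of_m2_def)

text \<open>The Lie algebra element stays constant while the base point \<open>Q\<close> and the
  vector \<open>P\<close> vary with the parameter. All conditions on \<open>P\<close> are linear
  over the polynomial ring, so they survive combinations and the cancelling of a polynomial
  factor.\<close>

definition annihilated_curve ::
  "nat \<Rightarrow> (nat \<Rightarrow> nat \<Rightarrow> 'k::field_char_0 poly m2) \<Rightarrow> (nat \<Rightarrow> nat \<Rightarrow> 'k poly m2) \<Rightarrow> bool" where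
  "annihilated_curve d Q P \<longleftrightarrow> (\<forall>i<3. \<forall>j<2. in_alg d (P i j)) \<and> top_hermitian P \<and>
     (\<forall>A. skew_2_1 A \<longrightarrow> pairing Q (slice_action (\<lambda>i j. const_m2 (A i j)) P) = 0)"

lemma annihilated_curve_add:
  "annihilated_curve d Q P \<Longrightarrow> annihilated_curve d Q R \<Longrightarrow> annihilated_curve d Q (\<lambda>i j. P i j + R i j)"
  unfolding annihilated_curve_def
  by (auto simp: slice_action_linear pairing_linear adj_top_hermitian intro!: top_hermitianI)

lemma annihilated_curve_smult:
  "annihilated_curve d Q P \<Longrightarrow> annihilated_curve d Q (\<lambda>i j. scal p * P i j)"
  unfolding annihilated_curve_def
  by (auto simp: slice_action_linear pairing_linear adj_top_hermitian adj_mult scal_commute intro!: top_hermitianI)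

lemma annihilated_curve_zero: "annihilated_curve d Q (\<lambda>i j. 0)"
  unfolding annihilated_curve_def by (simp add: slice_action_def pairing_def top_hermitian_def tr_simps)

lemma scal_cancel:
  fixes x :: "'a::idom m2"
  assumes "p \<noteq> 0"
  shows "scal p * x = scal p * y \<longleftrightarrow> x = y"
  using assms by (simp add: m2_eq_iff)

text \<open>The polynomial ring has no zero divisors, so a nonzero factor cancels from each of the
  linear conditions. This is the saturation that makes the limit at \<open>0\<close>
  possible.\<close>

lemma annihilated_curve_div:
  assumes "annihilated_curve d Q (\<lambda>i j. scal p * P i j)" and p: "p \<noteq> 0"
  shows "annihilated_curve d Q P"
proof -
  have "in_alg d (P i j)" if "in_alg d (scal p * P i j)" for i j
    using that p by (simp add: in_alg_def)
  moreover have "top_hermitian P"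
  proof -
    have "scal p * P j i = scal p * adj (P i j)" if "i < 2" "j < 2" for i j
    proof -
      have "adj (scal p * P i j) = scal p * P j i"
        using assms(1) that adj_top_hermitian[of "\<lambda>i j. scal p * P i j"] unfolding annihilated_curve_def by blast
      then show ?thesis by (simp add: adj_mult scal_commute)
    qed
    then show ?thesis unfolding top_hermitian_def scal_cancel[OF p] by blast
  qed
  ultimately show ?thesis
    using assms unfolding annihilated_curve_def by (simp add: slice_action_linear pairing_linear)
qed

lemma annihilated_curve_cong:
  assumes "annihilated_curve d Q P" and "\<And>i j. i < 3 \<Longrightarrow> j < 2 \<Longrightarrow> P i j = R i j"
  shows "annihilated_curve d Q R"
proof -
  have "slice_action A P i j = slice_action A R i j" if "i < 3" "j < 2" for A i j
    using assms(2) that by (simp add: slice_action_def)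
  then have "pairing Q (slice_action A P) = pairing Q (slice_action A R)" for A by (simp add: pairing_def)
  moreover have "top_hermitian R"
  proof (rule top_hermitianI)
    fix i j :: nat assume ij: "i < 2" "j < 2"
    have "top_hermitian P" using assms(1) unfolding annihilated_curve_def by blast
    from adj_top_hermitian[OF this ij] show "adj (R i j) = R j i"
      using assms(2)[of i j] assms(2)[of j i] ij by simp
  qed
  moreover have "in_alg d (R i j)" if "i < 3" "j < 2" for i j
    using assms(1) assms(2)[OF that] that unfolding annihilated_curve_def by metis
  ultimately show ?thesis using assms(1) unfolding annihilated_curve_def by simp
qed

text \<open>At \<open>Q\<close> itself the differentials may be dependent; for \<open>Q = 0\<close>
  three of them vanish. They are therefore taken along a line that joins \<open>Q\<close> to a point
  where they are independent.\<close>

lemma four_annihilated_vectors: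
  fixes Q :: "nat \<Rightarrow> nat \<Rightarrow> 'k::field_char_0 m2"
  assumes Q: "top_hermitian Q" "\<forall>i<3. \<forall>j<2. in_alg d (Q i j)"
  shows "\<exists>P :: nat \<Rightarrow> nat \<Rightarrow> nat \<Rightarrow> 'k m2.
    (\<forall>k<4. (\<forall>i<3. \<forall>j<2. in_alg d (P k i j)) \<and> top_hermitian (P k) \<and>
       (\<forall>A. skew_2_1 A \<longrightarrow> pairing Q (slice_action A (P k)) = 0)) \<and>
    (\<forall>c. (\<forall>i<3. \<forall>j<2. (\<Sum>k<4. scal (c k) * P k i j) = 0) \<longrightarrow> (\<forall>k<4. c k = 0))"
proof -
  \<comment> \<open>Here \<open>Y\<close> is diagonal with entries \<open>1\<close> and
    \<open>0\<close> and \<open>m\<close> is \<open>(1, 1)\<close>: \<open>Y\<close> is not scalar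
    and \<open>m\<close> is not an eigenvector of it.\<close>
  define Q1 :: "nat \<Rightarrow> nat \<Rightarrow> 'k m2" where "Q1 i j = (if i = 0 \<and> j = 0 \<or> i = 2 then 1 else 0)" for i j
  \<comment> \<open>The line through \<open>Q\<close> at parameter \<open>0\<close> and
    \<open>Q1\<close> at parameter \<open>1\<close>.\<close>
  define Qt where "Qt i j = const_m2 (Q i j) + scal [:0, 1:] * const_m2 (Q1 i j - Q i j)" for i j
  have Qt0: "eval_m2 0 (Qt i j) = Q i j" and Qt1: "eval_m2 1 (Qt i j) = Q1 i j" for i j
    by (simp_all add: Qt_def m2_eq_iff)
  have Qt: "top_hermitian Qt"
  proof (rule top_hermitianI)
    fix i j :: nat assume ij: "i < 2" "j < 2"
    have "Q j i = adj (Q i j)" using adj_top_hermitian[OF Q(1) ij] by simp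
    then show "adj (Qt i j) = Qt j i"
      using ij unfolding Qt_def Q1_def by (simp add: m2_eq_iff)
  qed
  have Qt_alg: "\<forall>i<3. \<forall>j<2. in_alg d (Qt i j)"
    using Q(2) unfolding Qt_def Q1_def by (auto simp: in_alg_def)
  let ?K = "{F. annihilated_curve d Qt (m2_of_coords F)}"
  let ?C = "{..<3::nat} \<times> {..<2::nat} \<times> {..<4::nat}"
  have coords_add: "m2_of_coords (\<lambda>x. F x + G x) = (\<lambda>i j. m2_of_coords F i j + m2_of_coords G i j)" for F G :: "_ \<Rightarrow> 'k poly"
    by (simp add: m2_of_coords_def m2_eq_iff fun_eq_iff)
  have coords_smult: "m2_of_coords (\<lambda>x. p * F x) = (\<lambda>i j. scal p * m2_of_coords F i j)" for p and F :: "_ \<Rightarrow> 'k poly"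
    by (simp add: m2_of_coords_def m2_eq_iff fun_eq_iff)
  have "\<exists>F :: nat \<Rightarrow> _. (\<forall>k<4. F k \<in> ?K) \<and>
    (\<forall>c. (\<forall>x\<in>?C. (\<Sum>k<4. c k * poly (F k x) 0) = 0) \<longrightarrow> (\<forall>k<4. c k = 0))"
  proof (rule saturate_curves[where t = 1 and F = "\<lambda>k. coords_of_m2 (invariant_differential k Qt)"])
    show "finite ?C" by simp
    show "(\<lambda>x. \<Sum>i<4. Polynomial.smult (c i) (F i x)) \<in> ?K" if F: "\<And>i. i < 4 \<Longrightarrow> F i \<in> ?K" for F and c :: "nat \<Rightarrow> 'k"
    proof -
      have "(\<lambda>x. \<Sum>i<n. Polynomial.smult (c i) (F i x)) \<in> ?K" if "n \<le> 4" for n :: nat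
        using that
      proof (induction n)
        case 0
        have "m2_of_coords (\<lambda>x. 0 :: 'k poly) = (\<lambda>i j. 0)" by (simp add: m2_of_coords_def m2_eq_iff fun_eq_iff)
        then show ?case by (simp add: annihilated_curve_zero)
      next
        case (Suc n)
        have "(\<lambda>x. (\<Sum>i<Suc n. Polynomial.smult (c i) (F i x))) = (\<lambda>x. (\<Sum>i<n. Polynomial.smult (c i) (F i x)) + [:c n:] * F n x)"
          by (simp add: fun_eq_iff)
        then show ?case
          using Suc F[of n] by (simp only: mem_Collect_eq coords_add coords_smult) (simp add: annihilated_curve_add annihilated_curve_smult)
      qed
      then show ?thesis by blast
    qed
    show "F \<in> ?K" if "(\<lambda>x. [:0, 1:] * F x) \<in> ?K" for F
      using that annihilated_curve_div[of d Qt "[:0, 1:]" "m2_of_coords F"] by (simp only: mem_Collect_eq coords_smult) simp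
    show "G \<in> ?K" if "F \<in> ?K" "\<And>x. x \<in> ?C \<Longrightarrow> F x = G x" for F G
      using that(1) that(2) annihilated_curve_cong[of d Qt "m2_of_coords F" "m2_of_coords G"] by (simp add: m2_of_coords_def)
    show "coords_of_m2 (invariant_differential k Qt) \<in> ?K" for k
    proof -
      have "skew_2_1 (\<lambda>i j. const_m2 (A i j))" if "skew_2_1 A" for A :: "nat \<Rightarrow> nat \<Rightarrow> 'k m2"
        using that unfolding skew_2_1_def by (metis const_m2_0 const_m2_neg_adj)
      then show ?thesis
        using pairing_invariant_differential[OF Qt] invariant_differential_top_hermitian[OF Qt]
          invariant_differential_in_alg[OF Qt_alg] by (simp add: annihilated_curve_def)
    qed
    fix c :: "nat \<Rightarrow> 'k" and i :: nat
    assume *: "\<And>x. x \<in> ?C \<Longrightarrow> (\<Sum>k<4. c k * poly (coords_of_m2 (invariant_differential k Qt) x) 1) = 0" and i: "i < 4"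
    have c0: "(\<Sum>k<4. c k * m11 (invariant_differential k Q1 i j)) = 0" if "i < 3" "j < 2" for i j
    proof -
      have "poly (m11 (invariant_differential k Qt i j)) 1 = m11 (invariant_differential k Q1 i j)" for k
        using arg_cong[OF eval_invariant_differential[of 1 k Qt i j], of m11] by (simp add: Qt1)
      then show ?thesis using *[of "(i, j, 0)"] that by (simp add: coords_of_m2_def)
    qed
    have "{..<4::nat} = {0, 1, 2, 3}" by auto
    \<comment> \<open>The system is triangular: the entries \<open>(0, 1)\<close>,
      \<open>(2, 1)\<close>, \<open>(1, 1)\<close> and \<open>(0, 0)\<close> determine
      \<open>c 3\<close>, \<open>c 2\<close>, \<open>c 0\<close> and \<open>c 1\<close> in this
      order.\<close>
    then have "c 3 = 0 \<and> c 2 = 0 \<and> c 1 = 0 \<and> c 0 = 0"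
      using c0[of 0 1] c0[of 2 1] c0[of 1 1] c0[of 0 0]
      by (simp add: invariant_differential_def Q1_def lessThan_2)
    then show "c i = 0" using i by (auto simp: eval_nat_numeral less_Suc_eq)
  qed simp
  then obtain F :: "nat \<Rightarrow> _" where F: "\<And>k. k < 4 \<Longrightarrow> annihilated_curve d Qt (m2_of_coords (F k))"
    and indep: "\<And>c. (\<forall>x\<in>?C. (\<Sum>k<4. c k * poly (F k x) 0) = 0) \<Longrightarrow> (\<forall>k<4. c k = 0)"
    by auto
  define P where "P k i j = eval_m2 0 (m2_of_coords (F k) i j)" for k i j
  show ?thesis
  proof (intro exI[of _ P] conjI allI impI)
    fix k :: nat assume k: "k < 4"
    show "in_alg d (P k i j)" if "i < 3" "j < 2" for i j
      using F[OF k] that unfolding annihilated_curve_def P_def by (auto simp: in_alg_def)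
    show "top_hermitian (P k)"
    proof (rule top_hermitianI)
      fix i j :: nat assume ij: "i < 2" "j < 2"
      have "top_hermitian (m2_of_coords (F k))" using F[OF k] unfolding annihilated_curve_def by blast
      from adj_top_hermitian[OF this ij] show "adj (P k i j) = P k j i"
        unfolding P_def by (simp flip: eval_m2_hom)
    qed
    show "pairing Q (slice_action A (P k)) = 0" if "skew_2_1 A" for A
    proof -
      have "poly (pairing Qt (slice_action (\<lambda>i j. const_m2 (A i j)) (m2_of_coords (F k)))) 0 = 0"
        using F[OF k] that unfolding annihilated_curve_def by simp
      then show ?thesis
        unfolding eval_pairing eval_slice_action by (simp add: Qt0 eval_m2_hom P_def[abs_def])
    qed
  next
    fix c :: "nat \<Rightarrow> 'k" and k :: nat
    assume 0: "\<forall>i<3. \<forall>j<2. (\<Sum>k<4. scal (c k) * P k i j) = 0" and k: "k < 4"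
    have "(\<Sum>k<4. c k * poly (F k (i, j, l)) 0) = 0" if "i < 3" "j < 2" "l < 4" for i j l
    proof -
      have z: "(\<Sum>k<4. scal (c k) * P k i j) = 0" using 0 that by blast
      have "l = 0 \<or> l = 1 \<or> l = 2 \<or> l = 3" using that(3) by auto
      then show ?thesis
        using arg_cong[OF z, of m11] arg_cong[OF z, of m12] arg_cong[OF z, of m21] arg_cong[OF z, of m22]
        by (auto simp: P_def m2_of_coords_def)
    qed
    then have "\<forall>x\<in>?C. (\<Sum>k<4. c k * poly (F k x) 0) = 0"
      by (intro ballI) (elim SigmaE, simp only: lessThan_iff)
    then show "c k = 0" using indep k by blast
  qed
qed

text \<open>Transposed positions contribute opposite values, since \<open>P\<close> is hermitian and
  the top of \<open>B\<close> skew-hermitian. This is why slice functionals vanish on the tangent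
  space of the nilpotent element.\<close>

lemma pairing_skew:
  fixes P :: "nat \<Rightarrow> nat \<Rightarrow> 'k::field_char_0 m2"
  assumes P: "top_hermitian P" and B: "\<And>i j. i < 2 \<Longrightarrow> j < 2 \<Longrightarrow> adj (B i j) = - B j i" and B2: "\<And>j. j < 2 \<Longrightarrow> B 2 j = 0"
  shows "pairing P B = 0"
proof -
  define t where "t i j = tr (adj (P i j) * B i j)" for i j
  have t: "t j i = - t i j" if "i < 2" "j < 2" for i j
  proof -
    have "t j i = - tr (P i j * adj (B i j))"
      unfolding t_def using adj_top_hermitian[OF P that(2,1)] B[OF that] by (simp add: tr_simps)
    also have "tr (P i j * adj (B i j)) = tr (adj (B i j * adj (P i j)))" by (simp add: adj_mult)
    also have "\<dots> = t i j" unfolding t_def tr_adj by (rule tr_commute)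
    finally show ?thesis .
  qed
  have "t 0 0 = 0" "t 1 1 = 0" "t 1 0 = - t 0 1" using t[of 0 0] t[of 1 1] t[of 0 1] by simp_all
  moreover have "t 2 j = 0" if "j < 2" for j using B2[OF that] by (simp add: t_def tr_simps)
  ultimately show ?thesis
    unfolding pairing_def t_def[symmetric] by (simp add: lessThan_2 lessThan_3 del: One_nat_def)
qed

lemma sum_swap_outer: "(\<Sum>i\<in>A. \<Sum>j\<in>B. \<Sum>k\<in>C. f i j k) = (\<Sum>k\<in>C. \<Sum>j\<in>B. \<Sum>i\<in>A. f i j k)"
proof -
  have "(\<Sum>i\<in>A. \<Sum>j\<in>B. \<Sum>k\<in>C. f i j k) = (\<Sum>j\<in>B. \<Sum>i\<in>A. \<Sum>k\<in>C. f i j k)" by (rule sum.swap)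
  also have "\<dots> = (\<Sum>j\<in>B. \<Sum>k\<in>C. \<Sum>i\<in>A. f i j k)" by (intro sum.cong refl sum.swap)
  also have "\<dots> = (\<Sum>k\<in>C. \<Sum>j\<in>B. \<Sum>i\<in>A. f i j k)" by (rule sum.swap)
  finally show ?thesis .
qed

text \<open>Left multiplication by a skew matrix is skew for the trace form, and so is right
  multiplication by the cyclic property of the trace.\<close>

lemma pairing_slice_action:
  assumes A: "\<And>i j. i < 3 \<Longrightarrow> j < 3 \<Longrightarrow> adj (A i j) = - A j i"
  shows "pairing P (slice_action A X) = - pairing (slice_action A P) X"
proof -
  have "(\<Sum>i<3. \<Sum>j<2. tr (adj (\<Sum>k<3. A i k * P k j) * X i j)) = (\<Sum>i<3. \<Sum>j<2. \<Sum>k<3. - tr (adj (P k j) * A k i * X i j))"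
    by (intro sum.cong refl) (simp add: adj_sum adj_mult A sum_distrib_right tr_sum tr_simps)
  also have "\<dots> = (\<Sum>k<3. \<Sum>j<2. \<Sum>i<3. - tr (adj (P k j) * A k i * X i j))"
    by (rule sum_swap_outer)
  also have "\<dots> = - (\<Sum>i<3. \<Sum>j<2. tr (adj (P i j) * (\<Sum>k<3. A i k * X k j)))"
    by (simp add: sum_distrib_left tr_sum sum_negf mult.assoc)
  finally have 1: "(\<Sum>i<3. \<Sum>j<2. tr (adj (P i j) * (\<Sum>k<3. A i k * X k j))) =
     - (\<Sum>i<3. \<Sum>j<2. tr (adj (\<Sum>k<3. A i k * P k j) * X i j))" by simp
  have "(\<Sum>i<3. \<Sum>j<2. tr (adj (\<Sum>l<2. P i l * A l j) * X i j)) = (\<Sum>i<3. \<Sum>j<2. \<Sum>l<2. - tr (adj (P i l) * (X i j * A j l)))"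
  proof (intro sum.cong refl)
    fix i j :: nat assume "i \<in> {..<3}" "j \<in> {..<2}"
    have "tr (adj (A l j) * adj (P i l) * X i j) = - tr (adj (P i l) * (X i j * A j l))" if "l < 2" for l
      using that \<open>j \<in> {..<2}\<close> tr_commute[of "A j l" "adj (P i l) * X i j"] by (simp add: A tr_simps mult.assoc)
    then show "tr (adj (\<Sum>l<2. P i l * A l j) * X i j) = (\<Sum>l<2. - tr (adj (P i l) * (X i j * A j l)))"
      by (simp add: adj_sum adj_mult sum_distrib_right tr_sum)
  qed
  also have "\<dots> = (\<Sum>i<3. \<Sum>l<2. \<Sum>j<2. - tr (adj (P i l) * (X i j * A j l)))"
    by (intro sum.cong refl sum.swap)
  also have "\<dots> = - (\<Sum>i<3. \<Sum>j<2. tr (adj (P i j) * (\<Sum>l<2. X i l * A l j)))"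
    by (simp add: sum_distrib_left tr_sum sum_negf)
  finally have 2: "(\<Sum>i<3. \<Sum>j<2. tr (adj (P i j) * (\<Sum>l<2. X i l * A l j))) =
     - (\<Sum>i<3. \<Sum>j<2. tr (adj (\<Sum>l<2. P i l * A l j) * X i j))" by simp
  show ?thesis
    unfolding pairing_def slice_action_def
    by (simp add: right_diff_distrib left_diff_distrib tr_simps sum_subtractf 1 2)
qed

definition slice_space :: "nat \<Rightarrow> (nat \<Rightarrow> nat \<Rightarrow> 'k::field_char_0 m2) \<Rightarrow> bool" where
  "slice_space d P \<longleftrightarrow> (\<forall>i<3. \<forall>j<2. in_alg d (P i j)) \<and> top_hermitian P"

text \<open>Serves to describe a point of the double dual of the quotient by an array
  \<open>Q\<close>, as far as its values on slice functionals are concerned.\<close>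

lemma slice_space_riesz:
  fixes l :: "(nat \<Rightarrow> nat \<Rightarrow> 'k::field_char_0 m2) \<Rightarrow> 'k"
  assumes add: "\<And>P R. slice_space d P \<Longrightarrow> slice_space d R \<Longrightarrow> l (\<lambda>i j. P i j + R i j) = l P + l R"
    and smult: "\<And>c P. slice_space d P \<Longrightarrow> l (\<lambda>i j. scal c * P i j) = c * l P"
    and cong: "\<And>P R. slice_space d P \<Longrightarrow> slice_space d R \<Longrightarrow> (\<And>i j. i < 3 \<Longrightarrow> j < 2 \<Longrightarrow> P i j = R i j) \<Longrightarrow> l P = l R"
  shows "\<exists>Q. slice_space d Q \<and> (\<forall>P. slice_space d P \<longrightarrow> l P = pairing Q P)"
proof -
  define u where "u p q x = (\<lambda>i j. if i = p \<and> j = q then x else 0 :: 'k m2)" for p q :: nat and x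
  define e where "e x = (\<lambda>i j :: nat. if i = (0::nat) \<and> j = 1 then x else if i = 1 \<and> j = 0 then adj x else 0 :: 'k m2)" for x :: "'k m2"
  have u_add: "u p q (x + y) = (\<lambda>i j. u p q x i j + u p q y i j)" and u_smult: "u p q (scal c * x) = (\<lambda>i j. scal c * u p q x i j)" for p q x y c
    by (auto simp: u_def fun_eq_iff)
  have e_add: "e (x + y) = (\<lambda>i j. e x i j + e y i j)" and e_smult: "e (scal c * x) = (\<lambda>i j. scal c * e x i j)" for x y c
    by (auto simp: e_def fun_eq_iff adj_mult scal_commute)
  have u2: "slice_space d (u 2 q x)" if "in_alg d x" for q x
    unfolding slice_space_def using that by (auto simp: u_def intro!: top_hermitianI)
  have ud: "slice_space d (u p p 1)" for p
    unfolding slice_space_def by (auto simp: u_def intro!: top_hermitianI)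
  have es: "slice_space d (e x)" if "in_alg d x" for x
    unfolding slice_space_def using that by (auto simp: e_def intro!: top_hermitianI)
  have add_closed: "slice_space d (\<lambda>i j. P i j + R i j)" if "slice_space d P" "slice_space d R" for P R
    using that unfolding slice_space_def by (auto simp: adj_top_hermitian intro!: top_hermitianI)
  have smult_closed: "slice_space d (\<lambda>i j. scal c * P i j)" if "slice_space d P" for P c
    using that unfolding slice_space_def by (auto simp: adj_top_hermitian adj_mult scal_commute intro!: top_hermitianI)
  have "\<exists>z. in_alg d z \<and> (\<forall>x. in_alg d x \<longrightarrow> l (u 2 q x) = tr (adj z * x))" for q
    using u2 add smult by (intro tr_riesz) (simp_all add: u_add u_smult)
  then obtain z where z: "\<And>q. in_alg d (z q)" "\<And>q x. in_alg d x \<Longrightarrow> l (u 2 q x) = tr (adj (z q) * x)" by metis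
  have "\<exists>w. in_alg d w \<and> (\<forall>x. in_alg d x \<longrightarrow> l (e x) = tr (adj w * x))"
    using es add smult by (intro tr_riesz) (simp_all add: e_add e_smult)
  then obtain w where w: "in_alg d w" "\<And>x. in_alg d x \<Longrightarrow> l (e x) = tr (adj w * x)" by blast
  \<comment> \<open>The off-diagonal entry enters the pairing twice, once as itself and once as its
    adjugate; hence the factor \<open>1/2\<close>.\<close>
  define w' where "w' = scal (1/2) * w"
  \<comment> \<open>The diagonal entries are halved because
    \<open>tr (scal s) = 2 * s\<close>.\<close>
  define Q where "Q i j = (if i = 2 then z j else if i = 0 \<and> j = 0 then scal (l (u 0 0 1) / 2)
    else if i = 1 \<and> j = 1 then scal (l (u 1 1 1) / 2) else if i = 0 \<and> j = 1 then w' else if i = 1 \<and> j = 0 then adj w' else 0)" for i j :: nat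
  have "top_hermitian Q"
    by (rule top_hermitianI) (auto simp: Q_def)
  moreover have "\<forall>i<3. \<forall>j<2. in_alg d (Q i j)"
    using z(1) w(1) by (auto simp: Q_def w'_def)
  ultimately have Q: "slice_space d Q" by (simp add: slice_space_def)
  have "l P = pairing Q P" if P: "slice_space d P" for P
  proof -
    have PA: "in_alg d (P i j)" if "i < 3" "j < 2" for i j using P that by (simp add: slice_space_def)
    have PH: "adj (P i j) = P j i" if "i < 2" "j < 2" for i j using P that by (simp add: slice_space_def adj_top_hermitian)
    have "P 0 0 = adj (P 0 0)" "P 1 1 = adj (P 1 1)" using PH[of 0 0] PH[of 1 1] by simp_all
    then obtain s r where sr: "P 0 0 = scal s" "P 1 1 = scal r" using self_adjoint_scal by metis
    have P10: "P 1 0 = adj (P 0 1)" using PH[of 0 1] by simp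
    define R where "R = (\<lambda>i j. scal s * u 0 0 1 i j + (scal r * u 1 1 1 i j + (e (P 0 1) i j + (u 2 0 (P 2 0) i j + u 2 1 (P 2 1) i j))))"
    have "P i j = R i j" if "i < 3" "j < 2" for i j
    proof -
      have "i = 0 \<or> i = 1 \<or> i = 2" "j = 0 \<or> j = 1" using that by auto
      then show ?thesis by (auto simp: R_def u_def e_def sr P10 simp del: One_nat_def)
    qed
    moreover have R: "slice_space d R" unfolding R_def
      by (intro add_closed smult_closed ud u2 es PA) simp_all
    ultimately have "l P = l R" using cong[OF P R] by blast
    also have "\<dots> = s * l (u 0 0 1) + (r * l (u 1 1 1) + (l (e (P 0 1)) + (l (u 2 0 (P 2 0)) + l (u 2 1 (P 2 1)))))"
      unfolding R_def using PA[of 0 1] PA[of 2 0] PA[of 2 1] by (simp add: add smult add_closed smult_closed ud u2 es)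
    also have "\<dots> = s * l (u 0 0 1) + (r * l (u 1 1 1) + (tr (adj w * P 0 1) + (tr (adj (z 0) * P 2 0) + tr (adj (z 1) * P 2 1))))"
      using PA[of 0 1] PA[of 2 0] PA[of 2 1] by (simp add: w(2) z(2))
    also have "tr (adj w * P 0 1) = tr (adj w' * P 0 1) + tr (w' * adj (P 0 1))"
      by (simp add: w'_def tr_def field_simps)
    finally show ?thesis
      by (simp add: pairing_def lessThan_2 lessThan_3 Q_def sr P10 tr_def del: One_nat_def)
  qed
  then show ?thesis using Q by blast
qed

section \<open>Skew-hermitian matrices\<close>

definition mat_prod :: "nat \<Rightarrow> (nat \<Rightarrow> nat \<Rightarrow> 'a::comm_ring_1 m2) \<Rightarrow> (nat \<Rightarrow> nat \<Rightarrow> 'a m2) \<Rightarrow> nat \<Rightarrow> nat \<Rightarrow> 'a m2" where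
  "mat_prod n X Y = (\<lambda>i j. \<Sum>k<n. X i k * Y k j)"

definition skew_hermitian :: "nat \<Rightarrow> nat \<Rightarrow> (nat \<Rightarrow> nat \<Rightarrow> 'a::comm_ring_1 m2) \<Rightarrow> bool" where
  "skew_hermitian n d X \<longleftrightarrow> (\<forall>i<n. \<forall>j<n. in_alg d (X i j) \<and> adj (X i j) = - X j i)"

definition block_diagonal :: "nat \<Rightarrow> (nat \<Rightarrow> nat \<Rightarrow> 'a::zero) \<Rightarrow> bool" where
  "block_diagonal n X \<longleftrightarrow> (\<forall>i<n. \<forall>j<n. (i < 3) \<noteq> (j < 3) \<longrightarrow> X i j = 0)"

definition block_off_diagonal :: "nat \<Rightarrow> (nat \<Rightarrow> nat \<Rightarrow> 'a::zero) \<Rightarrow> bool" where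
  "block_off_diagonal n X \<longleftrightarrow> (\<forall>i<n. \<forall>j<n. (i < 3) = (j < 3) \<longrightarrow> X i j = 0)"

definition elementary :: "nat \<Rightarrow> nat \<Rightarrow> 'a::comm_ring_1 m2 \<Rightarrow> nat \<Rightarrow> nat \<Rightarrow> 'a m2" where
  "elementary i j x = (\<lambda>k l. if k = i \<and> l = j then x else 0)"

text \<open>For \<open>i = j\<close> both terms fall on the same position and give
  \<open>x - adj x\<close>, the traceless part of \<open>x\<close> doubled.\<close>

definition skew_elementary :: "nat \<Rightarrow> nat \<Rightarrow> 'a::comm_ring_1 m2 \<Rightarrow> nat \<Rightarrow> nat \<Rightarrow> 'a m2" where
  "skew_elementary i j x = (\<lambda>k l. elementary i j x k l - elementary j i (adj x) k l)"

definition commutator :: "nat \<Rightarrow> (nat \<Rightarrow> nat \<Rightarrow> 'a::comm_ring_1 m2) \<Rightarrow> (nat \<Rightarrow> nat \<Rightarrow> 'a m2) \<Rightarrow> nat \<Rightarrow> nat \<Rightarrow> 'a m2" where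
  "commutator n X Y = (\<lambda>i j. mat_prod n X Y i j - mat_prod n Y X i j)"

lemma skew_hermitianD:
  "skew_hermitian n d X \<Longrightarrow> i < n \<Longrightarrow> j < n \<Longrightarrow> in_alg d (X i j)"
  "skew_hermitian n d X \<Longrightarrow> i < n \<Longrightarrow> j < n \<Longrightarrow> adj (X i j) = - X j i"
  unfolding skew_hermitian_def by blast+

lemma skew_hermitianI:
  "(\<And>i j. i < n \<Longrightarrow> j < n \<Longrightarrow> in_alg d (X i j)) \<Longrightarrow> (\<And>i j. i < n \<Longrightarrow> j < n \<Longrightarrow> adj (X i j) = - X j i) \<Longrightarrow>
  skew_hermitian n d X"
  unfolding skew_hermitian_def by blast

lemma skew_hermitian_closed:
  "skew_hermitian n d X \<Longrightarrow> skew_hermitian n d Y \<Longrightarrow> skew_hermitian n d (\<lambda>i j. X i j + Y i j)"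
  "skew_hermitian n d X \<Longrightarrow> skew_hermitian n d (\<lambda>i j. scal c * X i j)"
  "skew_hermitian n d (\<lambda>i j. 0)"
  by (auto intro!: skew_hermitianI simp: skew_hermitianD adj_mult scal_commute)

lemma adj_elementary: "adj (elementary i j x k l) = elementary j i (adj x) l k"
  by (simp add: elementary_def conj_commute)

lemma in_alg_elementary: "in_alg d x \<Longrightarrow> in_alg d (elementary i j x k l)"
  by (simp add: elementary_def)

lemma skew_hermitian_elementary: "in_alg d x \<Longrightarrow> skew_hermitian n d (skew_elementary i j x)"
  by (rule skew_hermitianI) (simp_all add: skew_elementary_def adj_elementary in_alg_elementary)

lemma mat_prod_in_alg:
  "skew_hermitian n d X \<Longrightarrow> skew_hermitian n d Y \<Longrightarrow> i < n \<Longrightarrow> j < n \<Longrightarrow> in_alg d (mat_prod n X Y i j)"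
  unfolding mat_prod_def by (auto intro!: in_alg_sum in_alg_simps skew_hermitianD(1))

lemma adj_mat_prod:
  assumes "skew_hermitian n d X" "skew_hermitian n d Y" "i < n" "j < n"
  shows "adj (mat_prod n X Y i j) = mat_prod n Y X j i"
  unfolding mat_prod_def using assms by (simp add: adj_sum adj_mult skew_hermitianD)

lemma skew_hermitian_commutator:
  assumes "skew_hermitian n d X" "skew_hermitian n d Y"
  shows "skew_hermitian n d (commutator n X Y)"
proof (rule skew_hermitianI)
  fix i j assume ij: "i < n" "j < n"
  show "in_alg d (commutator n X Y i j)"
    unfolding commutator_def using assms ij by (intro in_alg_simps mat_prod_in_alg)
  show "adj (commutator n X Y i j) = - commutator n X Y j i"
    unfolding commutator_def by (simp add: adj_mat_prod[OF assms ij] adj_mat_prod[OF assms(2,1) ij])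
qed

lemma mat_prod_elementary:
  assumes "j < n"
  shows "mat_prod n (elementary i j x) (elementary k l y) = (\<lambda>p q. if j = k then elementary i l (x * y) p q else 0)"
proof (intro ext)
  fix p q
  have "mat_prod n (elementary i j x) (elementary k l y) p q =
     (\<Sum>r<n. if r = j then (if p = i then x else 0) * (if j = k \<and> q = l then y else 0) else 0)"
    unfolding mat_prod_def elementary_def by (rule sum.cong) auto
  also have "\<dots> = (if j = k then elementary i l (x * y) p q else 0)"
    using assms by (simp add: elementary_def)
  finally show "mat_prod n (elementary i j x) (elementary k l y) p q = \<dots>" .
qed

lemma mat_prod_diff:
  "mat_prod n (\<lambda>i j. X i j - Y i j) W = (\<lambda>i j. mat_prod n X W i j - mat_prod n Y W i j)"
  "mat_prod n W (\<lambda>i j. X i j - Y i j) = (\<lambda>i j. mat_prod n W X i j - mat_prod n W Y i j)"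
  by (simp_all add: mat_prod_def left_diff_distrib right_diff_distrib sum_subtractf)

lemma mat_prod_skew_elementary:
  assumes "i < n" "j < n"
  shows "mat_prod n (skew_elementary i j x) (skew_elementary k l y) = (\<lambda>p q.
    (if j = k then elementary i l (x * y) p q else 0) - (if j = l then elementary i k (x * adj y) p q else 0)
    - ((if i = k then elementary j l (adj x * y) p q else 0) - (if i = l then elementary j k (adj x * adj y) p q else 0)))"
  unfolding skew_elementary_def mat_prod_diff by (simp add: mat_prod_elementary assms)

text \<open>The multiplication rule of matrix units; the two products that survive in the commutator
  are the two halves of one skew generator.\<close>

lemma commutator_chain:
  assumes "i < n" "j < n" "l < n" "i \<noteq> j" "j \<noteq> l" "i \<noteq> l"
  shows "commutator n (skew_elementary i j x) (skew_elementary j l y) = skew_elementary i l (x * y)"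
  unfolding commutator_def using assms
  by (simp add: mat_prod_skew_elementary) (simp add: skew_elementary_def adj_mult fun_eq_iff)

lemma commutator_disjoint:
  assumes "i < n" "j < n" "k < n" "l < n" "i \<noteq> k" "i \<noteq> l" "j \<noteq> k" "j \<noteq> l"
  shows "commutator n (skew_elementary i j x) (skew_elementary k l y) = (\<lambda>p q. 0)"
  unfolding commutator_def using assms by (simp add: mat_prod_skew_elementary)

text \<open>A diagonal generator sees only the part \<open>x - adj x\<close> of its argument, so
  scalars act by zero.\<close>

lemma commutator_diagonal:
  assumes "i < n" "l < n" "i \<noteq> l"
  shows "commutator n (skew_elementary i i x) (skew_elementary i l y) = skew_elementary i l ((x - adj x) * y)"
  unfolding commutator_def using assms
  by (simp add: mat_prod_skew_elementary) (auto simp: skew_elementary_def elementary_def adj_mult fun_eq_iff algebra_simps)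

lemma skew_elementary_swap: "skew_elementary j i x = (\<lambda>p q. - skew_elementary i j (adj x) p q)"
  by (simp add: skew_elementary_def fun_eq_iff)

lemma elementary_linear:
  "elementary i j (x + y) k l = elementary i j x k l + elementary i j y k l"
  "elementary i j (scal c * x) k l = scal c * elementary i j x k l"
  by (simp_all add: elementary_def)

lemma one_smult_matrix: "(1 :: 'a::semiring_1) \<cdot>\<^sub>m A = A"
  by (intro eq_matI) auto

lemma skew_elementary_zero:
  "\<not> (p = i \<and> q = j) \<Longrightarrow> \<not> (p = j \<and> q = i) \<Longrightarrow> skew_elementary i j x p q = 0"
  unfolding skew_elementary_def elementary_def by (simp only: if_False diff_self)

lemma lie_bracket_add:
  fixes a :: "'k::field mat"
  assumes "a \<in> carrier_mat N N" "x \<in> carrier_mat N N" "y \<in> carrier_mat N N"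
  shows "lie_bracket a (x + y) = lie_bracket a x + lie_bracket a y"
    and "lie_bracket (x + y) a = lie_bracket x a + lie_bracket y a"
proof -
  have "a * x \<in> carrier_mat N N" "x * a \<in> carrier_mat N N" "a * y \<in> carrier_mat N N" "y * a \<in> carrier_mat N N"
    using assms by simp_all
  then show "lie_bracket a (x + y) = lie_bracket a x + lie_bracket a y"
    "lie_bracket (x + y) a = lie_bracket x a + lie_bracket y a"
    unfolding lie_bracket_def using assms
    by (simp_all add: mult_add_distrib_mat[of _ N N _ N] add_mult_distrib_mat[of _ N N _ _ N])
      (intro eq_matI; auto)+
qed

lemma lie_bracket_smult:
  fixes a :: "'k::field mat"
  assumes "a \<in> carrier_mat N N" "x \<in> carrier_mat N N"
  shows "lie_bracket a (c \<cdot>\<^sub>m x) = c \<cdot>\<^sub>m lie_bracket a x"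
    and "lie_bracket (c \<cdot>\<^sub>m x) a = c \<cdot>\<^sub>m lie_bracket x a"
  unfolding lie_bracket_def using assms
  by (simp_all add: mult_smult_distrib[of _ N N _ N] mult_smult_assoc_mat[of _ N N _ N])
    (intro eq_matI; auto simp: algebra_simps)+

lemmas lie_bracket_linear = lie_bracket_add lie_bracket_smult

text \<open>
  \<open>\<Phi>\<close> identifies the matrices over the subalgebra with a subring of the \<open>N \<times> N\<close> matrices; the
  skew-hermitian ones correspond to \<open>g\<close>.
\<close>

locale skew_hermitian_model =
  fixes N n d :: nat and I :: "'k::field_char_0" and \<Phi> :: "(nat \<Rightarrow> nat \<Rightarrow> 'k m2) \<Rightarrow> 'k mat"
    and g g0 :: "'k mat set"
  assumes n: "7 \<le> n" and I: "I * I = -1"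
    and \<Phi>_carrier[simp]: "\<Phi> X \<in> carrier_mat N N"
    and \<Phi>_add: "\<Phi> (\<lambda>i j. X i j + Y i j) = \<Phi> X + \<Phi> Y"
    and \<Phi>_smult: "\<Phi> (\<lambda>i j. scal c * X i j) = c \<cdot>\<^sub>m \<Phi> X"
    and \<Phi>_mult: "(\<And>i j. i < n \<Longrightarrow> j < n \<Longrightarrow> in_alg d (X i j)) \<Longrightarrow> (\<And>i j. i < n \<Longrightarrow> j < n \<Longrightarrow> in_alg d (Y i j)) \<Longrightarrow>
      \<Phi> (mat_prod n X Y) = \<Phi> X * \<Phi> Y"
    and \<Phi>_cong: "(\<And>i j. i < n \<Longrightarrow> j < n \<Longrightarrow> X i j = Y i j) \<Longrightarrow> \<Phi> X = \<Phi> Y"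
    and \<Phi>_zeroD: "skew_hermitian n d X \<Longrightarrow> \<Phi> X = 0\<^sub>m N N \<Longrightarrow> i < n \<Longrightarrow> j < n \<Longrightarrow> X i j = 0"
    and g: "g = \<Phi> ` {X. skew_hermitian n d X}"
    and g0: "g0 = \<Phi> ` {X. skew_hermitian n d X \<and> block_diagonal n X}"
begin

lemma \<Phi>_dim[simp]: "dim_row (\<Phi> X) = N" "dim_col (\<Phi> X) = N"
  using carrier_matD[OF \<Phi>_carrier[of X]] by blast+

definition g1 where "g1 = \<Phi> ` {X. skew_hermitian n d X \<and> block_off_diagonal n X}"

definition Z where "Z i j x = \<Phi> (skew_elementary i j x)"

lemma \<Phi>_zero: "\<Phi> (\<lambda>i j. 0) = 0\<^sub>m N N"
proof -
  have "\<Phi> (\<lambda>i j. scal 0 * 0) = 0 \<cdot>\<^sub>m \<Phi> (\<lambda>i j. 0)" by (rule \<Phi>_smult)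
  moreover have "0 \<cdot>\<^sub>m \<Phi> (\<lambda>i j. 0) = 0\<^sub>m N N"
    by (intro eq_matI) auto
  ultimately show ?thesis by simp
qed

lemma \<Phi>_uminus: "\<Phi> (\<lambda>i j. - X i j) = (-1) \<cdot>\<^sub>m \<Phi> X"
  using \<Phi>_smult[of "-1" X] by (simp add: scal_simps)

lemma \<Phi>_diff: "\<Phi> (\<lambda>i j. X i j - Y i j) = \<Phi> X - \<Phi> Y"
proof -
  have "\<Phi> (\<lambda>i j. X i j + - Y i j) = \<Phi> X + (-1) \<cdot>\<^sub>m \<Phi> Y" unfolding \<Phi>_add \<Phi>_uminus ..
  also have "\<dots> = \<Phi> X - \<Phi> Y" using \<Phi>_carrier[of X] \<Phi>_carrier[of Y] by (intro eq_matI) auto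
  finally show ?thesis by simp
qed

lemma \<Phi>_eqD:
  assumes "skew_hermitian n d X" "skew_hermitian n d Y" "\<Phi> X = \<Phi> Y" "i < n" "j < n"
  shows "X i j = Y i j"
proof -
  have "skew_hermitian n d (\<lambda>i j. X i j + scal (-1) * Y i j)"
    by (intro skew_hermitian_closed assms)
  moreover have "\<Phi> (\<lambda>i j. X i j + scal (-1) * Y i j) = 0\<^sub>m N N"
    unfolding \<Phi>_add \<Phi>_smult using assms(3) \<Phi>_carrier[of Y] by (intro eq_matI) auto
  ultimately have "X i j + scal (-1) * Y i j = 0" using assms(4,5) by (rule \<Phi>_zeroD)
  then show ?thesis by (simp add: scal_simps)
qed

lemma bracket:
  assumes "skew_hermitian n d X" "skew_hermitian n d Y"
  shows "lie_bracket (\<Phi> X) (\<Phi> Y) = \<Phi> (commutator n X Y)"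
  unfolding lie_bracket_def commutator_def \<Phi>_diff
  using assms by (simp add: \<Phi>_mult skew_hermitianD)

lemma g0_subset: "g0 \<subseteq> g" and g1_subset: "g1 \<subseteq> g" and g_carrier: "g \<subseteq> carrier_mat N N"
  unfolding g g0 g1_def by auto

lemma g_closed: "x \<in> g \<Longrightarrow> y \<in> g \<Longrightarrow> x + y \<in> g" "x \<in> g \<Longrightarrow> c \<cdot>\<^sub>m x \<in> g"
  unfolding g by (force simp flip: \<Phi>_add \<Phi>_smult intro: skew_hermitian_closed)+

lemma g0_closed: "x \<in> g0 \<Longrightarrow> y \<in> g0 \<Longrightarrow> x + y \<in> g0" "x \<in> g0 \<Longrightarrow> c \<cdot>\<^sub>m x \<in> g0"
  unfolding g0 by (force simp: block_diagonal_def simp flip: \<Phi>_add \<Phi>_smult intro!: imageI skew_hermitian_closed)+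

lemma g1_closed: "x \<in> g1 \<Longrightarrow> y \<in> g1 \<Longrightarrow> x + y \<in> g1" "x \<in> g1 \<Longrightarrow> c \<cdot>\<^sub>m x \<in> g1"
  unfolding g1_def by (force simp: block_off_diagonal_def simp flip: \<Phi>_add \<Phi>_smult intro!: imageI skew_hermitian_closed)+

lemma zero_in_g1: "0\<^sub>m N N \<in> g1" and zero_in_g0: "0\<^sub>m N N \<in> g0"
  unfolding g1_def g0 \<Phi>_zero[symmetric] by (intro imageI; simp add: block_off_diagonal_def block_diagonal_def skew_hermitian_closed)+

lemma g0_g1_bracket:
  assumes "a \<in> g0" "x \<in> g1"
  shows "lie_bracket a x \<in> g1"
proof -
  obtain A X where A: "skew_hermitian n d A" "block_diagonal n A" "a = \<Phi> A"
    and X: "skew_hermitian n d X" "block_off_diagonal n X" "x = \<Phi> X"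
    using assms unfolding g0 g1_def by blast
  have "A i k * X k j = 0" "X i k * A k j = 0" if "i < n" "j < n" "k < n" "(i < 3) = (j < 3)" for i j k
    using A(2) X(2) that unfolding block_diagonal_def block_off_diagonal_def by (metis mult_zero_left mult_zero_right)+
  then have "block_off_diagonal n (commutator n A X)"
    unfolding block_off_diagonal_def commutator_def mat_prod_def by simp
  then show ?thesis
    unfolding A(3) X(3) bracket[OF A(1) X(1)] g1_def using skew_hermitian_commutator[OF A(1) X(1)] by blast
qed

lemma g0_bracket:
  assumes "a \<in> g0" "b \<in> g0"
  shows "lie_bracket a b \<in> g0"
proof -
  obtain A X where A: "skew_hermitian n d A" "block_diagonal n A" "a = \<Phi> A"
    and X: "skew_hermitian n d X" "block_diagonal n X" "b = \<Phi> X"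
    using assms unfolding g0 by blast
  have "A i k * X k j = 0" "X i k * A k j = 0" if "i < n" "j < n" "k < n" "(i < 3) \<noteq> (j < 3)" for i j k
    using A(2) X(2) that unfolding block_diagonal_def by (metis mult_zero_left mult_zero_right)+
  then have "block_diagonal n (commutator n A X)"
    unfolding block_diagonal_def commutator_def mat_prod_def by simp
  then show ?thesis
    unfolding A(3) X(3) bracket[OF A(1) X(1)] g0 using skew_hermitian_commutator[OF A(1) X(1)] by blast
qed

lemma jacobi:
  fixes a b x :: "'k mat"
  assumes "a \<in> carrier_mat N N" "b \<in> carrier_mat N N" "x \<in> carrier_mat N N"
  shows "lie_bracket a (lie_bracket b x) = lie_bracket (lie_bracket a b) x + lie_bracket b (lie_bracket a x)"
proof -
  have *: "p * (q - r) = p * q - p * r" "(q - r) * p = q * p - r * p"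
    if "p \<in> carrier_mat N N" "q \<in> carrier_mat N N" "r \<in> carrier_mat N N" for p q r :: "'k mat"
    using that by (simp_all add: mult_minus_distrib_mat[of _ N N _ N] minus_mult_distrib_mat[of _ N N _ _ N])
  have c: "p * q \<in> carrier_mat N N" if "p \<in> carrier_mat N N" "q \<in> carrier_mat N N" for p q :: "'k mat"
    using that by simp
  show ?thesis
    unfolding lie_bracket_def using assms
    by (simp add: * c assoc_mult_mat[of _ N N _ N _ N]) (intro eq_matI; auto)
qed

lemma Z_g: "in_alg d x \<Longrightarrow> Z i j x \<in> g"
  unfolding Z_def g using skew_hermitian_elementary by blast

lemma Z_g1: "in_alg d x \<Longrightarrow> i < 3 \<Longrightarrow> 3 \<le> j \<Longrightarrow> Z i j x \<in> g1"
  unfolding Z_def g1_def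
  by (intro imageI CollectI conjI skew_hermitian_elementary)
     (auto simp: block_off_diagonal_def skew_elementary_def elementary_def)

lemma Z_g0: "in_alg d x \<Longrightarrow> (i < 3) = (j < 3) \<Longrightarrow> Z i j x \<in> g0"
  unfolding Z_def g0
  by (intro imageI CollectI conjI skew_hermitian_elementary)
     (auto simp: block_diagonal_def skew_elementary_def elementary_def)

lemma Z_carrier[simp]: "Z i j x \<in> carrier_mat N N"
  by (simp add: Z_def)

lemma Z_dim[simp]: "dim_row (Z i j x) = N" "dim_col (Z i j x) = N"
  by (simp_all add: Z_def)

lemma Z_swap: "Z j i x = (-1) \<cdot>\<^sub>m Z i j (adj x)"
  unfolding Z_def by (subst skew_elementary_swap) (rule \<Phi>_uminus)

lemma Z_add: "Z i j (x + y) = Z i j x + Z i j y"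
proof -
  have "skew_elementary i j (x + y) = (\<lambda>p q. skew_elementary i j x p q + skew_elementary i j y p q)"
    by (simp add: skew_elementary_def elementary_linear fun_eq_iff)
  then show ?thesis by (simp add: Z_def \<Phi>_add)
qed

lemma Z_smult: "Z i j (scal c * x) = c \<cdot>\<^sub>m Z i j x"
proof -
  have "skew_elementary i j (scal c * x) = (\<lambda>p q. scal c * skew_elementary i j x p q)"
    by (simp add: skew_elementary_def adj_mult scal_commute[of "adj x"] elementary_linear right_diff_distrib)
  then show ?thesis by (simp add: Z_def \<Phi>_smult)
qed

lemma Z_chain:
  assumes "in_alg d x" "in_alg d y" "i < n" "j < n" "l < n" "i \<noteq> j" "j \<noteq> l" "i \<noteq> l"
  shows "lie_bracket (Z i j x) (Z j l y) = Z i l (x * y)"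
  unfolding Z_def using assms by (simp add: bracket skew_hermitian_elementary commutator_chain)

lemma Z_disjoint:
  assumes "in_alg d x" "in_alg d y" "i < n" "j < n" "k < n" "l < n" "i \<noteq> k" "i \<noteq> l" "j \<noteq> k" "j \<noteq> l"
  shows "lie_bracket (Z i j x) (Z k l y) = 0\<^sub>m N N"
  unfolding Z_def using assms by (simp add: bracket skew_hermitian_elementary commutator_disjoint \<Phi>_zero)

lemma Z_diagonal:
  assumes "in_alg d x" "in_alg d y" "i < n" "l < n" "i \<noteq> l"
  shows "lie_bracket (Z i i x) (Z i l y) = Z i l ((x - adj x) * y)"
  unfolding Z_def using assms by (simp add: bracket skew_hermitian_elementary commutator_diagonal)

text \<open>An off-diagonal skew-hermitian matrix is a sum of generators \<open>Z i j x\<close> with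
  one index in each block, and \<open>step\<close> adds one position at a time.\<close>

lemma g1_induct [consumes 1, case_names zero step]:
  assumes v: "v \<in> g1" and zero: "P (0\<^sub>m N N)"
    and step: "\<And>w i j x. P w \<Longrightarrow> w \<in> g1 \<Longrightarrow> i < 3 \<Longrightarrow> 3 \<le> j \<Longrightarrow> j < n \<Longrightarrow> in_alg d x \<Longrightarrow> P (w + Z i j x)"
  shows "P v"
proof -
  obtain X where X: "skew_hermitian n d X" "block_off_diagonal n X" "v = \<Phi> X" using v unfolding g1_def by blast
  \<comment> \<open>The restriction of \<open>X\<close> to the positions in \<open>S\<close> and
    their transposes.\<close>
  define R where "R S = (\<lambda>p q. if (p, q) \<in> S \<or> (q, p) \<in> S then X p q else 0)" for S :: "(nat \<times> nat) set"
  have R: "P (\<Phi> (R S)) \<and> \<Phi> (R S) \<in> g1" if "finite S" "S \<subseteq> {..<3} \<times> {3..<n}" for S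
    using that
  proof (induction S rule: finite_induct)
    case empty
    then show ?case using zero zero_in_g1 by (simp add: R_def \<Phi>_zero)
  next
    case (insert s S)
    obtain i j where s: "s = (i, j)" by (cases s)
    have ij: "i < 3" "3 \<le> j" "j < n" using insert.prems s by auto
    have in': "i < n" using ij n by simp
    have "R (insert s S) p q = R S p q + skew_elementary i j (X i j) p q" if "p < n" "q < n" for p q
    proof -
      have "(j, i) \<notin> S" "(i, j) \<notin> S" using insert.prems insert.hyps ij s by auto
      then show ?thesis
        using skew_hermitianD(2)[OF X(1) in' ij(3)] ij
        by (auto simp: R_def s skew_elementary_def elementary_def)
    qed
    then have eq: "\<Phi> (R (insert s S)) = \<Phi> (R S) + Z i j (X i j)"
      unfolding Z_def \<Phi>_add[symmetric] by (rule \<Phi>_cong)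
    have Xa: "in_alg d (X i j)" by (rule skew_hermitianD(1)[OF X(1) in' ij(3)])
    have "P (\<Phi> (R S))" "\<Phi> (R S) \<in> g1" using insert by auto
    then show ?case
      unfolding eq using step[OF _ _ ij Xa] g1_closed(1) Z_g1[OF Xa ij(1,2)] by blast
  qed
  have "\<Phi> X = \<Phi> (R ({..<3} \<times> {3..<n}))"
  proof (rule \<Phi>_cong)
    fix i j assume "i < n" "j < n"
    then show "X i j = R ({..<3} \<times> {3..<n}) i j"
      using X(2) unfolding block_off_diagonal_def R_def by auto
  qed
  then show ?thesis using R[of "{..<3} \<times> {3..<n}"] X(3) by simp
qed

section \<open>The involution\<close>

text \<open>It is its own inverse, so multiplying by it on both sides is conjugation. It is not
  skew-hermitian; multiplicativity of \<open>\<Phi>\<close> for all matrices over the subalgebra is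
  what makes it usable.\<close>

definition sign :: "nat \<Rightarrow> nat \<Rightarrow> 'k m2" where
  "sign i j = (if i = j then if i < 3 then 1 else -1 else 0)"

lemma sign_conj: 
  assumes "skew_hermitian n d X"
  shows "\<Phi> sign * \<Phi> X * \<Phi> sign = \<Phi> (\<lambda>i j. if (i < 3) = (j < 3) then X i j else - X i j)"
proof -
  have s: "in_alg d (sign i j)" for i j by (simp add: sign_def)
  have sX: "mat_prod n sign X i j = (if i < 3 then X i j else - X i j)" if "i < n" for i j
  proof -
    have "mat_prod n sign X i j = (\<Sum>k<n. if k = i then (if i < 3 then X i j else - X i j) else 0)"
      unfolding mat_prod_def by (rule sum.cong) (auto simp: sign_def)
    then show ?thesis using that by simp
  qed
  have sXs: "mat_prod n (mat_prod n sign X) sign i j = (if (i < 3) = (j < 3) then X i j else - X i j)" if "i < n" "j < n" for i j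
  proof -
    have "mat_prod n (mat_prod n sign X) sign i j = (\<Sum>k<n. if k = j then (if (i < 3) = (j < 3) then X i j else - X i j) else 0)"
      unfolding mat_prod_def[of n "mat_prod n sign X"] by (rule sum.cong) (auto simp: sign_def sX that)
    then show ?thesis using that by simp
  qed
  have "\<Phi> sign * \<Phi> X * \<Phi> sign = \<Phi> (mat_prod n (mat_prod n sign X) sign)"
    using s skew_hermitianD(1)[OF assms] by (simp add: \<Phi>_mult sX)
  also have "\<dots> = \<Phi> (\<lambda>i j. if (i < 3) = (j < 3) then X i j else - X i j)"
    by (rule \<Phi>_cong) (rule sXs)
  finally show ?thesis .
qed

definition flip where "flip X = (\<lambda>i j. if (i < (3::nat)) = (j < 3) then X i j else - X i j)"

lemma skew_hermitian_flip: "skew_hermitian n d X \<Longrightarrow> skew_hermitian n d (flip X)"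
  unfolding flip_def by (rule skew_hermitianI) (auto simp: skew_hermitianD)

lemma double_zero: "x = - x \<Longrightarrow> x = (0 :: 'k m2)"
proof -
  assume "x = - x"
  then have "m11 x = - m11 x" "m12 x = - m12 x" "m21 x = - m21 x" "m22 x = - m22 x" by (metis m2_sel)+
  moreover have "a = 0" if "a = - a" for a :: 'k
  proof -
    have "2 * a = 0" using that by (metis add.right_inverse mult_2)
    then show ?thesis by simp
  qed
  ultimately show ?thesis by (simp add: m2_eq_iff)
qed

lemma involution_exists: "\<exists>\<sigma>. symmetric_subalgebra N g g0 \<sigma>"
proof -
  define \<sigma> where "\<sigma> x = \<Phi> sign * x * \<Phi> sign" for x
  have \<sigma>: "\<sigma> (\<Phi> X) = \<Phi> (flip X)" if "skew_hermitian n d X" for X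
    unfolding \<sigma>_def flip_def using that by (rule sign_conj)
  have flip_flip: "flip (flip X) = X" for X :: "nat \<Rightarrow> nat \<Rightarrow> 'k m2" by (simp add: flip_def fun_eq_iff)
  have comm: "\<Phi> (commutator n (flip X) (flip Y)) = \<Phi> (flip (commutator n X Y))" for X Y
  proof (rule \<Phi>_cong)
    fix i j
    have "mat_prod n (flip X) (flip Y) i j = flip (mat_prod n X Y) i j" for X Y :: "nat \<Rightarrow> nat \<Rightarrow> 'k m2"
    proof -
      have "flip X i k * flip Y k j = (if (i < 3) = (j < 3) then X i k * Y k j else - (X i k * Y k j))" for k
        by (cases "i < 3"; cases "j < 3"; cases "k < 3") (simp_all add: flip_def)
      then have "mat_prod n (flip X) (flip Y) i j = (\<Sum>k<n. if (i < 3) = (j < 3) then X i k * Y k j else - (X i k * Y k j))"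
        by (simp only: mat_prod_def)
      then show ?thesis by (simp add: mat_prod_def flip_def sum_negf)
    qed
    then show "commutator n (flip X) (flip Y) i j = flip (commutator n X Y) i j"
      by (simp add: commutator_def flip_def)
  qed
  have "involutory_automorphism N g \<sigma>"
    unfolding involutory_automorphism_def
  proof (intro conjI ballI)
    show "\<sigma> \<in> LinearCombinations.module_hom class_ring (mat_subspace N g) (mat_subspace N g)"
    proof -
      have "\<sigma> x \<in> g" if "x \<in> g" for x
        using that \<sigma> skew_hermitian_flip unfolding g by auto
      moreover have "\<sigma> (x + y) = \<sigma> x + \<sigma> y" if "x \<in> g" "y \<in> g" for x y
      proof -
        have c: "x \<in> carrier_mat N N" "y \<in> carrier_mat N N" using that g_carrier by auto
        then have "\<Phi> sign * x \<in> carrier_mat N N" "\<Phi> sign * y \<in> carrier_mat N N"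
          by (auto intro: mult_carrier_mat[OF \<Phi>_carrier])
        with c show ?thesis unfolding \<sigma>_def
          by (simp add: mult_add_distrib_mat[of _ N N _ N] add_mult_distrib_mat[of _ N N _ _ N])
      qed
      moreover have "\<sigma> (c \<cdot>\<^sub>m x) = c \<cdot>\<^sub>m \<sigma> x" if "x \<in> g" for x c
      proof -
        have c: "x \<in> carrier_mat N N" using that g_carrier by auto
        then have "\<Phi> sign * x \<in> carrier_mat N N"
          by (auto intro: mult_carrier_mat[OF \<Phi>_carrier])
        with c show ?thesis unfolding \<sigma>_def
          by (simp add: mult_smult_distrib[of _ N N _ N] mult_smult_assoc_mat[of _ N N _ N])
      qed
      ultimately show ?thesis
        by (auto simp: LinearCombinations.module_hom_def mat_subspace_def module_mat_simps)
    qed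
    fix x assume "x \<in> g"
    then obtain X where X: "skew_hermitian n d X" "x = \<Phi> X" unfolding g by blast
    show "\<sigma> (\<sigma> x) = x" using X by (simp add: \<sigma> skew_hermitian_flip flip_flip)
    fix y assume "y \<in> g"
    then obtain Y where Y: "skew_hermitian n d Y" "y = \<Phi> Y" unfolding g by blast
    show "\<sigma> (lie_bracket x y) = lie_bracket (\<sigma> x) (\<sigma> y)"
      using X Y by (simp add: \<sigma> bracket skew_hermitian_flip skew_hermitian_commutator comm)
  next
    \<comment> \<open>An involution has to move some element; a generator of \<open>g1\<close>
      changes its sign.\<close>
    have e: "skew_hermitian n d (skew_elementary 0 3 1)" by (intro skew_hermitian_elementary) simp
    have "\<sigma> (Z 0 3 1) \<noteq> Z 0 3 1"
    proof
      assume "\<sigma> (Z 0 3 1) = Z 0 3 1"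
      then have "\<Phi> (flip (skew_elementary 0 3 1)) = \<Phi> (skew_elementary 0 3 1)" using \<sigma>[OF e] by (simp add: Z_def)
      from \<Phi>_eqD[OF skew_hermitian_flip[OF e] e this, of 0 3] n
      have "(1 :: 'k m2) = - 1" by (simp add: flip_def skew_elementary_def elementary_def)
      from double_zero[OF this] show False by simp
    qed
    then show "\<exists>x\<in>g. \<sigma> x \<noteq> x" using Z_g[of 1 0 3] by auto
  qed
  moreover have "g0 = eigenspace_on g \<sigma> 1"
  proof (intro equalityI subsetI)
    fix x assume "x \<in> g0"
    then obtain X where X: "skew_hermitian n d X" "block_diagonal n X" "x = \<Phi> X" unfolding g0 by blast
    have "\<Phi> (flip X) = \<Phi> X" by (rule \<Phi>_cong) (use X(2) in \<open>auto simp: flip_def block_diagonal_def\<close>)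
    then have "\<sigma> x = x" using \<sigma>[OF X(1)] X(3) by simp
    moreover have "x \<in> g" using X g by blast
    ultimately show "x \<in> eigenspace_on g \<sigma> 1" unfolding eigenspace_on_def one_smult_matrix by blast
  next
    fix x assume "x \<in> eigenspace_on g \<sigma> 1"
    then have "x \<in> g" "\<sigma> x = x" unfolding eigenspace_on_def one_smult_matrix by blast+
    then obtain X where "skew_hermitian n d X" "x = \<Phi> X" unfolding g by blast
    then have X: "skew_hermitian n d X" "x = \<Phi> X" "\<Phi> (flip X) = \<Phi> X"
      using \<sigma>[of X] \<open>\<sigma> x = x\<close> by simp_all
    have "block_diagonal n X"
      unfolding block_diagonal_def
    proof (intro allI impI)
      fix i j assume ij: "i < n" "j < n" "(i < 3) \<noteq> (j < 3)"
      have "flip X i j = X i j" by (rule \<Phi>_eqD[OF skew_hermitian_flip[OF X(1)] X(1,3) ij(1,2)])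
      then have "X i j = - X i j" using ij(3) unfolding flip_def by auto
      then show "X i j = 0" by (rule double_zero)
    qed
    then show "x \<in> g0" using X unfolding g0 by blast
  qed
  ultimately show ?thesis unfolding symmetric_subalgebra_def by blast
qed

text \<open>The two diagonal blocks commute. The inner bracket lands in the second block, the outer
  factor lies in the first. Such a double bracket removes the \<open>g0\<close> component of an
  element of \<open>g\<close>.\<close>

lemma double_bracket_g0:
  assumes y: "y \<in> g0" and ij: "i < 3" "j < 3" "3 \<le> l" "3 \<le> k" "l < n" "k < n"
  shows "lie_bracket (Z i j 1) (lie_bracket (Z l k 1) y) = 0\<^sub>m N N"
proof -
  obtain Y where Y: "skew_hermitian n d Y" "block_diagonal n Y" "y = \<Phi> Y" using y unfolding g0 by blast
  let ?A = "skew_elementary i j 1 :: nat \<Rightarrow> nat \<Rightarrow> 'k m2" and ?B = "skew_elementary l k 1 :: nat \<Rightarrow> nat \<Rightarrow> 'k m2"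
  have AB: "skew_hermitian n d ?A" "skew_hermitian n d ?B" by (intro skew_hermitian_elementary; simp)+
  let ?C = "commutator n ?B Y"
  have A0: "?A p q = 0" if "3 \<le> p \<or> 3 \<le> q" for p q
    by (rule skew_elementary_zero) (use that ij in linarith)+
  have B0: "?B p q = 0" if "p < 3 \<or> q < 3" for p q
    by (rule skew_elementary_zero) (use that ij in linarith)+
  have C0: "?C p q = 0" if "p < n" "q < n" "p < 3 \<or> q < 3" for p q
  proof -
    have "?B p r * Y r q = 0" "Y p r * ?B r q = 0" if "r < n" for r
    proof -
      show "?B p r * Y r q = 0"
      proof (cases "p < 3 \<or> r < 3")
        case False
        then have "Y r q = 0" using Y(2) \<open>p < 3 \<or> q < 3\<close> \<open>q < n\<close> that unfolding block_diagonal_def by auto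
        then show ?thesis by simp
      qed (simp add: B0)
      show "Y p r * ?B r q = 0"
      proof (cases "r < 3 \<or> q < 3")
        case False
        then have "Y p r = 0" using Y(2) \<open>p < 3 \<or> q < 3\<close> \<open>p < n\<close> that unfolding block_diagonal_def by auto
        then show ?thesis by simp
      qed (simp add: B0)
    qed
    then show ?thesis by (simp add: commutator_def mat_prod_def)
  qed
  have "commutator n ?A ?C p q = 0" if pq: "p < n" "q < n" for p q
  proof -
    have "?A p r * ?C r q = 0" "?C p r * ?A r q = 0" if "r < n" for r
      using A0[of p r] A0[of r q] C0[OF that pq(2)] C0[OF pq(1) that] by (cases "r < 3"; simp)+
    then show ?thesis by (simp add: commutator_def[of n ?A] mat_prod_def)
  qed
  then have "\<Phi> (commutator n ?A ?C) = \<Phi> (\<lambda>p q. 0)" by (intro \<Phi>_cong)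
  then show ?thesis
    unfolding Z_def Y(3) bracket[OF AB(2) Y(1)] bracket[OF AB(1) skew_hermitian_commutator[OF AB(2) Y(1)]] by (simp add: \<Phi>_zero)
qed

text \<open>Only the fixed algebra of \<open>\<sigma>\<close> is prescribed, so the other eigenspace
  has to be computed. Split a generator of \<open>g1\<close> into its components for
  \<open>1\<close> and \<open>-1\<close> and bracket twice with fixed elements from different
  blocks: the first component disappears, an eigenvector for \<open>-1\<close> is left, and every
  generator of \<open>g1\<close> arises in this way.\<close>

lemma involution_unique:
  assumes "symmetric_subalgebra N g g0 \<sigma>"
  shows "eigenspace_on g \<sigma> 1 = g0" "eigenspace_on g \<sigma> (-1) = g1"
proof -
  have inv: "involutory_automorphism N g \<sigma>" and e1: "g0 = eigenspace_on g \<sigma> 1"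
    using assms by (auto simp: symmetric_subalgebra_def)
  show "eigenspace_on g \<sigma> 1 = g0" using e1 by simp
  have \<sigma>g: "\<sigma> x \<in> g" if "x \<in> g" for x
    using inv that by (auto simp: involutory_automorphism_def LinearCombinations.module_hom_def mat_subspace_def)
  have \<sigma>_add: "\<sigma> (x + y) = \<sigma> x + \<sigma> y" if "x \<in> g" "y \<in> g" for x y
    using inv that by (auto simp: involutory_automorphism_def LinearCombinations.module_hom_def mat_subspace_def module_mat_simps)
  have \<sigma>_smult: "\<sigma> (c \<cdot>\<^sub>m x) = c \<cdot>\<^sub>m \<sigma> x" if "x \<in> g" for x c
    using inv that by (auto simp: involutory_automorphism_def LinearCombinations.module_hom_def mat_subspace_def module_mat_simps)
  have \<sigma>_bracket: "\<sigma> (lie_bracket x y) = lie_bracket (\<sigma> x) (\<sigma> y)" and \<sigma>\<sigma>: "\<sigma> (\<sigma> x) = x" if "x \<in> g" "y \<in> g" for x y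
    using inv that by (auto simp: involutory_automorphism_def)
  have carr: "x \<in> carrier_mat N N" if "x \<in> g" for x using that g_carrier by auto
  let ?E = "eigenspace_on g \<sigma> (-1)"
  have \<sigma>0: "\<sigma> a = a" if "a \<in> g0" for a
    using that e1 by (auto simp: eigenspace_on_def one_smult_matrix)
  have Z_E: "Z i l x \<in> ?E" if il: "i < 3" "3 \<le> l" "l < n" and x: "in_alg d x" for i l x
  proof -
    \<comment> \<open>A second index in each block is needed, so both blocks must have size at least
      two.\<close>
    have "\<exists>j<3. j \<noteq> i" by (rule exI[of _ "if i = 0 then 1 else 0"]) simp
    then obtain j where j: "j < 3" "j \<noteq> i" by blast
    have "\<exists>k. 3 \<le> k \<and> k < n \<and> k \<noteq> l" by (rule exI[of _ "if l = 3 then 4 else 3"]) (use n in simp)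
    then obtain k where k: "3 \<le> k" "k < n" "k \<noteq> l" by blast
    define y where "y = Z j k x"
    define y0 where "y0 = (1/2) \<cdot>\<^sub>m (y + \<sigma> y)"
    define y1 where "y1 = (1/2) \<cdot>\<^sub>m (y + (-1) \<cdot>\<^sub>m \<sigma> y)"
    have y: "y \<in> g" unfolding y_def by (rule Z_g[OF x])
    note yg = y \<sigma>g[OF y]
    have y0g: "y0 \<in> g" and y1g: "y1 \<in> g" unfolding y0_def y1_def by (intro g_closed yg)+
    have ysum: "y = y0 + y1" unfolding y0_def y1_def using carr[OF y] carr[OF \<sigma>g[OF y]] by (intro eq_matI) (auto simp: field_simps)
    have "\<sigma> y0 = 1 \<cdot>\<^sub>m y0"
      unfolding y0_def using carr[OF y] carr[OF \<sigma>g[OF y]] by (simp add: \<sigma>_smult \<sigma>_add g_closed yg \<sigma>\<sigma>[OF y y]) (intro eq_matI; auto)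
    then have y0: "y0 \<in> g0" using e1 y0g by (auto simp: eigenspace_on_def)
    have \<sigma>y1: "\<sigma> y1 = (-1) \<cdot>\<^sub>m y1"
      unfolding y1_def using carr[OF y] carr[OF \<sigma>g[OF y]] by (simp add: \<sigma>_smult \<sigma>_add g_closed yg \<sigma>\<sigma>[OF y y]) (intro eq_matI; auto)
    let ?A = "Z i j 1" and ?B = "Z l k 1"
    have A: "?A \<in> g0" and B: "?B \<in> g0" using il j k by (auto intro!: Z_g0)
    then have ABg: "?A \<in> g" "?B \<in> g" using g0_subset by auto
    have lt: "i < n" "j < n" using il j n by auto
    have gb: "lie_bracket a b \<in> g" if "a \<in> g" "b \<in> g" for a b
      using that unfolding g by (auto simp: bracket intro!: imageI skew_hermitian_commutator)
    \<comment> \<open>The bracket with \<open>?B\<close> moves the column index from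
      \<open>k\<close> to \<open>l\<close>; the one with \<open>?A\<close> then moves the row index
      from \<open>j\<close> to \<open>i\<close>.\<close>
    have "lie_bracket ?B y = Z j l x"
    proof -
      have "lie_bracket ?B y = lie_bracket ?B ((-1) \<cdot>\<^sub>m Z k j (adj x))" unfolding y_def by (subst Z_swap) simp
      also have "\<dots> = (-1) \<cdot>\<^sub>m lie_bracket ?B (Z k j (adj x))" by (rule lie_bracket_smult[of _ N]) simp_all
      also have "lie_bracket ?B (Z k j (adj x)) = Z l j (1 * adj x)" using x il j k lt by (intro Z_chain) auto
      also have "(-1) \<cdot>\<^sub>m Z l j (1 * adj x) = Z j l x" by (subst Z_swap[of j l]) simp
      finally show ?thesis .
    qed
    then have "lie_bracket ?A (lie_bracket ?B y) = Z i l x"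
      using Z_chain[of 1 x i j l] x il j lt by auto
    moreover have "lie_bracket ?A (lie_bracket ?B y) = lie_bracket ?A (lie_bracket ?B y1)"
    proof -
      have "lie_bracket ?A (lie_bracket ?B y) = lie_bracket ?A (lie_bracket ?B y0) + lie_bracket ?A (lie_bracket ?B y1)"
        unfolding ysum using carr y0g y1g ABg gb by (simp add: lie_bracket_linear[of _ N])
      also have "lie_bracket ?A (lie_bracket ?B y0) = 0\<^sub>m N N"
        using y0 il j k by (intro double_bracket_g0)
      finally show ?thesis using carr gb ABg y1g by simp
    qed
    ultimately have Zeq: "Z i l x = lie_bracket ?A (lie_bracket ?B y1)" by simp
    have "\<sigma> (Z i l x) = lie_bracket ?A (lie_bracket ?B ((-1) \<cdot>\<^sub>m y1))"
      unfolding Zeq using ABg gb y1g by (simp add: \<sigma>_bracket \<sigma>0[OF A] \<sigma>0[OF B] \<sigma>y1)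
    also have "\<dots> = (-1) \<cdot>\<^sub>m Z i l x"
      unfolding Zeq using carr ABg gb y1g by (simp add: lie_bracket_linear[of _ N])
    finally show ?thesis using Z_g[OF x] by (auto simp: eigenspace_on_def)
  qed
  have g1E: "g1 \<subseteq> ?E"
  proof
    fix v assume "v \<in> g1"
    then show "v \<in> ?E"
    proof (induction rule: g1_induct)
      case zero
      have "0\<^sub>m N N \<in> g" using zero_in_g1 g1_subset by blast
      moreover have "\<sigma> (0 \<cdot>\<^sub>m 0\<^sub>m N N) = 0 \<cdot>\<^sub>m \<sigma> (0\<^sub>m N N)" using \<sigma>_smult calculation by blast
      moreover have "0 \<cdot>\<^sub>m \<sigma> (0\<^sub>m N N) = 0\<^sub>m N N" "0 \<cdot>\<^sub>m 0\<^sub>m N N = (0\<^sub>m N N :: 'k mat)"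
        using carr[OF \<sigma>g[OF calculation(1)]] by (auto intro!: eq_matI)
      ultimately show ?case unfolding eigenspace_on_def by (auto intro!: eq_matI)
    next
      case (step w i j x)
      note z = Z_E[OF step(3-6)]
      have "w \<in> g" "\<sigma> w = (-1) \<cdot>\<^sub>m w" "Z i j x \<in> g" "\<sigma> (Z i j x) = (-1) \<cdot>\<^sub>m Z i j x"
        using step(1) z by (auto simp: eigenspace_on_def)
      note w = this
      have "\<sigma> (w + Z i j x) = (-1) \<cdot>\<^sub>m w + (-1) \<cdot>\<^sub>m Z i j x" using w by (simp add: \<sigma>_add)
      also have "\<dots> = (-1) \<cdot>\<^sub>m (w + Z i j x)"
        using carr[OF w(1)] carr[OF w(3)] by (intro eq_matI) auto
      finally show ?case
        using w unfolding eigenspace_on_def by (simp add: g_closed)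
    qed
  qed
  \<comment> \<open>The block diagonal part of an element is fixed by \<open>\<sigma>\<close>; if
    the element is negated, this part equals its own negative.\<close>
  moreover have "?E \<subseteq> g1"
  proof
    fix v assume v: "v \<in> ?E"
    then have vg: "v \<in> g" "\<sigma> v = (-1) \<cdot>\<^sub>m v" by (auto simp: eigenspace_on_def)
    then obtain X where X: "skew_hermitian n d X" "v = \<Phi> X" unfolding g by blast
    define X0 where "X0 i j = (if (i < 3) = (j < 3) then X i j else 0)" for i j :: nat
    define X1 where "X1 i j = (if (i < 3) = (j < 3) then 0 else X i j)" for i j :: nat
    have X01: "skew_hermitian n d X0" "skew_hermitian n d X1"
      unfolding X0_def X1_def using X(1) by (auto intro!: skew_hermitianI simp: skew_hermitianD)
    have x1: "\<Phi> X1 \<in> g1" unfolding g1_def using X01 by (auto simp: X1_def block_off_diagonal_def)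
    have x0: "\<Phi> X0 \<in> g0" unfolding g0 using X01 by (auto simp: X0_def block_diagonal_def)
    have vs: "v = \<Phi> X0 + \<Phi> X1" unfolding X(2) \<Phi>_add[symmetric] by (rule \<Phi>_cong) (simp add: X0_def X1_def)
    have x1E: "\<sigma> (\<Phi> X1) = (-1) \<cdot>\<^sub>m \<Phi> X1" "\<Phi> X1 \<in> g" "\<Phi> X0 \<in> g"
      using x1 g1E x0 g0_subset g1_subset by (auto simp: eigenspace_on_def)
    have "\<Phi> X0 + (-1) \<cdot>\<^sub>m \<Phi> X1 = (-1) \<cdot>\<^sub>m (\<Phi> X0 + \<Phi> X1)"
      using vg(2) x1E unfolding vs by (simp add: \<sigma>_add \<sigma>0[OF x0])
    then have "(\<Phi> X0 + (-1) \<cdot>\<^sub>m \<Phi> X1) $$ (i, j) = ((-1) \<cdot>\<^sub>m (\<Phi> X0 + \<Phi> X1)) $$ (i, j)" for i j by simp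
    moreover have "\<Phi> X0 $$ (i, j) = 0"
      if "i < N" "j < N" "(\<Phi> X0 + (-1) \<cdot>\<^sub>m \<Phi> X1) $$ (i, j) = ((-1) \<cdot>\<^sub>m (\<Phi> X0 + \<Phi> X1)) $$ (i, j)" for i j
    proof -
      have "\<Phi> X0 $$ (i, j) + \<Phi> X0 $$ (i, j) = 0"
        using that carr[OF x1E(2)] carr[OF x1E(3)] by (simp add: algebra_simps)
      then have "2 * \<Phi> X0 $$ (i, j) = 0" by simp
      then show ?thesis by simp
    qed
    ultimately have "\<Phi> X0 = 0\<^sub>m N N" using carr[OF x1E(3)] by (intro eq_matI) auto
    then have "v = \<Phi> X1" unfolding vs using carr[OF x1E(2)] by simp
    then show "v \<in> g1" using x1 by simp
  qed
  ultimately show "?E = g1" by blast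
qed

end

section \<open>The module \<open>g1\<close> and a point with a large orbit\<close>

context skew_hermitian_model
begin

abbreviation V where "V \<equiv> mat_subspace N g1"

lemma V_simps[simp]:
  "carrier V = g1" "add V = (+)" "module.smult V = (\<cdot>\<^sub>m)" "zero V = 0\<^sub>m N N"
  by (simp_all add: mat_subspace_def module_mat_simps)

lemma g1_carrier: "v \<in> g1 \<Longrightarrow> v \<in> carrier_mat N N" and g0_carrier: "v \<in> g0 \<Longrightarrow> v \<in> carrier_mat N N"
  using g1_subset g0_subset g_carrier by auto

lemma V_vs: "vectorspace class_ring V"
proof -
  have M: "vectorspace class_ring (module_mat TYPE('k) N N)" by (rule matrix_vs)
  have "submodule class_ring g1 (module_mat TYPE('k) N N)"
  proof (rule submodule.intro)
    show "Module.module class_ring (module_mat TYPE('k) N N)" using M by (simp add: vectorspace_def)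
  qed (use g1_carrier g1_closed zero_in_g1 in \<open>auto simp: module_mat_simps\<close>)
  then have "VectorSpace.subspace class_ring g1 (module_mat TYPE('k) N N)"
    using M by (simp add: VectorSpace.subspace_def)
  from vectorspace.subspace_is_vs[OF M this] show ?thesis by (simp add: mat_subspace_def)
qed

lemma V_fin_dim: "vectorspace.fin_dim class_ring V"
proof (rule vdim_le_functionals(1)[OF V_vs, of "{..<N} \<times> {..<N}" "\<lambda>p v. v $$ p"])
  show "v = \<zero>\<^bsub>V\<^esub>" if "v \<in> carrier V" "\<And>j. j \<in> {..<N} \<times> {..<N} \<Longrightarrow> v $$ j = 0" for v
    using that g1_carrier[of v] by (intro eq_matI) auto
qed (auto dest!: g1_carrier)

sublocale lie_action g0 V lie_bracket
proof (rule lie_action.intro[OF V_vs V_fin_dim])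
  show "g0 \<noteq> {}" using zero_in_g0 by auto
  show "lie_bracket a f \<in> carrier V" if "a \<in> g0" "f \<in> carrier V" for a f
    using g0_g1_bracket that by simp
  show "\<exists>d\<in>g0. \<forall>f\<in>carrier V. lie_bracket d f = lie_bracket a f \<oplus>\<^bsub>V\<^esub> lie_bracket b f" if "a \<in> g0" "b \<in> g0" for a b
    using that g0_carrier g1_carrier
    by (intro bexI[of _ "a + b"] g0_closed) (auto simp: lie_bracket_linear[of _ N])
  show "\<exists>d\<in>g0. \<forall>f\<in>carrier V. lie_bracket d f = c \<odot>\<^bsub>V\<^esub> lie_bracket a f" if "a \<in> g0" for a c
    using that g0_carrier g1_carrier
    by (intro bexI[of _ "c \<cdot>\<^sub>m a"] g0_closed) (auto simp: lie_bracket_linear[of _ N])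
qed (auto simp: lie_bracket_linear[of _ N] g0_carrier g1_carrier)

text \<open>A diagonal element; its coefficients are nonzero and have distinct squares, which makes
  the orbit large.\<close>

definition generic_vector where
  "generic_vector = Z 0 3 (scal 1) + (Z 1 4 (scal 2) + Z 2 5 (scal 3))"

lemma generic_vector_g1: "generic_vector \<in> g1"
  unfolding generic_vector_def by (intro g1_closed Z_g1) auto

text \<open>Each block of \<open>g0\<close> yields a proportionality between the values of
  \<open>f\<close> at the positions \<open>(i, 3 + l)\<close> and \<open>(l, 3 + i)\<close>. The two
  are incompatible unless both values vanish, because the squares of the coefficients differ.
  Diagonal positions and the columns from \<open>6\<close> on are treated separately.\<close>

lemma generic_annihilator:
  assumes f: "f \<in> carrier (dual_space V)"
    and van: "\<And>a. a \<in> g0 \<Longrightarrow> f (lie_bracket a generic_vector) = 0"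
    and diag: "\<And>i. i < 3 \<Longrightarrow> f (Z i (3 + i) 1) = 0"
  shows "f = \<zero>\<^bsub>dual_space V\<^esub>"
proof -
  have f_add: "f (v + w) = f v + f w" if "v \<in> g1" "w \<in> g1" for v w
    using f that by (auto simp: in_dual_space)
  have f_smult: "f (c \<cdot>\<^sub>m v) = c * f v" if "v \<in> g1" for v c
    using f that by (auto simp: in_dual_space)
  have f0: "f (0\<^sub>m N N) = 0"
  proof -
    have "f (0 \<cdot>\<^sub>m 0\<^sub>m N N) = 0 * f (0\<^sub>m N N)" by (rule f_smult[OF zero_in_g1])
    moreover have "0 \<cdot>\<^sub>m 0\<^sub>m N N = (0\<^sub>m N N :: 'k mat)" by (intro eq_matI) auto
    ultimately show ?thesis by simp
  qed
  define c :: "nat \<Rightarrow> 'k" where "c m = of_nat (Suc m)" for m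
  have c: "c m \<noteq> 0" for m by (simp add: c_def del: of_nat_Suc)
  have c_inj: "c i * c i \<noteq> c j * c j" if "i \<noteq> j" for i j
  proof -
    have "Suc i * Suc i \<noteq> Suc j * Suc j" using that by (metis Suc_inject nat_mult_eq_cancel_disj power2_eq_square power2_eq_iff_nonneg zero_le)
    then show ?thesis unfolding c_def of_nat_mult[symmetric] of_nat_eq_iff .
  qed
  define F where "F i j x = f (Z i j x)" for i j x
  have F_smult: "F i j (scal s * x) = s * F i j x" if "in_alg d x" "i < 3" "3 \<le> j" for i j s x
    unfolding F_def Z_smult using that by (intro f_smult Z_g1)
  have F_add: "F i j (x + y) = F i j x + F i j y" if "in_alg d x" "in_alg d y" "i < 3" "3 \<le> j" for i j x y
    unfolding F_def Z_add using that by (intro f_add Z_g1)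
  have c_simps: "c 0 = 1" "c 1 = 2" "c 2 = 3" by (simp_all add: c_def)
  \<comment> \<open>The vanishing condition with the bracket distributed over the three summands of
    \<open>generic_vector\<close>; for each generator used below, at most two of the terms
    survive.\<close>
  have split: "(\<Sum>m<3. f (lie_bracket a (Z m (3 + m) (scal (c m))))) = 0" if a: "a \<in> g0" for a
  proof -
    have Zg: "Z 0 3 (scal 1) \<in> g1" "Z 1 4 (scal 2) \<in> g1" "Z 2 5 (scal 3) \<in> g1" by (auto intro!: Z_g1)
    have "lie_bracket a generic_vector = lie_bracket a (Z 0 3 (scal 1)) + (lie_bracket a (Z 1 4 (scal 2)) + lie_bracket a (Z 2 5 (scal 3)))"
      unfolding generic_vector_def using g0_carrier[OF a] by (simp add: lie_bracket_linear[of _ N])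
    then have "f (lie_bracket a (Z 0 3 (scal 1))) + (f (lie_bracket a (Z 1 4 (scal 2))) + f (lie_bracket a (Z 2 5 (scal 3)))) = 0"
      using van[OF a] Zg a g0_g1_bracket g1_closed(1) by (simp add: f_add)
    then show ?thesis by (simp add: lessThan_3 c_simps[unfolded One_nat_def])
  qed
  have f_neg: "f (lie_bracket ((-1) \<cdot>\<^sub>m a) v) = - f (lie_bracket a v)" if "a \<in> g0" "v \<in> g1" for a v
    using that g0_carrier g1_carrier by (simp add: lie_bracket_linear[of _ N] f_smult g0_g1_bracket)
  have pick2: "(\<Sum>m<3. if m = l then a else if m = i then b else 0) = a + b" if "i < 3" "l < 3" "i \<noteq> l" for i l :: nat and a b :: 'k
  proof -
    have "i = 0 \<or> i = 1 \<or> i = 2" "l = 0 \<or> l = 1 \<or> l = 2" using that by auto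
    then show ?thesis using that(3) by (elim disjE) (simp_all add: lessThan_3)
  qed
  have pick1: "(\<Sum>m<3. if m = i then b else 0) = b" if "i < 3" for i :: nat and b :: 'k using that by simp
  have rel1: "c l * F i (3 + l) x = c i * F l (3 + i) (adj x)" if il: "i < 3" "l < 3" "i \<noteq> l" and x: "in_alg d x" for i l x
  proof -
    have a: "Z i l x \<in> g0" using il x by (auto intro: Z_g0)
    have "f (lie_bracket (Z i l x) (Z m (3 + m) (scal (c m)))) =
      (if m = l then c l * F i (3 + l) x else if m = i then - (c i * F l (3 + i) (adj x)) else 0)" if m: "m < 3" for m
    proof -
      have b: "m < n" "3 + m < n" "i < n" "l < n" using m n il by auto
      show ?thesis
      proof (cases "m = l")
        case True
        have "lie_bracket (Z i l x) (Z l (3 + l) (scal (c l))) = Z i (3 + l) (x * scal (c l))"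
          using il x b True by (intro Z_chain) auto
        then show ?thesis using True F_smult[OF x, of i "3 + l" "c l"] il by (simp add: F_def scal_commute)
      next
        case False
        show ?thesis
        proof (cases "m = i")
          case True
          have "lie_bracket (Z l i (adj x)) (Z i (3 + i) (scal (c i))) = Z l (3 + i) (adj x * scal (c i))"
            using il x b True by (intro Z_chain) auto
          moreover have "f (lie_bracket (Z i l x) (Z i (3 + i) (scal (c i)))) = - f (lie_bracket (Z l i (adj x)) (Z i (3 + i) (scal (c i))))"
            unfolding Z_swap[of i l x] using il x by (intro f_neg Z_g0 Z_g1) auto
          ultimately show ?thesis using True il F_smult[of "adj x" l "3 + i" "c i"] x by (simp add: F_def scal_commute)
        next
          case False
          have "lie_bracket (Z i l x) (Z m (3 + m) (scal (c m))) = 0\<^sub>m N N"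
            using il x b False \<open>m \<noteq> l\<close> by (intro Z_disjoint) auto
          then show ?thesis using False \<open>m \<noteq> l\<close> f0 by simp
        qed
      qed
    qed
    then have "(\<Sum>m<3. if m = l then c l * F i (3 + l) x else if m = i then - (c i * F l (3 + i) (adj x)) else 0) = 0"
      using split[OF a] by simp
    then show ?thesis unfolding pick2[OF il] by simp
  qed
  have rel2: "c l * F l (3 + i) (adj x) = c i * F i (3 + l) x" if il: "i < 3" "l < 3" "i \<noteq> l" and x: "in_alg d x" for i l x
  proof -
    have a: "Z (3 + i) (3 + l) x \<in> g0" using il x by (auto intro: Z_g0)
    have "f (lie_bracket (Z (3 + i) (3 + l) x) (Z m (3 + m) (scal (c m)))) =
      (if m = l then c l * F l (3 + i) (adj x) else if m = i then - (c i * F i (3 + l) x) else 0)" if m: "m < 3" for m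
    proof -
      have b: "m < n" "3 + m < n" "3 + i < n" "3 + l < n" "i < n" "l < n" using m n il by auto
      \<comment> \<open>\<open>Z_chain\<close> needs a shared inner index, so the summand at
        \<open>(m, 3 + m)\<close> is rewritten at \<open>(3 + m, m)\<close> at the cost of a
        sign.\<close>
      have swap: "f (lie_bracket a (Z m (3 + m) (scal (c m)))) = - f (Z_rhs)"
        if "a \<in> g0" "lie_bracket a (Z (3 + m) m (scal (c m))) = Z_rhs" for a Z_rhs
      proof -
        have "lie_bracket a (Z m (3 + m) (scal (c m))) = (-1) \<cdot>\<^sub>m lie_bracket a (Z (3 + m) m (scal (c m)))"
          unfolding Z_swap[of m "3 + m" "scal (c m)"] using g0_carrier[OF that(1)] by (simp add: lie_bracket_linear[of _ N])
        moreover have "lie_bracket a (Z (3 + m) m (scal (c m))) = (-1) \<cdot>\<^sub>m lie_bracket a (Z m (3 + m) (scal (c m)))"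
          unfolding Z_swap[of "3 + m" m "scal (c m)"] using g0_carrier[OF that(1)] by (simp add: lie_bracket_linear[of _ N])
        moreover have "lie_bracket a (Z m (3 + m) (scal (c m))) \<in> g1" using that(1) m by (intro g0_g1_bracket Z_g1) auto
        ultimately show ?thesis using that(2) f_smult g1_closed(2) by (metis mult_minus1)
      qed
      show ?thesis
      proof (cases "m = l")
        case True
        have "lie_bracket (Z (3 + i) (3 + l) x) (Z (3 + l) l (scal (c l))) = Z (3 + i) l (x * scal (c l))"
          using il x b True by (intro Z_chain) auto
        from swap[of "Z (3 + i) (3 + l) x"] this True a
        have "f (lie_bracket (Z (3 + i) (3 + l) x) (Z m (3 + m) (scal (c m)))) = - f (Z (3 + i) l (x * scal (c l)))" by simp
        also have "\<dots> = f (Z l (3 + i) (adj (x * scal (c l))))"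
          unfolding Z_swap[of "3 + i" l] using x il by (subst f_smult) (auto intro!: Z_g1)
        also have "\<dots> = c l * F l (3 + i) (adj x)"
          using F_smult[of "adj x" l "3 + i" "c l"] x il by (simp add: F_def adj_mult)
        finally show ?thesis using True by simp
      next
        case False
        show ?thesis
        proof (cases "m = i")
          case True
          have "lie_bracket (Z (3 + l) (3 + i) (adj x)) (Z (3 + i) i (scal (c i))) = Z (3 + l) i (adj x * scal (c i))"
            using il x b True by (intro Z_chain) auto
          from swap[of "Z (3 + l) (3 + i) (adj x)"] this True x il
          have "f (lie_bracket (Z (3 + l) (3 + i) (adj x)) (Z i (3 + i) (scal (c i)))) = - f (Z (3 + l) i (adj x * scal (c i)))"
            by (simp add: Z_g0)
          also have "\<dots> = f (Z i (3 + l) (adj (adj x * scal (c i))))"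
            unfolding Z_swap[of "3 + l" i] using x il by (subst f_smult) (auto intro!: Z_g1)
          also have "\<dots> = c i * F i (3 + l) x"
            using F_smult[of x i "3 + l" "c i"] x il by (simp add: F_def adj_mult)
          finally have "f (lie_bracket (Z (3 + l) (3 + i) (adj x)) (Z i (3 + i) (scal (c i)))) = c i * F i (3 + l) x" .
          moreover have "f (lie_bracket (Z (3 + i) (3 + l) x) (Z i (3 + i) (scal (c i)))) = - f (lie_bracket (Z (3 + l) (3 + i) (adj x)) (Z i (3 + i) (scal (c i))))"
            unfolding Z_swap[of "3 + i" "3 + l" x] using il x by (intro f_neg Z_g0 Z_g1) auto
          ultimately show ?thesis using True il by simp
        next
          case False
          have "lie_bracket (Z (3 + i) (3 + l) x) (Z m (3 + m) (scal (c m))) = 0\<^sub>m N N"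
            using il x b m False \<open>m \<noteq> l\<close> by (intro Z_disjoint) auto
          then show ?thesis using False \<open>m \<noteq> l\<close> f0 by simp
        qed
      qed
    qed
    then have "(\<Sum>m<3. if m = l then c l * F l (3 + i) (adj x) else if m = i then - (c i * F i (3 + l) x) else 0) = 0"
      using split[OF a] by simp
    then show ?thesis unfolding pick2[OF il] by simp
  qed
  \<comment> \<open>Combining the two relations multiplies the same value by
    \<open>c l * c l\<close> and by \<open>c i * c i\<close>.\<close>
  have off: "F i (3 + l) x = 0" if il: "i < 3" "l < 3" "i \<noteq> l" and x: "in_alg d x" for i l x
  proof -
    have "c l * (c l * F i (3 + l) x) = c i * (c l * F l (3 + i) (adj x))" using rel1[OF il x] by simp
    also have "\<dots> = c i * (c i * F i (3 + l) x)" using rel2[OF il x] by simp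
    finally have "(c l * c l - c i * c i) * F i (3 + l) x = 0" by (simp add: algebra_simps)
    then show ?thesis using c_inj[of l i] il(3) by simp
  qed
  \<comment> \<open>\<open>generic_vector\<close> is zero in columns from \<open>6\<close> on, so
    the generator joining such a column to \<open>3 + i\<close> isolates the value at one
    position.\<close>
  have far: "F i j x = 0" if i: "i < 3" and j: "6 \<le> j" "j < n" and x: "in_alg d x" for i j x
  proof -
    have a: "Z j (3 + i) (adj x) \<in> g0" using i j x by (auto intro: Z_g0)
    have "f (lie_bracket (Z j (3 + i) (adj x)) (Z m (3 + m) (scal (c m)))) = (if m = i then c i * F i j x else 0)" if m: "m < 3" for m
    proof -
      have b: "m < n" "3 + m < n" "3 + i < n" "i < n" using m n i by auto
      show ?thesis
      proof (cases "m = i")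
        case True
        have "lie_bracket (Z j (3 + i) (adj x)) (Z i (3 + i) (scal (c i))) = (-1) \<cdot>\<^sub>m lie_bracket (Z j (3 + i) (adj x)) (Z (3 + i) i (scal (c i)))"
          unfolding Z_swap[of i "3 + i" "scal (c i)"] by (simp add: lie_bracket_linear[of _ N])
        also have "lie_bracket (Z j (3 + i) (adj x)) (Z (3 + i) i (scal (c i))) = Z j i (adj x * scal (c i))"
          using i j x b by (intro Z_chain) auto
        also have "(-1) \<cdot>\<^sub>m Z j i (adj x * scal (c i)) = Z i j (scal (c i) * x)"
          by (subst Z_swap[of i j]) (simp add: adj_mult)
        finally show ?thesis using True F_smult[OF x i, of j "c i"] j by (simp add: F_def)
      next
        case False
        have "lie_bracket (Z j (3 + i) (adj x)) (Z m (3 + m) (scal (c m))) = 0\<^sub>m N N"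
          using i j m x b False by (intro Z_disjoint) auto
        then show ?thesis using False f0 by simp
      qed
    qed
    then have "(\<Sum>m<3. if m = i then c i * F i j x else 0) = 0" using split[OF a] by simp
    then show ?thesis unfolding pick1[OF i] using c by simp
  qed
  \<comment> \<open>The diagonal generator kills the value at \<open>x - adj x\<close>, the
    hypothesis \<open>diag\<close> the value at the scalar \<open>x + adj x\<close>; the sum of the
    two arguments is twice \<open>x\<close>.\<close>
  have dg: "F i (3 + i) x = 0" if i: "i < 3" and x: "in_alg d x" for i x
  proof -
    have a: "Z i i x \<in> g0" using i x by (auto intro: Z_g0)
    have "f (lie_bracket (Z i i x) (Z m (3 + m) (scal (c m)))) = (if m = i then c i * F i (3 + i) (x - adj x) else 0)" if m: "m < 3" for m
    proof -
      have b: "m < n" "3 + m < n" "i < n" using m n i by auto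
      show ?thesis
      proof (cases "m = i")
        case True
        have "lie_bracket (Z i i x) (Z i (3 + i) (scal (c i))) = Z i (3 + i) ((x - adj x) * scal (c i))"
          using x b True by (intro Z_diagonal) auto
        then show ?thesis using True F_smult[of "x - adj x" i "3 + i" "c i"] i x by (simp add: F_def scal_commute)
      next
        case False
        have "lie_bracket (Z i i x) (Z m (3 + m) (scal (c m))) = 0\<^sub>m N N"
          using i m x b False by (intro Z_disjoint) auto
        then show ?thesis using False f0 by simp
      qed
    qed
    then have "(\<Sum>m<3. if m = i then c i * F i (3 + i) (x - adj x) else 0) = 0" using split[OF a] by simp
    then have skew: "F i (3 + i) (x - adj x) = 0" unfolding pick1[OF i] using c by simp
    have "F i (3 + i) (scal (tr x) * 1) = 0" using F_smult[of 1 i "3 + i" "tr x"] diag[OF i] i by (simp add: F_def)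
    then have "F i (3 + i) (x + adj x) = 0" by (simp add: add_adj)
    then have "F i (3 + i) ((x - adj x) + (x + adj x)) = 0"
      using F_add[of "x - adj x" "x + adj x" i "3 + i"] skew x i by simp
    moreover have "(x - adj x) + (x + adj x) = scal 2 * x" by (simp add: m2_eq_iff)
    ultimately show ?thesis using F_smult[OF x i, of "3 + i" 2] by simp
  qed
  have all: "F i j x = 0" if "i < 3" "3 \<le> j" "j < n" "in_alg d x" for i j x
  proof (cases "6 \<le> j")
    case True
    then show ?thesis using far that by blast
  next
    case False
    then have "j = 3 + (j - 3)" "j - 3 < 3" using that by auto
    then show ?thesis using off[of i "j - 3" x] dg[of i x] that by metis
  qed
  have "f v = 0" if "v \<in> g1" for v
    using that
  proof (induction rule: g1_induct)
    case (step w i j x)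
    then show ?case using f_add[OF _ Z_g1[of x i j]] all[of i j x] by (simp add: F_def)
  qed (rule f0)
  then show ?thesis using f by (auto simp: dual_space_simps in_dual_space extensional_def fun_eq_iff)
qed

end

lemma pairing_linear_left:
  "pairing (\<lambda>i j. P i j + R i j) X = pairing P X + pairing R X"
  "pairing (\<lambda>i j. scal c * P i j) X = c * pairing P X"
proof -
  have "adj (scal c * P i j) * X i j = scal c * (adj (P i j) * X i j)" for i j
    by (simp add: adj_mult scal_commute mult.assoc)
  then show "pairing (\<lambda>i j. scal c * P i j) X = c * pairing P X"
    by (simp add: pairing_def tr_simps sum_distrib_left)
qed (simp add: pairing_def algebra_simps sum.distrib tr_simps)

lemma pairing_cong:
  "(\<And>i j. i < 3 \<Longrightarrow> j < 2 \<Longrightarrow> P i j = P' i j) \<Longrightarrow> (\<And>i j. i < 3 \<Longrightarrow> j < 2 \<Longrightarrow> X i j = X' i j) \<Longrightarrow> pairing P X = pairing P' X'"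
  unfolding pairing_def by (intro sum.cong refl) auto

section \<open>The nilpotent element and its grading\<close>

context skew_hermitian_model
begin

text \<open>
  Rows \<open>0\<close> and \<open>1\<close> of the upper right block of the nilpotent element span the isotropic space of
  \<open>e\<^sub>3 + I e\<^sub>4\<close> and \<open>e\<^sub>5 + I e\<^sub>6\<close>, row \<open>2\<close> is zero.
\<close>

definition isotropic_row :: "nat \<Rightarrow> nat \<Rightarrow> 'k m2" where
  "isotropic_row l k = scal (if k = 3 + 2 * l then 1 else if k = 4 + 2 * l then I else 0)"

definition nilpotent_coords :: "nat \<Rightarrow> nat \<Rightarrow> 'k m2" where
  "nilpotent_coords i j = (if i < 2 \<and> 3 \<le> j then isotropic_row i j
     else if j < 2 \<and> 3 \<le> i then - isotropic_row j i else 0)"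

text \<open>A multiple of the rotation generator in each of the two coordinate planes
  \<open>3, 4\<close> and \<open>5, 6\<close>. The factor \<open>I\<close> makes its square the
  identity there, and the isotropic rows become eigenvectors for \<open>-1\<close> under
  multiplication from the right.\<close>

definition grading_coords :: "nat \<Rightarrow> nat \<Rightarrow> 'k m2" where
  "grading_coords i j = scal (if i = 3 \<and> j = 4 \<or> i = 5 \<and> j = 6 then - I
     else if i = 4 \<and> j = 3 \<or> i = 6 \<and> j = 5 then I else 0)"

text \<open>The bilinear products of the rows of \<open>X\<close> with the two isotropic rows,
  without conjugation; on the isotropic rows themselves they vanish.\<close>

definition slice :: "(nat \<Rightarrow> nat \<Rightarrow> 'k m2) \<Rightarrow> nat \<Rightarrow> nat \<Rightarrow> 'k m2" where
  "slice X i j = X i (3 + 2 * j) + scal I * X i (4 + 2 * j)"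

lemma isotropic_row_simps: "in_alg d (isotropic_row l k)" "adj (isotropic_row l k) = isotropic_row l k"
  and isotropic_row_commute: "x * isotropic_row l k = isotropic_row l k * x"
  unfolding isotropic_row_def by (simp_all only: in_alg_simps adj_simps scal_commute[of x])

lemma sum_isotropic_row:
  assumes "l < 2"
  shows "(\<Sum>k<n. X k * isotropic_row l k) = X (3 + 2 * l) + scal I * X (4 + 2 * l)"
proof -
  have "(\<Sum>k<n. X k * isotropic_row l k) =
    (\<Sum>k<n. (if k = 3 + 2 * l then X k else 0) + (if k = 4 + 2 * l then scal I * X k else 0))"
    by (rule sum.cong) (auto simp: isotropic_row_def scal_simps scal_commute[of "X _"])
  also have "\<dots> = X (3 + 2 * l) + scal I * X (4 + 2 * l)"
    using n assms by (simp add: sum.distrib)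
  finally show ?thesis .
qed

lemma nilpotent_coords_row: "i < 2 \<Longrightarrow> nilpotent_coords i k = isotropic_row i k" "k < 3 \<or> 3 \<le> k \<Longrightarrow> nilpotent_coords 2 k = 0"
  by (auto simp: nilpotent_coords_def isotropic_row_def scal_simps)

lemma nilpotent_coords_skew: "skew_hermitian n d nilpotent_coords" "block_off_diagonal n nilpotent_coords"
proof -
  show "skew_hermitian n d nilpotent_coords"
    by (rule skew_hermitianI) (auto simp: nilpotent_coords_def isotropic_row_simps)
  show "block_off_diagonal n nilpotent_coords"
    unfolding block_off_diagonal_def nilpotent_coords_def by auto
qed

lemma grading_coords_skew: "skew_hermitian n d grading_coords" "block_diagonal n grading_coords"
proof -
  show "skew_hermitian n d grading_coords"
    unfolding grading_coords_def by (rule skew_hermitianI) (auto simp: scal_simps)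
  show "block_diagonal n grading_coords"
    unfolding block_diagonal_def grading_coords_def by (auto simp: scal_simps)
qed

lemma commutator_off_diagonal:
  assumes A: "block_diagonal n A" and X: "block_off_diagonal n X" and ij: "i < 3" "3 \<le> j" "j < n"
  shows "commutator n A X i j = (\<Sum>k<3. A i k * X k j) - (\<Sum>k<n. X i k * A k j)"
proof -
  have "(\<Sum>k<n. A i k * X k j) = (\<Sum>k<3. A i k * X k j)"
    by (rule sum.mono_neutral_right) (use n A ij in \<open>auto simp: block_diagonal_def\<close>)
  then show ?thesis by (simp add: commutator_def mat_prod_def)
qed

lemma block_off_diagonal_commutator:
  assumes A: "block_diagonal n A" and X: "block_off_diagonal n X"
  shows "block_off_diagonal n (commutator n A X)"
proof -
  have "A i k * X k j = 0" "X i k * A k j = 0" if "i < n" "j < n" "k < n" "(i < 3) = (j < 3)" for i j k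
    using A X that unfolding block_diagonal_def block_off_diagonal_def by (metis mult_zero_left mult_zero_right)+
  then show ?thesis unfolding block_off_diagonal_def commutator_def mat_prod_def by simp
qed

lemma \<Phi>_off_diagonal_cong:
  assumes X: "skew_hermitian n d X" "block_off_diagonal n X" and Y: "skew_hermitian n d Y" "block_off_diagonal n Y"
    and eq: "\<And>i j. i < 3 \<Longrightarrow> 3 \<le> j \<Longrightarrow> j < n \<Longrightarrow> X i j = Y i j"
  shows "\<Phi> X = \<Phi> Y"
proof (rule \<Phi>_cong)
  fix i j assume ij: "i < n" "j < n"
  consider "(i < 3) = (j < 3)" | "i < 3" "3 \<le> j" | "j < 3" "3 \<le> i" by linarith
  then show "X i j = Y i j"
  proof cases
    case 1
    then show ?thesis using X(2) Y(2) ij unfolding block_off_diagonal_def by metis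
  next
    case 2
    then show ?thesis using eq ij by blast
  next
    case 3
    then have "X j i = Y j i" using eq ij by blast
    then have "- X i j = - Y i j" using skew_hermitianD(2)[OF X(1) ij(2,1)] skew_hermitianD(2)[OF Y(1) ij(2,1)] by simp
    then show ?thesis by simp
  qed
qed

definition nilpotent where "nilpotent = \<Phi> nilpotent_coords"

definition grading where "grading = \<Phi> grading_coords"

lemma nilpotent_g1: "nilpotent \<in> g1" and grading_g0: "grading \<in> g0"
  unfolding nilpotent_def grading_def g1_def g0 using nilpotent_coords_skew grading_coords_skew by blast+

text \<open>The grading is supported in the second block, where it acts on the rows of the nilpotent
  element by \<open>-1\<close> from the right; the commutator turns the sign around.\<close>

lemma grading_nilpotent: "lie_bracket grading nilpotent = nilpotent"
  unfolding grading_def nilpotent_def bracket[OF grading_coords_skew(1) nilpotent_coords_skew(1)]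
proof (rule \<Phi>_off_diagonal_cong)
  fix i j :: nat assume ij: "i < 3" "3 \<le> j" "j < n"
  have "(\<Sum>k<3. grading_coords i k * nilpotent_coords k j) = 0"
    using ij by (intro sum.neutral) (auto simp: grading_coords_def scal_simps)
  then have c: "commutator n grading_coords nilpotent_coords i j = - (\<Sum>k<n. nilpotent_coords i k * grading_coords k j)"
    using commutator_off_diagonal[OF grading_coords_skew(2) nilpotent_coords_skew(2) ij] by simp
  show "commutator n grading_coords nilpotent_coords i j = nilpotent_coords i j"
  proof (cases "i < 2")
    case True
    have "(\<Sum>k<n. nilpotent_coords i k * grading_coords k j) = (\<Sum>k<n. grading_coords k j * isotropic_row i k)"
      by (simp add: nilpotent_coords_row(1)[OF True] isotropic_row_commute)
    also have "\<dots> = grading_coords (3 + 2 * i) j + scal I * grading_coords (4 + 2 * i) j"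
      by (rule sum_isotropic_row[OF True])
    also have "\<dots> = - isotropic_row i j"
    proof -
      have "i = 0 \<or> i = 1" using True by auto
      then show ?thesis by (auto simp: grading_coords_def isotropic_row_def scal_simps I)
    qed
    finally show ?thesis using c by (simp add: nilpotent_coords_row(1)[OF True])
  next
    case False
    then have "i = 2" using ij by simp
    moreover have "nilpotent_coords 2 k = 0" for k by (rule nilpotent_coords_row(2)) linarith
    ultimately show ?thesis using c by simp
  qed
qed (intro skew_hermitian_commutator block_off_diagonal_commutator nilpotent_coords_skew grading_coords_skew)+

lemma grading_cube: "grading * (grading * grading) = grading"
proof -
  have alg: "in_alg d (grading_coords i j)" for i j by (simp add: grading_coords_def)
  have expand: "(\<Sum>k<n. grading_coords i k * X k) = grading_coords i 3 * X 3 + (grading_coords i 4 * X 4 + (grading_coords i 5 * X 5 + grading_coords i 6 * X 6))" for i :: nat and X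
  proof -
    have "(\<Sum>k<n. grading_coords i k * X k) = (\<Sum>k\<in>{3,4,5,6}. grading_coords i k * X k)"
      by (rule sum.mono_neutral_right) (use n in \<open>auto simp: grading_coords_def scal_simps\<close>)
    then show ?thesis by simp
  qed
  \<comment> \<open>The square is the projection onto the four coordinates \<open>3\<close> to
    \<open>6\<close>.\<close>
  have sq: "mat_prod n grading_coords grading_coords i j = (if i = j \<and> i \<in> {3,4,5,6} then 1 else 0)" for i j :: nat
  proof -
    consider "i = 3" | "i = 4" | "i = 5" | "i = 6" | "i \<notin> {3,4,5,6}" by auto
    then show ?thesis
      unfolding mat_prod_def expand by cases (auto simp: grading_coords_def scal_simps I)
  qed
  have "mat_prod n grading_coords (mat_prod n grading_coords grading_coords) i j = grading_coords i j" for i j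
    unfolding mat_prod_def[of n grading_coords "mat_prod n grading_coords grading_coords"] expand sq
    by (auto simp: grading_coords_def scal_simps)
  then have "\<Phi> (mat_prod n grading_coords (mat_prod n grading_coords grading_coords)) = grading"
    unfolding grading_def by (intro \<Phi>_cong)
  moreover have "in_alg d (mat_prod n grading_coords grading_coords i j)" for i j by (simp add: sq)
  ultimately show ?thesis by (simp add: \<Phi>_mult alg grading_def)
qed

lemma nilpotent_nilpotent:
  assumes "linear_algebraic_group N G0" "lie_algebra_of N G0 = g0"
  shows "nilpotent_vector G0 (conjugation N) V nilpotent"
proof (rule nilpotent_vector_of_grading[OF assms(1)])
  show "grading \<in> lie_algebra_of N G0" using assms(2) grading_g0 by simp
qed (use nilpotent_g1 g1_closed(2) g1_carrier grading_cube grading_nilpotent in auto)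

section \<open>Functionals from the slice and the stabiliser action on them\<close>

definition coords :: "'k mat \<Rightarrow> nat \<Rightarrow> nat \<Rightarrow> 'k m2" where
  "coords w = (SOME X. skew_hermitian n d X \<and> block_off_diagonal n X \<and> w = \<Phi> X)"

lemma coords_\<Phi>:
  assumes "skew_hermitian n d X" "block_off_diagonal n X" "i < n" "j < n"
  shows "coords (\<Phi> X) i j = X i j"
proof -
  \<comment> \<open>\<open>\<Phi>\<close> is injective on skew-hermitian matrices, so the choice in
    \<open>coords\<close> affects only entries outside the \<open>n \<times> n\<close>
    range.\<close>
  have "skew_hermitian n d (coords (\<Phi> X)) \<and> block_off_diagonal n (coords (\<Phi> X)) \<and> \<Phi> X = \<Phi> (coords (\<Phi> X))"
    unfolding coords_def by (rule someI[of _ X]) (use assms in simp)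
  then show ?thesis using \<Phi>_eqD[OF _ assms(1) _ assms(3,4)] by metis
qed

definition slice_functional where
  "slice_functional P w = pairing P (slice (coords w))"

lemma slice_functional_\<Phi>:
  assumes "skew_hermitian n d X" "block_off_diagonal n X"
  shows "slice_functional P (\<Phi> X) = pairing P (slice X)"
  unfolding slice_functional_def
  by (rule pairing_cong) (use n in \<open>auto simp: slice_def coords_\<Phi>[OF assms]\<close>)

lemma slice_functional_linear:
  assumes "v \<in> g1" "w \<in> g1"
  shows "slice_functional P (v + w) = slice_functional P v + slice_functional P w"
    and "slice_functional P (c \<cdot>\<^sub>m v) = c * slice_functional P v"
proof -
  obtain X where X: "skew_hermitian n d X" "block_off_diagonal n X" "v = \<Phi> X" using assms(1) unfolding g1_def by blast
  obtain Y where Y: "skew_hermitian n d Y" "block_off_diagonal n Y" "w = \<Phi> Y" using assms(2) unfolding g1_def by blast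
  have off: "block_off_diagonal n (\<lambda>i j. X i j + Y i j)" "block_off_diagonal n (\<lambda>i j. scal c * X i j)"
    using X(2) Y(2) unfolding block_off_diagonal_def by auto
  have sl: "slice (\<lambda>i j. X i j + Y i j) = (\<lambda>i j. slice X i j + slice Y i j)"
    "slice (\<lambda>i j. scal c * X i j) = (\<lambda>i j. scal c * slice X i j)"
    by (simp_all add: slice_def fun_eq_iff algebra_simps) (simp add: scal_commute[of "scal I"] mult.assoc[symmetric])
  show "slice_functional P (v + w) = slice_functional P v + slice_functional P w"
    unfolding X(3) Y(3) \<Phi>_add[symmetric]
    using X Y off by (simp add: slice_functional_\<Phi> skew_hermitian_closed sl pairing_linear)
  show "slice_functional P (c \<cdot>\<^sub>m v) = c * slice_functional P v"
    unfolding X(3) \<Phi>_smult[symmetric]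
    using X off by (simp add: slice_functional_\<Phi> skew_hermitian_closed sl pairing_linear)
qed

lemma slice_commutator:
  assumes A: "block_diagonal n A" and X: "block_off_diagonal n X" and ij: "i < 3" "j < 2"
  shows "slice (commutator n A X) i j = (\<Sum>k<3. A i k * slice X k j) - (\<Sum>k<n. X i k * slice A k j)"
proof -
  have le: "3 + 2 * j < n" "4 + 2 * j < n" "3 \<le> 3 + 2 * j" "3 \<le> 4 + 2 * j" using ij n by auto
  have swap: "scal I * (x * y) = x * (scal I * y)" for x y :: "'k m2"
    by (simp add: scal_commute[of x] mult.assoc[symmetric])
  show ?thesis
    unfolding slice_def[of "commutator n A X"] commutator_off_diagonal[OF A X ij(1) le(3,1)] commutator_off_diagonal[OF A X ij(1) le(4,2)]
    unfolding slice_def right_diff_distrib sum_distrib_left swap distrib_left sum.distrib by simp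
qed

text \<open>As the rows of \<open>nilpotent\<close> are isotropic, the slice of its bracket with
  \<open>a\<close> has third row zero and upper part \<open>- r i * A * r j\<close>, where
  \<open>r 0\<close>, \<open>r 1\<close> are the isotropic rows. This part is skew-hermitian, hence
  orthogonal to every hermitian matrix.\<close>

lemma tangent_slice_functional:
  assumes a: "a \<in> g0" and P: "slice_space d P"
  shows "slice_functional P (lie_bracket a nilpotent) = 0"
proof -
  obtain A where A: "skew_hermitian n d A" "block_diagonal n A" "a = \<Phi> A" using a unfolding g0 by blast
  let ?C = "commutator n A nilpotent_coords"
  define B where "B i j = (if i < 2 then - (slice A (3 + 2 * i) j + scal I * slice A (4 + 2 * i) j) else 0)" for i j :: nat
  \<comment> \<open>Isotropy of the rows: \<open>1 + I * I = 0\<close>.\<close>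
  have sv: "slice nilpotent_coords k j = 0" if "k < 3" "j < 2" for k j
  proof -
    have "k = 0 \<or> k = 1 \<or> k = 2" "j = 0 \<or> j = 1" using that by auto
    then show ?thesis by (auto simp: slice_def nilpotent_coords_def isotropic_row_def scal_simps I)
  qed
  have slC: "slice ?C i j = B i j" if ij: "i < 3" "j < 2" for i j
  proof -
    have "slice ?C i j = - (\<Sum>k<n. nilpotent_coords i k * slice A k j)"
      unfolding slice_commutator[OF A(2) nilpotent_coords_skew(2) ij] by (simp add: sv ij)
    also have "\<dots> = B i j"
    proof (cases "i < 2")
      case True
      have "(\<Sum>k<n. nilpotent_coords i k * slice A k j) = (\<Sum>k<n. slice A k j * isotropic_row i k)"
        by (simp add: nilpotent_coords_row(1)[OF True] isotropic_row_commute)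
      also have "\<dots> = slice A (3 + 2 * i) j + scal I * slice A (4 + 2 * i) j" by (rule sum_isotropic_row[OF True])
      finally show ?thesis using True by (simp add: B_def)
    next
      case False
      then have "i = 2" using ij by simp
      moreover have "nilpotent_coords 2 k = 0" for k by (rule nilpotent_coords_row(2)) linarith
      ultimately show ?thesis by (simp add: B_def)
    qed
    finally show ?thesis .
  qed
  have "slice_functional P (lie_bracket a nilpotent) = pairing P (slice ?C)"
    unfolding A(3) nilpotent_def bracket[OF A(1) nilpotent_coords_skew(1)]
    using A nilpotent_coords_skew by (intro slice_functional_\<Phi> skew_hermitian_commutator block_off_diagonal_commutator)
  also have "\<dots> = pairing P B" by (rule pairing_cong) (simp_all add: slC)
  also have "\<dots> = 0"
  proof (rule pairing_skew)
    show "top_hermitian P" using P by (simp add: slice_space_def)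
    fix i j :: nat assume ij: "i < 2" "j < 2"
    have lt: "3 + 2 * i < n" "4 + 2 * i < n" "3 + 2 * j < n" "4 + 2 * j < n" using ij n by auto
    show "adj (B i j) = - B j i"
      using ij skew_hermitianD(2)[OF A(1) lt(1) lt(3)] skew_hermitianD(2)[OF A(1) lt(1) lt(4)]
        skew_hermitianD(2)[OF A(1) lt(2) lt(3)] skew_hermitianD(2)[OF A(1) lt(2) lt(4)]
      by (simp add: B_def slice_def adj_mult scal_commute[of "A _ _"] scal_commute[of "A _ _ * _"] distrib_left distrib_right mult.assoc)
  qed (simp add: B_def)
  finally show ?thesis .
qed

text \<open>Commuting with \<open>nilpotent\<close> expresses the second block of \<open>A\<close>
  on the isotropic rows through the upper left entries of \<open>A\<close>, so the slice of a
  commutator depends only on the slice. The third row of the same equation yields the zeros required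
  by \<open>skew_2_1\<close>.\<close>

lemma stabiliser_slice:
  assumes "a \<in> lie_stabiliser g0 V lie_bracket nilpotent"
  shows "\<exists>A. a = \<Phi> A \<and> skew_hermitian n d A \<and> block_diagonal n A \<and> skew_2_1 A \<and>
    (\<forall>X i j. block_off_diagonal n X \<longrightarrow> i < 3 \<longrightarrow> j < 2 \<longrightarrow> slice (commutator n A X) i j = slice_action A (slice X) i j)"
proof -
  have a: "a \<in> g0" "lie_bracket a nilpotent = 0\<^sub>m N N" using assms by (auto simp: lie_stabiliser_def)
  obtain A where A: "skew_hermitian n d A" "block_diagonal n A" "a = \<Phi> A" using a(1) unfolding g0 by blast
  have "\<Phi> (commutator n A nilpotent_coords) = 0\<^sub>m N N"
    using a(2) unfolding A(3) nilpotent_def bracket[OF A(1) nilpotent_coords_skew(1)] .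
  then have C0: "commutator n A nilpotent_coords i j = 0" if "i < n" "j < n" for i j
    using \<Phi>_zeroD[OF skew_hermitian_commutator[OF A(1) nilpotent_coords_skew(1)] _ that] by blast
  have nc2: "nilpotent_coords 2 k = 0" for k by (rule nilpotent_coords_row(2)) linarith
  have eq: "A i 0 * isotropic_row 0 k + A i 1 * isotropic_row 1 k = (\<Sum>m<n. nilpotent_coords i m * A m k)"
    if ik: "i < 3" "3 \<le> k" "k < n" for i k
  proof -
    have "(\<Sum>l<3. A i l * nilpotent_coords l k) = (\<Sum>m<n. nilpotent_coords i m * A m k)"
      using C0[of i k] commutator_off_diagonal[OF A(2) nilpotent_coords_skew(2) ik] ik n by simp
    then show ?thesis by (simp add: lessThan_3 nc2 nilpotent_coords_row(1) add.assoc del: One_nat_def)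
  qed
  \<comment> \<open>Columns \<open>3\<close> and \<open>5\<close> each contain the entry
    \<open>1\<close> of exactly one isotropic row, and row \<open>2\<close> of the nilpotent element
    is zero.\<close>
  have A2: "A 2 0 = 0" "A 2 1 = 0"
    using eq[of 2 3] eq[of 2 5] n by (simp_all add: nc2 isotropic_row_def scal_simps)
  have skew: "skew_2_1 A"
    unfolding skew_2_1_def using A2 skew_hermitianD(2)[OF A(1)] n by auto
  have sliceA: "slice A k i = isotropic_row 0 k * A 0 i + isotropic_row 1 k * A 1 i" if ik: "i < 2" "3 \<le> k" "k < n" for i k
  proof -
    have lt: "3 + 2 * i < n" "4 + 2 * i < n" "i < n" "0 < n" "1 < n" "i < 3" using ik n by auto
    have "(\<Sum>m<n. nilpotent_coords i m * A m k) = (\<Sum>m<n. A m k * isotropic_row i m)"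
      by (simp add: nilpotent_coords_row(1)[OF ik(1)] isotropic_row_commute)
    also have "\<dots> = A (3 + 2 * i) k + scal I * A (4 + 2 * i) k" by (rule sum_isotropic_row[OF ik(1)])
    finally have e: "A (3 + 2 * i) k + scal I * A (4 + 2 * i) k = A i 0 * isotropic_row 0 k + A i 1 * isotropic_row 1 k"
      using eq[OF lt(6) ik(2,3)] by simp
    \<comment> \<open>Skewness carries the relation between rows of \<open>A\<close> over to its
      columns.\<close>
    have "- (A k (3 + 2 * i) + scal I * A k (4 + 2 * i)) = adj (A (3 + 2 * i) k + scal I * A (4 + 2 * i) k)"
      using skew_hermitianD(2)[OF A(1) lt(1) ik(3)] skew_hermitianD(2)[OF A(1) lt(2) ik(3)]
      by (simp add: adj_mult scal_commute[of "A _ _"])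
    also have "\<dots> = - (isotropic_row 0 k * A 0 i + isotropic_row 1 k * A 1 i)"
      unfolding e using skew_hermitianD(2)[OF A(1) lt(3,4)] skew_hermitianD(2)[OF A(1) lt(3,5)]
      by (simp add: adj_mult isotropic_row_simps)
    finally show ?thesis unfolding slice_def by (simp only: neg_equal_iff_equal)
  qed
  have "slice (commutator n A X) i j = slice_action A (slice X) i j" if X: "block_off_diagonal n X" and ij: "i < 3" "j < 2" for X i j
  proof -
    have X0: "X i k = 0" if "k < 3" for k using X that ij n unfolding block_off_diagonal_def by auto
    have "(\<Sum>k<n. X i k * slice A k j) = (\<Sum>k<n. (X i k * isotropic_row 0 k) * A 0 j + (X i k * isotropic_row 1 k) * A 1 j)"
    proof (rule sum.cong)
      fix k assume "k \<in> {..<n}"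
      then show "X i k * slice A k j = (X i k * isotropic_row 0 k) * A 0 j + (X i k * isotropic_row 1 k) * A 1 j"
        by (cases "k < 3") (simp_all add: X0 sliceA[OF ij(2)] distrib_left mult.assoc)
    qed simp
    also have "\<dots> = slice X i 0 * A 0 j + slice X i 1 * A 1 j"
      using sum_isotropic_row[of 0 "X i"] sum_isotropic_row[of 1 "X i"]
      by (simp add: sum.distrib sum_distrib_right[symmetric] slice_def)
    finally show ?thesis
      unfolding slice_commutator[OF A(2) X ij] slice_action_def by (simp add: lessThan_2)
  qed
  then show ?thesis using A skew by blast
qed

text \<open>The slice action is skew for the pairing, so the dual action on slice functionals is
  again the slice action, now on their arrays.\<close>

lemma stabiliser_slice_functional:
  assumes a: "a \<in> lie_stabiliser g0 V lie_bracket nilpotent"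
  shows "\<exists>A. skew_2_1 A \<and> (\<forall>i<3. \<forall>j<3. in_alg d (A i j)) \<and>
    (\<forall>P. \<forall>w\<in>g1. - slice_functional P (lie_bracket a w) = slice_functional (slice_action A P) w)"
proof -
  obtain A where A: "a = \<Phi> A" "skew_hermitian n d A" "block_diagonal n A" "skew_2_1 A"
    and sl: "\<And>X i j. block_off_diagonal n X \<Longrightarrow> i < 3 \<Longrightarrow> j < 2 \<Longrightarrow> slice (commutator n A X) i j = slice_action A (slice X) i j"
    using stabiliser_slice[OF a] by blast
  have "- slice_functional P (lie_bracket a w) = slice_functional (slice_action A P) w" if w: "w \<in> g1" for P w
  proof -
    obtain X where X: "skew_hermitian n d X" "block_off_diagonal n X" "w = \<Phi> X" using w unfolding g1_def by blast
    have "slice_functional P (lie_bracket a w) = pairing P (slice (commutator n A X))"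
      unfolding A(1) X(3) bracket[OF A(2) X(1)]
      using A X by (intro slice_functional_\<Phi> skew_hermitian_commutator block_off_diagonal_commutator)
    also have "\<dots> = pairing P (slice_action A (slice X))"
      by (rule pairing_cong) (simp_all add: sl[OF X(2)])
    also have "\<dots> = - pairing (slice_action A P) (slice X)"
      using skew_hermitianD(2)[OF A(2)] n by (intro pairing_slice_action) auto
    also have "pairing (slice_action A P) (slice X) = slice_functional (slice_action A P) w"
      unfolding X(3) by (rule slice_functional_\<Phi>[OF X(1,2), symmetric])
    finally show ?thesis by simp
  qed
  then show ?thesis using A skew_hermitianD(1)[OF A(2)] n by (intro exI[of _ A]) auto
qed

text \<open>The slice of this generator has the single entry \<open>x\<close> at
  \<open>(i, j)\<close>; such test vectors recover the array \<open>P\<close> from its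
  functional.\<close>

lemma slice_functional_Z:
  assumes x: "in_alg d x" and ij: "i < 3" "j < 2"
  shows "slice_functional P (Z i (3 + 2 * j) x) = tr (adj (P i j) * x)"
proof -
  have off: "block_off_diagonal n (skew_elementary i (3 + 2 * j) x)"
    unfolding block_off_diagonal_def
  proof (intro allI impI)
    fix p q :: nat assume "(p < 3) = (q < 3)"
    then show "skew_elementary i (3 + 2 * j) x p q = 0"
      by (intro skew_elementary_zero) (use ij in linarith)+
  qed
  have "slice (skew_elementary i (3 + 2 * j) x) p q = (if p = i \<and> q = j then x else 0)" if "p < 3" "q < 2" for p q
  proof -
    have "skew_elementary i (3 + 2 * j) x p (4 + 2 * q) = 0"
      by (intro skew_elementary_zero) (use ij that in presburger)+
    moreover have "skew_elementary i (3 + 2 * j) x p (3 + 2 * q) = (if p = i \<and> q = j then x else 0)"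
    proof (cases "p = i \<and> q = j")
      case True
      then show ?thesis using ij by (simp add: skew_elementary_def elementary_def)
    next
      case False
      then show ?thesis by (subst skew_elementary_zero) (use ij that in auto)
    qed
    ultimately show ?thesis by (simp add: slice_def)
  qed
  then have "slice_functional P (Z i (3 + 2 * j) x) = (\<Sum>p<3. \<Sum>q<2. tr (adj (P p q) * (if p = i \<and> q = j then x else 0)))"
    unfolding Z_def slice_functional_\<Phi>[OF skew_hermitian_elementary[OF x] off] pairing_def
    by (intro sum.cong refl) auto
  also have "\<dots> = (\<Sum>p<3. if p = i then tr (adj (P i j) * x) else 0)"
  proof (intro sum.cong refl)
    fix p
    have "(\<Sum>q<2. tr (adj (P p q) * (if p = i \<and> q = j then x else 0))) =
      (\<Sum>q<2. if q = j then (if p = i then tr (adj (P i j) * x) else 0) else 0)"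
      by (intro sum.cong refl) (auto simp: tr_simps)
    then show "(\<Sum>q<2. tr (adj (P p q) * (if p = i \<and> q = j then x else 0))) = (if p = i then tr (adj (P i j) * x) else 0)"
      using ij by simp
  qed
  also have "\<dots> = tr (adj (P i j) * x)" using ij by simp
  finally show ?thesis .
qed

theorem not_isotropy_GNIB:
  assumes \<sigma>: "symmetric_subalgebra N g g0 \<sigma>" and groups: "symmetric_pair_groups N g g0 G G0"
  shows "\<not> isotropy_GNIB N g \<sigma> G0"
  unfolding isotropy_GNIB_def involution_unique[OF \<sigma>]
\<comment> \<open>Three vectors span \<open>g1\<close> together with the tangent space at the
  generic point, against four annihilated functionals at the nilpotent one.\<close>
proof (rule not_GNIB_criterion[where I = "{..<3::nat}" and m = 4 and e = "\<lambda>i. Z i (3 + i) 1"])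
  show "nilpotent_vector G0 (conjugation N) V nilpotent"
    using groups by (intro nilpotent_nilpotent) (simp_all add: symmetric_pair_groups_def)
  show "generic_vector \<in> carrier V" using generic_vector_g1 by simp
  show "finite {..<3::nat}" "card {..<3::nat} < 4" by simp_all
  show "Z i (3 + i) 1 \<in> carrier V" if "i \<in> {..<3}" for i
    using that by (auto intro: Z_g1)
  show "f = \<zero>\<^bsub>dual_space V\<^esub>"
    if "f \<in> carrier (dual_space V)" "\<And>a. a \<in> g0 \<Longrightarrow> f (lie_bracket a generic_vector) = 0"
      "\<And>j. j \<in> {..<3} \<Longrightarrow> f (Z j (3 + j) 1) = 0" for f
    using that by (intro generic_annihilator) auto
  let ?S = "lie_stabiliser g0 V lie_bracket nilpotent"
  let ?U = "tangent_space g0 lie_bracket nilpotent"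
  note nilpotent_V = nilpotent_g1
  \<comment> \<open>By the Jacobi identity \<open>[a, [b, v]] = [[a, b], v]\<close>, because
    \<open>[a, v] = 0\<close>.\<close>
  show "lie_bracket a (lie_bracket b nilpotent) \<in> ?U" if "a \<in> ?S" "b \<in> g0" for a b
  proof -
    have a: "a \<in> g0" "lie_bracket a nilpotent = 0\<^sub>m N N" using that(1) by (auto simp: lie_stabiliser_def)
    have carr: "a \<in> carrier_mat N N" "b \<in> carrier_mat N N" "nilpotent \<in> carrier_mat N N"
      using a that(2) g0_carrier g1_carrier nilpotent_g1 by auto
    have b0: "lie_bracket b (0\<^sub>m N N) = 0\<^sub>m N N" using carr unfolding lie_bracket_def by (intro eq_matI) auto
    have ab: "lie_bracket a b \<in> g0" using a(1) that(2) by (rule g0_bracket)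
    have "lie_bracket a (lie_bracket b nilpotent) = lie_bracket (lie_bracket a b) nilpotent"
      unfolding jacobi[OF carr] a(2) b0 using g1_carrier[OF g0_g1_bracket[OF ab nilpotent_g1]] by simp
    then show ?thesis using ab unfolding tangent_space_def by blast
  qed
  fix \<xi> assume \<xi>: "\<xi> \<in> carrier (dual_space (dual_space (quotient_space V ?U)))"
  interpret Q: quotient_by_subspace V ?U
    using tangent_submodule[of nilpotent] nilpotent_g1 by (intro quotient_by_subspace.intro V_vs) simp
  have U_van: "slice_functional P u = 0" if "slice_space d P" "u \<in> ?U" for P u
    using that tangent_slice_functional unfolding tangent_space_def by blast
  have desc: "descend V ?U (slice_functional P) \<in> carrier (dual_space Q.N)" if "slice_space d P" for P
    using that U_van by (intro Q.descend_in_dual) (simp_all add: slice_functional_linear)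
  \<comment> \<open>Only the values of \<open>\<xi>\<close> on functionals from the slice enter, and
    there it is the pairing with an array \<open>R\<close>.\<close>
  define l where "l P = \<xi> (descend V ?U (slice_functional P))" for P
  have "\<exists>R. slice_space d R \<and> (\<forall>P. slice_space d P \<longrightarrow> l P = pairing R P)"
  proof (rule slice_space_riesz)
    fix P R :: "nat \<Rightarrow> nat \<Rightarrow> 'k m2" assume P: "slice_space d P" and R: "slice_space d R"
    have "descend V ?U (slice_functional (\<lambda>i j. P i j + R i j)) = descend V ?U (slice_functional P) \<oplus>\<^bsub>dual_space Q.N\<^esub> descend V ?U (slice_functional R)"
      by (simp add: descend_def dual_space_simps slice_functional_def pairing_linear_left fun_eq_iff)
    then show "l (\<lambda>i j. P i j + R i j) = l P + l R"
      using \<xi> desc[OF P] desc[OF R] unfolding l_def in_dual_space[of \<xi>] by simp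
    show "l P = l R" if "\<And>i j. i < 3 \<Longrightarrow> j < 2 \<Longrightarrow> P i j = R i j"
    proof -
      have "slice_functional P = slice_functional R"
        unfolding slice_functional_def[abs_def] using pairing_cong[of P R, OF that] by auto
      then show ?thesis by (simp add: l_def)
    qed
  next
    fix c and P :: "nat \<Rightarrow> nat \<Rightarrow> 'k m2" assume P: "slice_space d P"
    have "descend V ?U (slice_functional (\<lambda>i j. scal c * P i j)) = c \<odot>\<^bsub>dual_space Q.N\<^esub> descend V ?U (slice_functional P)"
      by (simp add: descend_def dual_space_simps slice_functional_def pairing_linear_left fun_eq_iff)
    then show "l (\<lambda>i j. scal c * P i j) = c * l P"
      using \<xi> desc[OF P] unfolding l_def in_dual_space[of \<xi>] by simp
  qed
  then obtain R where R: "slice_space d R" and lR: "\<And>P. slice_space d P \<Longrightarrow> l P = pairing R P" by blast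
  have R': "top_hermitian R" "\<forall>i<3. \<forall>j<2. in_alg d (R i j)" using R unfolding slice_space_def by blast+
  obtain P :: "nat \<Rightarrow> nat \<Rightarrow> nat \<Rightarrow> 'k m2" where
    P: "\<And>k. k < 4 \<Longrightarrow> slice_space d (P k)"
      "\<And>k A. k < 4 \<Longrightarrow> skew_2_1 A \<Longrightarrow> pairing R (slice_action A (P k)) = 0"
    and indep: "\<And>c. (\<forall>i<3. \<forall>j<2. (\<Sum>k<4. scal (c k) * P k i j) = 0) \<Longrightarrow> (\<forall>k<4. c k = 0)"
    using four_annihilated_vectors[OF R'] unfolding slice_space_def by blast
  define f where "f k = (\<lambda>w\<in>g1. slice_functional (P k) w)" for k
  show "\<exists>f :: nat \<Rightarrow> _. (\<forall>i<4. f i \<in> carrier (dual_space V) \<and> (\<forall>u\<in>?U. f i u = 0) \<and>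
         (\<forall>a\<in>?S. \<xi> (descend V ?U (\<lambda>v. - f i (lie_bracket a v))) = 0)) \<and>
       (\<forall>c. (\<forall>v\<in>carrier V. (\<Sum>i<4. c i * f i v) = 0) \<longrightarrow> (\<forall>i<4. c i = 0))"
  proof (intro exI[of _ f] conjI allI impI ballI)
    fix k :: nat assume k: "k < 4"
    show "f k \<in> carrier (dual_space V)"
      unfolding in_dual_space f_def by (simp add: slice_functional_linear g1_closed)
    show "f k u = 0" if "u \<in> ?U" for u
      using U_van[OF P(1)[OF k] that] Q.U_subset that by (auto simp: f_def)
    fix a assume a: "a \<in> ?S"
    then have a0: "a \<in> g0" by (simp add: lie_stabiliser_def)
    obtain A where A: "skew_2_1 A" "\<forall>i<3. \<forall>j<3. in_alg d (A i j)"
      and act: "\<And>P w. w \<in> g1 \<Longrightarrow> - slice_functional P (lie_bracket a w) = slice_functional (slice_action A P) w"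
      using stabiliser_slice_functional[OF a] by blast
    have Pk: "\<forall>i<3. \<forall>j<2. in_alg d (P k i j)" "top_hermitian (P k)" using P(1)[OF k] unfolding slice_space_def by blast+
    have sl: "slice_space d (slice_action A (P k))"
      unfolding slice_space_def by (intro conjI allI impI slice_action_top_hermitian[OF Pk(2) A(1)] slice_action_in_alg[OF A(2) Pk(1)])
    have "descend V ?U (\<lambda>v. - f k (lie_bracket a v)) = descend V ?U (slice_functional (slice_action A (P k)))"
    proof
      fix C
      show "descend V ?U (\<lambda>v. - f k (lie_bracket a v)) C = descend V ?U (slice_functional (slice_action A (P k))) C"
      proof (cases "C \<in> carrier Q.N")
        case True
        then obtain v where v: "v \<in> g1" "C = ?U +>\<^bsub>V\<^esub> v" by (auto simp: Q.carrier_N)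
        \<comment> \<open>The representative used by \<open>descend\<close> has to lie in
          \<open>g1\<close>, where \<open>f k\<close> agrees with the slice functional.\<close>
        have "v \<in> C" unfolding v(2) by (rule Q.coset_self) (simp only: V_simps v(1))
        then have "(SOME w. w \<in> C) \<in> C" by (rule someI)
        moreover have "w \<in> g1" if w: "w \<in> C" for w
        proof -
          obtain u where u: "u \<in> ?U" "w = u + v" using w unfolding v(2) Q.coset_mem V_simps by blast
          have "u \<in> g1" using subsetD[OF Q.U_subset u(1)] by (simp only: V_simps)
          then show ?thesis unfolding u(2) using v(1) by (rule g1_closed(1))
        qed
        ultimately have "(SOME w. w \<in> C) \<in> g1" by blast
        then show ?thesis using True act g0_g1_bracket[OF a0] by (simp add: descend_def f_def)
      qed (simp add: descend_def)
    qed
    then show "\<xi> (descend V ?U (\<lambda>v. - f k (lie_bracket a v))) = 0"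
      using lR[OF sl] P(2)[OF k A(1)] by (simp add: l_def)
  next
    fix c :: "nat \<Rightarrow> 'k" and k :: nat assume c: "\<forall>v\<in>carrier V. (\<Sum>i<4. c i * f i v) = 0" and k: "k < 4"
    have "(\<Sum>k<4. scal (c k) * P k i j) = 0" if ij: "i < 3" "j < 2" for i j
    proof (rule tr_nondegenerate)
      have "in_alg d (P k i j)" if "k < 4" for k using P(1)[OF that] ij unfolding slice_space_def by blast
      then show "in_alg d (\<Sum>k<4. scal (c k) * P k i j)" by (intro in_alg_sum) simp
      fix x :: "'k m2" assume x: "in_alg d x"
      have Zg: "Z i (3 + 2 * j) x \<in> g1" using x ij by (intro Z_g1) auto
      have "tr (adj (\<Sum>k<4. scal (c k) * P k i j) * x) = (\<Sum>k<4. c k * tr (adj (P k i j) * x))"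
        by (simp add: adj_sum adj_mult sum_distrib_right tr_sum scal_commute mult.assoc tr_simps)
      also have "\<dots> = (\<Sum>k<4. c k * f k (Z i (3 + 2 * j) x))"
        using Zg by (simp add: f_def slice_functional_Z[OF x ij])
      also have "\<dots> = 0" using c Zg by simp
      finally show "tr (adj (\<Sum>k<4. scal (c k) * P k i j) * x) = 0" .
    qed
    then show "c k = 0" using indep[of c] k by blast
  qed
qed

end

section \<open>Orthonormal and symplectic bases\<close>

lemma vec_subspace_simps[simp]:
  "carrier (vec_subspace N U) = U" "add (vec_subspace N U) = (+)" "module.smult (vec_subspace N U) = (\<cdot>\<^sub>v)"
  "zero (vec_subspace N U) = 0\<^sub>v N"
  by (simp_all add: vec_subspace_def module_vec_simps)

locale vec_subspace_loc =
  fixes N :: nat and U :: "'k::field vec set"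
  assumes subspace: "VectorSpace.subspace class_ring U (module_vec TYPE('k) N)"
begin

lemma vs: "vectorspace class_ring (vec_subspace N U)"
  using vectorspace.subspace_is_vs[OF vec_vs subspace] by (simp add: vec_subspace_def)

lemma carr: "u \<in> U \<Longrightarrow> u \<in> carrier_vec N"
  and add: "u \<in> U \<Longrightarrow> w \<in> U \<Longrightarrow> u + w \<in> U"
  and smult: "u \<in> U \<Longrightarrow> c \<cdot>\<^sub>v u \<in> U"
  and zero: "0\<^sub>v N \<in> U"
  using subspace by (auto simp: VectorSpace.subspace_def submodule_def module_vec_simps)

lemma fin_dim: "vectorspace.fin_dim class_ring (vec_subspace N U)"
proof (rule vdim_le_functionals(1)[OF vs, of "{..<N}" "\<lambda>i v. v $ i"])
  show "v = \<zero>\<^bsub>vec_subspace N U\<^esub>" if "v \<in> carrier (vec_subspace N U)" "\<And>j. j \<in> {..<N} \<Longrightarrow> v $ j = 0" for v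
    using that carr[of v] by (intro eq_vecI) auto
qed (auto dest!: carr)

lemma minus: "u \<in> U \<Longrightarrow> w \<in> U \<Longrightarrow> u - w \<in> U"
proof -
  assume "u \<in> U" "w \<in> U"
  then have "u + (-1) \<cdot>\<^sub>v w \<in> U" by (intro add smult)
  moreover have "u + (-1) \<cdot>\<^sub>v w = u - w" using carr[OF \<open>u \<in> U\<close>] carr[OF \<open>w \<in> U\<close>] by (intro eq_vecI) auto
  ultimately show ?thesis by simp
qed

lemma lin_comb: "(\<And>i. i < r \<Longrightarrow> b i \<in> U) \<Longrightarrow> vec N (\<lambda>k. \<Sum>i<r. c i * b i $ k) \<in> U" for r :: nat
proof (induction r)
  case 0
  have "vec N (\<lambda>k. \<Sum>i<0. c i * b i $ k) = 0\<^sub>v N" by (intro eq_vecI) auto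
  then show ?case using zero by simp
next
  case (Suc r)
  have "vec N (\<lambda>k. \<Sum>i<Suc r. c i * b i $ k) = vec N (\<lambda>k. \<Sum>i<r. c i * b i $ k) + c r \<cdot>\<^sub>v b r"
    using carr[OF Suc.prems[of r]] by (intro eq_vecI) auto
  then show ?case using Suc by (simp add: add smult)
qed

text \<open>The length of the family is the dimension, so the dimensions prescribed in the theorem
  give families of known length; their independence will follow from invertibility of the basis
  matrix.\<close>

lemma spanning_family:
  "\<exists>b. (\<forall>i<vdim (vec_subspace N U). b i \<in> U) \<and>
    (\<forall>u\<in>U. \<exists>c. \<forall>k<N. u $ k = (\<Sum>i<vdim (vec_subspace N U). c i * b i $ k))"
proof -
  interpret V: vectorspace class_ring "vec_subspace N U" by (rule vs)
  obtain \<beta> where \<beta>: "finite \<beta>" "V.basis \<beta>" using V.finite_basis_exists[OF fin_dim] by blast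
  have \<beta>U: "\<beta> \<subseteq> U" "V.span \<beta> = U" using \<beta>(2) unfolding V.basis_def vec_subspace_simps by blast+
  have card: "card \<beta> = V.dim" using V.dim_basis[OF \<beta>] by simp
  obtain b where b: "bij_betw b {..<card \<beta>} \<beta>"
    using ex_bij_betw_nat_finite[OF \<beta>(1)] by (auto simp: atLeast0LessThan)
  have eval: "V.lincomb a B $ k = (\<Sum>v\<in>B. a v * v $ k)" if "finite B" "B \<subseteq> U" "k < N" for a B k
    using that
  proof (induction B rule: finite_induct)
    case (insert x B)
    have "V.lincomb a (insert x B) = a x \<odot>\<^bsub>vec_subspace N U\<^esub> x \<oplus>\<^bsub>vec_subspace N U\<^esub> V.lincomb a B"
      using insert.hyps insert.prems by (intro V.lincomb_insert2) auto
    moreover have "V.lincomb a B \<in> U" using V.lincomb_closed[of B a] insert.prems by auto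
    ultimately show ?case using insert carr[of x] carr[of "V.lincomb a B"] by simp
  qed (simp add: V.lincomb_def)
  have "\<exists>c. \<forall>k<N. u $ k = (\<Sum>i<V.dim. c i * b i $ k)" if u: "u \<in> U" for u
  proof -
    have "u \<in> V.span \<beta>" using u \<beta>U(2) by simp
    then obtain a where "V.lincomb a \<beta> = u"
      using V.finite_in_span[of \<beta> u] \<beta> \<beta>U(1) by auto
    then have "u $ k = (\<Sum>v\<in>\<beta>. a v * v $ k)" if "k < N" for k using eval[OF \<beta>(1) \<beta>U(1) that] by blast
    moreover have "(\<Sum>v\<in>\<beta>. a v * v $ k) = (\<Sum>i<V.dim. a (b i) * b i $ k)" for k
      unfolding card[symmetric] by (rule sum.reindex_bij_betw[OF b, symmetric])
    ultimately show ?thesis by (intro exI[of _ "\<lambda>i. a (b i)"]) simp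
  qed
  moreover have "b i \<in> U" if "i < V.dim" for i using b \<beta>U(1) that unfolding bij_betw_def card by blast
  ultimately show ?thesis by (intro exI[of _ b]) blast
qed

text \<open>Functionals biorthogonal to a family are independent, so \<open>r\<close> is at most the
  dimension of the dual of \<open>U\<close>, and this is at most the dimension of
  \<open>U\<close>.\<close>

lemma frame_le:
  fixes \<phi> :: "nat \<Rightarrow> 'k vec \<Rightarrow> 'k"
  assumes lin: "\<And>i u w. i < r \<Longrightarrow> u \<in> U \<Longrightarrow> w \<in> U \<Longrightarrow> \<phi> i (u + w) = \<phi> i u + \<phi> i w" "\<And>i c u. i < r \<Longrightarrow> u \<in> U \<Longrightarrow> \<phi> i (c \<cdot>\<^sub>v u) = c * \<phi> i u"
    and b: "\<And>i. i < r \<Longrightarrow> b i \<in> U" and \<delta>: "\<And>i j. i < r \<Longrightarrow> j < r \<Longrightarrow> \<phi> i (b j) = (if i = j then 1 else 0)"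
  shows "r \<le> vdim (vec_subspace N U)"
proof -
  interpret V: vectorspace class_ring "vec_subspace N U" by (rule vs)
  let ?D = "dual_space (vec_subspace N U)"
  have Dvs: "vectorspace class_ring ?D" by (rule dual_space_vectorspace) (auto simp: add smult)
  interpret D: vectorspace class_ring ?D by (rule Dvs)
  obtain \<beta> where \<beta>: "finite \<beta>" "V.basis \<beta>" using V.finite_basis_exists[OF fin_dim] by blast
  have \<beta>U: "\<beta> \<subseteq> U" "V.span \<beta> = U" using \<beta>(2) unfolding V.basis_def vec_subspace_simps by blast+
  have inj: "f = \<zero>\<^bsub>?D\<^esub>" if f: "f \<in> carrier ?D" "\<And>p. p \<in> \<beta> \<Longrightarrow> f p = 0" for f
  proof -
    have "f u = 0" if "u \<in> U" for u
      using functional_zero[OF vs f(1) _ f(2), of \<beta> u] \<beta>U that by simp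
    then show ?thesis using f(1) by (auto simp: dual_space_simps in_dual_space extensional_def fun_eq_iff)
  qed
  have ev: "(f \<oplus>\<^bsub>?D\<^esub> g) p = f p + g p" "(c \<odot>\<^bsub>?D\<^esub> f) p = c * f p" if "p \<in> \<beta>" for f g p c
    using that \<beta>U by (auto simp: dual_space_simps)
  have Dfin: "D.fin_dim" and Ddim: "D.dim \<le> card \<beta>"
    using vdim_le_functionals[OF Dvs \<beta>(1), of "\<lambda>p f. f p", OF ev(1) ev(2) inj] by blast+
  define f where "f i = (\<lambda>u\<in>U. \<phi> i u)" for i
  have fD: "f i \<in> carrier ?D" if "i < r" for i
    using that lin unfolding in_dual_space f_def by (simp add: add smult)
  have indep: "c j = 0" if c: "\<And>v. v \<in> carrier (vec_subspace N U) \<Longrightarrow> (\<Sum>i<r. c i * f i v) = 0" and j: "j < r" for c j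
  proof -
    have "(\<Sum>i<r. c i * f i (b j)) = (\<Sum>i<r. if i = j then c j else 0)"
      using j b[OF j] by (intro sum.cong refl) (auto simp: f_def \<delta>)
    then show ?thesis using c[of "b j"] b[OF j] j by simp
  qed
  have "\<not> D.lin_dep (f ` {..<r})" "card (f ` {..<r}) = r"
  proof -
    note * = dual_lin_indpt[OF Dvs, of r f]
    show "\<not> D.lin_dep (f ` {..<r})" by (rule *(1)) (fact fD indep)+
    show "card (f ` {..<r}) = r" by (rule *(2)) (fact fD indep)+
  qed
  then have "r \<le> D.dim" using D.li_le_dim(2)[OF Dfin, of "f ` {..<r}"] fD by auto
  then show ?thesis using Ddim V.dim_basis[OF \<beta>] by simp
qed

lemma frame_ge:
  fixes \<phi> :: "nat \<Rightarrow> 'k vec \<Rightarrow> 'k"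
  assumes lin: "\<And>i u w. i < r \<Longrightarrow> u \<in> U \<Longrightarrow> w \<in> U \<Longrightarrow> \<phi> i (u + w) = \<phi> i u + \<phi> i w" "\<And>i c u. i < r \<Longrightarrow> u \<in> U \<Longrightarrow> \<phi> i (c \<cdot>\<^sub>v u) = c * \<phi> i u"
    and inj: "\<And>u. u \<in> U \<Longrightarrow> (\<And>i. i < r \<Longrightarrow> \<phi> i u = 0) \<Longrightarrow> u = 0\<^sub>v N"
  shows "vdim (vec_subspace N U) \<le> r"
  using vdim_le_functionals(2)[OF vs, of "{..<r}" \<phi>] lin inj by simp

end

lemma bilinear_form_linear:
  fixes J :: "'k::field mat"
  assumes "J \<in> carrier_mat N N" "x \<in> carrier_vec N" "y \<in> carrier_vec N" "z \<in> carrier_vec N"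
  shows "bilinear_form J (x + y) z = bilinear_form J x z + bilinear_form J y z"
    and "bilinear_form J z (x + y) = bilinear_form J z x + bilinear_form J z y"
    and "bilinear_form J (c \<cdot>\<^sub>v x) z = c * bilinear_form J x z"
    and "bilinear_form J z (c \<cdot>\<^sub>v x) = c * bilinear_form J z x"
  unfolding bilinear_form_def using assms
  by (simp_all add: add_scalar_prod_distrib[of _ N] mult_add_distrib_mat_vec[of _ N N]
      scalar_prod_add_distrib[of _ N] mult_mat_vec[of _ N N])

lemma bilinear_form_sum:
  fixes J :: "'k::field mat" and r :: nat
  assumes J: "J \<in> carrier_mat N N" and b: "\<And>i. i < r \<Longrightarrow> b i \<in> carrier_vec N" and z: "z \<in> carrier_vec N"
  shows "bilinear_form J z (vec N (\<lambda>k. \<Sum>i<r. c i * b i $ k)) = (\<Sum>i<r. c i * bilinear_form J z (b i))"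
  using b
proof (induction r)
  case 0
  have "vec N (\<lambda>k. \<Sum>i<0. c i * b i $ k) = 0 \<cdot>\<^sub>v 0\<^sub>v N" by (intro eq_vecI) auto
  then show ?case using bilinear_form_linear(4)[OF J, of "0\<^sub>v N" "0\<^sub>v N" z 0] z by simp
next
  case (Suc r)
  have br: "b r \<in> carrier_vec N" using Suc.prems by simp
  have "vec N (\<lambda>k. \<Sum>i<Suc r. c i * b i $ k) = vec N (\<lambda>k. \<Sum>i<r. c i * b i $ k) + c r \<cdot>\<^sub>v b r"
    using br by (intro eq_vecI) auto
  then show ?case using Suc br z J by (simp add: bilinear_form_linear[of _ N])
qed

locale form_subspace = vec_subspace_loc N U for N and U :: "'k::field_char_0 vec set" +
  fixes J :: "'k mat"
  assumes J: "J \<in> carrier_mat N N"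
    and nondeg: "nondegenerate_on N J U"
begin

abbreviation B where "B \<equiv> bilinear_form J"

text \<open>A common frame for both kinds of forms: \<open>d\<close> is \<open>b\<close> itself for
  orthonormal families and consists of signed partners in the symplectic case.\<close>

definition dual_families :: "nat \<Rightarrow> (nat \<Rightarrow> 'k vec) \<Rightarrow> (nat \<Rightarrow> 'k vec) \<Rightarrow> bool" where
  "dual_families r b d \<longleftrightarrow> (\<forall>i<r. b i \<in> U \<and> d i \<in> U) \<and> (\<forall>i<r. \<forall>j<r. B (d i) (b j) = (if i = j then 1 else 0))"

lemma B_linear:
  assumes "x \<in> U" "y \<in> U" "z \<in> U"
  shows "B (x + y) z = B x z + B y z" "B z (x + y) = B z x + B z y"
    "B (c \<cdot>\<^sub>v x) z = c * B x z" "B z (c \<cdot>\<^sub>v x) = c * B z x"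
  using bilinear_form_linear[OF J, of x y z] assms carr by auto

lemma dual_families_le: "dual_families r b d \<Longrightarrow> r \<le> vdim (vec_subspace N U)"
  unfolding dual_families_def by (rule frame_le[of r "\<lambda>i. B (d i)" b]) (auto simp: B_linear)

definition proj where "proj r b d y = y - vec N (\<lambda>k. \<Sum>i<r. B (d i) y * b i $ k)" for r :: nat

lemma proj:
  assumes D: "dual_families r b d" and y: "y \<in> U"
  shows "proj r b d y \<in> U" "\<And>i. i < r \<Longrightarrow> B (d i) (proj r b d y) = 0"
    "\<And>x. x \<in> U \<Longrightarrow> B x y = B x (proj r b d y) + (\<Sum>i<r. B (d i) y * B x (b i))"
proof -
  have bU: "\<And>i. i < r \<Longrightarrow> b i \<in> U" and dU: "\<And>i. i < r \<Longrightarrow> d i \<in> U"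
    and db: "\<And>i j. i < r \<Longrightarrow> j < r \<Longrightarrow> B (d i) (b j) = (if i = j then 1 else 0)" using D unfolding dual_families_def by auto
  let ?s = "vec N (\<lambda>k. \<Sum>i<r. B (d i) y * b i $ k)"
  have sU: "?s \<in> U" by (rule lin_comb) (rule bU)
  show pU: "proj r b d y \<in> U" unfolding proj_def using y sU by (rule minus)
  have eq: "y = proj r b d y + ?s" unfolding proj_def using carr[OF y] by (intro eq_vecI) auto
  show split: "B x y = B x (proj r b d y) + (\<Sum>i<r. B (d i) y * B x (b i))" if x: "x \<in> U" for x
  proof -
    have "B x y = B x (proj r b d y) + B x ?s" by (subst eq) (rule B_linear(2)[OF pU sU x])
    then show ?thesis using bilinear_form_sum[OF J, of r b x] bU carr x by simp
  qed
  show "B (d i) (proj r b d y) = 0" if i: "i < r" for i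
  proof -
    have "(\<Sum>j<r. B (d j) y * B (d i) (b j)) = (\<Sum>j<r. if j = i then B (d i) y else 0)"
      using i by (intro sum.cong) (auto simp: db)
    then show ?thesis using split[OF dU[OF i]] i by simp
  qed
qed

text \<open>If no nonzero vector is orthogonal to all \<open>d i\<close>, the remainder
  \<open>proj\<close> of every vector vanishes, and this is its expansion in the family
  \<open>b\<close>.\<close>

lemma spanning_dual_families:
  assumes D: "dual_families r b d" and inj: "\<And>u. u \<in> U \<Longrightarrow> (\<And>i. i < r \<Longrightarrow> B (d i) u = 0) \<Longrightarrow> u = 0\<^sub>v N"
  shows "r = vdim (vec_subspace N U)" "\<And>u k. u \<in> U \<Longrightarrow> k < N \<Longrightarrow> u $ k = (\<Sum>i<r. B (d i) u * b i $ k)"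
proof -
  have "vdim (vec_subspace N U) \<le> r"
    using D inj unfolding dual_families_def by (intro frame_ge[of r "\<lambda>i. B (d i)"]) (auto simp: B_linear)
  then show "r = vdim (vec_subspace N U)" using dual_families_le[OF D] by simp
  fix u k assume u: "u \<in> U" and k: "k < N"
  have "proj r b d u = 0\<^sub>v N" using proj[OF D u] inj by blast
  then have "proj r b d u $ k = 0" using k by simp
  then show "u $ k = (\<Sum>i<r. B (d i) u * b i $ k)" unfolding proj_def using k carr[OF u] by simp
qed

end

text \<open>Take a largest orthonormal family. A vector orthogonal to it with
  \<open>B x x \<noteq> 0\<close> could be normalised by a square root and adjoined, so the
  orthogonal complement is totally isotropic, and nondegeneracy makes it zero.\<close>

lemma (in form_subspace) orthonormal_basis:
  assumes sym: "\<And>x y. x \<in> U \<Longrightarrow> y \<in> U \<Longrightarrow> B y x = B x y" and root: "\<And>x :: 'k. \<exists>s. s * s = x"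
  shows "\<exists>b. (\<forall>i<vdim (vec_subspace N U). b i \<in> U) \<and>
    (\<forall>i<vdim (vec_subspace N U). \<forall>j<vdim (vec_subspace N U). B (b i) (b j) = (if i = j then 1 else 0)) \<and>
    (\<forall>u\<in>U. \<exists>c. \<forall>k<N. u $ k = (\<Sum>i<vdim (vec_subspace N U). c i * b i $ k))"
proof -
  define P where "P r \<longleftrightarrow> (\<exists>b. dual_families r b b)" for r
  have "P 0" unfolding P_def dual_families_def by simp
  moreover have "r \<le> vdim (vec_subspace N U)" if "P r" for r using that dual_families_le unfolding P_def by blast
  ultimately obtain r where r: "P r" and max: "\<And>r'. P r' \<Longrightarrow> r' \<le> r"
    using Nat.ex_has_greatest_nat[of P 0 "vdim (vec_subspace N U)"] by auto
  obtain b where D: "dual_families r b b" using r unfolding P_def by blast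
  have bU: "\<And>i. i < r \<Longrightarrow> b i \<in> U" using D unfolding dual_families_def by blast
  have bb: "\<And>i j. i < r \<Longrightarrow> j < r \<Longrightarrow> B (b i) (b j) = (if i = j then 1 else 0)" using D unfolding dual_families_def by blast
  have iso: "B x x = 0" if x: "x \<in> U" and orth: "\<And>i. i < r \<Longrightarrow> B (b i) x = 0" for x
  proof (rule ccontr)
    assume ne: "B x x \<noteq> 0"
    obtain s where s: "s * s = B x x" using root by blast
    then have s0: "s \<noteq> 0" using ne by auto
    define z where "z = inverse s \<cdot>\<^sub>v x"
    have zU: "z \<in> U" unfolding z_def by (rule smult[OF x])
    have "B z z = inverse s * B x z" unfolding z_def by (rule B_linear(3)[OF x x smult[OF x]])
    also have "B x z = inverse s * (s * s)" unfolding z_def s by (rule B_linear(4)[OF x x x])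
    finally have zz: "B z z = 1" using s0 by (simp add: field_simps)
    have zb: "B (b i) z = 0" "B z (b i) = 0" if "i < r" for i
    proof -
      show "B (b i) z = 0" unfolding z_def using B_linear(4)[OF x x bU[OF that]] orth[OF that] by simp
      then show "B z (b i) = 0" using sym[OF bU[OF that] zU] by simp
    qed
    define b' where "b' i = (if i = r then z else b i)" for i
    have "dual_families (Suc r) b' b'"
      unfolding dual_families_def
    proof (intro conjI allI impI)
      fix i assume i: "i < Suc r"
      show "b' i \<in> U" using i bU zU by (simp add: b'_def)
      then show "b' i \<in> U" .
      fix j assume j: "j < Suc r"
      show "B (b' i) (b' j) = (if i = j then 1 else 0)"
        using i j bb[of i j] zb zz by (cases "i = r"; cases "j = r") (simp_all add: b'_def)
    qed
    then show False using max[of "Suc r"] unfolding P_def by auto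
  qed
  have inj: "x = 0\<^sub>v N" if x: "x \<in> U" and orth: "\<And>i. i < r \<Longrightarrow> B (b i) x = 0" for x
  proof -
    \<comment> \<open>Only the component of \<open>y\<close> orthogonal to the family matters, and
      on the complement the form vanishes by polarisation.\<close>
    have "B x y = 0" if y: "y \<in> U" for y
    proof -
      let ?y = "proj r b b y"
      note p = proj[OF D y]
      have xy: "x + ?y \<in> U" using x p(1) by (rule add)
      have "B (x + ?y) (x + ?y) = B x x + B x ?y + (B ?y x + B ?y ?y)"
        using B_linear(1)[OF x p(1) xy] B_linear(2)[OF x p(1) x] B_linear(2)[OF x p(1) p(1)] by simp
      moreover have "B (x + ?y) (x + ?y) = 0"
        using orth p(2) bU B_linear(2)[OF x p(1)] by (intro iso xy) simp
      ultimately have "2 * B x ?y = 0" using iso[OF x orth] iso[OF p(1) p(2)] sym[OF x p(1)] by simp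
      then have "B x ?y = 0" by simp
      moreover have "B x (b i) = 0" if "i < r" for i using sym[OF bU[OF that] x] orth[OF that] by simp
      ultimately show ?thesis using p(3)[OF x] by simp
    qed
    then show ?thesis using nondeg x unfolding nondegenerate_on_def by blast
  qed
  have dim: "r = vdim (vec_subspace N U)"
    by (rule spanning_dual_families(1)[OF D]) (rule inj)
  have "u $ k = (\<Sum>i<r. B (b i) u * b i $ k)" if "u \<in> U" "k < N" for u k
    by (rule spanning_dual_families(2)[OF D _ that]) (rule inj)
  then have "\<exists>c. \<forall>k<N. u $ k = (\<Sum>i<r. c i * b i $ k)" if "u \<in> U" for u
    using that by (intro exI[of _ "\<lambda>i. B (b i) u"]) blast
  then show ?thesis using bU bb unfolding dim[symmetric] by blast
qed

text \<open>The partners of a hyperbolic pair are neighbours rather than half the dimension apart,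
  so that each pair fills one \<open>2 \<times> 2\<close> block.\<close>

definition symplectic_gram :: "nat \<Rightarrow> nat \<Rightarrow> 'k::field" where
  "symplectic_gram i j = (if even i \<and> j = Suc i then 1 else if even j \<and> i = Suc j then -1 else 0)"

text \<open>Take a largest family of hyperbolic pairs. A nonzero vector orthogonal to it has a
  partner by nondegeneracy, and after projection and scaling of the partner the family grows by one
  pair.\<close>

lemma (in form_subspace) symplectic_basis:
  assumes alt: "\<And>x. x \<in> U \<Longrightarrow> B x x = 0"
  shows "\<exists>b. (\<forall>i<vdim (vec_subspace N U). b i \<in> U) \<and>
    (\<forall>i<vdim (vec_subspace N U). \<forall>j<vdim (vec_subspace N U). B (b i) (b j) = symplectic_gram i j) \<and>
    (\<forall>u\<in>U. \<exists>c. \<forall>k<N. u $ k = (\<Sum>i<vdim (vec_subspace N U). c i * b i $ k))"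
proof -
  have skew: "B y x = - B x y" if "x \<in> U" "y \<in> U" for x y
  proof -
    have xy: "x + y \<in> U" using that by (rule add)
    have "B (x + y) (x + y) = B x x + B x y + (B y x + B y y)"
      using B_linear(1)[OF that xy] B_linear(2)[OF that that(1)] B_linear(2)[OF that that(2)] by simp
    then have "B x y + B y x = 0" using alt that xy by simp
    then show ?thesis by (simp add: add_eq_0_iff)
  qed
  \<comment> \<open>The dual of a basis vector is its partner in the hyperbolic pair, up to
    sign.\<close>
  define dd where "dd b i = (if even i then (-1) \<cdot>\<^sub>v b (Suc i) else b (i - 1))" for b :: "nat \<Rightarrow> 'k vec" and i :: nat
  define gram where "gram r b \<longleftrightarrow> (\<forall>i<r. b i \<in> U) \<and> (\<forall>i<r. \<forall>j<r. B (b i) (b j) = symplectic_gram i j)" for r :: nat and b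
  have D: "dual_families (2 * r) b (dd b)" if g: "gram (2 * r) b" for r b
  proof -
    have ddU: "dd b i \<in> U" if "i < 2 * r" for i
    proof (cases "even i")
      case True
      then have "Suc i < 2 * r" using that by presburger
      then show ?thesis using g True unfolding gram_def dd_def by (simp add: smult)
    next
      case False
      then show ?thesis using g that unfolding gram_def dd_def by simp
    qed
    have "B (dd b i) (b j) = (if i = j then 1 else 0)" if ij: "i < 2 * r" "j < 2 * r" for i j
    proof (cases "even i")
      case True
      then have S: "Suc i < 2 * r" using ij by presburger
      then have "b (Suc i) \<in> U" "b j \<in> U" "B (b (Suc i)) (b j) = symplectic_gram (Suc i) j" using g ij unfolding gram_def by auto
      then have "B (dd b i) (b j) = - symplectic_gram (Suc i) j" using True B_linear(3)[of "b (Suc i)" "b (Suc i)" "b j"] by (simp add: dd_def)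
      then show ?thesis using True by (auto simp: symplectic_gram_def)
    next
      case False
      then have "B (b (i - 1)) (b j) = symplectic_gram (i - 1) j" using g ij unfolding gram_def by auto
      moreover have "symplectic_gram (i - 1) j = (if i = j then 1 else 0 :: 'k)"
      proof -
        obtain m where m: "i = Suc (2 * m)" using False by (auto elim!: oddE)
        have "\<not> (even j \<and> 2 * m = Suc j)" by presburger
        then show ?thesis using m by (auto simp: symplectic_gram_def)
      qed
      ultimately show ?thesis using False by (simp add: dd_def)
    qed
    then show ?thesis using g ddU unfolding dual_families_def gram_def by blast
  qed
  define P where "P r \<longleftrightarrow> (\<exists>b. gram (2 * r) b)" for r
  have "P 0" unfolding P_def gram_def by simp
  moreover have "r \<le> vdim (vec_subspace N U)" if "P r" for r
    using that D dual_families_le unfolding P_def by (metis le_add2 le_trans mult_2)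
  ultimately obtain r where r: "P r" and max: "\<And>r'. P r' \<Longrightarrow> r' \<le> r"
    using Nat.ex_has_greatest_nat[of P 0 "vdim (vec_subspace N U)"] by auto
  obtain b where g: "gram (2 * r) b" using r unfolding P_def by blast
  have bU: "\<And>i. i < 2 * r \<Longrightarrow> b i \<in> U" using g unfolding gram_def by blast
  have bb: "\<And>i j. i < 2 * r \<Longrightarrow> j < 2 * r \<Longrightarrow> B (b i) (b j) = symplectic_gram i j" using g unfolding gram_def by blast
  have orth_b: "B (b i) x = 0" "B x (b i) = 0" if x: "x \<in> U" and orth: "\<And>i. i < 2 * r \<Longrightarrow> B (dd b i) x = 0" and i: "i < 2 * r" for x i
  proof -
    show "B (b i) x = 0"
    proof (cases "even i")
      case True
      then have S: "Suc i < 2 * r" using i by presburger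
      show ?thesis using orth[OF S] True by (simp add: dd_def)
    next
      case False
      then have "B ((-1) \<cdot>\<^sub>v b i) x = 0" using orth[of "i - 1"] i by (auto simp: dd_def elim!: oddE)
      then show ?thesis using B_linear(3)[OF bU[OF i] bU[OF i] x] by simp
    qed
    then show "B x (b i) = 0" using skew[OF bU[OF i] x] by simp
  qed
  have inj: "x = 0\<^sub>v N" if x: "x \<in> U" and orth: "\<And>i. i < 2 * r \<Longrightarrow> B (dd b i) x = 0" for x
  proof (rule ccontr)
    assume "x \<noteq> 0\<^sub>v N"
    then obtain y where y: "y \<in> U" "B x y \<noteq> 0" using nondeg x unfolding nondegenerate_on_def by blast
    \<comment> \<open>The projection does not change the value against \<open>x\<close>, as
      \<open>x\<close> is orthogonal to the family.\<close>
    define z where "z = proj (2 * r) b (dd b) y"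
    note p = proj[OF D[OF g] y(1), folded z_def]
    have "B x y = B x z" using p(3)[OF x] orth_b(2)[OF x orth] by simp
    then have xz: "B x z \<noteq> 0" using y(2) by simp
    define w where "w = inverse (B x z) \<cdot>\<^sub>v z"
    have wU: "w \<in> U" unfolding w_def by (rule smult[OF p(1)])
    have xw: "B x w = 1" unfolding w_def using B_linear(4)[OF p(1) p(1) x] xz by simp
    have wx: "B w x = - 1" using skew[OF x wU] xw by simp
    have w_orth: "B (dd b i) w = 0" if "i < 2 * r" for i
    proof -
      have "dd b i \<in> U" using D[OF g] that unfolding dual_families_def by blast
      then show ?thesis unfolding w_def using B_linear(4)[OF p(1) p(1)] p(2)[OF that] by simp
    qed
    define b' where "b' i = (if i < 2 * r then b i else if i = 2 * r then x else w)" for i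
    have "gram (2 * Suc r) b'"
      unfolding gram_def
    proof (intro conjI allI impI)
      fix i assume i: "i < 2 * Suc r"
      show "b' i \<in> U" using bU x wU by (simp add: b'_def)
      fix j assume j: "j < 2 * Suc r"
      have "i < 2 * r \<or> i = 2 * r \<or> i = Suc (2 * r)" "j < 2 * r \<or> j = 2 * r \<or> j = Suc (2 * r)" using i j by auto
      \<comment> \<open>Excludes a link between the last old index and the new index
        \<open>2 * r\<close>: they are neighbours, but the smaller one is odd.\<close>
      moreover have parity: "odd m" if "2 * r = Suc m" for m using that by presburger
      ultimately show "B (b' i) (b' j) = symplectic_gram i j"
        using bb orth_b[OF x orth] orth_b[OF wU w_orth] alt[OF x] alt[OF wU] xw wx
        by (elim disjE) (auto simp: b'_def symplectic_gram_def dest: parity)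
    qed
    then show False using max[of "Suc r"] unfolding P_def by auto
  qed
  have dim: "2 * r = vdim (vec_subspace N U)"
    by (rule spanning_dual_families(1)[OF D[OF g]]) (rule inj)
  have "u $ k = (\<Sum>i<2 * r. B (dd b i) u * b i $ k)" if "u \<in> U" "k < N" for u k
    by (rule spanning_dual_families(2)[OF D[OF g] _ that]) (rule inj)
  then have "\<exists>c. \<forall>k<N. u $ k = (\<Sum>i<2 * r. c i * b i $ k)" if "u \<in> U" for u
    using that by (intro exI[of _ "\<lambda>i. B (dd b i) u"]) blast
  then show ?thesis using bU bb unfolding dim[symmetric] by blast
qed

section \<open>Matrices in an adapted basis\<close>

definition basis_matrix :: "nat \<Rightarrow> (nat \<Rightarrow> 'k::field vec) \<Rightarrow> 'k mat" where
  "basis_matrix N b = mat N N (\<lambda>(k, i). b i $ k)"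

lemma basis_matrix_carrier[simp]: "basis_matrix N b \<in> carrier_mat N N"
  by (simp add: basis_matrix_def)

lemma basis_matrix_mult_vec:
  assumes "c \<in> carrier_vec N"
  shows "basis_matrix N b *\<^sub>v c = vec N (\<lambda>k. \<Sum>i<N. c $ i * b i $ k)"
  using assms by (intro eq_vecI) (auto simp: basis_matrix_def scalar_prod_def atLeast0LessThan mult.commute intro!: sum.cong)

lemma sum_shift: "(\<Sum>i<N. f i) = (\<Sum>i<p. f i) + (\<Sum>i<N - p. f (p + i))" if "p \<le> N" for f :: "nat \<Rightarrow> 'k::comm_monoid_add"
proof -
  have "(\<Sum>i<N. f i) = (\<Sum>i<p. f i) + (\<Sum>i=p..<N. f i)"
    using sum.atLeastLessThan_concat[of 0 p N f] that by (simp add: atLeast0LessThan)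
  also have "(\<Sum>i=p..<N. f i) = (\<Sum>i<N - p. f (p + i))"
    using that by (intro sum.reindex_bij_witness[of _ "\<lambda>i. p + i" "\<lambda>i. i - p"]) auto
  finally show ?thesis .
qed

lemma conj_cancel:
  fixes A B Y :: "'k::field mat"
  assumes A: "A \<in> carrier_mat N N" and B: "B \<in> carrier_mat N N" and Y: "Y \<in> carrier_mat N N" and BA: "B * A = 1\<^sub>m N"
  shows "B * (A * Y * B) * A = Y"
proof -
  have "A * Y \<in> carrier_mat N N" using A Y by (rule mult_carrier_mat)
  then have "B * (A * Y * B) = B * (A * Y) * B" using B by (intro assoc_mult_mat[symmetric, of _ N N _ N _ N])
  also have "B * (A * Y) = B * A * Y" using A B Y by (intro assoc_mult_mat[symmetric, of _ N N _ N _ N])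
  also have "\<dots> = Y" using BA Y by simp
  finally have "B * (A * Y * B) * A = Y * B * A" by simp
  also have "\<dots> = Y * (B * A)" using A B Y by (intro assoc_mult_mat[of _ N N _ N _ N])
  finally show ?thesis using BA Y by simp
qed

lemma mult_mat_vec_entry:
  fixes A :: "'k::field mat"
  assumes "A \<in> carrier_mat N N" "c \<in> carrier_vec N" "i < N"
  shows "(A *\<^sub>v c) $ i = (\<Sum>j<N. A $$ (i, j) * c $ j)"
  using assms by (auto simp: scalar_prod_def atLeast0LessThan intro!: sum.cong)

lemma mult_mat_unit_vec:
  fixes A :: "'k::field mat"
  assumes "A \<in> carrier_mat N N" "j < N"
  shows "A *\<^sub>v unit_vec N j = col A j"
  using assms by (intro eq_vecI) (simp_all add: scalar_prod_right_unit)

text \<open>Spanning families of these lengths suffice: \<open>U\<close> and \<open>W\<close> span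
  the whole space, so the square basis matrix has a right inverse and is invertible.\<close>

locale adapted_basis =
  fixes N p :: nat and U W :: "'k::field_char_0 vec set" and b :: "nat \<Rightarrow> 'k vec"
  assumes decomposition: "direct_decomposition N U W" and p: "p \<le> N"
    and bU: "\<And>i. i < p \<Longrightarrow> b i \<in> U" and bW: "\<And>i. p \<le> i \<Longrightarrow> i < N \<Longrightarrow> b i \<in> W"
    and spanU: "\<And>u. u \<in> U \<Longrightarrow> \<exists>c. \<forall>k<N. u $ k = (\<Sum>i<p. c i * b i $ k)"
    and spanW: "\<And>w. w \<in> W \<Longrightarrow> \<exists>c. \<forall>k<N. w $ k = (\<Sum>i<N - p. c i * b (p + i) $ k)"
begin

sublocale U: vec_subspace_loc N U
  by (rule vec_subspace_loc.intro, rule decomposition[unfolded direct_decomposition_def, THEN conjunct1])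

sublocale W: vec_subspace_loc N W
  by (rule vec_subspace_loc.intro, rule decomposition[unfolded direct_decomposition_def, THEN conjunct2, THEN conjunct1])

abbreviation M where "M \<equiv> basis_matrix N b"

lemma U_coords: "u \<in> U \<Longrightarrow> \<exists>c\<in>carrier_vec N. u = M *\<^sub>v c \<and> (\<forall>i<N. p \<le> i \<longrightarrow> c $ i = 0)"
proof -
  assume u: "u \<in> U"
  then obtain c where c: "\<forall>k<N. u $ k = (\<Sum>i<p. c i * b i $ k)" using spanU by blast
  let ?c = "vec N (\<lambda>i. if i < p then c i else 0)"
  have "u = M *\<^sub>v ?c"
    using U.carr[OF u] p c by (intro eq_vecI) (simp_all add: basis_matrix_mult_vec sum_shift[OF p])
  then show ?thesis by (intro bexI[of _ ?c]) auto
qed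

lemma W_coords: "w \<in> W \<Longrightarrow> \<exists>c\<in>carrier_vec N. w = M *\<^sub>v c \<and> (\<forall>i<N. i < p \<longrightarrow> c $ i = 0)"
proof -
  assume w: "w \<in> W"
  then obtain c where c: "\<forall>k<N. w $ k = (\<Sum>i<N - p. c i * b (p + i) $ k)" using spanW by blast
  let ?c = "vec N (\<lambda>i. if i < p then 0 else c (i - p))"
  have "w = M *\<^sub>v ?c"
    using W.carr[OF w] p c by (intro eq_vecI) (simp_all add: basis_matrix_mult_vec sum_shift[OF p])
  then show ?thesis by (intro bexI[of _ ?c]) auto
qed

lemma basis_matrix_surj: "x \<in> carrier_vec N \<Longrightarrow> \<exists>c\<in>carrier_vec N. M *\<^sub>v c = x"
proof -
  assume x: "x \<in> carrier_vec N"
  moreover have "U <+>\<^bsub>module_vec TYPE('k) N\<^esub> W = carrier_vec N"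
    using decomposition unfolding direct_decomposition_def by (elim conjE)
  ultimately obtain u w where uw: "u \<in> U" "w \<in> W" "x = u + w"
    unfolding set_add_def' module_vec_simps by blast
  obtain c where c: "c \<in> carrier_vec N" "u = M *\<^sub>v c" using U_coords[OF uw(1)] by blast
  obtain e where e: "e \<in> carrier_vec N" "w = M *\<^sub>v e" using W_coords[OF uw(2)] by blast
  have "M *\<^sub>v (c + e) = x"
    unfolding uw(3) c(2) e(2) using c(1) e(1) by (simp add: mult_add_distrib_mat_vec[OF basis_matrix_carrier])
  then show ?thesis using c(1) e(1) by (intro bexI[of _ "c + e"]) auto
qed

definition M' where "M' = (SOME B. B \<in> carrier_mat N N \<and> M * B = 1\<^sub>m N \<and> B * M = 1\<^sub>m N)"

lemma M': "M' \<in> carrier_mat N N" "M * M' = 1\<^sub>m N" "M' * M = 1\<^sub>m N"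
proof -
  have "\<exists>c. c \<in> carrier_vec N \<and> M *\<^sub>v c = unit_vec N j" for j
    using basis_matrix_surj[of "unit_vec N j"] by auto
  then obtain c where c: "\<And>j. c j \<in> carrier_vec N" "\<And>j. M *\<^sub>v c j = unit_vec N j" by metis
  define B where "B = mat N N (\<lambda>(i, j). c j $ i)"
  have B: "B \<in> carrier_mat N N" by (simp add: B_def)
  have "M * B = 1\<^sub>m N"
  proof (rule eq_matI)
    fix i j assume "i < dim_row (1\<^sub>m N)" "j < dim_col (1\<^sub>m N)"
    then have ij: "i < N" "j < N" by simp_all
    have "col B j = c j" using c(1)[of j] ij by (intro eq_vecI) (auto simp: B_def)
    then have "(M * B) $$ (i, j) = (M *\<^sub>v c j) $ i" using ij B by (simp add: basis_matrix_def)
    then show "(M * B) $$ (i, j) = 1\<^sub>m N $$ (i, j)" using ij by (simp add: c(2) unit_vec_def)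
  qed (simp_all add: B_def basis_matrix_def)
  then have "\<exists>B. B \<in> carrier_mat N N \<and> M * B = 1\<^sub>m N \<and> B * M = 1\<^sub>m N"
    using mat_mult_left_right_inverse[OF basis_matrix_carrier B] B by blast
  from someI_ex[OF this] show "M' \<in> carrier_mat N N" "M * M' = 1\<^sub>m N" "M' * M = 1\<^sub>m N"
    unfolding M'_def by blast+
qed

lemma M_M'_vec: "x \<in> carrier_vec N \<Longrightarrow> M *\<^sub>v (M' *\<^sub>v x) = x" "x \<in> carrier_vec N \<Longrightarrow> M' *\<^sub>v (M *\<^sub>v x) = x"
  using assoc_mult_mat_vec[OF basis_matrix_carrier M'(1), of x b] assoc_mult_mat_vec[OF M'(1) basis_matrix_carrier, of x b] M'
  by simp_all

lemma U_iff: "u \<in> U \<longleftrightarrow> u \<in> carrier_vec N \<and> (\<forall>i<N. p \<le> i \<longrightarrow> (M' *\<^sub>v u) $ i = 0)"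
proof
  assume u: "u \<in> U"
  then obtain c where c: "c \<in> carrier_vec N" "u = M *\<^sub>v c" "\<forall>i<N. p \<le> i \<longrightarrow> c $ i = 0" using U_coords by blast
  then show "u \<in> carrier_vec N \<and> (\<forall>i<N. p \<le> i \<longrightarrow> (M' *\<^sub>v u) $ i = 0)"
    using M_M'_vec(2)[OF c(1)] U.carr[OF u] by simp
next
  assume u: "u \<in> carrier_vec N \<and> (\<forall>i<N. p \<le> i \<longrightarrow> (M' *\<^sub>v u) $ i = 0)"
  let ?c = "M' *\<^sub>v u"
  have c: "?c \<in> carrier_vec N" using M'(1) u by (intro mult_mat_vec_carrier) auto
  have "u = vec N (\<lambda>k. \<Sum>i<N. ?c $ i * b i $ k)"
    using M_M'_vec(1)[of u] u basis_matrix_mult_vec[OF c, of b] by simp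
  also have "\<dots> = vec N (\<lambda>k. \<Sum>i<p. ?c $ i * b i $ k)"
    using u p by (intro eq_vecI) (auto simp: sum_shift[OF p] intro!: sum.neutral)
  also have "\<dots> \<in> U" by (rule U.lin_comb) (rule bU)
  finally show "u \<in> U" .
qed

lemma W_iff: "w \<in> W \<longleftrightarrow> w \<in> carrier_vec N \<and> (\<forall>i<N. i < p \<longrightarrow> (M' *\<^sub>v w) $ i = 0)"
proof
  assume w: "w \<in> W"
  then obtain c where c: "c \<in> carrier_vec N" "w = M *\<^sub>v c" "\<forall>i<N. i < p \<longrightarrow> c $ i = 0" using W_coords by blast
  then show "w \<in> carrier_vec N \<and> (\<forall>i<N. i < p \<longrightarrow> (M' *\<^sub>v w) $ i = 0)"
    using M_M'_vec(2)[OF c(1)] W.carr[OF w] by simp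
next
  assume w: "w \<in> carrier_vec N \<and> (\<forall>i<N. i < p \<longrightarrow> (M' *\<^sub>v w) $ i = 0)"
  let ?c = "M' *\<^sub>v w"
  have c: "?c \<in> carrier_vec N" using M'(1) w by (intro mult_mat_vec_carrier) auto
  have "w = vec N (\<lambda>k. \<Sum>i<N. ?c $ i * b i $ k)"
    using M_M'_vec(1)[of w] w basis_matrix_mult_vec[OF c, of b] by simp
  also have "\<dots> = vec N (\<lambda>k. \<Sum>i<N - p. ?c $ (p + i) * b (p + i) $ k)"
    using w p by (intro eq_vecI) (auto simp: sum_shift[OF p] intro!: sum.neutral)
  also have "\<dots> \<in> W" using p by (intro W.lin_comb bW) auto
  finally show "w \<in> W" .
qed

text \<open>In coordinates \<open>U\<close> is given by the vanishing of the last
  \<open>N - p\<close> entries and \<open>W\<close> by that of the first \<open>p\<close>; to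
  preserve both is to have two zero off-diagonal blocks.\<close>

lemma preserves_iff:
  assumes X: "X \<in> carrier_mat N N"
  shows "(\<forall>u\<in>U. X *\<^sub>v u \<in> U) \<and> (\<forall>w\<in>W. X *\<^sub>v w \<in> W) \<longleftrightarrow>
    (\<forall>i<N. \<forall>j<N. (i < p) \<noteq> (j < p) \<longrightarrow> (M' * X * M) $$ (i, j) = 0)"
proof -
  let ?X = "M' * X * M"
  have X': "?X \<in> carrier_mat N N" using M'(1) X by (intro mult_carrier_mat[of _ N N]) simp_all
  have conj: "M' *\<^sub>v (X *\<^sub>v (M *\<^sub>v c)) = ?X *\<^sub>v c" if "c \<in> carrier_vec N" for c
    using M'(1) X that basis_matrix_carrier[of N b] by (simp add: assoc_mult_mat_vec[of _ N N _ N] mult_mat_vec_carrier[of _ N N] mult_carrier_mat[of _ N N])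
  have Xc: "X *\<^sub>v x \<in> carrier_vec N" if "x \<in> carrier_vec N" for x using X that by simp
  have Mc: "M *\<^sub>v x \<in> carrier_vec N" if "x \<in> carrier_vec N" for x by (rule mult_mat_vec_carrier[OF basis_matrix_carrier that])
  note entry = mult_mat_vec_entry[OF X']
  have unit: "(?X *\<^sub>v unit_vec N j) $ i = ?X $$ (i, j)" if "i < N" "j < N" for i j
    using that X' unfolding mult_mat_unit_vec[OF X' that(2)] by (intro index_col) (simp_all only: carrier_matD)
  have uM: "M' *\<^sub>v (M *\<^sub>v unit_vec N j) = unit_vec N j" for j by (rule M_M'_vec) simp
  show ?thesis
  proof
    assume pres: "(\<forall>u\<in>U. X *\<^sub>v u \<in> U) \<and> (\<forall>w\<in>W. X *\<^sub>v w \<in> W)"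
    show "\<forall>i<N. \<forall>j<N. (i < p) \<noteq> (j < p) \<longrightarrow> ?X $$ (i, j) = 0"
    proof (intro allI impI)
      fix i j assume ij: "i < N" "j < N" "(i < p) \<noteq> (j < p)"
      have "(M' *\<^sub>v (X *\<^sub>v (M *\<^sub>v unit_vec N j))) $ i = 0"
      proof (cases "j < p")
        case True
        have "M *\<^sub>v unit_vec N j \<in> U" unfolding U_iff uM using True Mc by auto
        then have "X *\<^sub>v (M *\<^sub>v unit_vec N j) \<in> U" using pres by blast
        then show ?thesis using ij True unfolding U_iff by simp
      next
        case False
        have "M *\<^sub>v unit_vec N j \<in> W" unfolding W_iff uM using False ij Mc by auto
        then have "X *\<^sub>v (M *\<^sub>v unit_vec N j) \<in> W" using pres by blast
        then show ?thesis using ij False unfolding W_iff by simp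
      qed
      then show "?X $$ (i, j) = 0" using conj[of "unit_vec N j"] unit ij by simp
    qed
  next
    assume block: "\<forall>i<N. \<forall>j<N. (i < p) \<noteq> (j < p) \<longrightarrow> ?X $$ (i, j) = 0"
    have coords: "M' *\<^sub>v (X *\<^sub>v x) = ?X *\<^sub>v (M' *\<^sub>v x)" if "x \<in> carrier_vec N" for x
      using conj[of "M' *\<^sub>v x"] M_M'_vec(1)[OF that] M'(1) that by simp
    have M'c: "M' *\<^sub>v x \<in> carrier_vec N" if "x \<in> carrier_vec N" for x using M'(1) that by (intro mult_mat_vec_carrier)
    have "X *\<^sub>v u \<in> U" if u: "u \<in> U" for u
    proof -
      have uc: "u \<in> carrier_vec N" and u0: "\<forall>i<N. p \<le> i \<longrightarrow> (M' *\<^sub>v u) $ i = 0" using u unfolding U_iff by blast+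
      have "(?X *\<^sub>v (M' *\<^sub>v u)) $ i = 0" if i: "i < N" "p \<le> i" for i
        unfolding entry[OF M'c[OF uc] i(1)]
      proof (rule sum.neutral, rule ballI)
        fix j assume "j \<in> {..<N}"
        then show "?X $$ (i, j) * (M' *\<^sub>v u) $ j = 0" using block u0 i by (cases "j < p") auto
      qed
      then show ?thesis unfolding U_iff coords[OF uc] using Xc[OF uc] by blast
    qed
    moreover have "X *\<^sub>v w \<in> W" if w: "w \<in> W" for w
    proof -
      have wc: "w \<in> carrier_vec N" and w0: "\<forall>i<N. i < p \<longrightarrow> (M' *\<^sub>v w) $ i = 0" using w unfolding W_iff by blast+
      have "(?X *\<^sub>v (M' *\<^sub>v w)) $ i = 0" if i: "i < N" "i < p" for i
        unfolding entry[OF M'c[OF wc] i(1)]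
      proof (rule sum.neutral, rule ballI)
        fix j assume "j \<in> {..<N}"
        then show "?X $$ (i, j) * (M' *\<^sub>v w) $ j = 0" using block w0 i by (cases "j < p") auto
      qed
      then show ?thesis unfolding W_iff coords[OF wc] using Xc[OF wc] by blast
    qed
    ultimately show "(\<forall>u\<in>U. X *\<^sub>v u \<in> U) \<and> (\<forall>w\<in>W. X *\<^sub>v w \<in> W)" by blast
  qed
qed

lemma conj_eq_iff:
  assumes "X \<in> carrier_mat N N" "Y \<in> carrier_mat N N"
  shows "X = M * Y * M' \<longleftrightarrow> M' * X * M = Y"
proof -
  have "M' * (M * Y * M') * M = Y" by (rule conj_cancel[OF basis_matrix_carrier M'(1) assms(2) M'(3)])
  moreover have "M * (M' * X * M) * M' = X" by (rule conj_cancel[OF M'(1) basis_matrix_carrier assms(1) M'(2)])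
  ultimately show ?thesis by metis
qed

end

section \<open>Form algebras in an adapted basis\<close>

lemma bilinear_form_transpose:
  fixes J :: "'k::field mat"
  assumes "J \<in> carrier_mat N N" "x \<in> carrier_vec N" "y \<in> carrier_vec N"
  shows "bilinear_form J x y = bilinear_form (transpose_mat J) y x"
proof -
  have "(transpose_mat J *\<^sub>v x) \<bullet> y = x \<bullet> (J *\<^sub>v y)" by (rule transpose_vec_mult_scalar[OF assms(1,3,2)])
  moreover have "(transpose_mat J *\<^sub>v x) \<bullet> y = y \<bullet> (transpose_mat J *\<^sub>v x)"
    using assms by (intro comm_scalar_prod[of _ N] mult_mat_vec_carrier[of _ N N]) simp_all
  ultimately show ?thesis unfolding bilinear_form_def by simp
qed

lemma bilinear_form_sum_left:
  fixes J :: "'k::field mat" and r :: nat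
  assumes J: "J \<in> carrier_mat N N" and b: "\<And>i. i < r \<Longrightarrow> b i \<in> carrier_vec N" and z: "z \<in> carrier_vec N"
  shows "bilinear_form J (vec N (\<lambda>k. \<Sum>i<r. c i * b i $ k)) z = (\<Sum>i<r. c i * bilinear_form J (b i) z)"
proof -
  have Jt: "transpose_mat J \<in> carrier_mat N N" using J by simp
  have "(\<Sum>i<r. c i * bilinear_form J (b i) z) = (\<Sum>i<r. c i * bilinear_form (transpose_mat J) z (b i))"
    by (intro sum.cong refl arg_cong2[of _ _ _ _ "(*)"] bilinear_form_transpose[OF J] z b) simp
  then show ?thesis
    using bilinear_form_sum[OF Jt b z, where c = c] bilinear_form_transpose[OF J vec_carrier z] by simp
qed

text \<open>Collects infinitesimal invariance into the vanishing of a single bilinear form, which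
  can then be tested on basis vectors.\<close>

lemma bilinear_form_infinitesimal:
  fixes J X :: "'k::field mat"
  assumes J: "J \<in> carrier_mat N N" and X: "X \<in> carrier_mat N N" and x: "x \<in> carrier_vec N" and y: "y \<in> carrier_vec N"
  shows "bilinear_form J (X *\<^sub>v x) y + bilinear_form J x (X *\<^sub>v y) = bilinear_form (transpose_mat X * J + J * X) x y"
proof -
  have Jy: "J *\<^sub>v y \<in> carrier_vec N" and Xt: "transpose_mat X \<in> carrier_mat N N" and Xx: "X *\<^sub>v x \<in> carrier_vec N"
    using J X x y by simp_all
  have XtJ: "transpose_mat X * J \<in> carrier_mat N N" "J * X \<in> carrier_mat N N" using Xt J X by (auto intro: mult_carrier_mat[of _ N N])
  have "(X *\<^sub>v x) \<bullet> (J *\<^sub>v y) = x \<bullet> (transpose_mat X *\<^sub>v (J *\<^sub>v y))"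
  proof -
    have "x \<bullet> (transpose_mat X *\<^sub>v (J *\<^sub>v y)) = (transpose_mat (transpose_mat X) *\<^sub>v x) \<bullet> (J *\<^sub>v y)"
      by (rule transpose_vec_mult_scalar[OF Xt Jy x, symmetric])
    then show ?thesis by simp
  qed
  also have "transpose_mat X *\<^sub>v (J *\<^sub>v y) = (transpose_mat X * J) *\<^sub>v y"
    by (rule assoc_mult_mat_vec[OF Xt J y, symmetric])
  finally have "bilinear_form J (X *\<^sub>v x) y = x \<bullet> ((transpose_mat X * J) *\<^sub>v y)" by (simp add: bilinear_form_def)
  moreover have "bilinear_form J x (X *\<^sub>v y) = x \<bullet> ((J * X) *\<^sub>v y)"
    unfolding bilinear_form_def by (subst assoc_mult_mat_vec[OF J X y]) (rule refl)
  moreover have "x \<bullet> ((transpose_mat X * J + J * X) *\<^sub>v y) = x \<bullet> ((transpose_mat X * J) *\<^sub>v y) + x \<bullet> ((J * X) *\<^sub>v y)"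
    unfolding add_mult_distrib_mat_vec[OF XtJ y]
    using x y XtJ by (intro scalar_prod_add_distrib[of _ N] mult_mat_vec_carrier[of _ N N])
  ultimately show ?thesis by (simp add: bilinear_form_def)
qed

context adapted_basis
begin

lemma basis_carrier: "i < N \<Longrightarrow> b i \<in> carrier_vec N"
  using bU[of i] bW[of i] U.carr W.carr by (cases "i < p") auto

lemma basis_spans: "x \<in> carrier_vec N \<Longrightarrow> \<exists>c. x = vec N (\<lambda>k. \<Sum>i<N. c i * b i $ k)"
  using basis_matrix_surj[of x] basis_matrix_mult_vec[of _ N b] by metis

lemma mult_basis_vec:
  assumes X: "X \<in> carrier_mat N N" and s: "s < N"
  shows "X *\<^sub>v b s = vec N (\<lambda>k. \<Sum>i<N. (M' * X * M) $$ (i, s) * b i $ k)"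
proof -
  let ?X = "M' * X * M"
  have MX: "M' * X \<in> carrier_mat N N" using M'(1) X by (rule mult_carrier_mat)
  then have X': "?X \<in> carrier_mat N N" by (rule mult_carrier_mat) simp
  have bs: "b s = M *\<^sub>v unit_vec N s"
    unfolding mult_mat_unit_vec[OF basis_matrix_carrier s] using basis_carrier[OF s] s
    by (intro eq_vecI) (auto simp: basis_matrix_def)
  have XM: "X * M \<in> carrier_mat N N" using X by (rule mult_carrier_mat) simp
  have "M * ?X = X * M"
  proof -
    have "?X = M' * (X * M)" by (rule assoc_mult_mat[OF M'(1) X basis_matrix_carrier])
    then have "M * ?X = M * M' * (X * M)" by (simp only: assoc_mult_mat[OF basis_matrix_carrier M'(1) XM])
    then show ?thesis unfolding M'(2) left_mult_one_mat[OF XM] .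
  qed
  then have "X *\<^sub>v b s = (M * ?X) *\<^sub>v unit_vec N s"
    unfolding bs using assoc_mult_mat_vec[OF X basis_matrix_carrier, of "unit_vec N s" b] by simp
  also have "\<dots> = M *\<^sub>v (?X *\<^sub>v unit_vec N s)"
    by (rule assoc_mult_mat_vec[OF basis_matrix_carrier X']) simp
  also have "?X *\<^sub>v unit_vec N s = col ?X s" by (rule mult_mat_unit_vec[OF X' s])
  also have "M *\<^sub>v col ?X s = vec N (\<lambda>k. \<Sum>i<N. col ?X s $ i * b i $ k)"
    by (rule basis_matrix_mult_vec) (rule col_carrier_vec[OF s X'])
  also have "\<dots> = vec N (\<lambda>k. \<Sum>i<N. ?X $$ (i, s) * b i $ k)"
  proof -
    have "col ?X s $ i = ?X $$ (i, s)" if "i < N" for i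
      using X' s that by (intro index_col) (simp_all only: carrier_matD)
    then show ?thesis by simp
  qed
  finally show ?thesis .
qed

lemma form_algebra_iff:
  assumes J: "J \<in> carrier_mat N N" and K: "\<And>i j. i < N \<Longrightarrow> j < N \<Longrightarrow> bilinear_form J (b i) (b j) = K i j"
  shows "X \<in> form_algebra N J \<longleftrightarrow> X \<in> carrier_mat N N \<and>
    (\<forall>r<N. \<forall>s<N. (\<Sum>k<N. (M' * X * M) $$ (k, r) * K k s) + (\<Sum>k<N. (M' * X * M) $$ (k, s) * K r k) = 0)"
proof (cases "X \<in> carrier_mat N N")
  case X: True
  define G where "G = transpose_mat X * J + J * X"
  have G: "G \<in> carrier_mat N N" unfolding G_def using J X by (intro add_carrier_mat mult_carrier_mat[of _ N N])
  have basis_value: "bilinear_form G (b r) (b s) =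
      (\<Sum>k<N. (M' * X * M) $$ (k, r) * K k s) + (\<Sum>k<N. (M' * X * M) $$ (k, s) * K r k)" if "r < N" "s < N" for r s
  proof -
    have "bilinear_form G (b r) (b s) = bilinear_form J (X *\<^sub>v b r) (b s) + bilinear_form J (b r) (X *\<^sub>v b s)"
      unfolding G_def using bilinear_form_infinitesimal[OF J X basis_carrier[OF that(1)] basis_carrier[OF that(2)]] by (rule sym)
    also have "\<dots> = (\<Sum>k<N. (M' * X * M) $$ (k, r) * bilinear_form J (b k) (b s)) +
        (\<Sum>k<N. (M' * X * M) $$ (k, s) * bilinear_form J (b r) (b k))"
      unfolding mult_basis_vec[OF X that(1)] mult_basis_vec[OF X that(2)]
      by (intro arg_cong2[of _ _ _ _ "(+)"] bilinear_form_sum_left[OF J] bilinear_form_sum[OF J] basis_carrier that) simp_all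
    finally show ?thesis using K that by simp
  qed
  have "(\<forall>x\<in>carrier_vec N. \<forall>y\<in>carrier_vec N. bilinear_form G x y = 0) \<longleftrightarrow> (\<forall>r<N. \<forall>s<N. bilinear_form G (b r) (b s) = 0)"
  proof
    assume "\<forall>x\<in>carrier_vec N. \<forall>y\<in>carrier_vec N. bilinear_form G x y = 0"
    then show "\<forall>r<N. \<forall>s<N. bilinear_form G (b r) (b s) = 0" using basis_carrier by blast
  next
    assume 0: "\<forall>r<N. \<forall>s<N. bilinear_form G (b r) (b s) = 0"
    show "\<forall>x\<in>carrier_vec N. \<forall>y\<in>carrier_vec N. bilinear_form G x y = 0"
    proof (intro ballI)
      fix x y :: "'k vec" assume x: "x \<in> carrier_vec N" and y: "y \<in> carrier_vec N"
      obtain c where c: "x = vec N (\<lambda>k. \<Sum>i<N. c i * b i $ k)" using basis_spans[OF x] by blast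
      obtain e where e: "y = vec N (\<lambda>k. \<Sum>i<N. e i * b i $ k)" using basis_spans[OF y] by blast
      have "bilinear_form G (b r) y = 0" if "r < N" for r
      proof -
        have "bilinear_form G (b r) y = (\<Sum>i<N. e i * bilinear_form G (b r) (b i))"
          unfolding e by (rule bilinear_form_sum[OF G _ basis_carrier[OF that]]) (rule basis_carrier)
        also have "\<dots> = 0" using 0 that by (intro sum.neutral) simp
        finally show ?thesis .
      qed
      moreover have "bilinear_form G x y = (\<Sum>i<N. c i * bilinear_form G (b i) y)"
        unfolding c by (rule bilinear_form_sum_left[OF G _ y]) (rule basis_carrier)
      ultimately show "bilinear_form G x y = 0" by simp
    qed
  qed
  moreover have "X \<in> form_algebra N J \<longleftrightarrow> (\<forall>x\<in>carrier_vec N. \<forall>y\<in>carrier_vec N. bilinear_form G x y = 0)"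
    unfolding form_algebra_def G_def using bilinear_form_infinitesimal[OF J X] X by simp
  ultimately show ?thesis using X basis_value by simp
qed (simp add: form_algebra_def)

text \<open>Conjugation by the basis matrix transports every condition of the model, so what is left
  to supply is a coordinate map \<open>\<mu>\<close> describing \<open>g\<close> and its
  blocks.\<close>

lemma skew_hermitian_model_in_basis:
  fixes \<mu> :: "(nat \<Rightarrow> nat \<Rightarrow> 'k m2) \<Rightarrow> 'k mat"
  assumes n: "7 \<le> n" and I: "I * I = (-1 :: 'k)"
    and \<mu>_carrier: "\<And>y. \<mu> y \<in> carrier_mat N N"
    and \<mu>_add: "\<And>y z. \<mu> (\<lambda>i j. y i j + z i j) = \<mu> y + \<mu> z"
    and \<mu>_smult: "\<And>c y. \<mu> (\<lambda>i j. scal c * y i j) = c \<cdot>\<^sub>m \<mu> y"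
    and \<mu>_mult: "\<And>y z. (\<And>i j. i < n \<Longrightarrow> j < n \<Longrightarrow> in_alg d (y i j)) \<Longrightarrow> (\<And>i j. i < n \<Longrightarrow> j < n \<Longrightarrow> in_alg d (z i j)) \<Longrightarrow>
      \<mu> (mat_prod n y z) = \<mu> y * \<mu> z"
    and \<mu>_cong: "\<And>y z. (\<And>i j. i < n \<Longrightarrow> j < n \<Longrightarrow> y i j = z i j) \<Longrightarrow> \<mu> y = \<mu> z"
    and \<mu>_zeroD: "\<And>y i j. skew_hermitian n d y \<Longrightarrow> \<mu> y = 0\<^sub>m N N \<Longrightarrow> i < n \<Longrightarrow> j < n \<Longrightarrow> y i j = 0"
    and \<mu>_block: "\<And>y. skew_hermitian n d y \<Longrightarrow>
      block_diagonal n y \<longleftrightarrow> (\<forall>i<N. \<forall>j<N. (i < p) \<noteq> (j < p) \<longrightarrow> \<mu> y $$ (i, j) = 0)"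
    and g: "\<And>X. X \<in> g \<longleftrightarrow> X \<in> carrier_mat N N \<and> (\<exists>y. skew_hermitian n d y \<and> M' * X * M = \<mu> y)"
  shows "skew_hermitian_model N n d I (\<lambda>y. M * \<mu> y * M') g (preserving g U W)"
proof
  have M\<mu>: "M * \<mu> y \<in> carrier_mat N N" for y using \<mu>_carrier by (intro mult_carrier_mat[of _ N N]) simp_all
  show carrier: "M * \<mu> y * M' \<in> carrier_mat N N" for y using M\<mu> M'(1) by (rule mult_carrier_mat)
  have M'\<mu>: "\<mu> y * M' \<in> carrier_mat N N" for y using \<mu>_carrier M'(1) by (rule mult_carrier_mat)
  show "M * \<mu> (\<lambda>i j. y i j + z i j) * M' = M * \<mu> y * M' + M * \<mu> z * M'" for y z
    unfolding \<mu>_add mult_add_distrib_mat[OF basis_matrix_carrier \<mu>_carrier \<mu>_carrier]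
    by (rule add_mult_distrib_mat[OF M\<mu> M\<mu> M'(1)])
  show "M * \<mu> (\<lambda>i j. scal c * y i j) * M' = c \<cdot>\<^sub>m (M * \<mu> y * M')" for c y
    unfolding \<mu>_smult mult_smult_distrib[OF basis_matrix_carrier \<mu>_carrier]
    by (rule mult_smult_assoc_mat[OF M\<mu> M'(1)])
  show "M * \<mu> (mat_prod n y z) * M' = M * \<mu> y * M' * (M * \<mu> z * M')"
    if "\<And>i j. i < n \<Longrightarrow> j < n \<Longrightarrow> in_alg d (y i j)" "\<And>i j. i < n \<Longrightarrow> j < n \<Longrightarrow> in_alg d (z i j)" for y z
  proof -
    have "M * \<mu> y * M' * (M * \<mu> z * M') = M * \<mu> y * (M' * (M * (\<mu> z * M')))"
      unfolding assoc_mult_mat[OF basis_matrix_carrier \<mu>_carrier M'(1)]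
        assoc_mult_mat[OF basis_matrix_carrier M'\<mu> mult_carrier_mat[OF basis_matrix_carrier M'\<mu>]]
        assoc_mult_mat[OF \<mu>_carrier M'(1) mult_carrier_mat[OF basis_matrix_carrier M'\<mu>]]
        assoc_mult_mat[OF basis_matrix_carrier \<mu>_carrier mult_carrier_mat[OF M'(1) mult_carrier_mat[OF basis_matrix_carrier M'\<mu>]]]
      by (rule refl)
    also have "M' * (M * (\<mu> z * M')) = M' * M * (\<mu> z * M')"
      by (rule assoc_mult_mat[OF M'(1) basis_matrix_carrier M'\<mu>, symmetric])
    also have "\<dots> = \<mu> z * M'" unfolding M'(3) by (rule left_mult_one_mat[OF M'\<mu>])
    also have "M * \<mu> y * (\<mu> z * M') = M * \<mu> y * \<mu> z * M'"
      by (rule assoc_mult_mat[OF M\<mu> \<mu>_carrier M'(1), symmetric])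
    also have "M * \<mu> y * \<mu> z = M * (\<mu> y * \<mu> z)"
      by (rule assoc_mult_mat[OF basis_matrix_carrier \<mu>_carrier \<mu>_carrier])
    also have "\<mu> y * \<mu> z = \<mu> (mat_prod n y z)" by (rule \<mu>_mult[symmetric]) (fact that)+
    finally show ?thesis by (rule sym)
  qed
  show "M * \<mu> y * M' = M * \<mu> z * M'" if "\<And>i j. i < n \<Longrightarrow> j < n \<Longrightarrow> y i j = z i j" for y z
    using \<mu>_cong[OF that] by simp
  have inv: "M' * X * M = \<mu> y \<longleftrightarrow> X = M * \<mu> y * M'" if "X \<in> carrier_mat N N" for X y
    using conj_eq_iff[OF that \<mu>_carrier] by blast
  show "y i j = 0" if y: "skew_hermitian n d y" and 0: "M * \<mu> y * M' = 0\<^sub>m N N" and ij: "i < n" "j < n" for y i j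
  proof (rule \<mu>_zeroD[OF y _ ij])
    have "M' * 0\<^sub>m N N * M = \<mu> y" unfolding inv[OF zero_carrier_mat] 0 ..
    then show "\<mu> y = 0\<^sub>m N N"
      unfolding right_mult_zero_mat[OF M'(1)] left_mult_zero_mat[OF basis_matrix_carrier] by (rule sym)
  qed
  show geq: "g = (\<lambda>y. M * \<mu> y * M') ` {X. skew_hermitian n d X}"
  proof (intro equalityI subsetI)
    fix X assume "X \<in> g"
    then obtain y where "X \<in> carrier_mat N N" "skew_hermitian n d y" "M' * X * M = \<mu> y" unfolding g by blast
    then show "X \<in> (\<lambda>y. M * \<mu> y * M') ` {X. skew_hermitian n d X}" using inv[of X y] by blast
  next
    fix X assume "X \<in> (\<lambda>y. M * \<mu> y * M') ` {X. skew_hermitian n d X}"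
    then obtain y where y: "skew_hermitian n d y" "X = M * \<mu> y * M'" by blast
    then have "X \<in> carrier_mat N N" using carrier by blast
    then show "X \<in> g" unfolding g using y inv[of X y] by blast
  qed
  have preserved: "(\<forall>u\<in>U. (M * \<mu> y * M') *\<^sub>v u \<in> U) \<and> (\<forall>w\<in>W. (M * \<mu> y * M') *\<^sub>v w \<in> W) \<longleftrightarrow> block_diagonal n y"
    if "skew_hermitian n d y" for y
  proof -
    have "M' * (M * \<mu> y * M') * M = \<mu> y" using inv[OF carrier, of y y] by blast
    then show ?thesis unfolding preserves_iff[OF carrier] \<mu>_block[OF that] by simp
  qed
  show "preserving g U W = (\<lambda>y. M * \<mu> y * M') ` {X. skew_hermitian n d X \<and> block_diagonal n X}"
    unfolding preserving_def geq using preserved by blast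
qed (fact n I)+

end

text \<open>
  Scalar and diagonal \<open>2 \<times> 2\<close> matrices \<open>y\<close> with \<open>adj y i j = - y j i\<close> are determined by their upper
  left entries, because \<open>m22 (y i j) = - m11 (y j i)\<close>.
\<close>

definition corner_matrix :: "nat \<Rightarrow> (nat \<Rightarrow> nat \<Rightarrow> 'a m2) \<Rightarrow> 'a mat" where
  "corner_matrix n y = mat n n (\<lambda>(i, j). m11 (y i j))"

definition m2_entry :: "nat \<Rightarrow> nat \<Rightarrow> 'a m2 \<Rightarrow> 'a" where
  "m2_entry a c x = (if a = 0 then if c = 0 then m11 x else m12 x else if c = 0 then m21 x else m22 x)"

text \<open>The usual ring isomorphism from matrices of \<open>2 \<times> 2\<close> blocks to
  matrices of twice the size.\<close>

definition flatten :: "nat \<Rightarrow> (nat \<Rightarrow> nat \<Rightarrow> 'a m2) \<Rightarrow> 'a mat" where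
  "flatten n y = mat (2 * n) (2 * n) (\<lambda>(r, s). m2_entry (r mod 2) (s mod 2) (y (r div 2) (s div 2)))"

lemma corner_matrix_zeroD:
  assumes y: "skew_hermitian n d y" and d: "d \<le> 2" and ij: "i < n" "j < n" and 0: "m11 (y i j) = 0" "m11 (y j i) = 0"
  shows "y i j = 0"
proof -
  have "in_alg d (y i j)" "adj (y i j) = - y j i" using skew_hermitianD[OF y ij] by blast+
  then have "m12 (y i j) = 0" "m21 (y i j) = 0" "m22 (y i j) = - m11 (y j i)"
    using d by (auto simp: in_alg_def m2_eq_iff)
  then show ?thesis using 0 by (simp add: m2_eq_iff)
qed

text \<open>In scalar and diagonal matrices the entry \<open>m12\<close> is zero, and then taking
  the upper left entry is multiplicative.\<close>

lemma corner_matrix_mult: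
  assumes "d \<le> 2" and y: "\<And>i j. i < n \<Longrightarrow> j < n \<Longrightarrow> in_alg d (y i j)"
  shows "corner_matrix n (mat_prod n y z) = corner_matrix n y * corner_matrix n z"
proof (rule eq_matI)
  fix i j assume "i < dim_row (corner_matrix n y * corner_matrix n z)" "j < dim_col (corner_matrix n y * corner_matrix n z)"
  then have ij: "i < n" "j < n" by (simp_all add: corner_matrix_def)
  have "m12 (y i k) = 0" if "k < n" for k using y[OF ij(1) that] assms(1) by (simp add: in_alg_def)
  then show "corner_matrix n (mat_prod n y z) $$ (i, j) = (corner_matrix n y * corner_matrix n z) $$ (i, j)"
    using ij by (simp add: corner_matrix_def mat_prod_def scalar_prod_def atLeast0LessThan)
qed (simp_all add: corner_matrix_def)

lemma sum_even_odd: "(\<Sum>k<2 * n. f k) = (\<Sum>k<n. f (2 * k) + f (Suc (2 * k)))" for f :: "nat \<Rightarrow> 'a::comm_monoid_add"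
  by (induction n) (simp_all add: add.assoc)

lemma m2_entry_simps[simp]:
  "m2_entry a c (x + y) = m2_entry a c x + m2_entry a c y"
  "m2_entry a c (scal k * x) = k * m2_entry a c x"
  by (simp_all add: m2_entry_def)

lemma m2_entry_mult:
  "m2_entry a c (x * y) = m2_entry a 0 x * m2_entry 0 c y + m2_entry a 1 x * m2_entry 1 c y"
  by (simp add: m2_entry_def)

lemma m2_entry_sum: "m2_entry a c (sum f A) = (\<Sum>i\<in>A. m2_entry a c (f i))"
  by (simp add: m2_entry_def)

lemma flatten_mult:
  fixes y z :: "nat \<Rightarrow> nat \<Rightarrow> 'k::field m2"
  shows "flatten n (mat_prod n y z) = flatten n y * flatten n z"
proof (rule eq_matI)
  fix r s assume "r < dim_row (flatten n y * flatten n z)" "s < dim_col (flatten n y * flatten n z)"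
  then have rs: "r < 2 * n" "s < 2 * n" by (simp_all add: flatten_def)
  show "flatten n (mat_prod n y z) $$ (r, s) = (flatten n y * flatten n z) $$ (r, s)"
    using rs by (simp add: flatten_def scalar_prod_def atLeast0LessThan sum_even_odd mat_prod_def m2_entry_sum m2_entry_mult)
qed (simp_all add: flatten_def)

lemma flatten_entry:
  assumes "i < n" "j < n"
  shows "flatten n y $$ (2 * i, 2 * j) = m11 (y i j)" "flatten n y $$ (2 * i, Suc (2 * j)) = m12 (y i j)"
    "flatten n y $$ (Suc (2 * i), 2 * j) = m21 (y i j)" "flatten n y $$ (Suc (2 * i), Suc (2 * j)) = m22 (y i j)"
  using assms by (simp_all add: flatten_def m2_entry_def)

lemma even_odd_cases:
  fixes r :: nat
  assumes "r < 2 * n"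
  obtains i where "i < n" "r = 2 * i" | i where "i < n" "r = Suc (2 * i)"
proof (cases "even r")
  case True
  then show ?thesis using assms that(1)[of "r div 2"] by auto
next
  case False
  then show ?thesis using assms that(2)[of "r div 2"] by (auto elim!: oddE)
qed

text \<open>Since \<open>p\<close> is even, the boundary at \<open>p\<close> does not cut through a
  \<open>2 \<times> 2\<close> block.\<close>

lemma flatten_zero_iff:
  fixes y :: "nat \<Rightarrow> nat \<Rightarrow> 'k::field m2"
  assumes "even p"
  shows "(\<forall>i<n. \<forall>j<n. (i < p div 2) \<noteq> (j < p div 2) \<longrightarrow> y i j = 0) \<longleftrightarrow>
    (\<forall>r<2 * n. \<forall>s<2 * n. (r < p) \<noteq> (s < p) \<longrightarrow> flatten n y $$ (r, s) = 0)" (is "?L \<longleftrightarrow> ?R")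
proof
  have half: "r div 2 < p div 2 \<longleftrightarrow> r < p" for r using assms by (auto elim!: evenE)
  {
    assume L: ?L
    show ?R
    proof (intro allI impI)
      fix r s assume rs: "r < 2 * n" "s < 2 * n" "(r < p) \<noteq> (s < p)"
      then have "r div 2 < n" "s div 2 < n" "(r div 2 < p div 2) \<noteq> (s div 2 < p div 2)" unfolding half by auto
      then have "y (r div 2) (s div 2) = 0" using L by blast
      then show "flatten n y $$ (r, s) = 0" using rs(1,2) by (simp add: flatten_def m2_entry_def)
    qed
  next
    assume R: ?R
    show ?L
    proof (intro allI impI)
      fix i j assume ij: "i < n" "j < n" "(i < p div 2) \<noteq> (j < p div 2)"
      have "flatten n y $$ (2 * i + a, 2 * j + c) = 0" if "a < 2" "c < 2" for a c
      proof -
        have "(2 * i + a) div 2 = i" "(2 * j + c) div 2 = j" using that by simp_all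
        then have "(2 * i + a < p) \<noteq> (2 * j + c < p)" using ij(3) half by metis
        then show ?thesis using R ij(1,2) that by auto
      qed
      from this[of 0 0] this[of 0 1] this[of 1 0] this[of 1 1] show "y i j = 0"
        by (simp add: m2_eq_iff flatten_entry[OF ij(1,2)])
    qed
  }
qed

context adapted_basis
begin

lemma corner_model:
  assumes n: "7 \<le> N" and p3: "p = 3" and d: "d \<le> 2" and I: "I * I = (-1 :: 'k)"
    and g: "\<And>X. X \<in> g \<longleftrightarrow> X \<in> carrier_mat N N \<and> (\<exists>y. skew_hermitian N d y \<and> M' * X * M = corner_matrix N y)"
  shows "skew_hermitian_model N N d I (\<lambda>y. M * corner_matrix N y * M') g (preserving g U W)"
proof (rule skew_hermitian_model_in_basis[OF n I _ _ _ corner_matrix_mult[OF d] _ _ _ g])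
  show "corner_matrix N (\<lambda>i j. y i j + z i j) = corner_matrix N y + corner_matrix N z" for y z :: "nat \<Rightarrow> nat \<Rightarrow> 'k m2"
    by (intro eq_matI) (simp_all add: corner_matrix_def)
  show "corner_matrix N (\<lambda>i j. scal c * y i j) = c \<cdot>\<^sub>m corner_matrix N y" for c and y :: "nat \<Rightarrow> nat \<Rightarrow> 'k m2"
    by (intro eq_matI) (simp_all add: corner_matrix_def)
  show "corner_matrix N y = corner_matrix N z" if "\<And>i j. i < N \<Longrightarrow> j < N \<Longrightarrow> y i j = z i j" for y z :: "nat \<Rightarrow> nat \<Rightarrow> 'k m2"
    using that by (intro eq_matI) (simp_all add: corner_matrix_def)
  show "y i j = 0" if y: "skew_hermitian N d y" and 0: "corner_matrix N y = 0\<^sub>m N N" and ij: "i < N" "j < N" for y :: "nat \<Rightarrow> nat \<Rightarrow> 'k m2" and i j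
  proof -
    have "corner_matrix N y $$ (i, j) = 0" "corner_matrix N y $$ (j, i) = 0" unfolding 0 using ij by simp_all
    then show ?thesis using ij by (intro corner_matrix_zeroD[OF y d]) (simp_all add: corner_matrix_def)
  qed
  show "block_diagonal N y \<longleftrightarrow> (\<forall>i<N. \<forall>j<N. (i < p) \<noteq> (j < p) \<longrightarrow> corner_matrix N y $$ (i, j) = 0)"
    if y: "skew_hermitian N d y" for y :: "nat \<Rightarrow> nat \<Rightarrow> 'k m2"
  proof
    assume "block_diagonal N y"
    then show "\<forall>i<N. \<forall>j<N. (i < p) \<noteq> (j < p) \<longrightarrow> corner_matrix N y $$ (i, j) = 0"
      unfolding block_diagonal_def p3 by (simp add: corner_matrix_def)
  next
    assume R: "\<forall>i<N. \<forall>j<N. (i < p) \<noteq> (j < p) \<longrightarrow> corner_matrix N y $$ (i, j) = 0"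
    show "block_diagonal N y"
      unfolding block_diagonal_def
    proof (intro allI impI)
      fix i j assume ij: "i < N" "j < N" "(i < 3) \<noteq> (j < 3)"
      then have "corner_matrix N y $$ (i, j) = 0" "corner_matrix N y $$ (j, i) = 0" using R unfolding p3 by blast+
      then show "y i j = 0" using ij(1,2) by (intro corner_matrix_zeroD[OF y d]) (simp_all add: corner_matrix_def)
    qed
  qed
qed (simp_all add: corner_matrix_def)

lemma flatten_model:
  assumes N: "N = 2 * n" and n: "7 \<le> n" and p6: "p = 6" and I: "I * I = (-1 :: 'k)"
    and g: "\<And>X. X \<in> g \<longleftrightarrow> X \<in> carrier_mat N N \<and> (\<exists>y. skew_hermitian n 4 y \<and> M' * X * M = flatten n y)"
  shows "skew_hermitian_model N n 4 I (\<lambda>y. M * flatten n y * M') g (preserving g U W)"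
proof (rule skew_hermitian_model_in_basis[OF n I _ _ _ flatten_mult _ _ _ g])
  show "flatten n (\<lambda>i j. y i j + z i j) = flatten n y + flatten n z" for y z :: "nat \<Rightarrow> nat \<Rightarrow> 'k m2"
    by (intro eq_matI) (simp_all add: flatten_def)
  show "flatten n (\<lambda>i j. scal c * y i j) = c \<cdot>\<^sub>m flatten n y" for c and y :: "nat \<Rightarrow> nat \<Rightarrow> 'k m2"
    by (intro eq_matI) (simp_all add: flatten_def)
  show "flatten n y = flatten n z" if "\<And>i j. i < n \<Longrightarrow> j < n \<Longrightarrow> y i j = z i j" for y z :: "nat \<Rightarrow> nat \<Rightarrow> 'k m2"
    using that by (intro eq_matI) (auto simp: flatten_def)
  show "y i j = 0" if 0: "flatten n y = 0\<^sub>m N N" and ij: "i < n" "j < n" for y :: "nat \<Rightarrow> nat \<Rightarrow> 'k m2" and i j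
    using flatten_entry[OF ij, of y] ij unfolding 0 N by (simp add: m2_eq_iff)
  show "block_diagonal n y \<longleftrightarrow> (\<forall>i<N. \<forall>j<N. (i < p) \<noteq> (j < p) \<longrightarrow> flatten n y $$ (i, j) = 0)" for y :: "nat \<Rightarrow> nat \<Rightarrow> 'k m2"
    using flatten_zero_iff[of 6 n y] unfolding block_diagonal_def N p6 by simp
qed (simp_all add: flatten_def N)

lemma gl_model:
  assumes n: "7 \<le> N" and p3: "p = 3" and I: "I * I = (-1 :: 'k)"
  shows "skew_hermitian_model N N 2 I (\<lambda>y. M * corner_matrix N y * M') (carrier_mat N N) (preserving (carrier_mat N N) U W)"
proof (rule corner_model[OF n p3 _ I])
  fix X :: "'k mat"
  have "\<exists>y. skew_hermitian N 2 y \<and> Y = corner_matrix N y" if "Y \<in> carrier_mat N N" for Y :: "'k mat"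
  proof (intro exI conjI)
    \<comment> \<open>Every matrix occurs: the negative transpose in the lower right entries makes
      the pair skew-hermitian.\<close>
    let ?y = "\<lambda>i j. M2 (Y $$ (i, j)) 0 0 (- Y $$ (j, i))"
    show "skew_hermitian N 2 ?y" by (rule skew_hermitianI) (simp_all add: in_alg_def m2_eq_iff)
    show "Y = corner_matrix N ?y" using that by (intro eq_matI) (simp_all add: corner_matrix_def)
  qed
  moreover have "M' * X * M \<in> carrier_mat N N" if "X \<in> carrier_mat N N"
    using M'(1) that by (intro mult_carrier_mat[of _ N N]) simp_all
  ultimately show "X \<in> carrier_mat N N \<longleftrightarrow> X \<in> carrier_mat N N \<and> (\<exists>y. skew_hermitian N 2 y \<and> M' * X * M = corner_matrix N y)"
    by blast
qed simp

text \<open>On scalar matrices \<open>adj\<close> is the identity, so skew-hermitian means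
  skew-symmetric, and in an orthonormal basis this is invariance of the form.\<close>

lemma so_model:
  assumes n: "7 \<le> N" and p3: "p = 3" and I: "I * I = (-1 :: 'k)" and J: "J \<in> carrier_mat N N"
    and K: "\<And>i j. i < N \<Longrightarrow> j < N \<Longrightarrow> bilinear_form J (b i) (b j) = (if i = j then 1 else 0)"
  shows "skew_hermitian_model N N 1 I (\<lambda>y. M * corner_matrix N y * M') (form_algebra N J) (preserving (form_algebra N J) U W)"
proof (rule corner_model[OF n p3 _ I])
  fix X :: "'k mat"
  have "(\<exists>y. skew_hermitian N 1 y \<and> Y = corner_matrix N y) \<longleftrightarrow>
      (\<forall>r<N. \<forall>s<N. (\<Sum>k<N. Y $$ (k, r) * (if k = s then 1 else 0)) + (\<Sum>k<N. Y $$ (k, s) * (if r = k then 1 else 0)) = 0)"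
    (is "?L \<longleftrightarrow> ?R") if Y: "Y \<in> carrier_mat N N" for Y :: "'k mat"
  proof -
    have R: "?R \<longleftrightarrow> (\<forall>r<N. \<forall>s<N. Y $$ (s, r) + Y $$ (r, s) = 0)"
      by (simp add: if_distrib[of "(*) _"] cong: if_cong)
    show ?thesis
    proof
      assume ?L
      then obtain y where y: "skew_hermitian N 1 y" "Y = corner_matrix N y" by blast
      have "m11 (y s r) + m11 (y r s) = 0" if "r < N" "s < N" for r s
      proof -
        have "in_alg 1 (y r s)" "adj (y r s) = - y s r" using skew_hermitianD[OF y(1) that] by blast+
        then have "m11 (y r s) = m22 (y r s)" "m22 (y r s) = - m11 (y s r)" by (auto simp: in_alg_def m2_eq_iff)
        then show ?thesis by simp
      qed
      then show ?R unfolding R unfolding y(2) by (simp add: corner_matrix_def)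
    next
      assume ?R
      then have skew: "Y $$ (s, r) + Y $$ (r, s) = 0" if "r < N" "s < N" for r s unfolding R using that by blast
      let ?y = "\<lambda>i j. scal (Y $$ (i, j))"
      have "skew_hermitian N 1 ?y"
      proof (rule skew_hermitianI)
        fix i j assume "i < N" "j < N"
        then have "Y $$ (i, j) = - Y $$ (j, i)" using skew[of j i] by (simp add: eq_neg_iff_add_eq_0)
        then show "adj (?y i j) = - ?y j i" by (simp add: m2_eq_iff)
      qed simp
      moreover have "Y = corner_matrix N ?y" using Y by (intro eq_matI) (simp_all add: corner_matrix_def)
      ultimately show ?L by blast
    qed
  qed
  then have char: "(\<exists>y. skew_hermitian N 1 y \<and> M' * X * M = corner_matrix N y) \<longleftrightarrow>
      (\<forall>r<N. \<forall>s<N. (\<Sum>k<N. (M' * X * M) $$ (k, r) * (if k = s then 1 else 0)) + (\<Sum>k<N. (M' * X * M) $$ (k, s) * (if r = k then 1 else 0)) = 0)"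
    if "X \<in> carrier_mat N N"
    using mult_carrier_mat[OF mult_carrier_mat[OF M'(1) that] basis_matrix_carrier] .
  have iff: "X \<in> form_algebra N J \<longleftrightarrow> X \<in> carrier_mat N N \<and>
      (\<forall>r<N. \<forall>s<N. (\<Sum>k<N. (M' * X * M) $$ (k, r) * (if k = s then 1 else 0)) + (\<Sum>k<N. (M' * X * M) $$ (k, s) * (if r = k then 1 else 0)) = 0)"
    by (rule form_algebra_iff[OF J K])
  show "X \<in> form_algebra N J \<longleftrightarrow> X \<in> carrier_mat N N \<and> (\<exists>y. skew_hermitian N 1 y \<and> M' * X * M = corner_matrix N y)"
    unfolding iff by (intro conj_cong refl char[symmetric])
qed simp

lemma sum_symplectic_gram:
  fixes f :: "nat \<Rightarrow> 'k"
  assumes "i < n"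
  shows "(\<Sum>k<2 * n. f k * symplectic_gram k (2 * i)) = - f (Suc (2 * i))"
    "(\<Sum>k<2 * n. f k * symplectic_gram k (Suc (2 * i))) = f (2 * i)"
    "(\<Sum>k<2 * n. f k * symplectic_gram (2 * i) k) = f (Suc (2 * i))"
    "(\<Sum>k<2 * n. f k * symplectic_gram (Suc (2 * i)) k) = - f (2 * i)"
proof -
  have g: "symplectic_gram k (2 * i) = (if k = Suc (2 * i) then -1 else 0 :: 'k)"
    "symplectic_gram k (Suc (2 * i)) = (if k = 2 * i then 1 else 0 :: 'k)"
    "symplectic_gram (2 * i) k = (if k = Suc (2 * i) then 1 else 0 :: 'k)"
    "symplectic_gram (Suc (2 * i)) k = (if k = 2 * i then -1 else 0 :: 'k)" for k
  proof -
    have "\<not> (even k \<and> 2 * i = Suc k)" by presburger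
    then show "symplectic_gram k (2 * i) = (if k = Suc (2 * i) then -1 else 0 :: 'k)"
      "symplectic_gram (2 * i) k = (if k = Suc (2 * i) then 1 else 0 :: 'k)"
      by (auto simp: symplectic_gram_def)
    show "symplectic_gram k (Suc (2 * i)) = (if k = 2 * i then 1 else 0 :: 'k)"
      "symplectic_gram (Suc (2 * i)) k = (if k = 2 * i then -1 else 0 :: 'k)"
      by (auto simp: symplectic_gram_def)
  qed
  have "(\<Sum>k<2 * n. f k * (if k = l then e else 0)) = f l * e" if "l < 2 * n" for l e
  proof -
    have "(\<Sum>k<2 * n. f k * (if k = l then e else 0)) = (\<Sum>k<2 * n. if k = l then f l * e else 0)"
      by (intro sum.cong) auto
    then show ?thesis using that by simp
  qed
  from this[of "Suc (2 * i)"] this[of "2 * i"] assms show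
    "(\<Sum>k<2 * n. f k * symplectic_gram k (2 * i)) = - f (Suc (2 * i))"
    "(\<Sum>k<2 * n. f k * symplectic_gram k (Suc (2 * i))) = f (2 * i)"
    "(\<Sum>k<2 * n. f k * symplectic_gram (2 * i) k) = f (Suc (2 * i))"
    "(\<Sum>k<2 * n. f k * symplectic_gram (Suc (2 * i)) k) = - f (2 * i)"
    unfolding g by simp_all
qed

text \<open>The adjugate of a \<open>2 \<times> 2\<close> block is its transpose conjugated by the
  standard alternating form. So the skew-hermitian condition is invariance of the symplectic form,
  read block by block.\<close>

lemma sp_model:
  assumes N: "N = 2 * n" and n: "7 \<le> n" and p6: "p = 6" and I: "I * I = (-1 :: 'k)" and J: "J \<in> carrier_mat N N"
    and K: "\<And>i j. i < N \<Longrightarrow> j < N \<Longrightarrow> bilinear_form J (b i) (b j) = symplectic_gram i j"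
  shows "skew_hermitian_model N n 4 I (\<lambda>y. M * flatten n y * M') (form_algebra N J) (preserving (form_algebra N J) U W)"
proof (rule flatten_model[OF N n p6 I])
  fix X :: "'k mat"
  have "(\<exists>y. skew_hermitian n 4 y \<and> Y = flatten n y) \<longleftrightarrow>
      (\<forall>r<N. \<forall>s<N. (\<Sum>k<N. Y $$ (k, r) * symplectic_gram k s) + (\<Sum>k<N. Y $$ (k, s) * symplectic_gram r k) = 0)"
    (is "?L \<longleftrightarrow> ?R") if Y: "Y \<in> carrier_mat N N" for Y :: "'k mat"
  proof -
    let ?y = "\<lambda>i j. M2 (Y $$ (2 * i, 2 * j)) (Y $$ (2 * i, Suc (2 * j))) (Y $$ (Suc (2 * i), 2 * j)) (Y $$ (Suc (2 * i), Suc (2 * j)))"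
    have Yy: "Y = flatten n ?y"
    proof (rule eq_matI)
      fix r s assume "r < dim_row (flatten n ?y)" "s < dim_col (flatten n ?y)"
      then have "r < 2 * n" "s < 2 * n" by (simp_all add: flatten_def)
      then show "Y $$ (r, s) = flatten n ?y $$ (r, s)"
        by (elim even_odd_cases) (simp_all add: flatten_entry)
    qed (use Y N in \<open>simp_all add: flatten_def\<close>)
    have unique: "skew_hermitian n 4 ?y" if "skew_hermitian n 4 y" "Y = flatten n y" for y
    proof (rule skew_hermitianI)
      fix i j assume ij: "i < n" "j < n"
      have "?y i j = y i j" "?y j i = y j i" unfolding that(2) using ij by (simp_all add: flatten_entry m2_eq_iff)
      then show "in_alg 4 (?y i j)" "adj (?y i j) = - ?y j i" using skew_hermitianD[OF that(1) ij] by simp_all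
    qed
    have "?L \<longleftrightarrow> skew_hermitian n 4 ?y" using unique Yy by blast
    also have "\<dots> \<longleftrightarrow> (\<forall>i<n. \<forall>j<n. adj (?y i j) = - ?y j i)"
      unfolding skew_hermitian_def by (simp add: in_alg_def)
    also have "\<dots> \<longleftrightarrow> ?R"
    proof
      assume L: "\<forall>i<n. \<forall>j<n. adj (?y i j) = - ?y j i"
      have e: "Y $$ (Suc (2 * i), Suc (2 * j)) = - Y $$ (2 * j, 2 * i)" "Y $$ (2 * i, Suc (2 * j)) = Y $$ (2 * j, Suc (2 * i))"
        "Y $$ (Suc (2 * i), 2 * j) = Y $$ (Suc (2 * j), 2 * i)" if "i < n" "j < n" for i j
        using L[rule_format, OF that] by (simp_all add: m2_eq_iff)
      show ?R
      proof (intro allI impI)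
        fix r s assume "r < N" "s < N"
        then have "r < 2 * n" "s < 2 * n" unfolding N .
        then show "(\<Sum>k<N. Y $$ (k, r) * symplectic_gram k s) + (\<Sum>k<N. Y $$ (k, s) * symplectic_gram r k) = 0"
          unfolding N
        \<comment> \<open>Equal parities of \<open>r\<close> and \<open>s\<close> give the
          off-diagonal entries of the equation between blocks, mixed parities the diagonal
          ones.\<close>
        proof (elim even_odd_cases, goal_cases)
          case (1 i j)
          then show ?case using e(3)[of i j] by (simp add: sum_symplectic_gram)
        next
          case (2 i j)
          then show ?case using e(1)[of i j] by (simp add: sum_symplectic_gram)
        next
          case (3 i j)
          then show ?case using e(1)[of j i] by (simp add: sum_symplectic_gram)
        next
          case (4 i j)
          then show ?case using e(2)[of i j] by (simp add: sum_symplectic_gram)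
        qed
      qed
    next
      assume R: ?R
      show "\<forall>i<n. \<forall>j<n. adj (?y i j) = - ?y j i"
      proof (intro allI impI)
        fix i j assume ij: "i < n" "j < n"
        have R': "(\<Sum>k<2 * n. Y $$ (k, r) * symplectic_gram k s) + (\<Sum>k<2 * n. Y $$ (k, s) * symplectic_gram r k) = 0"
          if "r < 2 * n" "s < 2 * n" for r s
          using R that unfolding N by blast
        have adj_eq: "adj (M2 x1 x2 x3 x4) = - M2 y1 y2 y3 y4"
          if "- y3 + x3 = 0" "y1 + x4 = 0" "x1 + y4 = 0" "y2 + - x2 = 0" for x1 x2 x3 x4 y1 y2 y3 y4 :: 'k
          using that by (simp add: m2_eq_iff add_eq_0_iff)
        have bounds: "2 * i < 2 * n" "2 * j < 2 * n" "Suc (2 * i) < 2 * n" "Suc (2 * j) < 2 * n" using ij by simp_all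
        have "- Y $$ (Suc (2 * j), 2 * i) + Y $$ (Suc (2 * i), 2 * j) = 0"
          using R'[OF bounds(1,2)] unfolding sum_symplectic_gram[OF ij(1)] sum_symplectic_gram[OF ij(2)] .
        moreover have "Y $$ (2 * j, 2 * i) + Y $$ (Suc (2 * i), Suc (2 * j)) = 0"
          using R'[OF bounds(1,4)] unfolding sum_symplectic_gram[OF ij(1)] sum_symplectic_gram[OF ij(2)] .
        moreover have "Y $$ (2 * i, 2 * j) + Y $$ (Suc (2 * j), Suc (2 * i)) = 0"
          using R'[OF bounds(2,3)] unfolding sum_symplectic_gram[OF ij(1)] sum_symplectic_gram[OF ij(2)] .
        moreover have "Y $$ (2 * j, Suc (2 * i)) + - Y $$ (2 * i, Suc (2 * j)) = 0"
          using R'[OF bounds(3,4)] unfolding sum_symplectic_gram[OF ij(1)] sum_symplectic_gram[OF ij(2)] .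
        ultimately show "adj (?y i j) = - ?y j i" by (rule adj_eq)
      qed
    qed
    finally show ?thesis .
  qed
  then have char: "(\<exists>y. skew_hermitian n 4 y \<and> M' * X * M = flatten n y) \<longleftrightarrow>
      (\<forall>r<N. \<forall>s<N. (\<Sum>k<N. (M' * X * M) $$ (k, r) * symplectic_gram k s) + (\<Sum>k<N. (M' * X * M) $$ (k, s) * symplectic_gram r k) = 0)"
    if "X \<in> carrier_mat N N"
    using mult_carrier_mat[OF mult_carrier_mat[OF M'(1) that] basis_matrix_carrier] .
  have iff: "X \<in> form_algebra N J \<longleftrightarrow> X \<in> carrier_mat N N \<and>
      (\<forall>r<N. \<forall>s<N. (\<Sum>k<N. (M' * X * M) $$ (k, r) * symplectic_gram k s) + (\<Sum>k<N. (M' * X * M) $$ (k, s) * symplectic_gram r k) = 0)"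
    by (rule form_algebra_iff[OF J K])
  show "X \<in> form_algebra N J \<longleftrightarrow> X \<in> carrier_mat N N \<and> (\<exists>y. skew_hermitian n 4 y \<and> M' * X * M = flatten n y)"
    unfolding iff by (intro conj_cong refl char[symmetric])
qed

end

section \<open>Joining the bases of the two summands; the three families\<close>

definition joined_family :: "nat \<Rightarrow> (nat \<Rightarrow> 'a) \<Rightarrow> (nat \<Rightarrow> 'a) \<Rightarrow> nat \<Rightarrow> 'a" where
  "joined_family p b c i = (if i < p then b i else c (i - p))"

lemma joined_family_simps[simp]:
  "i < p \<Longrightarrow> joined_family p b c i = b i" "\<not> i < p \<Longrightarrow> joined_family p b c i = c (i - p)" "joined_family p b c (p + i) = c i"
  by (simp_all add: joined_family_def)

lemma adapted_basis_joined_family: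
  fixes U W :: "'k::field_char_0 vec set"
  assumes dec: "direct_decomposition N U W" and p: "p \<le> N"
    and b: "\<forall>i<p. b i \<in> U" "\<forall>u\<in>U. \<exists>a. \<forall>k<N. u $ k = (\<Sum>i<p. a i * b i $ k)"
    and c: "\<forall>i<N - p. c i \<in> W" "\<forall>w\<in>W. \<exists>a. \<forall>k<N. w $ k = (\<Sum>i<N - p. a i * c i $ k)"
  shows "adapted_basis N p U W (joined_family p b c)"
proof (rule adapted_basis.intro[OF dec p])
  show "joined_family p b c i \<in> U" if "i < p" for i using b(1) that by simp
  show "joined_family p b c i \<in> W" if "p \<le> i" "i < N" for i using c(1) that by simp
  show "\<exists>a. \<forall>k<N. u $ k = (\<Sum>i<p. a i * joined_family p b c i $ k)" if "u \<in> U" for u using b(2) that by simp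
  show "\<exists>a. \<forall>k<N. w $ k = (\<Sum>i<N - p. a i * joined_family p b c (p + i) $ k)" if "w \<in> W" for w using c(2) that by simp
qed

lemma bilinear_form_joined_family:
  fixes J :: "'k::field mat" and K :: "nat \<Rightarrow> nat \<Rightarrow> 'k"
  assumes b: "\<forall>i<p. b i \<in> U" and c: "\<forall>i<N - p. c i \<in> W"
    and bb: "\<forall>i<p. \<forall>j<p. bilinear_form J (b i) (b j) = K i j"
    and cc: "\<forall>i<N - p. \<forall>j<N - p. bilinear_form J (c i) (c j) = K (p + i) (p + j)"
    and UW: "\<And>u w. u \<in> U \<Longrightarrow> w \<in> W \<Longrightarrow> bilinear_form J u w = 0 \<and> bilinear_form J w u = 0"
    and K: "\<And>i j. i < p \<Longrightarrow> p \<le> j \<Longrightarrow> K i j = 0 \<and> K j i = 0"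
    and ij: "i < N" "j < N"
  shows "bilinear_form J (joined_family p b c i) (joined_family p b c j) = K i j"
proof (cases "i < p")
  case i: True
  show ?thesis
  proof (cases "j < p")
    case True
    then show ?thesis using i bb by simp
  next
    case False
    then show ?thesis using i b c UW[of "b i" "c (j - p)"] K[of i j] ij by simp
  qed
next
  case i: False
  show ?thesis
  proof (cases "j < p")
    case True
    then show ?thesis using i b c UW[of "b j" "c (i - p)"] K[of j i] ij by simp
  next
    case False
    have "bilinear_form J (c (i - p)) (c (j - p)) = K (p + (i - p)) (p + (j - p))" using cc i False ij by simp
    then show ?thesis using i False by simp
  qed
qed

lemma (in skew_hermitian_model) no_GNIB:
  "(\<exists>\<sigma>. symmetric_subalgebra N g g0 \<sigma>) \<and>
    (\<forall>\<sigma> G G0. symmetric_subalgebra N g g0 \<sigma> \<and> symmetric_pair_groups N g g0 G G0 \<longrightarrow> \<not> isotropy_GNIB N g \<sigma> G0)"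
  using involution_exists not_isotropy_GNIB by blast

lemma direct_decomposition_subspaces:
  assumes "direct_decomposition N U W"
  shows "vec_subspace_loc N U" "vec_subspace_loc N W"
  using assms unfolding direct_decomposition_def vec_subspace_loc_def by blast+

lemma orthogonal_decomposition_subspaces:
  assumes "orthogonal_decomposition N J U W" "J \<in> carrier_mat N N"
  shows "form_subspace N U J" "form_subspace N W J"
  using assms direct_decomposition_subspaces[of N U W]
  unfolding orthogonal_decomposition_def form_subspace_def form_subspace_axioms_def by blast+

lemma square_root_exists: "\<exists>s. s * s = (x :: 'k::alg_closed_field)"
  using nth_root_exists[of 2 x] by (auto simp: power2_eq_square)

theorem theorem6p4:
  fixes n :: nat
  assumes "n \<ge> 7"
  shows
    "(\<forall>(U :: 'k::{alg_closed_field, field_char_0} vec set) W g g0.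
        direct_decomposition n U W \<and>
        vdim (vec_subspace n U) = 3 \<and> vdim (vec_subspace n W) = n - 3 \<and>
        g = gl_algebra n \<and> g0 = preserving g U W \<longrightarrow>
          (\<exists>\<sigma>. symmetric_subalgebra n g g0 \<sigma>) \<and>
          (\<forall>\<sigma> G G0. symmetric_subalgebra n g g0 \<sigma> \<and> symmetric_pair_groups n g g0 G G0 \<longrightarrow>
             \<not> isotropy_GNIB n g \<sigma> G0)) \<and>
     (\<forall>(J :: 'k mat) U W g g0.
        orthogonal_form n J \<and> orthogonal_decomposition n J U W \<and>
        vdim (vec_subspace n U) = 3 \<and> vdim (vec_subspace n W) = n - 3 \<and>
        g = form_algebra n J \<and> g0 = preserving g U W \<longrightarrow>
          (\<exists>\<sigma>. symmetric_subalgebra n g g0 \<sigma>) \<and>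
          (\<forall>\<sigma> G G0. symmetric_subalgebra n g g0 \<sigma> \<and> symmetric_pair_groups n g g0 G G0 \<longrightarrow>
             \<not> isotropy_GNIB n g \<sigma> G0)) \<and>
     (\<forall>(J :: 'k mat) U W g g0.
        symplectic_form (2 * n) J \<and> orthogonal_decomposition (2 * n) J U W \<and>
        vdim (vec_subspace (2 * n) U) = 6 \<and> vdim (vec_subspace (2 * n) W) = 2 * n - 6 \<and>
        g = form_algebra (2 * n) J \<and> g0 = preserving g U W \<longrightarrow>
          (\<exists>\<sigma>. symmetric_subalgebra (2 * n) g g0 \<sigma>) \<and>
          (\<forall>\<sigma> G G0. symmetric_subalgebra (2 * n) g g0 \<sigma> \<and>
                    symmetric_pair_groups (2 * n) g g0 G G0 \<longrightarrow>
             \<not> isotropy_GNIB (2 * n) g \<sigma> G0))"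
proof -
  \<comment> \<open>The square root of \<open>-1\<close> from which the isotropic vectors are
    built.\<close>
  obtain I :: 'k where I: "I * I = -1" using square_root_exists by blast
  show ?thesis
  \<comment> \<open>With the first conjunct required to be universally quantified, only the three
    families are separated; the conjunction inside each of them stays whole for
    \<open>no_GNIB\<close>.\<close>
  proof (intro conjI[of "All _"] allI impI, goal_cases)
    case (1 U W g g0)
    then have dec: "direct_decomposition n U W" and dim: "vdim (vec_subspace n U) = 3" "vdim (vec_subspace n W) = n - 3"
      and g: "g = gl_algebra n" and g0: "g0 = preserving g U W" by blast+
    note U = vec_subspace_loc.spanning_family[OF direct_decomposition_subspaces(1)[OF dec], unfolded dim]
    note W = vec_subspace_loc.spanning_family[OF direct_decomposition_subspaces(2)[OF dec], unfolded dim]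
    obtain b where b: "\<forall>i<3::nat. b i \<in> U" "\<forall>u\<in>U. \<exists>a. \<forall>k<n. u $ k = (\<Sum>i<3::nat. a i * b i $ k)" using U by blast
    obtain c where c: "\<forall>i<n - 3. c i \<in> W" "\<forall>w\<in>W. \<exists>a. \<forall>k<n. w $ k = (\<Sum>i<n - 3. a i * c i $ k)" using W by blast
    have "3 \<le> n" using assms by simp
    note basis = adapted_basis_joined_family[OF dec this b c]
    show ?case unfolding g0 g
      by (rule skew_hermitian_model.no_GNIB[OF adapted_basis.gl_model[OF basis assms refl I]])
  next
    case (2 J U W g g0)
    then have form: "orthogonal_form n J" and orth: "orthogonal_decomposition n J U W"
      and dim: "vdim (vec_subspace n U) = 3" "vdim (vec_subspace n W) = n - 3"
      and g: "g = form_algebra n J" and g0: "g0 = preserving g U W" by blast+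
    have J: "J \<in> carrier_mat n n" and sym: "\<And>x y. x \<in> carrier_vec n \<Longrightarrow> y \<in> carrier_vec n \<Longrightarrow> bilinear_form J y x = bilinear_form J x y"
      using form unfolding orthogonal_form_def by blast+
    have dec: "direct_decomposition n U W" and zero: "\<And>u w. u \<in> U \<Longrightarrow> w \<in> W \<Longrightarrow> bilinear_form J u w = 0"
      using orth unfolding orthogonal_decomposition_def by blast+
    note carr = vec_subspace_loc.carr[OF direct_decomposition_subspaces(1)[OF dec]]
      vec_subspace_loc.carr[OF direct_decomposition_subspaces(2)[OF dec]]
    have U: "\<exists>b. (\<forall>i<3::nat. b i \<in> U) \<and> (\<forall>i<3::nat. \<forall>j<3::nat. bilinear_form J (b i) (b j) = (if i = j then 1 else 0)) \<and>
        (\<forall>u\<in>U. \<exists>a. \<forall>k<n. u $ k = (\<Sum>i<3::nat. a i * b i $ k))"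
      by (rule form_subspace.orthonormal_basis[OF orthogonal_decomposition_subspaces(1)[OF orth J], unfolded dim])
        (intro sym carr, assumption+, rule square_root_exists)
    have W: "\<exists>c. (\<forall>i<n - 3. c i \<in> W) \<and> (\<forall>i<n - 3. \<forall>j<n - 3. bilinear_form J (c i) (c j) = (if i = j then 1 else 0)) \<and>
        (\<forall>w\<in>W. \<exists>a. \<forall>k<n. w $ k = (\<Sum>i<n - 3. a i * c i $ k))"
      by (rule form_subspace.orthonormal_basis[OF orthogonal_decomposition_subspaces(2)[OF orth J], unfolded dim])
        (intro sym carr, assumption+, rule square_root_exists)
    obtain b where b: "\<forall>i<3::nat. b i \<in> U" "\<forall>i<3::nat. \<forall>j<3::nat. bilinear_form J (b i) (b j) = (if i = j then 1 else 0)"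
      "\<forall>u\<in>U. \<exists>a. \<forall>k<n. u $ k = (\<Sum>i<3::nat. a i * b i $ k)" using U by blast
    obtain c where c: "\<forall>i<n - 3. c i \<in> W" "\<forall>i<n - 3. \<forall>j<n - 3. bilinear_form J (c i) (c j) = (if i = j then 1 else 0)"
      "\<forall>w\<in>W. \<exists>a. \<forall>k<n. w $ k = (\<Sum>i<n - 3. a i * c i $ k)" using W by blast
    have "3 \<le> n" using assms by simp
    note basis = adapted_basis_joined_family[OF dec this b(1,3) c(1,3)]
    have K: "bilinear_form J (joined_family 3 b c i) (joined_family 3 b c j) = (if i = j then 1 else 0)" if "i < n" "j < n" for i j
      by (rule bilinear_form_joined_family[where K = "\<lambda>i j. if i = j then 1 else 0", OF b(1) c(1) b(2) _ _ _ that])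
        (use c(2) zero sym[OF carr] in auto)
    show ?case unfolding g0 g
      by (rule skew_hermitian_model.no_GNIB[OF adapted_basis.so_model[OF basis assms refl I J K]])
  next
    case (3 J U W g g0)
    let ?N = "2 * n"
    from 3 have form: "symplectic_form ?N J" and orth: "orthogonal_decomposition ?N J U W"
      and dim: "vdim (vec_subspace ?N U) = 6" "vdim (vec_subspace ?N W) = ?N - 6"
      and g: "g = form_algebra ?N J" and g0: "g0 = preserving g U W" by blast+
    have J: "J \<in> carrier_mat ?N ?N" and alt: "\<And>x. x \<in> carrier_vec ?N \<Longrightarrow> bilinear_form J x x = 0"
      using form unfolding symplectic_form_def by blast+
    have dec: "direct_decomposition ?N U W" and zero: "\<And>u w. u \<in> U \<Longrightarrow> w \<in> W \<Longrightarrow> bilinear_form J u w = 0"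
      using orth unfolding orthogonal_decomposition_def by blast+
    note carr = vec_subspace_loc.carr[OF direct_decomposition_subspaces(1)[OF dec]]
      vec_subspace_loc.carr[OF direct_decomposition_subspaces(2)[OF dec]]
    \<comment> \<open>The decomposition provides orthogonality in one order only; the other order
      follows because the form is alternating.\<close>
    have UW: "bilinear_form J u w = 0 \<and> bilinear_form J w u = 0" if u: "u \<in> U" and w: "w \<in> W" for u w
    proof -
      note c = carr(1)[OF u] carr(2)[OF w]
      have "bilinear_form J (u + w) (u + w) = bilinear_form J u (u + w) + bilinear_form J w (u + w)"
        by (rule bilinear_form_linear(1)[OF J c]) (intro add_carrier_vec c)
      also have "\<dots> = bilinear_form J u u + bilinear_form J u w + (bilinear_form J w u + bilinear_form J w w)"
        unfolding bilinear_form_linear(2)[OF J c c(1)] bilinear_form_linear(2)[OF J c c(2)] ..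
      finally show ?thesis using alt[OF c(1)] alt[OF c(2)] alt[OF add_carrier_vec[OF c]] zero[OF u w] by simp
    qed
    have U: "\<exists>b. (\<forall>i<6::nat. b i \<in> U) \<and> (\<forall>i<6::nat. \<forall>j<6::nat. bilinear_form J (b i) (b j) = symplectic_gram i j) \<and>
        (\<forall>u\<in>U. \<exists>a. \<forall>k<?N. u $ k = (\<Sum>i<6::nat. a i * b i $ k))"
      by (rule form_subspace.symplectic_basis[OF orthogonal_decomposition_subspaces(1)[OF orth J], unfolded dim]) (intro alt carr)
    have W: "\<exists>c. (\<forall>i<?N - 6. c i \<in> W) \<and> (\<forall>i<?N - 6. \<forall>j<?N - 6. bilinear_form J (c i) (c j) = symplectic_gram i j) \<and>
        (\<forall>w\<in>W. \<exists>a. \<forall>k<?N. w $ k = (\<Sum>i<?N - 6. a i * c i $ k))"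
      by (rule form_subspace.symplectic_basis[OF orthogonal_decomposition_subspaces(2)[OF orth J], unfolded dim]) (intro alt carr)
    obtain b where b: "\<forall>i<6::nat. b i \<in> U" "\<forall>i<6::nat. \<forall>j<6::nat. bilinear_form J (b i) (b j) = symplectic_gram i j"
      "\<forall>u\<in>U. \<exists>a. \<forall>k<?N. u $ k = (\<Sum>i<6::nat. a i * b i $ k)" using U by blast
    obtain c where c: "\<forall>i<?N - 6. c i \<in> W" "\<forall>i<?N - 6. \<forall>j<?N - 6. bilinear_form J (c i) (c j) = symplectic_gram i j"
      "\<forall>w\<in>W. \<exists>a. \<forall>k<?N. w $ k = (\<Sum>i<?N - 6. a i * c i $ k)" using W by blast
    have "6 \<le> ?N" using assms by simp
    note basis = adapted_basis_joined_family[OF dec this b(1,3) c(1,3)]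
    \<comment> \<open>\<open>6\<close> is even, so the shift keeps parities and with them the
      hyperbolic pairs.\<close>
    have shift: "symplectic_gram (6 + i) (6 + j) = (symplectic_gram i j :: 'k)" for i j :: nat
      by (simp add: symplectic_gram_def)
    \<comment> \<open>A pair consists of an even index and its successor, so none straddles
      \<open>6\<close>.\<close>
    have cross: "symplectic_gram i j = (0 :: 'k) \<and> symplectic_gram j i = (0 :: 'k)" if "i < 6" "6 \<le> j" for i j :: nat
    proof -
      have "\<not> (even i \<and> j = Suc i)" "\<not> (even j \<and> i = Suc j)" using that by presburger+
      then show ?thesis unfolding symplectic_gram_def by presburger
    qed
    have K: "bilinear_form J (joined_family 6 b c i) (joined_family 6 b c j) = symplectic_gram i j" if "i < ?N" "j < ?N" for i j
      by (rule bilinear_form_joined_family[where K = symplectic_gram, OF b(1) c(1) b(2) _ UW cross that])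
        (use c(2) shift in simp)
    show ?case unfolding g0 g
      by (rule skew_hermitian_model.no_GNIB[OF adapted_basis.sp_model[OF basis refl assms refl I J K]])
  qed
qed

end
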